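(* Let $\Bbbk$ be an algebraically closed field of characteristic zero and let $A$ be a locally finite $\mathbb{N}$-graded $\Bbbk$-algebra which is generalized Artin--Schelter regular of dimension $d$. Let $\tau$ be a graded automorphism of $A$. Then the graded twist ${}_\tau A$ is also generalized Artin--Schelter regular of dimension $d$.
   Context: A graded algebra $A=\bigoplus_{k\ge 0}A_k$ is locally finite if each $A_k$ is finite-dimensional over $\Bbbk$. Let $J(A)$ be the graded Jacobson radical of $A$ (so $A_{\ge1}\subset J(A)$) and $S=A/J(A)=A_0/J(A_0)$, a finite-dimensional semisimple algebra. A locally finite graded algebra $A$ is generalized Artin--Schelter regular of dimension $d$ if $A$ has graded global dimension $d$ and there is a $\Bbbk$-central invertible $(S,S)$-bimodule $V$ such that, as $(S,S)$-bimodules, $\mathrm{Ext}_A^i(S,A)\cong V$ for $i=d$ and $\mathrm{Ext}_A^i(S,A)=0$ for $i\neq d$. For a graded automorphism $\tau$ of $A$, the graded (left, "Zhang") twist ${}_\tau A$ is the graded algebra with the same underlying graded vector space as $A$ and multiplication $x\star y=\tau^n(x)y$ for $x\in A_m$, $y\in A_n$, where the product on the right is taken in $A$. *)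

theory Defs
  imports "HOL-Algebra.Algebra" "HOL-Library.Extended_Nat"
begin

section \<open>Modules and bimodules over rings that need not be commutative\<close>

text \<open>
  The locale \<^locale>\<open>module\<close> of the library assumes a commutative ring of scalars. As there, the
  fields \<^const>\<open>monoid.mult\<close> and \<^const>\<open>one\<close> of a record that represents a (bi)module carry no meaning.
\<close>

locale left_module = R?: ring R + M?: abelian_group M
  for R :: "('a, 'y) ring_scheme" (structure) and M :: "('a, 'm, 'x) module_scheme" (structure) +
  assumes smult_closed:
      "\<lbrakk>a \<in> carrier R; x \<in> carrier M\<rbrakk> \<Longrightarrow> a \<odot>\<^bsub>M\<^esub> x \<in> carrier M"
    and smult_l_distr:
      "\<lbrakk>a \<in> carrier R; b \<in> carrier R; x \<in> carrier M\<rbrakk> \<Longrightarrow>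
        (a \<oplus>\<^bsub>R\<^esub> b) \<odot>\<^bsub>M\<^esub> x = a \<odot>\<^bsub>M\<^esub> x \<oplus>\<^bsub>M\<^esub> b \<odot>\<^bsub>M\<^esub> x"
    and smult_r_distr:
      "\<lbrakk>a \<in> carrier R; x \<in> carrier M; y \<in> carrier M\<rbrakk> \<Longrightarrow>
        a \<odot>\<^bsub>M\<^esub> (x \<oplus>\<^bsub>M\<^esub> y) = a \<odot>\<^bsub>M\<^esub> x \<oplus>\<^bsub>M\<^esub> a \<odot>\<^bsub>M\<^esub> y"
    and smult_assoc:
      "\<lbrakk>a \<in> carrier R; b \<in> carrier R; x \<in> carrier M\<rbrakk> \<Longrightarrow>
        (a \<otimes>\<^bsub>R\<^esub> b) \<odot>\<^bsub>M\<^esub> x = a \<odot>\<^bsub>M\<^esub> (b \<odot>\<^bsub>M\<^esub> x)"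
    and smult_one: "x \<in> carrier M \<Longrightarrow> \<one>\<^bsub>R\<^esub> \<odot>\<^bsub>M\<^esub> x = x"

record ('r, 's, 'v) bimodule = "('r, 'v) module" +
  rsmult :: "'v \<Rightarrow> 's \<Rightarrow> 'v"  (infixl \<open>\<triangleleft>\<index>\<close> 70)

locale bimodule = left_module R V + S?: ring S
  for R :: "('r, 'y) ring_scheme" (structure) and S :: "('s, 'z) ring_scheme" (structure)
    and V :: "('r, 's, 'v, 'x) bimodule_scheme" (structure) +
  assumes rsmult_closed:
      "\<lbrakk>v \<in> carrier V; s \<in> carrier S\<rbrakk> \<Longrightarrow> v \<triangleleft>\<^bsub>V\<^esub> s \<in> carrier V"
    and rsmult_r_distr:
      "\<lbrakk>v \<in> carrier V; s \<in> carrier S; t \<in> carrier S\<rbrakk> \<Longrightarrow>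
        v \<triangleleft>\<^bsub>V\<^esub> (s \<oplus>\<^bsub>S\<^esub> t) = v \<triangleleft>\<^bsub>V\<^esub> s \<oplus>\<^bsub>V\<^esub> v \<triangleleft>\<^bsub>V\<^esub> t"
    and rsmult_l_distr:
      "\<lbrakk>v \<in> carrier V; w \<in> carrier V; s \<in> carrier S\<rbrakk> \<Longrightarrow>
        (v \<oplus>\<^bsub>V\<^esub> w) \<triangleleft>\<^bsub>V\<^esub> s = v \<triangleleft>\<^bsub>V\<^esub> s \<oplus>\<^bsub>V\<^esub> w \<triangleleft>\<^bsub>V\<^esub> s"
    and rsmult_assoc:
      "\<lbrakk>v \<in> carrier V; s \<in> carrier S; t \<in> carrier S\<rbrakk> \<Longrightarrow>
        v \<triangleleft>\<^bsub>V\<^esub> (s \<otimes>\<^bsub>S\<^esub> t) = (v \<triangleleft>\<^bsub>V\<^esub> s) \<triangleleft>\<^bsub>V\<^esub> t"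
    and rsmult_one: "v \<in> carrier V \<Longrightarrow> v \<triangleleft>\<^bsub>V\<^esub> \<one>\<^bsub>S\<^esub> = v"
    and smult_rsmult:
      "\<lbrakk>r \<in> carrier R; v \<in> carrier V; s \<in> carrier S\<rbrakk> \<Longrightarrow>
        (r \<odot>\<^bsub>V\<^esub> v) \<triangleleft>\<^bsub>V\<^esub> s = r \<odot>\<^bsub>V\<^esub> (v \<triangleleft>\<^bsub>V\<^esub> s)"

definition bimodule_isomorphic ::
    "'r ring \<Rightarrow> ('s, 'x) ring_scheme \<Rightarrow> ('r, 's, 'v) bimodule \<Rightarrow> ('r, 's, 'w) bimodule \<Rightarrow> bool"
  where "bimodule_isomorphic R S V W \<longleftrightarrow> (\<exists>\<theta>.
     bij_betw \<theta> (carrier V) (carrier W) \<and>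
     (\<forall>v\<in>carrier V. \<forall>w\<in>carrier V. \<theta> (v \<oplus>\<^bsub>V\<^esub> w) = \<theta> v \<oplus>\<^bsub>W\<^esub> \<theta> w) \<and>
     (\<forall>r\<in>carrier R. \<forall>v\<in>carrier V. \<theta> (r \<odot>\<^bsub>V\<^esub> v) = r \<odot>\<^bsub>W\<^esub> \<theta> v) \<and>
     (\<forall>s\<in>carrier S. \<forall>v\<in>carrier V. \<theta> (v \<triangleleft>\<^bsub>V\<^esub> s) = \<theta> v \<triangleleft>\<^bsub>W\<^esub> s))"

definition regular_bimodule :: "'r ring \<Rightarrow> ('r, 'r, 'r) bimodule"
  where "regular_bimodule R =
    \<lparr>carrier = carrier R, monoid.mult = monoid.mult R, one = one R,
     ring.zero = ring.zero R, ring.add = ring.add R,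
     smult = monoid.mult R, rsmult = monoid.mult R\<rparr>"

definition restrict_right :: "('t \<Rightarrow> 's) \<Rightarrow> ('r, 's, 'v) bimodule \<Rightarrow> ('r, 't, 'v) bimodule"
  where "restrict_right f V =
    \<lparr>carrier = carrier V, monoid.mult = monoid.mult V, one = one V,
     ring.zero = ring.zero V, ring.add = ring.add V,
     smult = smult V, rsmult = (\<lambda>v t. v \<triangleleft>\<^bsub>V\<^esub> f t)\<rparr>"

text \<open>
  The tensor product \<open>V \<otimes>\<^sub>S W\<close>: the free abelian group on \<open>V \<times> W\<close> modulo the subgroup generated
  by the biadditivity and balancing relations.
\<close>

definition tensor_rels ::
    "'s ring \<Rightarrow> ('r, 's, 'v) bimodule \<Rightarrow> ('s, 't, 'w) bimodule \<Rightarrow> ('v \<times> 'w \<Rightarrow>\<^sub>0 int) set"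
  where "tensor_rels S V W =
    {frag_of (v \<oplus>\<^bsub>V\<^esub> v', w) - frag_of (v, w) - frag_of (v', w) | v v' w.
        v \<in> carrier V \<and> v' \<in> carrier V \<and> w \<in> carrier W} \<union>
    {frag_of (v, w \<oplus>\<^bsub>W\<^esub> w') - frag_of (v, w) - frag_of (v, w') | v w w'.
        v \<in> carrier V \<and> w \<in> carrier W \<and> w' \<in> carrier W} \<union>
    {frag_of (v \<triangleleft>\<^bsub>V\<^esub> s, w) - frag_of (v, s \<odot>\<^bsub>W\<^esub> w) | v s w.
        v \<in> carrier V \<and> s \<in> carrier S \<and> w \<in> carrier W}"

definition tensor ::
    "'s ring \<Rightarrow> ('r, 's, 'v) bimodule \<Rightarrow> ('s, 't, 'w) bimodule
      \<Rightarrow> ('r, 't, ('v \<times> 'w \<Rightarrow>\<^sub>0 int) set) bimodule"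
  where "tensor S V W =
    (let F = free_Abelian_group (carrier V \<times> carrier W);
         N = generate F (tensor_rels S V W)
     in \<lparr>carrier = carrier (F Mod N), monoid.mult = undefined, one = undefined,
         ring.zero = one (F Mod N), ring.add = monoid.mult (F Mod N),
         smult = (\<lambda>r C. \<Union>c\<in>C. N #>\<^bsub>F\<^esub> frag_extend (\<lambda>(v, w). frag_of (r \<odot>\<^bsub>V\<^esub> v, w)) c),
         rsmult = (\<lambda>C t. \<Union>c\<in>C. N #>\<^bsub>F\<^esub> frag_extend (\<lambda>(v, w). frag_of (v, w \<triangleleft>\<^bsub>W\<^esub> t)) c)\<rparr>)"

text \<open>
  The inverse is sought with carrier in the type of \<open>V\<close>. This is no restriction when \<open>V\<close> has an
  infinite carrier type at least as large as \<open>S\<close>: an invertible bimodule is finitely generated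
  on either side, hence no larger than that type.
\<close>

definition invertible_bimodule :: "'s ring \<Rightarrow> ('s, 's, 'v) bimodule \<Rightarrow> bool"
  where "invertible_bimodule S V \<longleftrightarrow> bimodule S S V \<and>
    (\<exists>W :: ('s, 's, 'v) bimodule. bimodule S S W \<and>
       bimodule_isomorphic S S (tensor S V W) (regular_bimodule S) \<and>
       bimodule_isomorphic S S (tensor S W V) (regular_bimodule S))"


section \<open>Graded algebras and graded modules\<close>

definition homogeneous_decomposition ::
    "('b, 'x) ring_scheme \<Rightarrow> ('i \<Rightarrow> 'b set) \<Rightarrow> 'b \<Rightarrow> ('i \<Rightarrow> 'b) \<Rightarrow> bool"
  where "homogeneous_decomposition M D x c \<longleftrightarrow>
    (\<forall>i. c i \<in> D i) \<and> finite {i. c i \<noteq> \<zero>\<^bsub>M\<^esub>} \<and> x = (\<Oplus>\<^bsub>M\<^esub>i\<in>{i. c i \<noteq> \<zero>\<^bsub>M\<^esub>}. c i)"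

definition direct_sum_decomposition :: "('b, 'x) ring_scheme \<Rightarrow> ('i \<Rightarrow> 'b set) \<Rightarrow> bool"
  where "direct_sum_decomposition M D \<longleftrightarrow>
    (\<forall>i. subgroup (D i) (add_monoid M)) \<and>
    (\<forall>x\<in>carrier M. \<exists>!c. homogeneous_decomposition M D x c)"

definition component :: "('b, 'x) ring_scheme \<Rightarrow> ('i \<Rightarrow> 'b set) \<Rightarrow> 'b \<Rightarrow> 'i \<Rightarrow> 'b"
  where "component M D x = (THE c. homogeneous_decomposition M D x c)"

record ('k, 'a) graded_algebra = "('k, 'a) module" +
  grade :: "nat \<Rightarrow> 'a set"

record ('a, 'm) graded_module = "('a, 'm) module" +
  homog :: "int \<Rightarrow> 'm set"

locale graded_algebra = K?: field K + A?: ring A + K_module?: module K A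
  for K :: "('k, 'y) ring_scheme" (structure) and A :: "('k, 'a, 'x) graded_algebra_scheme" (structure) +
  assumes smult_mult_left:
      "\<lbrakk>c \<in> carrier K; x \<in> carrier A; y \<in> carrier A\<rbrakk> \<Longrightarrow>
        (c \<odot>\<^bsub>A\<^esub> x) \<otimes>\<^bsub>A\<^esub> y = c \<odot>\<^bsub>A\<^esub> (x \<otimes>\<^bsub>A\<^esub> y)"
    and smult_mult_right:
      "\<lbrakk>c \<in> carrier K; x \<in> carrier A; y \<in> carrier A\<rbrakk> \<Longrightarrow>
        x \<otimes>\<^bsub>A\<^esub> (c \<odot>\<^bsub>A\<^esub> y) = c \<odot>\<^bsub>A\<^esub> (x \<otimes>\<^bsub>A\<^esub> y)"
    and grade_submodule: "submodule (grade A n) K A"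
    and grade_direct_sum: "direct_sum_decomposition A (grade A)"
    and one_grade: "\<one>\<^bsub>A\<^esub> \<in> grade A 0"
    and mult_grade: "\<lbrakk>x \<in> grade A m; y \<in> grade A n\<rbrakk> \<Longrightarrow> x \<otimes>\<^bsub>A\<^esub> y \<in> grade A (m + n)"

locale locally_finite_graded_algebra = graded_algebra +
  assumes finite_dimensional:
    "\<exists>B. finite B \<and> B \<subseteq> grade A n \<and>
       (\<forall>x\<in>grade A n. \<exists>c\<in>B \<rightarrow> carrier K. x = (\<Oplus>\<^bsub>A\<^esub>b\<in>B. c b \<odot>\<^bsub>A\<^esub> b))"

definition graded_left_module ::
    "('k, 'a) graded_algebra \<Rightarrow> ('a, 'm) graded_module \<Rightarrow> bool"
  where "graded_left_module A M \<longleftrightarrow> left_module A M \<and>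
    direct_sum_decomposition M (homog M) \<and>
    (\<forall>m n. \<forall>a\<in>grade A m. \<forall>x\<in>homog M n. a \<odot>\<^bsub>M\<^esub> x \<in> homog M (int m + n))"

definition linear_maps ::
    "('k, 'a) graded_algebra \<Rightarrow> ('a, 'm, 'x) module_scheme \<Rightarrow> ('a, 'n, 'y) module_scheme
      \<Rightarrow> ('m \<Rightarrow> 'n) set"
  where "linear_maps A M N = {f \<in> carrier M \<rightarrow> carrier N.
    (\<forall>x\<in>carrier M. \<forall>y\<in>carrier M. f (x \<oplus>\<^bsub>M\<^esub> y) = f x \<oplus>\<^bsub>N\<^esub> f y) \<and>
    (\<forall>a\<in>carrier A. \<forall>x\<in>carrier M. f (a \<odot>\<^bsub>M\<^esub> x) = a \<odot>\<^bsub>N\<^esub> f x)}"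

definition graded_maps ::
    "('k, 'a) graded_algebra \<Rightarrow> ('a, 'm) graded_module \<Rightarrow> ('a, 'n) graded_module
      \<Rightarrow> ('m \<Rightarrow> 'n) set"
  where "graded_maps A M N =
    {f \<in> linear_maps A M N. \<forall>n. \<forall>x\<in>homog M n. f x \<in> homog N n}"

definition regular_module :: "('k, 'a) graded_algebra \<Rightarrow> ('a, 'a) module"
  where "regular_module A =
    \<lparr>carrier = carrier A, monoid.mult = monoid.mult A, one = one A,
     ring.zero = ring.zero A, ring.add = ring.add A,
     smult = monoid.mult A\<rparr>"


section \<open>Graded projective resolutions and graded global dimension\<close>

text \<open>
  HOL cannot quantify over modules with carriers in arbitrary types. All modules below, other
  than the one being resolved, have their carrier in one type \<open>'m\<close>, which plays the role of a
  universe. As soon as \<open>'m\<close> is infinite and at least as large as \<open>A\<close>, it contains isomorphic copies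
  of all cyclic graded modules and is closed under graded free covers and quotients. So
  projectivity and (by the graded form of Auslander's theorem) global dimension then do not
  depend on the choice of \<open>'m\<close>.
\<close>

definition graded_projective ::
    "('k, 'a) graded_algebra \<Rightarrow> ('a, 'm) graded_module \<Rightarrow> bool"
  where "graded_projective A P \<longleftrightarrow> graded_left_module A P \<and>
    (\<forall>(M :: ('a, 'm) graded_module) (N :: ('a, 'm) graded_module).
       graded_left_module A M \<longrightarrow> graded_left_module A N \<longrightarrow>
       (\<forall>g\<in>graded_maps A M N. \<forall>f\<in>graded_maps A P N. g ` carrier M = carrier N \<longrightarrow>
          (\<exists>h\<in>graded_maps A P M. \<forall>x\<in>carrier P. g (h x) = f x)))"

text \<open>\<open>\<dots> \<rightarrow> P 2 \<rightarrow> P 1 \<rightarrow> P 0 \<rightarrow> M \<rightarrow> 0\<close> is exact, with maps \<open>\<delta> i : P (i + 1) \<rightarrow> P i\<close> and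
  \<open>\<epsilon> : P 0 \<rightarrow> M\<close> of degree 0.\<close>

definition graded_projective_resolution ::
    "('k, 'a) graded_algebra \<Rightarrow> ('a, 'n) graded_module \<Rightarrow>
     (nat \<Rightarrow> ('a, 'm) graded_module) \<Rightarrow> (nat \<Rightarrow> 'm \<Rightarrow> 'm) \<Rightarrow> ('m \<Rightarrow> 'n) \<Rightarrow> bool"
  where "graded_projective_resolution A M P \<delta> \<epsilon> \<longleftrightarrow>
    (\<forall>i. graded_projective A (P i)) \<and>
    \<epsilon> \<in> graded_maps A (P 0) M \<and>
    (\<forall>i. \<delta> i \<in> graded_maps A (P (Suc i)) (P i)) \<and>
    \<epsilon> ` carrier (P 0) = carrier M \<and>
    \<delta> 0 ` carrier (P 1) = {x \<in> carrier (P 0). \<epsilon> x = \<zero>\<^bsub>M\<^esub>} \<and>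
    (\<forall>i. \<delta> (Suc i) ` carrier (P (Suc (Suc i))) =
         {x \<in> carrier (P (Suc i)). \<delta> i x = \<zero>\<^bsub>P i\<^esub>})"

definition graded_projective_dimension ::
    "('k, 'a) graded_algebra \<Rightarrow> ('a, 'm) graded_module \<Rightarrow> enat"
  where "graded_projective_dimension A M =
    Inf {enat n | n. \<exists>(P :: nat \<Rightarrow> ('a, 'm) graded_module) \<delta> \<epsilon>.
       graded_projective_resolution A M P \<delta> \<epsilon> \<and> (\<forall>i>n. carrier (P i) = {\<zero>\<^bsub>P i\<^esub>})}"

definition graded_global_dimension :: "'m itself \<Rightarrow> ('k, 'a) graded_algebra \<Rightarrow> enat"
  where "graded_global_dimension _ A =
    (SUP M\<in>{M :: ('a, 'm) graded_module. graded_left_module A M}. graded_projective_dimension A M)"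


section \<open>The graded Jacobson radical and the semisimple quotient\<close>

definition graded_left_ideal :: "('k, 'a) graded_algebra \<Rightarrow> 'a set \<Rightarrow> bool"
  where "graded_left_ideal A I \<longleftrightarrow> submodule I A (regular_module A) \<and>
    (\<forall>x\<in>I. \<forall>n. component A (grade A) x n \<in> I)"

definition maximal_graded_left_ideal :: "('k, 'a) graded_algebra \<Rightarrow> 'a set \<Rightarrow> bool"
  where "maximal_graded_left_ideal A I \<longleftrightarrow> graded_left_ideal A I \<and> I \<noteq> carrier A \<and>
    (\<forall>I'. graded_left_ideal A I' \<longrightarrow> I \<subseteq> I' \<longrightarrow> I' = I \<or> I' = carrier A)"

definition graded_jacobson_radical :: "('k, 'a) graded_algebra \<Rightarrow> 'a set"
  where "graded_jacobson_radical A =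
    {x \<in> carrier A. \<forall>I. maximal_graded_left_ideal A I \<longrightarrow> x \<in> I}"

definition top_ring :: "('k, 'a) graded_algebra \<Rightarrow> 'a set ring"
  where "top_ring A = A Quot graded_jacobson_radical A"

definition to_top :: "('k, 'a) graded_algebra \<Rightarrow> 'a \<Rightarrow> 'a set"
  where "to_top A a = graded_jacobson_radical A +>\<^bsub>A\<^esub> a"

text \<open>\<open>S = A/J(A)\<close> as a graded left \<open>A\<close>-module.\<close>

definition top_module :: "('k, 'a) graded_algebra \<Rightarrow> ('a, 'a set) graded_module"
  where "top_module A =
    \<lparr>carrier = carrier (top_ring A), monoid.mult = monoid.mult (top_ring A),
     one = one (top_ring A),
     ring.zero = ring.zero (top_ring A), ring.add = ring.add (top_ring A),
     smult = (\<lambda>a C. to_top A a \<otimes>\<^bsub>top_ring A\<^esub> C),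
     homog = (\<lambda>n. if 0 \<le> n then to_top A ` grade A (nat n) else {\<zero>\<^bsub>top_ring A\<^esub>})\<rparr>"


section \<open>The bimodules \<open>Ext\<^sub>A\<^sup>i(S, A)\<close>\<close>

text \<open>
  The complex \<open>Hom\<^sub>A(P i, A)\<close> consists of all \<open>A\<close>-linear maps, not only of sums of homogeneous
  ones. Maps are made extensional, so that equality of functions is equality on \<open>P i\<close>.
\<close>

definition hom_group ::
    "('k, 'a) graded_algebra \<Rightarrow> ('a, 'm) graded_module \<Rightarrow> ('m \<Rightarrow> 'a) ring"
  where "hom_group A P =
    \<lparr>carrier = linear_maps A P (regular_module A) \<inter> extensional (carrier P),
     monoid.mult = undefined, one = undefined,
     ring.zero = (\<lambda>x\<in>carrier P. \<zero>\<^bsub>A\<^esub>),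
     ring.add = (\<lambda>f g. \<lambda>x\<in>carrier P. f x \<oplus>\<^bsub>A\<^esub> g x)\<rparr>"

definition cocycles ::
    "('k, 'a) graded_algebra \<Rightarrow> (nat \<Rightarrow> ('a, 'm) graded_module) \<Rightarrow> (nat \<Rightarrow> 'm \<Rightarrow> 'm) \<Rightarrow> nat
      \<Rightarrow> ('m \<Rightarrow> 'a) set"
  where "cocycles A P \<delta> i =
    {f \<in> carrier (hom_group A (P i)). \<forall>x\<in>carrier (P (Suc i)). f (\<delta> i x) = \<zero>\<^bsub>A\<^esub>}"

fun coboundaries ::
    "('k, 'a) graded_algebra \<Rightarrow> (nat \<Rightarrow> ('a, 'm) graded_module) \<Rightarrow> (nat \<Rightarrow> 'm \<Rightarrow> 'm) \<Rightarrow> nat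
      \<Rightarrow> ('m \<Rightarrow> 'a) set"
  where
    "coboundaries A P \<delta> 0 = {\<zero>\<^bsub>hom_group A (P 0)\<^esub>}"
  | "coboundaries A P \<delta> (Suc i) =
       {compose (carrier (P (Suc i))) g (\<delta> i) | g. g \<in> carrier (hom_group A (P i))}"

definition is_lift ::
    "('k, 'a) graded_algebra \<Rightarrow> (nat \<Rightarrow> ('a, 'm) graded_module) \<Rightarrow> (nat \<Rightarrow> 'm \<Rightarrow> 'm)
      \<Rightarrow> ('m \<Rightarrow> 'n) \<Rightarrow> ('n \<Rightarrow> 'n) \<Rightarrow> (nat \<Rightarrow> 'm \<Rightarrow> 'm) \<Rightarrow> bool"
  where "is_lift A P \<delta> \<epsilon> \<rho> \<phi> \<longleftrightarrow>
    (\<forall>i. \<phi> i \<in> graded_maps A (P i) (P i)) \<and>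
    (\<forall>x\<in>carrier (P 0). \<epsilon> (\<phi> 0 x) = \<rho> (\<epsilon> x)) \<and>
    (\<forall>i. \<forall>x\<in>carrier (P (Suc i)). \<delta> i (\<phi> (Suc i) x) = \<phi> i (\<delta> i x))"

text \<open>
  For a graded projective resolution \<open>(P, \<delta>, \<epsilon>)\<close> of \<open>S\<close>, this is \<open>Ext\<^sub>A\<^sup>i(S, A)\<close> with the structure
  of an \<open>(S, A)\<close>-bimodule that it inherits from the \<open>(A, S)\<close>-bimodule \<open>S\<close> and the
  \<open>(A, A)\<close>-bimodule \<open>A\<close>. The element \<open>s\<close> acts from the left by precomposition with any degree 0
  chain map \<open>\<phi>\<close> lifting the right multiplication \<open>x \<mapsto> x s\<close> of \<open>S\<close>; such a \<open>\<phi>\<close> is unique up to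
  homotopy, so all cosets in the union for \<open>smult\<close> agree, as do those for \<open>rsmult\<close>.
\<close>

definition Ext_top ::
    "('k, 'a) graded_algebra \<Rightarrow> (nat \<Rightarrow> ('a, 'm) graded_module) \<Rightarrow> (nat \<Rightarrow> 'm \<Rightarrow> 'm)
      \<Rightarrow> ('m \<Rightarrow> 'a set) \<Rightarrow> nat \<Rightarrow> ('a set, 'a, ('m \<Rightarrow> 'a) set) bimodule"
  where "Ext_top A P \<delta> \<epsilon> i =
    (let H = hom_group A (P i); B = coboundaries A P \<delta> i
     in \<lparr>carrier = {B +>\<^bsub>H\<^esub> f | f. f \<in> cocycles A P \<delta> i}, monoid.mult = undefined, one = undefined,
         ring.zero = B, ring.add = set_add H,
         smult = (\<lambda>s C. \<Union>{B +>\<^bsub>H\<^esub> compose (carrier (P i)) f (\<phi> i) | f \<phi>.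
                            f \<in> C \<and> is_lift A P \<delta> \<epsilon> (\<lambda>x. x \<otimes>\<^bsub>top_ring A\<^esub> s) \<phi>}),
         rsmult = (\<lambda>C a. \<Union>{B +>\<^bsub>H\<^esub> (\<lambda>x\<in>carrier (P i). f x \<otimes>\<^bsub>A\<^esub> a) | f. f \<in> C})\<rparr>)"


section \<open>Generalized Artin--Schelter regular algebras\<close>

definition central_bimodule ::
    "'k ring \<Rightarrow> ('k, 'a) graded_algebra \<Rightarrow> ('a set, 'a set, 'v) bimodule \<Rightarrow> bool"
  where "central_bimodule K A V \<longleftrightarrow> (\<forall>c\<in>carrier K. \<forall>v\<in>carrier V.
    to_top A (c \<odot>\<^bsub>A\<^esub> \<one>\<^bsub>A\<^esub>) \<odot>\<^bsub>V\<^esub> v = v \<triangleleft>\<^bsub>V\<^esub> to_top A (c \<odot>\<^bsub>A\<^esub> \<one>\<^bsub>A\<^esub>))"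

text \<open>
  A priori \<open>Ext\<^sub>A\<^sup>i(S, A)\<close> is only an \<open>(S, A)\<close>-bimodule. An isomorphism with \<open>V\<close> of \<open>(S, S)\<close>-bimodules
  means that the right action of \<open>A\<close> factors through \<open>S\<close>, that is, an isomorphism of
  \<open>(S, A)\<close>-bimodules with \<open>V\<close> restricted along \<open>A \<rightarrow> S\<close>. By the comparison theorem it does
  not matter which graded projective resolution of \<open>S\<close> is used to compute \<open>Ext\<close>.

  If \<open>A \<noteq> 0\<close>, the resolution of \<open>S\<close> in \<open>'m\<close> already forces \<open>'m\<close> to be at least as large as \<open>S\<close>. When \<open>K\<close>
  is infinite, \<open>K\<close>, \<open>S\<close> and the locally finite algebra \<open>A\<close> have the same cardinality, so that \<open>'m\<close> is
  large enough for the notions above.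
\<close>

definition generalized_AS_regular ::
    "'m itself \<Rightarrow> 'k ring \<Rightarrow> ('k, 'a) graded_algebra \<Rightarrow> nat \<Rightarrow> bool"
  where "generalized_AS_regular U K A d \<longleftrightarrow>
    locally_finite_graded_algebra K A \<and>
    graded_global_dimension U A = enat d \<and>
    (\<exists>V :: ('a set, 'a set, 'm) bimodule.
       invertible_bimodule (top_ring A) V \<and> central_bimodule K A V \<and>
       (\<exists>(P :: nat \<Rightarrow> ('a, 'm) graded_module) \<delta> \<epsilon>.
          graded_projective_resolution A (top_module A) P \<delta> \<epsilon> \<and>
          bimodule_isomorphic (top_ring A) A (Ext_top A P \<delta> \<epsilon> d) (restrict_right (to_top A) V) \<and>
          (\<forall>i. i \<noteq> d \<longrightarrow>
             carrier (Ext_top A P \<delta> \<epsilon> i) = {\<zero>\<^bsub>Ext_top A P \<delta> \<epsilon> i\<^esub>})))"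


section \<open>Graded twists\<close>

definition graded_automorphism ::
    "'k ring \<Rightarrow> ('k, 'a) graded_algebra \<Rightarrow> ('a \<Rightarrow> 'a) \<Rightarrow> bool"
  where "graded_automorphism K A \<tau> \<longleftrightarrow> \<tau> \<in> ring_iso A A \<and>
    (\<forall>c\<in>carrier K. \<forall>x\<in>carrier A. \<tau> (c \<odot>\<^bsub>A\<^esub> x) = c \<odot>\<^bsub>A\<^esub> \<tau> x) \<and>
    (\<forall>n. \<tau> ` grade A n = grade A n)"

text \<open>\<open>x \<star> y = \<tau>\<^sup>n(x) y\<close> for \<open>y\<close> of degree \<open>n\<close>, extended additively to all \<open>y\<close>.\<close>

definition graded_twist :: "('a \<Rightarrow> 'a) \<Rightarrow> ('k, 'a) graded_algebra \<Rightarrow> ('k, 'a) graded_algebra"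
  where "graded_twist \<tau> A = A\<lparr>monoid.mult := (\<lambda>x y.
    \<Oplus>\<^bsub>A\<^esub>n\<in>{n. component A (grade A) y n \<noteq> \<zero>\<^bsub>A\<^esub>}. (\<tau> ^^ n) x \<otimes>\<^bsub>A\<^esub> component A (grade A) y n)\<rparr>"

definition char_zero :: "'k ring \<Rightarrow> bool"
  where "char_zero K \<longleftrightarrow> (\<forall>n::nat. 0 < n \<longrightarrow> [n] \<cdot>\<^bsub>K\<^esub> \<one>\<^bsub>K\<^esub> \<noteq> \<zero>\<^bsub>K\<^esub>)"

end

theory Submission
  imports Defs
begin

text \<open>
  Write \<open>B\<close> for the twist of \<open>A\<close> and \<open>t\<^sub>n = \<tau>\<^sup>n\<close>. A graded left \<open>A\<close>-module \<open>M\<close> becomes a graded left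
  \<open>B\<close>-module on the same graded group by \<open>a \<star> x = t\<^sub>n(a) x\<close> for \<open>x \<in> M\<^sub>n\<close>, and the maps of degree 0
  between graded modules do not change. So graded projectivity, resolutions and the graded global
  dimension carry over, the graded left ideals of \<open>A\<close> and \<open>B\<close> are the same sets, and
  \<open>S = A/J(A)\<close>, which lives in degree 0 where \<open>t\<^sub>0\<close> is the identity, is the same for both.

  The group \<open>Hom\<^sub>A(P, A)\<close> of all linear maps is compared with \<open>Hom\<^sub>B(P, B)\<close> one degree at a time: if
  \<open>f\<close> is \<open>A\<close>-linear of degree \<open>k\<close>, then \<open>t\<^sub>k \<circ> f\<close> is \<open>B\<close>-linear. A map has a component in every degree,
  and at each element only finitely many of them are non-zero, so \<open>\<Sum>\<^sub>k f\<^sub>k \<mapsto> \<Sum>\<^sub>k t\<^sub>k f\<^sub>k\<close> is defined on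
  all maps (\<open>compwise\<close>, \<open>twist_hom\<close>). It is an isomorphism of complexes that commutes with the left
  action of \<open>S\<close>. Hence \<open>Ext\<^sup>i\<close> still vanishes for \<open>i \<noteq> d\<close>, and \<open>Ext\<^sup>d\<close> becomes the bimodule \<open>V\<close>
  with a new right action: \<open>a \<in> A\<^sub>0\<close> sends the class of \<open>f\<close> to the class of
  \<open>\<Sum>\<^sub>k f\<^sub>k t\<^sub>-\<^sub>k(a)\<close> (\<open>right_mult_twist\<close>).

  It remains to see that the new bimodule is invertible and central. By Morita theory a left linear
  endomorphism of the invertible bimodule \<open>V\<close> is right multiplication by a unique element of \<open>S\<close>
  (\<open>left_linear_endomorphism\<close>). For any sequence \<open>r : \<int> \<rightarrow> A\<close> the map
  \<open>[\<Sum>\<^sub>k f\<^sub>k] \<mapsto> [\<Sum>\<^sub>k f\<^sub>k r\<^sub>k]\<close> is such an endomorphism, given by an element \<open>seq_action r\<close> of \<open>S\<close>. So the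
  new right action is the old one along the ring endomorphism \<open>\<rho>\<^sub>-\<^sub>1\<close> of \<open>S\<close>, where \<open>\<rho>\<^sub>j\<close> sends the
  class of \<open>a \<in> A\<^sub>0\<close> to \<open>seq_action (\<lambda>k. t\<^sub>j\<^sub>k(a))\<close> (\<open>top_twist\<close>), and invertibility follows once \<open>\<rho>\<^sub>-\<^sub>1\<close> is
  bijective (\<open>invertible_bimodule_twist_right\<close>).

  In fact \<open>\<rho>\<^sub>i \<rho>\<^sub>j = \<rho>\<^sub>i\<^sub>+\<^sub>j\<close> (\<open>top_twist_top_twist\<close>). The automorphism \<open>\<tau>\<close> acts on everything in sight: a
  \<open>\<tau>\<close>-semilinear lift of \<open>\<tau> : S \<rightarrow> S\<close> to the resolution acts on \<open>Ext\<^sup>d\<close> and preserves degrees,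
  so \<open>\<tau>\<close> commutes with \<open>\<rho>\<^sub>j\<close> (\<open>seq_action_equivariant\<close>). If \<open>Ext\<^sup>d\<close> were a finite sum of its
  homogeneous parts, on the part of degree \<open>k\<close> the action of \<open>\<rho>\<^sub>i(\<rho>\<^sub>j(s))\<close> would be that of
  \<open>\<tau>\<^sup>i\<^sup>k(\<rho>\<^sub>j(s)) = \<rho>\<^sub>j(\<tau>\<^sup>i\<^sup>k(s))\<close>, which is \<open>\<tau>\<^sup>j\<^sup>k(\<tau>\<^sup>i\<^sup>k(s))\<close> there, and the claim would be clear. In
  general a cocycle may have infinitely many components with non-zero class. Local finiteness replaces the
  decomposition: the sequence \<open>t\<^sub>i\<^sub>k(a)\<close> stays in the finite-dimensional space \<open>A\<^sub>0\<close>, so in terms of a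
  finite spanning set it is a finite sum of scalar sequences times fixed elements, for which \<open>seq_action\<close> can be
  computed term by term (\<open>seq_action_J\<close>, \<open>top_twist_combinations\<close>).
\<close>

section \<open>Graded abelian groups\<close>

locale graded_group = abelian_group M for M :: "('b, 'x) ring_scheme" (structure) +
  fixes D :: "'i \<Rightarrow> 'b set"
  assumes decomposition: "direct_sum_decomposition M D"
begin

abbreviation part :: "'b \<Rightarrow> 'i \<Rightarrow> 'b" where "part \<equiv> component M D"

definition support :: "'b \<Rightarrow> 'i set" where "support x = {i. part x i \<noteq> \<zero>}"

lemma grade_subgroup: "subgroup (D i) (add_monoid M)"
  using decomposition by (simp add: direct_sum_decomposition_def)

lemma grade_carrier: "x \<in> D i \<Longrightarrow> x \<in> carrier M"
  using subgroup.subset[OF grade_subgroup] by auto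

lemma zero_grade: "\<zero> \<in> D i"
  using subgroup.one_closed[OF grade_subgroup[of i]] by simp

lemma add_grade: "x \<in> D i \<Longrightarrow> y \<in> D i \<Longrightarrow> x \<oplus> y \<in> D i"
  using subgroup.m_closed[OF grade_subgroup[of i]] by simp

lemma neg_grade: "x \<in> D i \<Longrightarrow> \<ominus> x \<in> D i"
  using subgroup.m_inv_closed[OF grade_subgroup[of i]] by (simp add: a_inv_def)

lemma minus_grade: "x \<in> D i \<Longrightarrow> y \<in> D i \<Longrightarrow> x \<ominus> y \<in> D i"
  by (simp add: a_minus_def add_grade neg_grade)

lemma homogeneous_parts:
  assumes "x \<in> carrier M" shows "homogeneous_decomposition M D x (part x)"
proof -
  have "\<exists>!c. homogeneous_decomposition M D x c"
    using decomposition assms by (simp add: direct_sum_decomposition_def)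
  then show ?thesis unfolding component_def by (rule theI')
qed

lemma part_unique:
  assumes "x \<in> carrier M" "homogeneous_decomposition M D x c" shows "part x = c"
proof -
  have "\<exists>!c. homogeneous_decomposition M D x c"
    using decomposition assms by (simp add: direct_sum_decomposition_def)
  then show ?thesis using assms homogeneous_parts by blast
qed

lemma part_grade: "x \<in> carrier M \<Longrightarrow> part x i \<in> D i"
  using homogeneous_parts by (simp add: homogeneous_decomposition_def)

lemma part_closed: "x \<in> carrier M \<Longrightarrow> part x i \<in> carrier M"
  using part_grade grade_carrier by blast

lemma finite_support: "x \<in> carrier M \<Longrightarrow> finite (support x)"
  using homogeneous_parts by (simp add: homogeneous_decomposition_def support_def)

lemma sum_parts: "x \<in> carrier M \<Longrightarrow> x = (\<Oplus>i\<in>support x. part x i)"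
  using homogeneous_parts by (simp add: homogeneous_decomposition_def support_def)

lemma finsum_support:
  assumes "finite F" "{i. c i \<noteq> \<zero>} \<subseteq> F" "\<And>i. c i \<in> carrier M"
  shows "(\<Oplus>i\<in>F. c i) = (\<Oplus>i\<in>{i. c i \<noteq> \<zero>}. c i)"
  by (rule add.finprod_mono_neutral_cong_right) (use assms in auto)

lemma part_eqI:
  assumes "finite F" "\<And>i. c i \<in> D i" "\<And>i. i \<notin> F \<Longrightarrow> c i = \<zero>" "x = (\<Oplus>i\<in>F. c i)"
  shows "part x = c"
proof (rule part_unique)
  have c: "c i \<in> carrier M" for i using assms(2) grade_carrier by blast
  show x: "x \<in> carrier M" using assms(4) c by simp
  have F: "{i. c i \<noteq> \<zero>} \<subseteq> F" using assms(3) by auto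
  then show "homogeneous_decomposition M D x c"
    unfolding homogeneous_decomposition_def
    using finsum_support[OF assms(1) F] assms(2,4) c finite_subset[OF F assms(1)] by auto
qed

lemma part_homogeneous:
  assumes "x \<in> D i" shows "part x = (\<lambda>j. if j = i then x else \<zero>)"
  by (rule part_eqI[of "{i}"]) (use assms zero_grade grade_carrier in \<open>auto simp: Pi_def\<close>)

lemma part_zero: "part \<zero> i = \<zero>"
  using part_homogeneous[OF zero_grade, of i] by simp

lemma part_add:
  assumes x: "x \<in> carrier M" and y: "y \<in> carrier M"
  shows "part (x \<oplus> y) = (\<lambda>i. part x i \<oplus> part y i)"
proof (rule part_eqI[of "support x \<union> support y"])
  let ?F = "support x \<union> support y"
  show fin: "finite ?F" using finite_support assms by simp
  show "part x i \<oplus> part y i \<in> D i" for i using assms part_grade add_grade by blast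
  show "part x i \<oplus> part y i = \<zero>" if "i \<notin> ?F" for i
    using that by (simp add: support_def)
  have "(\<Oplus>i\<in>?F. part z i) = z" if z: "z \<in> carrier M" "support z \<subseteq> ?F" for z
    using finsum_support[OF fin, of "part z"] z part_closed sum_parts[OF z(1)]
    by (auto simp: support_def)
  then have "x \<oplus> y = (\<Oplus>i\<in>?F. part x i) \<oplus> (\<Oplus>i\<in>?F. part y i)" using assms by auto
  also have "\<dots> = (\<Oplus>i\<in>?F. part x i \<oplus> part y i)"
    using assms part_closed by (intro finsum_addf[symmetric]) auto
  finally show "x \<oplus> y = (\<Oplus>i\<in>?F. part x i \<oplus> part y i)" .
qed

text \<open>
  In this form of induction \<open>Q\<close> has to hold for the parts of the given \<open>x\<close> only. It serves to
  prove that \<open>x\<close> lies in a graded subgroup that contains its parts.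
\<close>

lemma parts_induct [consumes 1, case_names part zero add]:
  assumes x: "x \<in> carrier M"
    and hom: "\<And>i. Q (part x i)" and zero: "Q \<zero>"
    and add: "\<And>x y. x \<in> carrier M \<Longrightarrow> y \<in> carrier M \<Longrightarrow> Q x \<Longrightarrow> Q y \<Longrightarrow> Q (x \<oplus> y)"
  shows "Q x"
proof -
  have Q: "Q (\<Oplus>i\<in>F. part x i)" if "finite F" for F
    using that
  proof (induction F rule: finite_induct)
    case empty then show ?case using zero by simp
  next
    case (insert i F)
    then show ?case
      using x part_closed hom by (auto simp: Pi_def intro!: add)
  qed
  show ?thesis using Q[OF finite_support[OF x]] sum_parts[OF x] by simp
qed

lemma homogeneous_induct [consumes 1, case_names grade add]:
  assumes x: "x \<in> carrier M"
    and hom: "\<And>i x. x \<in> D i \<Longrightarrow> Q x"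
    and add: "\<And>x y. x \<in> carrier M \<Longrightarrow> y \<in> carrier M \<Longrightarrow> Q x \<Longrightarrow> Q y \<Longrightarrow> Q (x \<oplus> y)"
  shows "Q x"
  using x hom[OF part_grade[OF x]] hom[OF zero_grade] add by (rule parts_induct)

end

text \<open>
  The homomorphism that extends a family of homomorphisms on the homogeneous parts.
\<close>

definition glue ::
    "('b, 'x) ring_scheme \<Rightarrow> ('i \<Rightarrow> 'b set) \<Rightarrow> ('c, 'y) ring_scheme \<Rightarrow> ('i \<Rightarrow> 'b \<Rightarrow> 'c) \<Rightarrow> 'b \<Rightarrow> 'c"
  where "glue M D N h x =
    (\<Oplus>\<^bsub>N\<^esub>i\<in>{i. component M D x i \<noteq> \<zero>\<^bsub>M\<^esub>}. h i (component M D x i))"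

definition additive_on ::
    "'b set \<Rightarrow> ('b, 'x) ring_scheme \<Rightarrow> ('c, 'y) ring_scheme \<Rightarrow> ('b \<Rightarrow> 'c) \<Rightarrow> bool"
  where "additive_on E M N h \<longleftrightarrow> (\<forall>x\<in>E. h x \<in> carrier N) \<and>
    (\<forall>x\<in>E. \<forall>y\<in>E. h (x \<oplus>\<^bsub>M\<^esub> y) = h x \<oplus>\<^bsub>N\<^esub> h y)"

abbreviation additive ::
    "('b, 'x) ring_scheme \<Rightarrow> ('c, 'y) ring_scheme \<Rightarrow> ('b \<Rightarrow> 'c) \<Rightarrow> bool"
  where "additive M N h \<equiv> additive_on (carrier M) M N h"

lemma additive_onI:
  assumes "\<And>x. x \<in> E \<Longrightarrow> h x \<in> carrier N"
    "\<And>x y. x \<in> E \<Longrightarrow> y \<in> E \<Longrightarrow> h (x \<oplus>\<^bsub>M\<^esub> y) = h x \<oplus>\<^bsub>N\<^esub> h y"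
  shows "additive_on E M N h"
  using assms by (auto simp: additive_on_def)

lemma additive_onD:
  assumes "additive_on E M N h"
  shows "x \<in> E \<Longrightarrow> h x \<in> carrier N"
    "x \<in> E \<Longrightarrow> y \<in> E \<Longrightarrow> h (x \<oplus>\<^bsub>M\<^esub> y) = h x \<oplus>\<^bsub>N\<^esub> h y"
  using assms by (auto simp: additive_on_def)

lemma additive_on_subset: "additive_on E M N h \<Longrightarrow> Y \<subseteq> E \<Longrightarrow> additive_on Y M N h"
  by (auto simp: additive_on_def)

lemma additive_on_zero:
  assumes "abelian_group M" "abelian_group N" "subgroup E (add_monoid M)" "additive_on E M N h"
  shows "h \<zero>\<^bsub>M\<^esub> = \<zero>\<^bsub>N\<^esub>"
proof -
  interpret M: abelian_group M by fact
  interpret N: abelian_group N by fact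
  have z: "\<zero>\<^bsub>M\<^esub> \<in> E" using subgroup.one_closed[OF assms(3)] by simp
  have "h \<zero>\<^bsub>M\<^esub> = h \<zero>\<^bsub>M\<^esub> \<oplus>\<^bsub>N\<^esub> h \<zero>\<^bsub>M\<^esub>"
    using additive_onD(2)[OF assms(4) z z] by simp
  then show ?thesis using additive_onD(1)[OF assms(4) z] by (simp add: N.add.r_cancel_one')
qed

lemma additive_zero:
  assumes "abelian_group M" "abelian_group N" "additive M N h"
  shows "h \<zero>\<^bsub>M\<^esub> = \<zero>\<^bsub>N\<^esub>"
  using additive_on_zero[OF assms(1,2) _ assms(3)] group.subgroup_self
  by (metis abelian_group.a_group assms(1) partial_object.select_convs(1))

lemma additive_neg:
  assumes "abelian_group M" "abelian_group N" "additive M N h" "x \<in> carrier M"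
  shows "h (\<ominus>\<^bsub>M\<^esub> x) = \<ominus>\<^bsub>N\<^esub> h x"
proof -
  interpret M: abelian_group M by fact
  interpret N: abelian_group N by fact
  have "h (\<ominus>\<^bsub>M\<^esub> x) \<oplus>\<^bsub>N\<^esub> h x = \<zero>\<^bsub>N\<^esub>"
    using additive_onD(2)[OF assms(3), of "\<ominus>\<^bsub>M\<^esub> x" x] additive_zero[OF assms(1-3)] assms(4)
    by (simp add: M.l_neg)
  then show ?thesis
    using additive_onD(1)[OF assms(3)] assms(4) by (simp add: N.minus_equality)
qed

lemma additive_minus:
  assumes "abelian_group M" "abelian_group N" "additive M N h" "x \<in> carrier M" "y \<in> carrier M"
  shows "h (x \<ominus>\<^bsub>M\<^esub> y) = h x \<ominus>\<^bsub>N\<^esub> h y"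
proof -
  interpret M: abelian_group M by fact
  show ?thesis
    using assms additive_neg[OF assms(1-3)] additive_onD(2)[OF assms(3), of x "\<ominus>\<^bsub>M\<^esub> y"]
    by (simp add: a_minus_def)
qed

lemma additive_comp:
  assumes "additive M N h" "additive N L k" shows "additive M L (\<lambda>x. k (h x))"
  using assms by (auto simp: additive_on_def Pi_def)

lemma additive_finsum:
  assumes "abelian_group M" "abelian_group N" "additive M N h" "finite F" "f \<in> F \<rightarrow> carrier M"
  shows "h (\<Oplus>\<^bsub>M\<^esub>i\<in>F. f i) = (\<Oplus>\<^bsub>N\<^esub>i\<in>F. h (f i))"
  using assms(4,5)
proof (induction F rule: finite_induct)
  interpret M: abelian_group M by fact
  interpret N: abelian_group N by fact
  case empty
  then show ?case using additive_zero[OF assms(1-3)] by simp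
next
  interpret M: abelian_group M by fact
  interpret N: abelian_group N by fact
  case (insert i F)
  then show ?case using additive_onD[OF assms(3)] by (simp add: Pi_def)
qed

context graded_group
begin

lemma glue_eq_finsum:
  assumes N: "abelian_group N" and h: "\<And>i. additive_on (D i) M N (h i)"
    and x: "x \<in> carrier M" and F: "finite F" "support x \<subseteq> F"
  shows "glue M D N h x = (\<Oplus>\<^bsub>N\<^esub>i\<in>F. h i (part x i))"
proof -
  interpret N: abelian_group N by fact
  have z: "h i \<zero> = \<zero>\<^bsub>N\<^esub>" for i
    by (rule additive_on_zero[OF _ N grade_subgroup h]) unfold_locales
  have "h i (part x i) \<in> carrier N" for i using additive_onD(1)[OF h part_grade[OF x]] .
  then show ?thesis
    unfolding glue_def using F z
    by (intro N.add.finprod_mono_neutral_cong_left) (auto simp: support_def)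
qed

lemma glue_grade:
  assumes N: "abelian_group N" and h: "\<And>i. additive_on (D i) M N (h i)" and x: "x \<in> D i"
  shows "glue M D N h x = h i x"
proof -
  interpret N: abelian_group N by fact
  have "support x \<subseteq> {i}" using part_homogeneous[OF x] by (auto simp: support_def)
  then show ?thesis
    using glue_eq_finsum[OF N h grade_carrier[OF x], of "{i}"] part_homogeneous[OF x]
      additive_onD(1)[OF h x] by (simp add: Pi_def)
qed

lemma glue_additive:
  assumes N: "abelian_group N" and h: "\<And>i. additive_on (D i) M N (h i)"
  shows "additive M N (glue M D N h)"
proof (rule additive_onI)
  interpret N: abelian_group N by fact
  have hc: "h i (part x i) \<in> carrier N" if "x \<in> carrier M" for i x
    using additive_onD(1)[OF h part_grade[OF that]] .
  fix x assume x: "x \<in> carrier M"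
  show "glue M D N h x \<in> carrier N"
    using glue_eq_finsum[OF N h x finite_support[OF x] subset_refl] hc[OF x] by (simp add: N.finsum_closed Pi_def)
  fix y assume y: "y \<in> carrier M"
  let ?F = "support x \<union> support y \<union> support (x \<oplus> y)"
  have F: "finite ?F" using finite_support x y by auto
  have "glue M D N h (x \<oplus> y) = (\<Oplus>\<^bsub>N\<^esub>i\<in>?F. h i (part x i \<oplus> part y i))"
    using glue_eq_finsum[OF N h _ F, of "x \<oplus> y"] x y part_add[OF x y] by auto
  also have "\<dots> = (\<Oplus>\<^bsub>N\<^esub>i\<in>?F. h i (part x i) \<oplus>\<^bsub>N\<^esub> h i (part y i))"
    using additive_onD(2)[OF h] part_grade x y by simp
  also have "\<dots> = (\<Oplus>\<^bsub>N\<^esub>i\<in>?F. h i (part x i)) \<oplus>\<^bsub>N\<^esub> (\<Oplus>\<^bsub>N\<^esub>i\<in>?F. h i (part y i))"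
    using hc x y by (intro N.finsum_addf) auto
  also have "\<dots> = glue M D N h x \<oplus>\<^bsub>N\<^esub> glue M D N h y"
    using glue_eq_finsum[OF N h x F] glue_eq_finsum[OF N h y F]
    by (simp add: le_supI1)
  finally show "glue M D N h (x \<oplus> y) = glue M D N h x \<oplus>\<^bsub>N\<^esub> glue M D N h y" .
qed

lemma additive_eqI:
  assumes "additive M N g" "additive M N h" "\<And>i x. x \<in> D i \<Longrightarrow> g x = h x" "x \<in> carrier M"
  shows "g x = h x"
  using assms(4)
proof (induction rule: homogeneous_induct)
  case (grade i x) then show ?case by (rule assms(3))
next
  case (add x y) then show ?case using assms(1,2) by (simp add: additive_on_def)
qed

end

section \<open>Graded modules and the comparison theorem\<close>

lemma (in left_module) zero_smult: "x \<in> carrier M \<Longrightarrow> \<zero>\<^bsub>R\<^esub> \<odot>\<^bsub>M\<^esub> x = \<zero>\<^bsub>M\<^esub>"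
  by (rule additive_zero[OF R.abelian_group_axioms M.abelian_group_axioms, of "\<lambda>a. a \<odot>\<^bsub>M\<^esub> x"])
    (auto simp: additive_on_def smult_closed smult_l_distr)

lemma (in left_module) smult_minus:
  "a \<in> carrier R \<Longrightarrow> x \<in> carrier M \<Longrightarrow> y \<in> carrier M \<Longrightarrow>
    a \<odot>\<^bsub>M\<^esub> (x \<ominus>\<^bsub>M\<^esub> y) = a \<odot>\<^bsub>M\<^esub> x \<ominus>\<^bsub>M\<^esub> a \<odot>\<^bsub>M\<^esub> y"
  by (rule additive_minus[OF M.abelian_group_axioms M.abelian_group_axioms])
    (auto simp: additive_on_def smult_closed smult_r_distr)

lemma graded_left_moduleD:
  assumes "graded_left_module A M"
  shows "left_module A M" "graded_group M (homog M)" "abelian_group M"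
    "a \<in> grade A m \<Longrightarrow> x \<in> homog M n \<Longrightarrow> a \<odot>\<^bsub>M\<^esub> x \<in> homog M (int m + n)"
proof -
  show l: "left_module A M" using assms by (simp add: graded_left_module_def)
  then show "abelian_group M" by (rule left_module.axioms)
  then show "graded_group M (homog M)"
    using assms by (simp add: graded_left_module_def graded_group_def graded_group_axioms_def)
  show "a \<in> grade A m \<Longrightarrow> x \<in> homog M n \<Longrightarrow> a \<odot>\<^bsub>M\<^esub> x \<in> homog M (int m + n)"
    using assms by (simp add: graded_left_module_def)
qed

lemma linear_mapsI:
  assumes "\<And>x. x \<in> carrier M \<Longrightarrow> f x \<in> carrier N"
    "\<And>x y. x \<in> carrier M \<Longrightarrow> y \<in> carrier M \<Longrightarrow> f (x \<oplus>\<^bsub>M\<^esub> y) = f x \<oplus>\<^bsub>N\<^esub> f y"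
    "\<And>a x. a \<in> carrier A \<Longrightarrow> x \<in> carrier M \<Longrightarrow> f (a \<odot>\<^bsub>M\<^esub> x) = a \<odot>\<^bsub>N\<^esub> f x"
  shows "f \<in> linear_maps A M N"
  using assms by (auto simp: linear_maps_def)

lemma linear_mapsD:
  assumes "f \<in> linear_maps A M N"
  shows "x \<in> carrier M \<Longrightarrow> f x \<in> carrier N"
    "x \<in> carrier M \<Longrightarrow> y \<in> carrier M \<Longrightarrow> f (x \<oplus>\<^bsub>M\<^esub> y) = f x \<oplus>\<^bsub>N\<^esub> f y"
    "a \<in> carrier A \<Longrightarrow> x \<in> carrier M \<Longrightarrow> f (a \<odot>\<^bsub>M\<^esub> x) = a \<odot>\<^bsub>N\<^esub> f x"
    "additive M N f"
  using assms by (auto simp: linear_maps_def additive_on_def)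

lemma graded_mapsI:
  assumes "\<And>x. x \<in> carrier M \<Longrightarrow> f x \<in> carrier N"
    "\<And>x y. x \<in> carrier M \<Longrightarrow> y \<in> carrier M \<Longrightarrow> f (x \<oplus>\<^bsub>M\<^esub> y) = f x \<oplus>\<^bsub>N\<^esub> f y"
    "\<And>a x. a \<in> carrier A \<Longrightarrow> x \<in> carrier M \<Longrightarrow> f (a \<odot>\<^bsub>M\<^esub> x) = a \<odot>\<^bsub>N\<^esub> f x"
    "\<And>n x. x \<in> homog M n \<Longrightarrow> f x \<in> homog N n"
  shows "f \<in> graded_maps A M N"
  using assms by (auto simp: graded_maps_def linear_maps_def)

lemma graded_mapsD:
  assumes "f \<in> graded_maps A M N"
  shows "x \<in> carrier M \<Longrightarrow> f x \<in> carrier N"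
    "x \<in> carrier M \<Longrightarrow> y \<in> carrier M \<Longrightarrow> f (x \<oplus>\<^bsub>M\<^esub> y) = f x \<oplus>\<^bsub>N\<^esub> f y"
    "a \<in> carrier A \<Longrightarrow> x \<in> carrier M \<Longrightarrow> f (a \<odot>\<^bsub>M\<^esub> x) = a \<odot>\<^bsub>N\<^esub> f x"
    "x \<in> homog M n \<Longrightarrow> f x \<in> homog N n"
    "additive M N f" "f \<in> linear_maps A M N"
  using assms by (auto simp: graded_maps_def linear_maps_def additive_on_def)

lemma graded_maps_zero:
  assumes "graded_left_module A M" "graded_left_module A N" "f \<in> graded_maps A M N"
  shows "f \<zero>\<^bsub>M\<^esub> = \<zero>\<^bsub>N\<^esub>"
  using additive_zero[OF graded_left_moduleD(3)[OF assms(1)] graded_left_moduleD(3)[OF assms(2)]]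
    graded_mapsD(5)[OF assms(3)] by blast

lemma graded_maps_minus_arg:
  assumes "graded_left_module A M" "graded_left_module A N" "f \<in> graded_maps A M N"
    "x \<in> carrier M" "y \<in> carrier M"
  shows "f (x \<ominus>\<^bsub>M\<^esub> y) = f x \<ominus>\<^bsub>N\<^esub> f y"
  using additive_minus[OF graded_left_moduleD(3)[OF assms(1)] graded_left_moduleD(3)[OF assms(2)]]
    graded_mapsD(5)[OF assms(3)] assms(4,5) by blast

lemma graded_maps_comp:
  assumes "f \<in> graded_maps A M N" "g \<in> graded_maps A N L"
  shows "(\<lambda>x. g (f x)) \<in> graded_maps A M L"
  using graded_mapsD[OF assms(1)] graded_mapsD[OF assms(2)] by (intro graded_mapsI) auto

lemma graded_maps_minus:
  assumes N: "graded_left_module A N"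
    and f: "f \<in> graded_maps A M N" and g: "g \<in> graded_maps A M N"
  shows "(\<lambda>x. f x \<ominus>\<^bsub>N\<^esub> g x) \<in> graded_maps A M N"
proof -
  interpret N: left_module A N using N by (rule graded_left_moduleD)
  interpret N: graded_group N "homog N" using N by (rule graded_left_moduleD)
  note f = graded_mapsD[OF f] and g = graded_mapsD[OF g]
  show ?thesis
  proof (rule graded_mapsI)
    fix x y assume "x \<in> carrier M" "y \<in> carrier M"
    then show "f (x \<oplus>\<^bsub>M\<^esub> y) \<ominus>\<^bsub>N\<^esub> g (x \<oplus>\<^bsub>M\<^esub> y)
        = (f x \<ominus>\<^bsub>N\<^esub> g x) \<oplus>\<^bsub>N\<^esub> (f y \<ominus>\<^bsub>N\<^esub> g y)"
      using f g by (simp add: a_minus_def N.M.minus_add N.M.a_ac)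
  qed (use f g in \<open>simp_all add: N.smult_minus N.minus_grade\<close>)
qed

lemma part_graded_map:
  assumes M: "graded_group M D" and N: "graded_group N E" and g: "additive M N g"
    and gr: "\<And>n x. x \<in> D n \<Longrightarrow> g x \<in> E n" and x: "x \<in> carrier M"
  shows "component N E (g x) n = g (component M D x n)"
proof -
  interpret M: graded_group M D by fact
  interpret N: graded_group N E by fact
  note z = additive_zero[OF M.abelian_group_axioms N.abelian_group_axioms g]
  show ?thesis using x
  proof (induction rule: M.homogeneous_induct)
    case (grade i x)
    then show ?case using M.part_homogeneous N.part_homogeneous[OF gr] z by simp
  next
    case (add x y)
    then show ?case
      using additive_onD[OF g] M.part_add N.part_add M.part_closed by simp
  qed
qed

text \<open>
  This grades a copy of a graded subgroup: the closure of the image under taking parts is what makes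
  the parts of \<open>g x\<close> come from \<open>M\<close>.
\<close>

lemma direct_sum_decomposition_pullback:
  assumes N: "graded_group N D" and M: "abelian_group M" and g: "additive M N g"
    and inj: "inj_on g (carrier M)"
    and E: "\<And>n. E n = {x \<in> carrier M. g x \<in> D n}"
    and parts: "\<And>x n. x \<in> carrier M \<Longrightarrow> component N D (g x) n \<in> g ` carrier M"
  shows "direct_sum_decomposition M E"
  unfolding direct_sum_decomposition_def
proof (intro conjI allI ballI)
  interpret N: graded_group N D by fact
  interpret M: abelian_group M by fact
  note z = additive_zero[OF M N.abelian_group_axioms g]
  note gD = additive_onD[OF g]
  show "subgroup (E i) (add_monoid M)" for i
  proof (rule M.add.subgroupI)
    show "E i \<subseteq> carrier M" by (auto simp: E)
    have "\<zero>\<^bsub>M\<^esub> \<in> E i" using z N.zero_grade by (simp add: E)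
    then show "E i \<noteq> {}" by blast
    show "\<ominus>\<^bsub>M\<^esub> x \<in> E i" if "x \<in> E i" for x
      using that N.neg_grade additive_neg[OF M N.abelian_group_axioms g] by (simp add: E)
    show "x \<oplus>\<^bsub>M\<^esub> y \<in> E i" if "x \<in> E i" "y \<in> E i" for x y
      using that N.add_grade gD by (simp add: E)
  qed
  fix x assume x: "x \<in> carrier M"
  have z_iff: "g y = \<zero>\<^bsub>N\<^esub> \<longleftrightarrow> y = \<zero>\<^bsub>M\<^esub>" if "y \<in> carrier M" for y
    using inj_on_eq_iff[OF inj that M.zero_closed] z by simp
  show "\<exists>!c. homogeneous_decomposition M E x c"
  proof (rule ex_ex1I)
    define c where "c n = inv_into (carrier M) g (N.part (g x) n)" for n
    have c: "c n \<in> carrier M" "g (c n) = N.part (g x) n" for n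
      using parts[OF x] by (auto simp: c_def inv_into_into f_inv_into_f)
    have supp: "{n. c n \<noteq> \<zero>\<^bsub>M\<^esub>} = N.support (g x)"
      unfolding N.support_def c(2)[symmetric] using z_iff[OF c(1)] by simp
    then have fin: "finite {n. c n \<noteq> \<zero>\<^bsub>M\<^esub>}" using N.finite_support gD(1) x by simp
    have "g (\<Oplus>\<^bsub>M\<^esub>n\<in>{n. c n \<noteq> \<zero>\<^bsub>M\<^esub>}. c n) = g x"
      using additive_finsum[OF M N.abelian_group_axioms g fin, of c] c supp N.sum_parts[of "g x"] gD(1) x
      by simp
    then have "x = (\<Oplus>\<^bsub>M\<^esub>n\<in>{n. c n \<noteq> \<zero>\<^bsub>M\<^esub>}. c n)"
      using inj_onD[OF inj] x c(1) M.finsum_closed[of c] by (simp add: Pi_def)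
    then have "homogeneous_decomposition M E x c"
      using c fin N.part_grade gD(1) x by (simp add: homogeneous_decomposition_def E)
    then show "\<exists>c. homogeneous_decomposition M E x c" by (rule exI[of _ c])
  next
    have gc: "N.part (g x) = (\<lambda>n. g (c n)) \<and> (\<forall>n. c n \<in> carrier M)"
      if "homogeneous_decomposition M E x c" for c
    proof -
      have c: "\<And>n. c n \<in> carrier M" "\<And>n. g (c n) \<in> D n" and fin: "finite {n. c n \<noteq> \<zero>\<^bsub>M\<^esub>}"
        and x: "x = (\<Oplus>\<^bsub>M\<^esub>n\<in>{n. c n \<noteq> \<zero>\<^bsub>M\<^esub>}. c n)"
        using that by (auto simp: homogeneous_decomposition_def E)
      have "g x = (\<Oplus>\<^bsub>N\<^esub>n\<in>{n. c n \<noteq> \<zero>\<^bsub>M\<^esub>}. g (c n))"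
        using additive_finsum[OF M N.abelian_group_axioms g fin, of c] c x by simp
      then show ?thesis
        using N.part_eqI[OF fin, of "\<lambda>n. g (c n)"] c z by auto
    qed
    fix c d assume "homogeneous_decomposition M E x c" "homogeneous_decomposition M E x d"
    then have "g (c n) = g (d n)" "c n \<in> carrier M" "d n \<in> carrier M" for n
      using gc[of c] gc[of d] fun_cong[of "\<lambda>n. g (c n)" "\<lambda>n. g (d n)" n] by auto
    then show "c = d" using inj_onD[OF inj] by blast
  qed
qed

text \<open>
  Projectivity is a statement about modules with carrier in one type, so the target \<open>N\<close> is
  replaced by a copy of the image of \<open>g\<close>, carried by a section of \<open>g\<close>.
\<close>

lemma graded_projective_lift:
  fixes P M :: "('a, 'm) graded_module" and N :: "('a, 'n) graded_module"
  assumes gr: "\<And>m. grade A m \<subseteq> carrier A"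
    and P: "graded_projective A P" and M: "graded_left_module A M" and N: "graded_left_module A N"
    and g: "g \<in> graded_maps A M N" and f: "f \<in> graded_maps A P N"
    and im: "\<And>x. x \<in> carrier P \<Longrightarrow> f x \<in> g ` carrier M"
  shows "\<exists>h\<in>graded_maps A P M. \<forall>x\<in>carrier P. g (h x) = f x"
proof -
  interpret M: left_module A M using M by (rule graded_left_moduleD)
  interpret M: graded_group M "homog M" using M by (rule graded_left_moduleD)
  interpret N: left_module A N using N by (rule graded_left_moduleD)
  interpret N: graded_group N "homog N" using N by (rule graded_left_moduleD)
  note gD = graded_mapsD[OF g] and fD = graded_mapsD[OF f]
  define I where "I = g ` carrier M"
  define \<sigma> where "\<sigma> = inv_into (carrier M) g"
  have I: "y \<in> carrier N" if "y \<in> I" for y using that gD(1) by (auto simp: I_def)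
  have \<sigma>: "\<sigma> y \<in> carrier M" "g (\<sigma> y) = y" if "y \<in> I" for y
    using that by (auto simp: \<sigma>_def I_def inv_into_into f_inv_into_f)
  have I_add: "x \<oplus>\<^bsub>N\<^esub> y \<in> I" if "x \<in> I" "y \<in> I" for x y
    using that gD(2) by (metis (no_types, lifting) I_def M.M.a_closed image_iff)
  have I_zero: "\<zero>\<^bsub>N\<^esub> \<in> I"
    using graded_maps_zero[OF M N g] by (metis I_def M.M.zero_closed imageI)
  have I_neg: "\<ominus>\<^bsub>N\<^esub> x \<in> I" if "x \<in> I" for x
    using that additive_neg[OF M.M.abelian_group_axioms N.M.abelian_group_axioms gD(5)]
    by (metis (no_types, lifting) I_def M.M.a_inv_closed image_iff)
  have I_smult: "a \<odot>\<^bsub>N\<^esub> x \<in> I" if "a \<in> carrier A" "x \<in> I" for a x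
    using that gD(3) M.smult_closed by (metis (no_types, lifting) I_def image_iff)
  have I_part: "N.part y n \<in> I" if y: "y \<in> I" for y n
  proof -
    obtain m where m: "m \<in> carrier M" "y = g m" using y by (auto simp: I_def)
    have "N.part y n = g (M.part m n)"
      using part_graded_map[OF graded_left_moduleD(2)[OF M] graded_left_moduleD(2)[OF N] gD(5,4) m(1)] m
      by simp
    then show ?thesis using M.part_closed[OF m(1)] by (simp add: I_def)
  qed
  define N' :: "('a, 'm) graded_module" where
    "N' = \<lparr>carrier = \<sigma> ` I, monoid.mult = undefined, one = undefined, ring.zero = \<sigma> \<zero>\<^bsub>N\<^esub>,
       ring.add = (\<lambda>x y. \<sigma> (g x \<oplus>\<^bsub>N\<^esub> g y)), smult = (\<lambda>a x. \<sigma> (a \<odot>\<^bsub>N\<^esub> g x)),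
       homog = (\<lambda>n. {x \<in> \<sigma> ` I. g x \<in> homog N n})\<rparr>"
  have N'_group: "abelian_group N'"
  proof (rule abelian_groupI)
    fix x assume "x \<in> carrier N'"
    then obtain x' where x': "x' \<in> I" "x = \<sigma> x'" by (auto simp: N'_def)
    have "\<sigma> (\<ominus>\<^bsub>N\<^esub> x') \<oplus>\<^bsub>N'\<^esub> x = \<zero>\<^bsub>N'\<^esub>"
      using x' I I_neg by (simp add: N'_def \<sigma> N.M.l_neg)
    then show "\<exists>y\<in>carrier N'. y \<oplus>\<^bsub>N'\<^esub> x = \<zero>\<^bsub>N'\<^esub>"
      using I_neg x' by (auto simp: N'_def)
  qed (use I I_add I_zero in \<open>auto simp: N'_def \<sigma> N.M.a_ac\<close>)
  have g_N': "additive N' N g" by (auto simp: additive_on_def N'_def \<sigma> I I_add)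
  have "left_module A N'"
  proof (intro left_module.intro left_module_axioms.intro M.ring_axioms N'_group)
    fix a b x assume a: "a \<in> carrier A" "b \<in> carrier A" and "x \<in> carrier N'"
    then obtain x' where x': "x' \<in> I" "x = \<sigma> x'" by (auto simp: N'_def)
    show "(a \<oplus>\<^bsub>A\<^esub> b) \<odot>\<^bsub>N'\<^esub> x = a \<odot>\<^bsub>N'\<^esub> x \<oplus>\<^bsub>N'\<^esub> b \<odot>\<^bsub>N'\<^esub> x"
      using a x' I I_smult by (simp add: N'_def \<sigma> N.smult_l_distr)
  qed (use I I_add I_smult in \<open>auto simp: N'_def \<sigma> N.smult_r_distr N.smult_assoc N.smult_one\<close>)
  moreover have "direct_sum_decomposition N' (homog N')"
  proof (rule direct_sum_decomposition_pullback[OF graded_left_moduleD(2)[OF N] N'_group g_N'])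
    show "inj_on g (carrier N')" by (auto simp: inj_on_def N'_def \<sigma>)
    show "N.part (g x) n \<in> g ` carrier N'" if x: "x \<in> carrier N'" for x n
    proof -
      have "N.part (g x) n \<in> I" using x I_part by (auto simp: N'_def \<sigma>)
      then show ?thesis by (auto simp: N'_def image_image \<sigma> intro!: rev_image_eqI)
    qed
  qed (auto simp: N'_def)
  moreover have "a \<odot>\<^bsub>N'\<^esub> x \<in> homog N' (int m + n)"
    if "a \<in> grade A m" "x \<in> homog N' n" for a x m n
    using that gr[of m] I_smult graded_left_moduleD(4)[OF N] by (auto simp: N'_def \<sigma>)
  ultimately have N'_mod: "graded_left_module A N'"
    unfolding graded_left_module_def by blast
  have g': "(\<lambda>x. \<sigma> (g x)) \<in> graded_maps A M N'" and f': "(\<lambda>x. \<sigma> (f x)) \<in> graded_maps A P N'"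
  proof -
    have P': "graded_group P (homog P)"
      using P unfolding graded_projective_def by (blast dest: graded_left_moduleD(2))
    have gI: "g x \<in> I" if "x \<in> carrier M" for x using that by (simp add: I_def)
    have fI: "f x \<in> I" if "x \<in> carrier P" for x using im[OF that] by (simp add: I_def)
    show "(\<lambda>x. \<sigma> (g x)) \<in> graded_maps A M N'"
      using gD(1-4) gI M.grade_carrier by (intro graded_mapsI) (auto simp: N'_def \<sigma>)
    show "(\<lambda>x. \<sigma> (f x)) \<in> graded_maps A P N'"
      using fD(1-4) fI graded_group.grade_carrier[OF P'] by (intro graded_mapsI) (auto simp: N'_def \<sigma>)
  qed
  have onto: "(\<lambda>x. \<sigma> (g x)) ` carrier M = carrier N'" by (auto simp: N'_def I_def)
  have "\<exists>h\<in>graded_maps A P M. \<forall>x\<in>carrier P. \<sigma> (g (h x)) = \<sigma> (f x)"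
    using P[unfolded graded_projective_def, THEN conjunct2, rule_format, OF M N'_mod g' f' onto] .
  then obtain h where h: "h \<in> graded_maps A P M"
    "\<And>x. x \<in> carrier P \<Longrightarrow> \<sigma> (g (h x)) = \<sigma> (f x)" by blast
  have "g (h x) = f x" if x: "x \<in> carrier P" for x
  proof -
    have "g (h x) \<in> I" using graded_mapsD(1)[OF h(1) x] by (simp add: I_def)
    moreover have "f x \<in> I" using im[OF x] by (simp add: I_def)
    ultimately show ?thesis using arg_cong[OF h(2)[OF x], of g] by (simp add: \<sigma>(2))
  qed
  with h(1) show ?thesis by blast
qed

text \<open>
  The comparison theorem asks for projective modules in its source and for an exact complex in its
  target, so exactness is split off from \<^const>\<open>graded_projective_resolution\<close>.
\<close>

definition graded_resolution ::
    "('k, 'a) graded_algebra \<Rightarrow> ('a, 'n) graded_module \<Rightarrow>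
     (nat \<Rightarrow> ('a, 'm) graded_module) \<Rightarrow> (nat \<Rightarrow> 'm \<Rightarrow> 'm) \<Rightarrow> ('m \<Rightarrow> 'n) \<Rightarrow> bool"
  where "graded_resolution A M P \<delta> \<epsilon> \<longleftrightarrow>
    graded_left_module A M \<and> (\<forall>i. graded_left_module A (P i)) \<and>
    \<epsilon> \<in> graded_maps A (P 0) M \<and>
    (\<forall>i. \<delta> i \<in> graded_maps A (P (Suc i)) (P i)) \<and>
    \<epsilon> ` carrier (P 0) = carrier M \<and>
    \<delta> 0 ` carrier (P 1) = {x \<in> carrier (P 0). \<epsilon> x = \<zero>\<^bsub>M\<^esub>} \<and>
    (\<forall>i. \<delta> (Suc i) ` carrier (P (Suc (Suc i))) =
         {x \<in> carrier (P (Suc i)). \<delta> i x = \<zero>\<^bsub>P i\<^esub>})"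

lemma graded_resolutionD:
  assumes "graded_resolution A M P \<delta> \<epsilon>"
  shows "graded_left_module A M" "graded_left_module A (P i)"
    "\<epsilon> \<in> graded_maps A (P 0) M" "\<delta> i \<in> graded_maps A (P (Suc i)) (P i)"
    "y \<in> carrier M \<Longrightarrow> y \<in> \<epsilon> ` carrier (P 0)"
    "x \<in> carrier (P 0) \<Longrightarrow> \<epsilon> x = \<zero>\<^bsub>M\<^esub> \<Longrightarrow> x \<in> \<delta> 0 ` carrier (P (Suc 0))"
    "x \<in> carrier (P (Suc i)) \<Longrightarrow> \<delta> i x = \<zero>\<^bsub>P i\<^esub> \<Longrightarrow> x \<in> \<delta> (Suc i) ` carrier (P (Suc (Suc i)))"
    "z \<in> carrier (P (Suc 0)) \<Longrightarrow> \<epsilon> (\<delta> 0 z) = \<zero>\<^bsub>M\<^esub>"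
    "z \<in> carrier (P (Suc (Suc i))) \<Longrightarrow> \<delta> i (\<delta> (Suc i) z) = \<zero>\<^bsub>P i\<^esub>"
proof -
  note R = assms[unfolded graded_resolution_def One_nat_def]
  show "graded_left_module A M" using R by (rule conjunct1)
  show "graded_left_module A (P i)" using R[THEN conjunct2, THEN conjunct1] by (rule spec)
  show "\<epsilon> \<in> graded_maps A (P 0) M" using R[THEN conjunct2, THEN conjunct2] by (rule conjunct1)
  note R = R[THEN conjunct2, THEN conjunct2, THEN conjunct2]
  show "\<delta> i \<in> graded_maps A (P (Suc i)) (P i)" using R[THEN conjunct1] by (rule spec)
  note R = R[THEN conjunct2]
  show "y \<in> \<epsilon> ` carrier (P 0)" if "y \<in> carrier M" using R[THEN conjunct1] that by blast
  note R = R[THEN conjunct2]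
  show "x \<in> \<delta> 0 ` carrier (P (Suc 0))" if "x \<in> carrier (P 0)" "\<epsilon> x = \<zero>\<^bsub>M\<^esub>"
    using R[THEN conjunct1] that by blast
  show "\<epsilon> (\<delta> 0 z) = \<zero>\<^bsub>M\<^esub>" if "z \<in> carrier (P (Suc 0))" using R[THEN conjunct1] that by blast
  note R = R[THEN conjunct2, THEN spec, of i]
  show "x \<in> \<delta> (Suc i) ` carrier (P (Suc (Suc i)))" if "x \<in> carrier (P (Suc i))" "\<delta> i x = \<zero>\<^bsub>P i\<^esub>"
    using R that by blast
  show "\<delta> i (\<delta> (Suc i) z) = \<zero>\<^bsub>P i\<^esub>" if "z \<in> carrier (P (Suc (Suc i)))" using R that by blast
qed

lemma graded_projective_resolution_iff:
  assumes "graded_left_module A M"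
  shows "graded_projective_resolution A M P \<delta> \<epsilon> \<longleftrightarrow>
    graded_resolution A M P \<delta> \<epsilon> \<and> (\<forall>i. graded_projective A (P i))"
proof -
  have "(\<forall>i. graded_projective A (P i)) \<longrightarrow> (\<forall>i. graded_left_module A (P i))"
    by (auto simp: graded_projective_def)
  with assms show ?thesis
    unfolding graded_resolution_def graded_projective_resolution_def by satx
qed

lemma comparison_exists:
  fixes P Q :: "nat \<Rightarrow> ('a, 'm) graded_module" and M :: "('a, 'n) graded_module"
    and N :: "('a, 'l) graded_module"
  assumes gr: "\<And>m. grade A m \<subseteq> carrier A"
    and P: "graded_resolution A M P \<delta> \<epsilon>" and proj: "\<And>i. graded_projective A (P i)"
    and Q: "graded_resolution A N Q \<gamma> \<eta>" and u: "u \<in> graded_maps A M N"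
  obtains \<phi> where "\<And>i. \<phi> i \<in> graded_maps A (P i) (Q i)"
    "\<And>x. x \<in> carrier (P 0) \<Longrightarrow> \<eta> (\<phi> 0 x) = u (\<epsilon> x)"
    "\<And>i x. x \<in> carrier (P (Suc i)) \<Longrightarrow> \<gamma> i (\<phi> (Suc i) x) = \<phi> i (\<delta> i x)"
proof -
  note P = graded_resolutionD[OF P] and Q = graded_resolutionD[OF Q]
  note lift = graded_projective_lift[OF gr proj Q(2)]
  note \<delta> = graded_mapsD[OF P(4)] and \<gamma> = graded_mapsD[OF Q(4)]
  define S where "S n f \<longleftrightarrow> f \<in> graded_maps A (P n) (Q n) \<and>
    (n = 0 \<longrightarrow> (\<forall>x\<in>carrier (P 0). \<eta> (f x) = u (\<epsilon> x))) \<and>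
    (\<forall>x\<in>carrier (P (Suc n)). f (\<delta> n x) \<in> \<gamma> n ` carrier (Q (Suc n)))" for n f
  have "\<exists>\<phi>. \<forall>n. S n (\<phi> n) \<and> (\<forall>x\<in>carrier (P (Suc n)). \<gamma> n (\<phi> (Suc n) x) = \<phi> n (\<delta> n x))"
  proof (rule dependent_nat_choice)
    obtain f where f: "f \<in> graded_maps A (P 0) (Q 0)" "\<forall>x\<in>carrier (P 0). \<eta> (f x) = u (\<epsilon> x)"
      using lift[OF Q(1,3) graded_maps_comp[OF P(3) u]] Q(5) graded_mapsD(1)[OF u] graded_mapsD(1)[OF P(3)]
      by blast
    have "f (\<delta> 0 x) \<in> \<gamma> 0 ` carrier (Q (Suc 0))" if x: "x \<in> carrier (P (Suc 0))" for x
      using Q(6) f \<delta>(1)[OF x] P(8)[OF x] graded_maps_zero[OF P(1) Q(1) u] graded_mapsD(1)[OF f(1)]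
      by simp
    with f show "\<exists>f. S 0 f" by (auto simp: S_def)
  next
    fix f n assume S: "S n f"
    then have f: "f \<in> graded_maps A (P n) (Q n)" by (simp add: S_def)
    obtain h where h: "h \<in> graded_maps A (P (Suc n)) (Q (Suc n))"
      "\<forall>x\<in>carrier (P (Suc n)). \<gamma> n (h x) = f (\<delta> n x)"
      using lift[OF Q(2,4) graded_maps_comp[OF P(4) f]] S by (auto simp: S_def)
    have "h (\<delta> (Suc n) x) \<in> \<gamma> (Suc n) ` carrier (Q (Suc (Suc n)))" if x: "x \<in> carrier (P (Suc (Suc n)))" for x
      using Q(7) h \<delta>(1)[OF x] P(9)[OF x] graded_maps_zero[OF P(2) Q(2) f] graded_mapsD(1)[OF h(1)]
      by simp
    with h show "\<exists>h. S (Suc n) h \<and> (\<forall>x\<in>carrier (P (Suc n)). \<gamma> n (h x) = f (\<delta> n x))"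
      by (auto simp: S_def)
  qed
  then obtain \<phi> where \<phi>: "\<And>n. S n (\<phi> n)"
    "\<And>n x. x \<in> carrier (P (Suc n)) \<Longrightarrow> \<gamma> n (\<phi> (Suc n) x) = \<phi> n (\<delta> n x)" by blast
  show ?thesis by (rule that[of \<phi>]) (use \<phi> in \<open>auto simp: S_def\<close>)
qed

lemma chain_map_null_homotopic:
  fixes P Q :: "nat \<Rightarrow> ('a, 'm) graded_module" and M :: "('a, 'n) graded_module"
    and N :: "('a, 'l) graded_module"
  assumes gr: "\<And>m. grade A m \<subseteq> carrier A"
    and P: "graded_resolution A M P \<delta> \<epsilon>" and proj: "\<And>i. graded_projective A (P i)"
    and Q: "graded_resolution A N Q \<gamma> \<eta>"
    and \<chi>: "\<And>i. \<chi> i \<in> graded_maps A (P i) (Q i)"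
    and \<chi>0: "\<And>x. x \<in> carrier (P 0) \<Longrightarrow> \<eta> (\<chi> 0 x) = \<zero>\<^bsub>N\<^esub>"
    and \<chi>Suc: "\<And>i x. x \<in> carrier (P (Suc i)) \<Longrightarrow> \<gamma> i (\<chi> (Suc i) x) = \<chi> i (\<delta> i x)"
  obtains s where "\<And>i. s i \<in> graded_maps A (P i) (Q (Suc i))"
    "\<And>x. x \<in> carrier (P 0) \<Longrightarrow> \<chi> 0 x = \<gamma> 0 (s 0 x)"
    "\<And>i x. x \<in> carrier (P (Suc i)) \<Longrightarrow> \<chi> (Suc i) x = \<gamma> (Suc i) (s (Suc i) x) \<oplus>\<^bsub>Q (Suc i)\<^esub> s i (\<delta> i x)"
proof -
  note P = graded_resolutionD[OF P] and Q = graded_resolutionD[OF Q]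
  interpret Q: abelian_group "Q i" for i using graded_left_moduleD(3)[OF Q(2)] .
  note lift = graded_projective_lift[OF gr proj Q(2) Q(2)]
  note \<delta> = graded_mapsD[OF P(4)] and \<gamma> = graded_mapsD[OF Q(4)] and \<chi>D = graded_mapsD[OF \<chi>]
  define S where "S n f \<longleftrightarrow> f \<in> graded_maps A (P n) (Q (Suc n)) \<and>
    (n = 0 \<longrightarrow> (\<forall>x\<in>carrier (P 0). \<gamma> 0 (f x) = \<chi> 0 x)) \<and>
    (\<forall>x\<in>carrier (P (Suc n)). \<gamma> n (f (\<delta> n x)) = \<chi> n (\<delta> n x))" for n f
  have "\<exists>s. \<forall>n. S n (s n) \<and>
      (\<forall>x\<in>carrier (P (Suc n)). \<gamma> (Suc n) (s (Suc n) x) = \<chi> (Suc n) x \<ominus>\<^bsub>Q (Suc n)\<^esub> s n (\<delta> n x))"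
  proof (rule dependent_nat_choice)
    obtain f where f: "f \<in> graded_maps A (P 0) (Q (Suc 0))" "\<forall>x\<in>carrier (P 0). \<gamma> 0 (f x) = \<chi> 0 x"
      using lift[OF Q(4) \<chi>] \<chi>0 \<chi>D(1) Q(6) by blast
    with \<delta>(1) show "\<exists>f. S 0 f" by (auto simp: S_def)
  next
    fix f n assume S: "S n f"
    then have f: "f \<in> graded_maps A (P n) (Q (Suc n))" by (simp add: S_def)
    let ?d = "\<lambda>x. \<chi> (Suc n) x \<ominus>\<^bsub>Q (Suc n)\<^esub> f (\<delta> n x)"
    have d: "?d \<in> graded_maps A (P (Suc n)) (Q (Suc n))"
      by (rule graded_maps_minus[OF Q(2) \<chi> graded_maps_comp[OF P(4) f]])
    have "\<gamma> n (?d x) = \<zero>\<^bsub>Q n\<^esub>" if x: "x \<in> carrier (P (Suc n))" for x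
    proof -
      have "\<gamma> n (?d x) = \<gamma> n (\<chi> (Suc n) x) \<ominus>\<^bsub>Q n\<^esub> \<gamma> n (f (\<delta> n x))"
        using graded_maps_minus_arg[OF Q(2) Q(2) Q(4)] \<chi>D(1)[OF x] graded_mapsD(1)[OF f \<delta>(1)[OF x]] by simp
      also have "\<dots> = \<chi> n (\<delta> n x) \<ominus>\<^bsub>Q n\<^esub> \<chi> n (\<delta> n x)"
        using \<chi>Suc[OF x] S x by (simp add: S_def)
      also have "\<dots> = \<zero>\<^bsub>Q n\<^esub>" using \<chi>D(1)[OF \<delta>(1)[OF x]] by (simp add: Q.r_neg a_minus_def)
      finally show ?thesis .
    qed
    then have "?d x \<in> \<gamma> (Suc n) ` carrier (Q (Suc (Suc n)))" if x: "x \<in> carrier (P (Suc n))" for x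
      using Q(7) graded_mapsD(1)[OF d x] x by blast
    then obtain h where h: "h \<in> graded_maps A (P (Suc n)) (Q (Suc (Suc n)))"
      "\<forall>x\<in>carrier (P (Suc n)). \<gamma> (Suc n) (h x) = ?d x"
      using lift[OF Q(4) d] by blast
    have "\<gamma> (Suc n) (h (\<delta> (Suc n) x)) = \<chi> (Suc n) (\<delta> (Suc n) x)" if x: "x \<in> carrier (P (Suc (Suc n)))" for x
      using h \<delta>(1)[OF x] P(9)[OF x] graded_maps_zero[OF P(2) Q(2) f] \<chi>D(1)[OF \<delta>(1)[OF x]]
      by (simp add: a_minus_def)
    with h show "\<exists>h. S (Suc n) h \<and> (\<forall>x\<in>carrier (P (Suc n)). \<gamma> (Suc n) (h x) = ?d x)"
      by (auto simp: S_def)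
  qed
  then obtain s where s: "\<And>n. S n (s n)"
    "\<And>n x. x \<in> carrier (P (Suc n)) \<Longrightarrow> \<gamma> (Suc n) (s (Suc n) x) = \<chi> (Suc n) x \<ominus>\<^bsub>Q (Suc n)\<^esub> s n (\<delta> n x)"
    by blast
  have sm: "s n \<in> graded_maps A (P n) (Q (Suc n))" for n using s(1)[of n] by (simp add: S_def)
  show ?thesis
  proof (rule that[of s])
    show "\<chi> (Suc i) x = \<gamma> (Suc i) (s (Suc i) x) \<oplus>\<^bsub>Q (Suc i)\<^esub> s i (\<delta> i x)" if x: "x \<in> carrier (P (Suc i))" for i x
      using s(2)[OF x] \<chi>D(1)[OF x] graded_mapsD(1)[OF sm \<delta>(1)[OF x]]
      by (simp add: a_minus_def Q.a_assoc Q.l_neg)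
  qed (use s sm in \<open>auto simp: S_def\<close>)
qed

section \<open>The graded Jacobson radical\<close>

locale graded_k_algebra = graded_algebra K A
  for K :: "'k ring" and A :: "('k, 'a) graded_algebra" (structure)

sublocale graded_k_algebra \<subseteq> graded_group A "grade A"
  using grade_direct_sum by unfold_locales

context graded_k_algebra
begin

lemma grade_subset: "grade A n \<subseteq> carrier A"
  using grade_carrier by auto

abbreviation J where "J \<equiv> graded_jacobson_radical A"

lemma part_part: "x \<in> carrier A \<Longrightarrow> part (part x m) n = (if n = m then part x m else \<zero>)"
  using part_homogeneous[OF part_grade, of x m] by simp

lemma additive_mult_left: "a \<in> carrier A \<Longrightarrow> additive A A (\<lambda>x. a \<otimes> x)"
  by (auto simp: additive_on_def A.r_distr)

lemma additive_mult_right: "a \<in> carrier A \<Longrightarrow> additive A A (\<lambda>x. x \<otimes> a)"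
  by (auto simp: additive_on_def A.l_distr)

lemma additive_part: "additive A A (\<lambda>x. part x n)"
  by (auto simp: additive_on_def part_closed part_add)

lemma part_zero_mult:
  assumes a: "a \<in> carrier A" and x: "x \<in> carrier A"
  shows "part (a \<otimes> x) 0 = part a 0 \<otimes> part x 0"
  using a
proof (induction rule: homogeneous_induct)
  case (grade i a)
  then have a: "a \<in> carrier A" by (rule grade_carrier)
  show ?case
  proof (rule additive_eqI[OF _ _ _ x])
    show "additive A A (\<lambda>x. part (a \<otimes> x) 0)"
      by (rule additive_comp[OF additive_mult_left[OF a] additive_part])
    show "additive A A (\<lambda>x. part a 0 \<otimes> part x 0)"
      by (rule additive_comp[OF additive_part additive_mult_left]) (simp add: part_closed a)
    fix j x assume x: "x \<in> grade A j"
    then have xc: "x \<in> carrier A" by (rule grade_carrier)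
    show "part (a \<otimes> x) 0 = part a 0 \<otimes> part x 0"
      using part_homogeneous[OF x] part_homogeneous[OF grade] part_homogeneous[OF mult_grade[OF grade x]] a xc
      by simp
  qed
next
  case (add a b)
  then show ?case using x by (simp add: part_add A.l_distr part_closed)
qed

lemma subgroup_regular_module:
  "subgroup I (add_monoid (regular_module A)) \<longleftrightarrow> subgroup I (add_monoid A)"
  by (simp add: subgroup_def m_inv_def regular_module_def)

lemma graded_left_ideal_iff:
  "graded_left_ideal A I \<longleftrightarrow> subgroup I (add_monoid A) \<and>
    (\<forall>a\<in>carrier A. \<forall>x\<in>I. a \<otimes> x \<in> I) \<and> (\<forall>x\<in>I. \<forall>n. part x n \<in> I)"
  unfolding graded_left_ideal_def submodule_def subgroup_regular_module
  by (auto simp: submodule_axioms_def regular_module_def)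

lemma graded_left_idealI:
  assumes "I \<subseteq> carrier A" "\<zero> \<in> I" "\<And>x y. x \<in> I \<Longrightarrow> y \<in> I \<Longrightarrow> x \<ominus> y \<in> I"
    "\<And>a x. a \<in> carrier A \<Longrightarrow> x \<in> I \<Longrightarrow> a \<otimes> x \<in> I" "\<And>x n. x \<in> I \<Longrightarrow> part x n \<in> I"
  shows "graded_left_ideal A I"
proof -
  have neg: "\<ominus> x \<in> I" if "x \<in> I" for x
    using assms(3)[OF assms(2) that] subsetD[OF assms(1) that] by (simp add: a_minus_def)
  have "x \<oplus> y \<in> I" if "x \<in> I" "y \<in> I" for x y
    using assms(3)[OF that(1) neg[OF that(2)]] that subsetD[OF assms(1)] by (simp add: a_minus_def)
  then have "subgroup I (add_monoid A)"
    using assms(1,2) neg by (intro A.add.subgroupI) (auto simp: a_inv_def)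
  then show ?thesis using assms by (simp add: graded_left_ideal_iff)
qed

lemma graded_left_idealD:
  assumes "graded_left_ideal A I"
  shows "x \<in> I \<Longrightarrow> x \<in> carrier A" "\<zero> \<in> I" "x \<in> I \<Longrightarrow> y \<in> I \<Longrightarrow> x \<oplus> y \<in> I"
    "x \<in> I \<Longrightarrow> y \<in> I \<Longrightarrow> x \<ominus> y \<in> I"
    "a \<in> carrier A \<Longrightarrow> x \<in> I \<Longrightarrow> a \<otimes> x \<in> I" "x \<in> I \<Longrightarrow> part x n \<in> I"
proof -
  have s: "subgroup I (add_monoid A)" using assms by (simp add: graded_left_ideal_iff)
  show "x \<in> I \<Longrightarrow> x \<in> carrier A" using subgroup.mem_carrier[OF s] by simp
  show "\<zero> \<in> I" using subgroup.one_closed[OF s] by simp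
  show "x \<in> I \<Longrightarrow> y \<in> I \<Longrightarrow> x \<oplus> y \<in> I" using subgroup.m_closed[OF s] by simp
  show "x \<in> I \<Longrightarrow> y \<in> I \<Longrightarrow> x \<ominus> y \<in> I"
    using subgroup.m_closed[OF s] subgroup.m_inv_closed[OF s] by (simp add: a_minus_def a_inv_def)
qed (use assms in \<open>auto simp: graded_left_ideal_iff\<close>)

lemma graded_left_ideal_one: "graded_left_ideal A I \<Longrightarrow> \<one> \<in> I \<Longrightarrow> I = carrier A"
  using graded_left_idealD(1,5)[of I] A.r_one by (metis subsetI subset_antisym)

lemma maximal_graded_left_idealD:
  assumes "maximal_graded_left_ideal A I"
  shows "graded_left_ideal A I" "\<one> \<notin> I"
    "graded_left_ideal A I' \<Longrightarrow> I \<subseteq> I' \<Longrightarrow> \<one> \<notin> I' \<Longrightarrow> I' = I"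
  using assms graded_left_ideal_one by (auto simp: maximal_graded_left_ideal_def)

lemma maximal_graded_left_idealI:
  assumes "graded_left_ideal A I" "\<one> \<notin> I"
    "\<And>I'. graded_left_ideal A I' \<Longrightarrow> I \<subseteq> I' \<Longrightarrow> I' \<noteq> I \<Longrightarrow> \<one> \<in> I'"
  shows "maximal_graded_left_ideal A I"
  using assms graded_left_ideal_one by (auto simp: maximal_graded_left_ideal_def)

text \<open>
  The left ideal \<open>I + A\<^sub>\<ge>\<^sub>1\<close> consists of the elements with degree 0 part in \<open>I\<close>. It is proper, since
  otherwise \<open>1\<close> would lie in \<open>I\<close>, so it equals \<open>I\<close> if \<open>I\<close> is maximal.
\<close>

lemma mem_maximal_iff:
  assumes "maximal_graded_left_ideal A I" "x \<in> carrier A"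
  shows "x \<in> I \<longleftrightarrow> part x 0 \<in> I"
proof -
  note I = maximal_graded_left_idealD[OF assms(1)]
  note ID = graded_left_idealD[OF I(1)]
  define I' where "I' = {z \<in> carrier A. part z 0 \<in> I}"
  have "graded_left_ideal A I'"
  proof (rule graded_left_idealI)
    show "x \<ominus> y \<in> I'" if "x \<in> I'" "y \<in> I'" for x y
    proof -
      have "part (x \<ominus> y) 0 = part x 0 \<ominus> part y 0"
        using that by (intro additive_minus[OF A.abelian_group_axioms A.abelian_group_axioms additive_part])
          (auto simp: I'_def)
      then show ?thesis using that ID(4) by (simp add: I'_def)
    qed
  qed (auto simp: I'_def ID part_zero part_zero_mult part_closed part_part)
  moreover have "I \<subseteq> I'" using ID(1,6) by (auto simp: I'_def)
  moreover have "\<one> \<notin> I'" using I(2) part_homogeneous[OF one_grade] by (simp add: I'_def)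
  ultimately have "I' = I" by (rule I(3))
  then show ?thesis using assms(2) by (auto simp: I'_def)
qed

lemma J_iff: "x \<in> J \<longleftrightarrow> x \<in> carrier A \<and> (\<forall>I. maximal_graded_left_ideal A I \<longrightarrow> x \<in> I)"
  by (simp add: graded_jacobson_radical_def)

lemma J_part_zero: "x \<in> carrier A \<Longrightarrow> x \<in> J \<longleftrightarrow> part x 0 \<in> J"
  using mem_maximal_iff by (auto simp: J_iff part_closed)

lemma positive_grade_J: "x \<in> grade A n \<Longrightarrow> 0 < n \<Longrightarrow> x \<in> J"
  using J_part_zero[OF grade_carrier] part_homogeneous[of x n]
    graded_left_idealD(2)[OF maximal_graded_left_idealD(1)] by (simp add: J_iff)

lemma J_graded_left_ideal: "graded_left_ideal A J"
proof (rule graded_left_idealI)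
  note D = graded_left_idealD[OF maximal_graded_left_idealD(1)]
  show "J \<subseteq> carrier A" by (auto simp: J_iff)
  show "\<zero> \<in> J" by (simp add: J_iff D(2))
  show "x \<ominus> y \<in> J" if "x \<in> J" "y \<in> J" for x y using that D(4) by (simp add: J_iff)
  show "a \<otimes> x \<in> J" if "a \<in> carrier A" "x \<in> J" for a x using that D(5) by (simp add: J_iff)
  show "part x n \<in> J" if "x \<in> J" for x n using that D(6) part_closed by (simp add: J_iff)
qed

lemmas JD = graded_left_idealD[OF J_graded_left_ideal]

text \<open>
  For \<open>b\<close> in degree 0 outside a maximal \<open>I\<close>, right multiplication by \<open>b\<close> embeds \<open>A/(I : b)\<close>
  into the simple module \<open>A/I\<close>, so \<open>(I : b)\<close> is again maximal.
\<close>

lemma J_mult_degree_zero: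
  assumes x: "x \<in> J" and b: "b \<in> grade A 0" and I: "maximal_graded_left_ideal A I"
  shows "part x 0 \<otimes> b \<in> I"
proof (cases "b \<in> I")
  note ID = graded_left_idealD[OF maximal_graded_left_idealD(1)[OF I]]
  case True
  then show ?thesis using x JD(1) ID(5) part_closed by blast
next
  case False
  note ID = graded_left_idealD[OF maximal_graded_left_idealD(1)[OF I]]
  have bc: "b \<in> carrier A" using b by (rule grade_carrier)
  have minus_b: "part (x \<ominus> y) 0 \<otimes> b = part x 0 \<otimes> b \<ominus> part y 0 \<otimes> b"
    if "x \<in> carrier A" "y \<in> carrier A" for x y
    using additive_minus[OF A.abelian_group_axioms A.abelian_group_axioms
        additive_comp[OF additive_part additive_mult_right[OF bc]] that] .
  have minus_0: "part (x \<ominus> y) 0 = part x 0 \<ominus> part y 0"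
    if "x \<in> carrier A" "y \<in> carrier A" for x y
    using additive_minus[OF A.abelian_group_axioms A.abelian_group_axioms additive_part that] .
  define L where "L = {z \<in> carrier A. part z 0 \<otimes> b \<in> I}"
  have "maximal_graded_left_ideal A L"
  proof (rule maximal_graded_left_idealI)
    show "graded_left_ideal A L"
      by (rule graded_left_idealI)
        (auto simp: L_def ID bc part_zero part_zero_mult part_closed part_part minus_b A.m_assoc)
    show "\<one> \<notin> L" using False part_homogeneous[OF one_grade] bc by (simp add: L_def)
    fix L' assume L': "graded_left_ideal A L'" "L \<subseteq> L'" "L' \<noteq> L"
    note L'D = graded_left_idealD[OF L'(1)]
    obtain z where z: "z \<in> L'" "part z 0 \<otimes> b \<notin> I" using L'(2,3) L'D(1) by (auto simp: L_def)
    define I' where "I' = {y \<in> carrier A. \<exists>l\<in>L'. part y 0 \<ominus> part l 0 \<otimes> b \<in> I}"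
    have "graded_left_ideal A I'"
    proof (rule graded_left_idealI)
      show "\<zero> \<in> I'"
        using L'D(2) ID(2) bc by (auto simp: I'_def part_zero a_minus_def intro!: bexI[of _ "\<zero>"])
    next
      fix x y assume "x \<in> I'" "y \<in> I'"
      then obtain l m where lm: "l \<in> L'" "m \<in> L'" and c: "x \<in> carrier A" "y \<in> carrier A"
        and i: "part x 0 \<ominus> part l 0 \<otimes> b \<in> I" "part y 0 \<ominus> part m 0 \<otimes> b \<in> I"
        by (auto simp: I'_def)
      have lc: "l \<in> carrier A" "m \<in> carrier A" using lm L'D(1) by auto
      have swap: "(p \<ominus> q) \<ominus> (r \<ominus> s) = (p \<ominus> r) \<ominus> (q \<ominus> s)"
        if "p \<in> carrier A" "q \<in> carrier A" "r \<in> carrier A" "s \<in> carrier A" for p q r s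
        using that by (simp add: a_minus_def A.minus_add A.a_ac)
      have "part (x \<ominus> y) 0 \<ominus> part (l \<ominus> m) 0 \<otimes> b \<in> I"
        using ID(4)[OF i] c lc part_closed bc by (simp add: minus_0[OF c] minus_b[OF lc] swap)
      then show "x \<ominus> y \<in> I'" using L'D(4) lm c by (auto simp: I'_def)
    next
      fix a x assume a: "a \<in> carrier A" and "x \<in> I'"
      then obtain l where l: "l \<in> L'" and x: "x \<in> carrier A"
        and i: "part x 0 \<ominus> part l 0 \<otimes> b \<in> I" by (auto simp: I'_def)
      have lc: "l \<in> carrier A" using l L'D(1) by auto
      have "part a 0 \<otimes> (part x 0 \<ominus> part l 0 \<otimes> b) =
          part (a \<otimes> x) 0 \<ominus> part (a \<otimes> l) 0 \<otimes> b"
        using additive_minus[OF A.abelian_group_axioms A.abelian_group_axioms additive_mult_left, of "part a 0"]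
          a x lc bc part_closed by (simp add: part_zero_mult A.m_assoc)
      then have "part (a \<otimes> x) 0 \<ominus> part (a \<otimes> l) 0 \<otimes> b \<in> I"
        using ID(5)[OF part_closed[OF a, of 0] i] by simp
      then show "a \<otimes> x \<in> I'" using L'D(5)[OF a l] a x by (auto simp: I'_def)
    next
      fix x n assume "x \<in> I'"
      then obtain l where l: "l \<in> L'" and x: "x \<in> carrier A"
        and i: "part x 0 \<ominus> part l 0 \<otimes> b \<in> I" by (auto simp: I'_def)
      have "\<zero> \<ominus> part \<zero> 0 \<otimes> b \<in> I" using ID(2) bc by (simp add: part_zero a_minus_def)
      then show "part x n \<in> I'"
        using L'D(2) l i x part_closed by (cases "n = 0") (auto simp: I'_def part_part)
    qed (auto simp: I'_def)
    moreover have "I \<subseteq> I'"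
    proof
      fix x assume x: "x \<in> I"
      have "part x 0 \<ominus> part \<zero> 0 \<otimes> b = part x 0"
        using ID(1)[OF x] part_closed bc by (simp add: part_zero a_minus_def)
      then show "x \<in> I'" using ID(1,6)[OF x] L'D(2) by (auto simp: I'_def intro!: bexI[of _ "\<zero>"])
    qed
    moreover have "part z 0 \<otimes> b \<in> I'"
    proof -
      have zc: "part z 0 \<otimes> b \<in> grade A 0"
        using mult_grade[OF part_grade[OF L'D(1)[OF z(1)]] b, of 0] by simp
      have "part (part z 0 \<otimes> b) 0 \<ominus> part z 0 \<otimes> b = \<zero>"
        using part_homogeneous[OF zc] grade_carrier[OF zc] by (simp add: a_minus_def A.r_neg)
      then show ?thesis using grade_carrier[OF zc] ID(2) z(1) by (auto simp: I'_def intro!: bexI[of _ z])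
    qed
    ultimately have "I' = carrier A"
      using z(2) maximal_graded_left_idealD(3)[OF I, of I'] graded_left_ideal_one by blast
    then have "b \<in> I'" using bc by simp
    then obtain l where l: "l \<in> L'" "b \<ominus> part l 0 \<otimes> b \<in> I"
      using part_homogeneous[OF b] unfolding I'_def by auto
    have lc: "l \<in> carrier A" using l L'D(1) by auto
    have "\<one> \<ominus> part l 0 \<in> L"
    proof -
      have "part (\<one> \<ominus> part l 0) 0 \<otimes> b = b \<ominus> part l 0 \<otimes> b"
        using minus_b[OF A.one_closed part_closed[OF lc]] part_homogeneous[OF one_grade] bc lc
        by (simp add: part_part)
      then show ?thesis using l lc part_closed by (simp add: L_def)
    qed
    then have "(\<one> \<ominus> part l 0) \<oplus> part l 0 \<in> L'"
      using L'(2) L'D(3,6) l by blast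
    then show "\<one> \<in> L'" using lc part_closed by (simp add: a_minus_def A.a_assoc A.l_neg)
  qed
  then show ?thesis using x by (auto simp: J_iff L_def)
qed

lemma J_ideal: "ideal J A"
proof (rule idealI[OF A.ring_axioms])
  show "subgroup J (add_monoid A)" using J_graded_left_ideal by (simp add: graded_left_ideal_iff)
  fix a x assume x: "a \<in> J" and b: "x \<in> carrier A"
  show "x \<otimes> a \<in> J" using JD(5) x b by simp
  have "part a 0 \<otimes> part x 0 \<in> J"
    using J_mult_degree_zero[OF x part_grade[OF b]] part_closed JD(1)[OF x] b by (simp add: J_iff)
  then show "a \<otimes> x \<in> J" using JD(1)[OF x] b by (subst J_part_zero) (simp_all add: part_zero_mult)
qed

end

sublocale graded_k_algebra \<subseteq> J: ideal "graded_jacobson_radical A" A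
  by (rule J_ideal)

section \<open>The top of a graded algebra\<close>

sublocale graded_k_algebra \<subseteq> S: ring "top_ring A"
  unfolding top_ring_def by (rule J.quotient_is_ring)

context graded_k_algebra
begin

lemma top_hom: "to_top A \<in> ring_hom A (top_ring A)"
  using J.rcos_ring_hom by (simp add: top_ring_def to_top_def[abs_def])

lemma top_closed: "a \<in> carrier A \<Longrightarrow> to_top A a \<in> carrier (top_ring A)"
  using ring_hom_closed[OF top_hom] .

lemma top_add: "a \<in> carrier A \<Longrightarrow> b \<in> carrier A \<Longrightarrow> to_top A (a \<oplus> b) = to_top A a \<oplus>\<^bsub>top_ring A\<^esub> to_top A b"
  using ring_hom_add[OF top_hom] .

lemma top_mult: "a \<in> carrier A \<Longrightarrow> b \<in> carrier A \<Longrightarrow> to_top A (a \<otimes> b) = to_top A a \<otimes>\<^bsub>top_ring A\<^esub> to_top A b"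
  using ring_hom_mult[OF top_hom] .

lemma top_one: "to_top A \<one> = \<one>\<^bsub>top_ring A\<^esub>"
  using ring_hom_one[OF top_hom] .

lemma top_additive: "additive A (top_ring A) (to_top A)"
  by (auto simp: additive_on_def top_closed top_add)

lemma top_zero: "to_top A \<zero> = \<zero>\<^bsub>top_ring A\<^esub>"
  using additive_zero[OF A.abelian_group_axioms S.abelian_group_axioms top_additive] .

lemma top_surj: "carrier (top_ring A) = to_top A ` carrier A"
  by (auto simp: top_ring_def to_top_def FactRing_def A_RCOSETS_def' a_r_coset_def)

lemma top_eq_iff: "a \<in> carrier A \<Longrightarrow> b \<in> carrier A \<Longrightarrow> to_top A a = to_top A b \<longleftrightarrow> a \<ominus> b \<in> J"
  unfolding to_top_def using quotient_eq_iff_same_a_r_cos[OF J_ideal] by blast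

lemma top_eq_zero_iff: "a \<in> carrier A \<Longrightarrow> to_top A a = \<zero>\<^bsub>top_ring A\<^esub> \<longleftrightarrow> a \<in> J"
  using top_eq_iff[of a "\<zero>"] by (simp add: top_zero a_minus_def)

lemma top_part_zero: "a \<in> carrier A \<Longrightarrow> to_top A (part a 0) = to_top A a"
proof -
  assume a: "a \<in> carrier A"
  have "part (part a 0 \<ominus> a) 0 = \<zero>"
    using additive_minus[OF A.abelian_group_axioms A.abelian_group_axioms additive_part, of "part a 0" a] a part_closed
    by (simp add: part_part a_minus_def A.r_neg)
  then show ?thesis using a part_closed J_part_zero[of "part a 0 \<ominus> a"] JD(2) by (simp add: top_eq_iff)
qed

lemma top_rep: "s \<in> carrier (top_ring A) \<Longrightarrow> \<exists>a\<in>grade A 0. to_top A a = s"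
proof -
  assume "s \<in> carrier (top_ring A)"
  then obtain a where a: "a \<in> carrier A" "s = to_top A a" by (auto simp: top_surj)
  show ?thesis by (rule bexI[OF _ part_grade[OF a(1)]]) (simp add: top_part_zero a)
qed

lemma top_positive: "a \<in> grade A n \<Longrightarrow> 0 < n \<Longrightarrow> to_top A a = \<zero>\<^bsub>top_ring A\<^esub>"
  using positive_grade_J top_eq_zero_iff grade_carrier by blast

lemma top_module_simps [simp]:
  "carrier (top_module A) = carrier (top_ring A)" "ring.zero (top_module A) = \<zero>\<^bsub>top_ring A\<^esub>"
  "ring.add (top_module A) = ring.add (top_ring A)"
  "smult (top_module A) a C = to_top A a \<otimes>\<^bsub>top_ring A\<^esub> C"
  by (simp_all add: top_module_def)

lemma top_module_homog: "homog (top_module A) n = (if n = 0 then carrier (top_ring A) else {\<zero>\<^bsub>top_ring A\<^esub>})"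
proof -
  have "to_top A ` grade A 0 = carrier (top_ring A)"
    using top_rep top_closed grade_carrier by blast
  moreover have "to_top A ` grade A (nat n) = {\<zero>\<^bsub>top_ring A\<^esub>}" if "0 < n"
    using top_positive[of _ "nat n"] that zero_grade[of "nat n"] by force
  ultimately show ?thesis by (auto simp: top_module_def)
qed

lemma top_module_group: "abelian_group (top_module A)"
  by (rule abelian_groupI) (auto simp: S.a_ac intro!: bexI[of _ "\<ominus>\<^bsub>top_ring A\<^esub> _"] S.l_neg S.r_neg)

text \<open>
  The grading of \<open>S\<close> is concentrated in degree 0, because the radical contains \<open>A\<^sub>\<ge>\<^sub>1\<close>.
\<close>

lemma top_module_graded: "graded_left_module A (top_module A)"
proof -
  have "left_module A (top_module A)"
    by (intro left_module.intro left_module_axioms.intro A.ring_axioms top_module_group)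
      (auto simp: top_closed top_add top_mult top_one S.l_distr S.r_distr S.m_assoc)
  moreover have "direct_sum_decomposition (top_module A) (homog (top_module A))"
    unfolding direct_sum_decomposition_def
  proof (intro conjI allI ballI)
    interpret T: abelian_group "top_module A" by (rule top_module_group)
    show "subgroup (homog (top_module A) i) (add_monoid (top_module A))" for i
      using T.add.subgroup_self T.add.triv_subgroup by (simp add: top_module_homog)
    fix x assume x: "x \<in> carrier (top_module A)"
    have 0: "{n::int. (if n = 0 then y else z) \<noteq> z} = (if y = z then {} else {0})" for y z :: "'a set"
      by auto
    show "\<exists>!c. homogeneous_decomposition (top_module A) (homog (top_module A)) x c"
    proof (rule ex1I[of _ "\<lambda>n. if n = 0 then x else \<zero>\<^bsub>top_ring A\<^esub>"])
      show "homogeneous_decomposition (top_module A) (homog (top_module A)) x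
          (\<lambda>n. if n = 0 then x else \<zero>\<^bsub>top_ring A\<^esub>)"
        using x T.finsum_empty by (auto simp: homogeneous_decomposition_def top_module_homog 0)
      fix c assume c: "homogeneous_decomposition (top_module A) (homog (top_module A)) x c"
      then have c0: "c 0 \<in> carrier (top_ring A)" "\<And>n. n \<noteq> 0 \<Longrightarrow> c n = \<zero>\<^bsub>top_ring A\<^esub>"
        by (auto simp: homogeneous_decomposition_def top_module_homog split: if_splits)
      then have eq: "c = (\<lambda>n. if n = 0 then c 0 else \<zero>\<^bsub>top_ring A\<^esub>)" by (intro ext) simp
      have "x = (\<Oplus>\<^bsub>top_module A\<^esub>n\<in>{n. c n \<noteq> \<zero>\<^bsub>top_ring A\<^esub>}. c n)"
        using c by (simp add: homogeneous_decomposition_def)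
      also have "\<dots> = c 0"
        using c0 0[of "c 0" "\<zero>\<^bsub>top_ring A\<^esub>"] by (subst (1 2) eq) (auto simp: Pi_def)
      finally have "x = c 0" .
      show "c = (\<lambda>n. if n = 0 then x else \<zero>\<^bsub>top_ring A\<^esub>)"
        unfolding \<open>x = c 0\<close> by (rule eq)
    qed
  qed
  moreover have "a \<odot>\<^bsub>top_module A\<^esub> x \<in> homog (top_module A) (int m + n)"
    if "a \<in> grade A m" "x \<in> homog (top_module A) n" for m n a x
  proof (cases "n = 0 \<and> m = 0")
    case True
    then show ?thesis using that top_closed grade_carrier by (auto simp: top_module_homog)
  next
    case False
    then have "to_top A a \<otimes>\<^bsub>top_ring A\<^esub> x = \<zero>\<^bsub>top_ring A\<^esub>"
      using that top_positive[of a m] top_closed[OF grade_carrier[OF that(1)]]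
      by (cases "n = 0") (auto simp: top_module_homog)
    then show ?thesis by (simp add: top_module_homog)
  qed
  ultimately show ?thesis unfolding graded_left_module_def by blast
qed

lemma graded_maps_top_module_right_mult:
  assumes "s \<in> carrier (top_ring A)"
  shows "(\<lambda>x. x \<otimes>\<^bsub>top_ring A\<^esub> s) \<in> graded_maps A (top_module A) (top_module A)"
  by (rule graded_mapsI)
    (use assms in \<open>auto simp: top_module_homog S.l_distr S.m_assoc top_closed split: if_splits\<close>)

end

section \<open>Graded twists\<close>

lemma
  fixes M N :: "('b, 'x) ring_scheme"
  assumes "carrier N = carrier M" "ring.add N = ring.add M" "\<zero>\<^bsub>N\<^esub> = \<zero>\<^bsub>M\<^esub>"
  shows same_group_add_monoid: "add_monoid N = add_monoid M"
    and same_group_abelian: "abelian_group M \<Longrightarrow> abelian_group N"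
    and same_group_finsum: "finsum N = finsum M"
    and same_group_decomposition: "direct_sum_decomposition N D = direct_sum_decomposition M D"
    and same_group_component: "component N D = component M D"
proof -
  show *: "add_monoid N = add_monoid M" using assms by simp
  show f: "finsum N = finsum M" unfolding finsum_def[abs_def] by (simp add: *)
  show "abelian_group M \<Longrightarrow> abelian_group N"
    unfolding abelian_group_def abelian_monoid_def abelian_group_axioms_def by (simp only: *)
  have h: "homogeneous_decomposition N D = homogeneous_decomposition M D"
    unfolding homogeneous_decomposition_def[abs_def] by (simp add: f assms)
  show "direct_sum_decomposition N D = direct_sum_decomposition M D"
    unfolding direct_sum_decomposition_def by (simp only: h * assms)
  show "component N D = component M D"
    unfolding component_def[abs_def] by (simp only: h)
qed

text \<open>
  A total function: for \<open>k < 0\<close> it uses the inverse of \<open>\<tau>\<close> on the set \<open>C\<close>, which has arbitrary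
  values outside of \<open>C\<close>.
\<close>

definition int_power :: "'a set \<Rightarrow> ('a \<Rightarrow> 'a) \<Rightarrow> int \<Rightarrow> 'a \<Rightarrow> 'a"
  where "int_power C \<tau> k = (if 0 \<le> k then \<tau> ^^ nat k else inv_into C \<tau> ^^ nat (- k))"

lemma int_power_of_nat: "int_power C \<tau> (int n) = \<tau> ^^ n"
  by (simp add: int_power_def)

lemma int_power_invariant:
  assumes "Q (\<lambda>x. x)" "\<And>f. Q f \<Longrightarrow> Q (\<lambda>x. \<tau> (f x))" "\<And>f. Q f \<Longrightarrow> Q (\<lambda>x. inv_into C \<tau> (f x))"
  shows "Q (int_power C \<tau> k)"
proof -
  have "Q (g ^^ n)" if "\<And>f. Q f \<Longrightarrow> Q (\<lambda>x. g (f x))" for g :: "'a \<Rightarrow> 'a" and n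
  proof (induction n)
    case 0 then show ?case using assms(1) by (simp add: id_def)
  next
    case (Suc n) then show ?case using that by (simp add: comp_def)
  qed
  then show ?thesis using assms(2,3) by (simp add: int_power_def)
qed

lemma int_power_closed:
  assumes "bij_betw \<tau> C C" "x \<in> C" shows "int_power C \<tau> k x \<in> C"
  using int_power_invariant[of "\<lambda>f. \<forall>x\<in>C. f x \<in> C" \<tau> C] assms
  by (auto simp: bij_betw_def inv_into_into)

lemma int_power_succ:
  assumes \<tau>: "bij_betw \<tau> C C" and x: "x \<in> C" shows "int_power C \<tau> (k + 1) x = \<tau> (int_power C \<tau> k x)"
proof (cases "0 \<le> k")
  case True
  then have "nat (k + 1) = Suc (nat k)" by simp
  with True show ?thesis by (simp add: int_power_def)
next
  case False
  define n where "n = nat (- k - 1)"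
  have k: "k = - int (Suc n)" using False by (simp add: n_def)
  have 1: "int_power C \<tau> k x = inv_into C \<tau> ((inv_into C \<tau> ^^ n) x)" by (simp add: int_power_def k nat_add_distrib)
  have 2: "int_power C \<tau> (k + 1) x = (inv_into C \<tau> ^^ n) x" by (auto simp: int_power_def k)
  have "(inv_into C \<tau> ^^ n) x \<in> C" using int_power_closed[OF \<tau> x, of "k + 1"] by (simp add: 2)
  then show ?thesis using \<tau> by (simp add: 1 2 f_inv_into_f bij_betw_def)
qed

lemma int_power_add:
  assumes \<tau>: "bij_betw \<tau> C C" and x: "x \<in> C" shows "int_power C \<tau> (i + j) x = int_power C \<tau> i (int_power C \<tau> j x)"
proof (induction i rule: int_induct[where k = 0])
  case base
  show ?case by (simp add: int_power_def)
next
  case (step1 i)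
  show ?case
    using step1 int_power_succ[OF \<tau> x, of "i + j"] int_power_succ[OF \<tau> int_power_closed[OF \<tau> x], of i j]
    by (simp add: algebra_simps)
next
  case (step2 i)
  let ?y = "int_power C \<tau> j x"
  have "\<tau> (int_power C \<tau> (i - 1 + j) x) = \<tau> (int_power C \<tau> (i - 1) ?y)"
    using step2 int_power_succ[OF \<tau> x, of "i - 1 + j"] int_power_succ[OF \<tau> int_power_closed[OF \<tau> x], of "i - 1" j]
    by (simp add: algebra_simps)
  then show ?case
    using \<tau> int_power_closed[OF \<tau>] x by (auto simp: bij_betw_def dest: inj_onD)
qed

text \<open>
  The integer powers of a graded automorphism, as a family: with \<open>t\<close> also \<open>k \<mapsto> t\<^sub>-\<^sub>k\<close> is of this kind,
  so that every statement about a twist can be read backwards.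
\<close>

locale graded_flow = graded_k_algebra K A
  for K :: "'k ring" and A :: "('k, 'a) graded_algebra" (structure) +
  fixes t :: "int \<Rightarrow> 'a \<Rightarrow> 'a"
  assumes t_closed: "x \<in> carrier A \<Longrightarrow> t k x \<in> carrier A"
    and t_add: "x \<in> carrier A \<Longrightarrow> y \<in> carrier A \<Longrightarrow> t k (x \<oplus> y) = t k x \<oplus> t k y"
    and t_mult: "x \<in> carrier A \<Longrightarrow> y \<in> carrier A \<Longrightarrow> t k (x \<otimes> y) = t k x \<otimes> t k y"
    and t_smult: "c \<in> carrier K \<Longrightarrow> x \<in> carrier A \<Longrightarrow> t k (c \<odot> x) = c \<odot> t k x"
    and t_grade: "x \<in> grade A n \<Longrightarrow> t k x \<in> grade A n"
    and t_0: "x \<in> carrier A \<Longrightarrow> t 0 x = x"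
    and t_t: "x \<in> carrier A \<Longrightarrow> t i (t j x) = t (i + j) x"
begin

lemma t_additive: "additive A A (t k)"
  by (auto simp: additive_on_def t_closed t_add)

lemma t_zero: "t k \<zero> = \<zero>"
  using additive_zero[OF A.abelian_group_axioms A.abelian_group_axioms t_additive] .

lemma t_inverse: "x \<in> carrier A \<Longrightarrow> t k (t (- k) x) = x" "x \<in> carrier A \<Longrightarrow> t (- k) (t k x) = x"
  by (simp_all add: t_t t_0)

lemma t_one: "t k \<one> = \<one>"
proof -
  have "t k \<one> = t k \<one> \<otimes> t k (t (- k) \<one>)" by (simp add: t_inverse t_closed)
  also have "\<dots> = \<one>" by (subst t_mult[symmetric]) (simp_all add: t_closed t_inverse)
  finally show ?thesis .
qed

lemma t_minus: "x \<in> carrier A \<Longrightarrow> y \<in> carrier A \<Longrightarrow> t k (x \<ominus> y) = t k x \<ominus> t k y"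
  using additive_minus[OF A.abelian_group_axioms A.abelian_group_axioms t_additive] .

lemma part_t: "x \<in> carrier A \<Longrightarrow> part (t k x) n = t k (part x n)"
  by (rule part_graded_map[OF graded_group_axioms graded_group_axioms t_additive t_grade])

text \<open>
  Preimages under the automorphism \<open>t\<^sub>k\<close> permute the graded left ideals, preserving inclusions.
\<close>

lemma maximal_graded_left_ideal_t:
  assumes "maximal_graded_left_ideal A I"
  shows "maximal_graded_left_ideal A {x \<in> carrier A. t k x \<in> I}"
proof -
  have L: "graded_left_ideal A {x \<in> carrier A. t j x \<in> I}" if "graded_left_ideal A I" for I j
    using graded_left_idealD[OF that]
    by (intro graded_left_idealI)
      (auto simp: t_zero t_minus t_mult t_closed part_closed part_t[symmetric])
  note I = maximal_graded_left_idealD[OF assms]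
  show ?thesis
  proof (rule maximal_graded_left_idealI[OF L[OF I(1)]])
    show "\<one> \<notin> {x \<in> carrier A. t k x \<in> I}" using I(2) by (simp add: t_one)
    fix I' assume I': "graded_left_ideal A I'" "{x \<in> carrier A. t k x \<in> I} \<subseteq> I'"
      "I' \<noteq> {x \<in> carrier A. t k x \<in> I}"
    let ?L = "{x \<in> carrier A. t (- k) x \<in> I'}"
    have "I \<subseteq> ?L"
      using I'(2) graded_left_idealD(1)[OF I(1)] by (auto simp: t_inverse t_closed)
    moreover have "?L \<noteq> I"
    proof
      assume "?L = I"
      then have "x \<in> I'" if "x \<in> carrier A" "t k x \<in> I" for x using that by (metis (no_types, lifting) mem_Collect_eq t_inverse(2))
      moreover have "x \<in> carrier A \<and> t k x \<in> I" if "x \<in> I'" for x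
        using that \<open>?L = I\<close> graded_left_idealD(1)[OF I'(1) that] t_closed t_inverse(2) by auto
      ultimately show False using I'(3) by blast
    qed
    ultimately have "\<one> \<in> ?L" using I(3)[OF L[OF I'(1)]] by blast
    then show "\<one> \<in> I'" by (simp add: t_one)
  qed
qed

lemma t_J: "x \<in> J \<Longrightarrow> t k x \<in> J"
  using maximal_graded_left_ideal_t[of _ k] by (auto simp: J_iff t_closed)

lemma graded_flow_inverse: "graded_flow K A (\<lambda>k. t (- k))"
  by unfold_locales (auto simp: t_closed t_add t_mult t_smult t_grade t_0 t_t)

lemma top_t_cong:
  "a \<in> carrier A \<Longrightarrow> b \<in> carrier A \<Longrightarrow> to_top A a = to_top A b \<Longrightarrow> to_top A (t k a) = to_top A (t k b)"
  using t_J[of "a \<ominus> b" k] by (simp add: top_eq_iff t_closed t_minus)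

end

lemma graded_automorphism_flow:
  fixes K :: "'k ring" and A :: "('k, 'a) graded_algebra"
  assumes A: "graded_algebra K A" and \<tau>: "graded_automorphism K A \<tau>"
  shows "graded_flow K A (int_power (carrier A) \<tau>)"
proof -
  interpret graded_k_algebra K A using A by (simp add: graded_k_algebra_def)
  have hom: "\<tau> \<in> ring_hom A A" and bij: "bij_betw \<tau> (carrier A) (carrier A)"
    using \<tau> by (auto simp: graded_automorphism_def ring_iso_def)
  let ?i = "inv_into (carrier A) \<tau>"
  have smult: "\<tau> (c \<odot>\<^bsub>A\<^esub> x) = c \<odot>\<^bsub>A\<^esub> \<tau> x" if "c \<in> carrier K" "x \<in> carrier A" for c x
    using \<tau> that by (simp add: graded_automorphism_def)
  have grade: "\<tau> ` grade A n = grade A n" for n using \<tau> by (simp add: graded_automorphism_def)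
  note homD = ring_hom_closed[OF hom] ring_hom_add[OF hom] ring_hom_mult[OF hom]
  have i: "?i x \<in> carrier A" "\<tau> (?i x) = x" if "x \<in> carrier A" for x
    using bij that by (auto simp: bij_betw_def inv_into_into f_inv_into_f)
  have i_eq: "?i x = y" if "\<tau> y = x" "y \<in> carrier A" for x y
    using bij that by (auto simp: bij_betw_def)
  define Q where "Q f \<longleftrightarrow> (\<forall>x\<in>carrier A. f x \<in> carrier A) \<and>
    (\<forall>x\<in>carrier A. \<forall>y\<in>carrier A. f (x \<oplus>\<^bsub>A\<^esub> y) = f x \<oplus>\<^bsub>A\<^esub> f y \<and> f (x \<otimes>\<^bsub>A\<^esub> y) = f x \<otimes>\<^bsub>A\<^esub> f y) \<and>
    (\<forall>c\<in>carrier K. \<forall>x\<in>carrier A. f (c \<odot>\<^bsub>A\<^esub> x) = c \<odot>\<^bsub>A\<^esub> f x) \<and>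
    (\<forall>n. \<forall>x\<in>grade A n. f x \<in> grade A n)" for f
  have "Q (int_power (carrier A) \<tau> k)" for k
  proof (rule int_power_invariant)
    show "Q (\<lambda>x. x)" by (simp add: Q_def)
    fix f assume f: "Q f"
    have "\<tau> x \<in> grade A n" if "x \<in> grade A n" for x n using grade[of n] that by blast
    then show "Q (\<lambda>x. \<tau> (f x))" using f by (simp add: Q_def homD smult)
    have "?i (x \<oplus>\<^bsub>A\<^esub> y) = ?i x \<oplus>\<^bsub>A\<^esub> ?i y" "?i (x \<otimes>\<^bsub>A\<^esub> y) = ?i x \<otimes>\<^bsub>A\<^esub> ?i y"
      if "x \<in> carrier A" "y \<in> carrier A" for x y using that by (auto intro!: i_eq simp: homD i)
    moreover have "?i (c \<odot>\<^bsub>A\<^esub> x) = c \<odot>\<^bsub>A\<^esub> ?i x" if "c \<in> carrier K" "x \<in> carrier A" for c x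
      using that by (auto intro!: i_eq simp: smult i)
    moreover have "?i x \<in> grade A n" if "x \<in> grade A n" for x n
    proof -
      obtain y where "y \<in> grade A n" "x = \<tau> y" using \<open>x \<in> grade A n\<close> grade[of n] by blast
      then show ?thesis using i_eq[of y x] grade_carrier by simp
    qed
    ultimately show "Q (\<lambda>x. ?i (f x))" using f by (simp add: Q_def i)
  qed
  then show ?thesis
    using int_power_add[OF bij] by unfold_locales (auto simp: Q_def, simp add: int_power_def)
qed

text \<open>
  \<open>B\<close> has the product \<open>x \<star> y = t\<^sub>n(x) y\<close>. The situation is symmetric: \<open>A\<close> is in the same way a
  twist of \<open>B\<close> by the inverse powers.
\<close>

locale twist_pair = A: graded_flow K A t + B: graded_flow K B t
  for K :: "'k ring" and A B :: "('k, 'a) graded_algebra" and t +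
  assumes carrier_B: "carrier B = carrier A" and add_B: "ring.add B = ring.add A"
    and zero_B: "\<zero>\<^bsub>B\<^esub> = \<zero>\<^bsub>A\<^esub>" and one_B: "\<one>\<^bsub>B\<^esub> = \<one>\<^bsub>A\<^esub>"
    and grade_B: "grade B = grade A" and smult_B: "smult B = smult A"
    and mult_B: "x \<in> carrier A \<Longrightarrow> y \<in> grade A n \<Longrightarrow> x \<otimes>\<^bsub>B\<^esub> y = t (int n) x \<otimes>\<^bsub>A\<^esub> y"

text \<open>
  Twisting is a relation between modules, not an operation, as twisting back gives the original
  scalar multiplication on the carriers only. The relation is symmetric in \<open>A\<close> and \<open>B\<close>
  (\<open>twisted_modules_sym\<close>), so half of each equivalence below suffices.
\<close>

definition twisted_modules ::
    "('k, 'a) graded_algebra \<Rightarrow> ('k, 'a) graded_algebra \<Rightarrow> (int \<Rightarrow> 'a \<Rightarrow> 'a)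
      \<Rightarrow> ('a, 'm) graded_module \<Rightarrow> ('a, 'm) graded_module \<Rightarrow> bool"
  where "twisted_modules A B t M M' \<longleftrightarrow> graded_left_module A M \<and> graded_left_module B M' \<and>
    carrier M' = carrier M \<and> ring.add M' = ring.add M \<and> \<zero>\<^bsub>M'\<^esub> = \<zero>\<^bsub>M\<^esub> \<and> homog M' = homog M \<and>
    (\<forall>a\<in>carrier A. \<forall>n. \<forall>x\<in>homog M n. a \<odot>\<^bsub>M'\<^esub> x = t n a \<odot>\<^bsub>M\<^esub> x)"

lemma twisted_modulesD:
  assumes "twisted_modules A B t M M'"
  shows "graded_left_module A M" "graded_left_module B M'"
    "carrier M' = carrier M" "ring.add M' = ring.add M" "\<zero>\<^bsub>M'\<^esub> = \<zero>\<^bsub>M\<^esub>" "homog M' = homog M"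
    "a \<in> carrier A \<Longrightarrow> x \<in> homog M n \<Longrightarrow> a \<odot>\<^bsub>M'\<^esub> x = t n a \<odot>\<^bsub>M\<^esub> x"
  using assms by (auto simp: twisted_modules_def)

context twist_pair
begin

lemma twist_pair_sym: "twist_pair K B A (\<lambda>k. t (- k))"
proof (intro twist_pair.intro A.graded_flow_inverse B.graded_flow_inverse twist_pair_axioms.intro)
  show "x \<otimes>\<^bsub>A\<^esub> y = t (- int n) x \<otimes>\<^bsub>B\<^esub> y" if "x \<in> carrier B" "y \<in> grade B n" for x y n
    using that mult_B[of "t (- int n) x" y n] by (simp add: carrier_B grade_B A.t_closed A.t_inverse)
qed (simp_all add: carrier_B add_B zero_B one_B grade_B smult_B)

lemma twisted_modules_sym:
  assumes "twisted_modules A B t M M'"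
  shows "twisted_modules B A (\<lambda>k. t (- k)) M' M"
  using twisted_modulesD[OF assms]
  by (auto simp: twisted_modules_def carrier_B A.t_closed A.t_inverse)

lemma twisted_module_exists:
  assumes "graded_left_module A M"
  shows "\<exists>M'. twisted_modules A B t M M'"
proof -
  interpret M: left_module A M using assms by (rule graded_left_moduleD)
  interpret M: graded_group M "homog M" using assms by (rule graded_left_moduleD)
  note gr = graded_left_moduleD(4)[OF assms]
  define h where "h a n x = t n a \<odot>\<^bsub>M\<^esub> x" for a n x
  define M' where "M' = M\<lparr>smult := \<lambda>a. glue M (homog M) M (h a)\<rparr>"
  have M'_simps: "carrier M' = carrier M" "ring.add M' = ring.add M" "\<zero>\<^bsub>M'\<^esub> = \<zero>\<^bsub>M\<^esub>" "homog M' = homog M"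
    by (simp_all add: M'_def)
  have h: "additive_on (homog M n) M M (h a n)" if "a \<in> carrier A" for a n
    using that M.grade_carrier
    by (auto simp: additive_on_def h_def A.t_closed M.smult_closed M.smult_r_distr)
  have add: "additive M M (smult M' a)" if "a \<in> carrier A" for a
    using M.glue_additive[OF M.abelian_group_axioms h[OF that]] by (simp add: M'_def)
  have hom: "a \<odot>\<^bsub>M'\<^esub> x = t n a \<odot>\<^bsub>M\<^esub> x" if "a \<in> carrier A" "x \<in> homog M n" for a x n
    using M.glue_grade[OF M.abelian_group_axioms h] that by (simp add: M'_def h_def)
  have "left_module B M'"
  proof (intro left_module.intro left_module_axioms.intro B.A.ring_axioms)
    show "abelian_group M'" by (rule same_group_abelian[OF M'_simps(1-3) M.abelian_group_axioms])
    show "\<one>\<^bsub>B\<^esub> \<odot>\<^bsub>M'\<^esub> x = x" if "x \<in> carrier M'" for x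
      using M.additive_eqI[OF add, of "\<one>\<^bsub>A\<^esub>" "\<lambda>x. x" x] M.grade_carrier that
      by (simp add: one_B hom A.t_one M.smult_one additive_on_def M'_simps)
    fix a b x assume "a \<in> carrier B" and "x \<in> carrier M'"
    then have a: "a \<in> carrier A" and x: "x \<in> carrier M" by (simp_all add: carrier_B M'_simps)
    show "a \<odot>\<^bsub>M'\<^esub> x \<in> carrier M'" using additive_onD(1)[OF add[OF a] x] by (simp add: M'_simps)
    show "a \<odot>\<^bsub>M'\<^esub> (x \<oplus>\<^bsub>M'\<^esub> y) = a \<odot>\<^bsub>M'\<^esub> x \<oplus>\<^bsub>M'\<^esub> a \<odot>\<^bsub>M'\<^esub> y" if "y \<in> carrier M'" for y
      using additive_onD(2)[OF add[OF a] x] that by (simp add: M'_simps)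
    assume "b \<in> carrier B"
    then have b: "b \<in> carrier A" by (simp add: carrier_B)
    have ab: "a \<oplus>\<^bsub>A\<^esub> b \<in> carrier A" "a \<otimes>\<^bsub>B\<^esub> b \<in> carrier A" using a b B.A.m_closed by (simp_all add: carrier_B)
    have "(a \<oplus>\<^bsub>A\<^esub> b) \<odot>\<^bsub>M'\<^esub> x = a \<odot>\<^bsub>M'\<^esub> x \<oplus>\<^bsub>M\<^esub> b \<odot>\<^bsub>M'\<^esub> x"
    proof (rule M.additive_eqI[OF add[OF ab(1)] _ _ x])
      show "additive M M (\<lambda>x. a \<odot>\<^bsub>M'\<^esub> x \<oplus>\<^bsub>M\<^esub> b \<odot>\<^bsub>M'\<^esub> x)"
        using additive_onD[OF add[OF a]] additive_onD[OF add[OF b]]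
        by (auto simp: additive_on_def M.M.a_ac)
    qed (use a b ab M.grade_carrier in \<open>simp add: hom A.t_add A.t_closed M.smult_l_distr\<close>)
    then show "(a \<oplus>\<^bsub>B\<^esub> b) \<odot>\<^bsub>M'\<^esub> x = a \<odot>\<^bsub>M'\<^esub> x \<oplus>\<^bsub>M'\<^esub> b \<odot>\<^bsub>M'\<^esub> x" by (simp add: add_B M'_simps)
    show "(a \<otimes>\<^bsub>B\<^esub> b) \<odot>\<^bsub>M'\<^esub> x = a \<odot>\<^bsub>M'\<^esub> (b \<odot>\<^bsub>M'\<^esub> x)"
    proof (rule M.additive_eqI[OF add[OF ab(2)] additive_comp[OF add[OF b] add[OF a]] _ x])
      fix n x assume x: "x \<in> homog M n"
      then have xc: "x \<in> carrier M" by (rule M.grade_carrier)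
      have add_t: "additive A M (\<lambda>b. t n b \<odot>\<^bsub>M\<^esub> x)"
        using xc by (auto simp: additive_on_def A.t_closed A.t_add M.smult_closed M.smult_l_distr)
      have ba: "additive A A (\<lambda>b. a \<otimes>\<^bsub>B\<^esub> b)"
        using B.additive_mult_left[of a] a by (simp add: additive_on_def carrier_B add_B)
      show "(a \<otimes>\<^bsub>B\<^esub> b) \<odot>\<^bsub>M'\<^esub> x = a \<odot>\<^bsub>M'\<^esub> (b \<odot>\<^bsub>M'\<^esub> x)"
        unfolding hom[OF ab(2) x] hom[OF b x]
      proof (rule A.additive_eqI[OF additive_comp[OF ba add_t] additive_comp[OF add_t add[OF a]] _ b])
        fix m b assume b: "b \<in> grade A m"
        then have bc: "b \<in> carrier A" by (rule A.grade_carrier)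
        have tbx: "t n b \<odot>\<^bsub>M\<^esub> x \<in> homog M (int m + n)" using gr[OF A.t_grade[OF b] x] .
        show "t n (a \<otimes>\<^bsub>B\<^esub> b) \<odot>\<^bsub>M\<^esub> x = a \<odot>\<^bsub>M'\<^esub> (t n b \<odot>\<^bsub>M\<^esub> x)"
          using a bc xc unfolding hom[OF a tbx] mult_B[OF a b]
          by (simp add: A.t_mult A.t_closed A.t_t M.smult_assoc add.commute)
      qed
    qed
  qed
  moreover have "direct_sum_decomposition M' (homog M')"
    using M.decomposition same_group_decomposition[OF M'_simps(1-3), of "homog M"] by (simp add: M'_simps)
  moreover have "a \<odot>\<^bsub>M'\<^esub> x \<in> homog M' (int m + n)" if "a \<in> grade B m" "x \<in> homog M' n" for a x m n
    using that hom[OF A.grade_carrier, of a m x n] gr[OF A.t_grade] by (simp add: grade_B M'_simps)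
  ultimately have "graded_left_module B M'" unfolding graded_left_module_def by blast
  then show ?thesis using assms hom M'_simps unfolding twisted_modules_def by blast
qed

lemma graded_maps_twisted_subset:
  assumes M: "twisted_modules A B t M M'" and N: "twisted_modules A B t N N'"
  shows "graded_maps A M N \<subseteq> graded_maps B M' N'"
proof
  fix f assume f: "f \<in> graded_maps A M N"
  note M = twisted_modulesD[OF M] and N = twisted_modulesD[OF N] and f = graded_mapsD[OF f]
  interpret M': left_module B M' using M(2) by (rule graded_left_moduleD)
  interpret N': left_module B N' using N(2) by (rule graded_left_moduleD)
  interpret M: graded_group M "homog M" using M(1) by (rule graded_left_moduleD)
  have "f (a \<odot>\<^bsub>M'\<^esub> x) = a \<odot>\<^bsub>N'\<^esub> f x" if a: "a \<in> carrier A" and x: "x \<in> carrier M" for a x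
    using x
  proof (induction rule: M.homogeneous_induct)
    case (grade n x)
    then show ?case
      using M(7)[OF a grade] N(7)[OF a f(4)[OF grade]] f(3) a M.grade_carrier A.t_closed by simp
  next
    case (add x y)
    then show ?case
      using M'.smult_r_distr[of a x y] N'.smult_r_distr[of a "f x" "f y"] M'.smult_closed[of a] a f(1,2)
      by (simp add: carrier_B M(3,4) N(3,4))
  qed
  then show "f \<in> graded_maps B M' N'"
    using f M N by (intro graded_mapsI) (simp_all add: carrier_B)
qed

end

lemma (in twist_pair) graded_maps_twisted:
  assumes M: "twisted_modules A B t M M'" and N: "twisted_modules A B t N N'"
  shows "graded_maps A M N = graded_maps B M' N'"
  using graded_maps_twisted_subset[OF assms]
    twist_pair.graded_maps_twisted_subset[OF twist_pair_sym twisted_modules_sym[OF M] twisted_modules_sym[OF N]]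
  by blast

text \<open>
  A lifting problem over \<open>B\<close> is the same lifting problem over \<open>A\<close>, after its two modules have been twisted back.
\<close>

lemma (in twist_pair) graded_projective_twisted:
  fixes P P' :: "('a, 'm) graded_module"
  assumes P: "twisted_modules A B t P P'" and proj: "graded_projective A P"
  shows "graded_projective B P'"
  unfolding graded_projective_def
proof (intro conjI allI impI ballI)
  show "graded_left_module B P'" using twisted_modulesD(2)[OF P] .
  fix M' N' :: "('a, 'm) graded_module" and g f
  assume M': "graded_left_module B M'" and N': "graded_left_module B N'"
    and g: "g \<in> graded_maps B M' N'" and f: "f \<in> graded_maps B P' N'" and onto: "g ` carrier M' = carrier N'"
  obtain M where "twisted_modules B A (\<lambda>k. t (- k)) M' M"
    using twist_pair.twisted_module_exists[OF twist_pair_sym M'] by blast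
  then have M: "twisted_modules A B t M M'" using twist_pair.twisted_modules_sym[OF twist_pair_sym] by force
  obtain N where "twisted_modules B A (\<lambda>k. t (- k)) N' N"
    using twist_pair.twisted_module_exists[OF twist_pair_sym N'] by blast
  then have N: "twisted_modules A B t N N'" using twist_pair.twisted_modules_sym[OF twist_pair_sym] by force
  have "\<exists>h\<in>graded_maps A P M. \<forall>x\<in>carrier P. g (h x) = f x"
    using proj[unfolded graded_projective_def, THEN conjunct2, rule_format, of M N g f]
      twisted_modulesD[OF M] twisted_modulesD[OF N] g f onto
    by (simp add: graded_maps_twisted[OF M N] graded_maps_twisted[OF P N])
  then show "\<exists>h\<in>graded_maps B P' M'. \<forall>x\<in>carrier P'. g (h x) = f x"
    using twisted_modulesD(3)[OF P] graded_maps_twisted[OF P M] by simp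
qed

lemma (in twist_pair) resolution_twisted:
  assumes M: "twisted_modules A B t M M'" and P: "\<And>i. twisted_modules A B t (P i) (P' i)"
    and res: "graded_projective_resolution A M P \<delta> \<epsilon>"
  shows "graded_projective_resolution B M' P' \<delta> \<epsilon>"
proof -
  note MD = twisted_modulesD[OF M] and PD = twisted_modulesD[OF P]
  show ?thesis
    using res graded_projective_twisted[OF P]
    unfolding graded_projective_resolution_def MD(3,5) PD(3,5)
      graded_maps_twisted[OF P P, symmetric] graded_maps_twisted[OF P M, symmetric]
    by (intro conjI; elim conjE; (assumption | simp only:))
qed

context twist_pair
begin

lemma part_B: "component B (grade B) = component A (grade A)"
  using same_group_component[OF carrier_B add_B zero_B] by (simp add: grade_B)

lemma minus_B: "x \<ominus>\<^bsub>B\<^esub> y = x \<ominus>\<^bsub>A\<^esub> y"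
  using same_group_add_monoid[OF carrier_B add_B zero_B] by (simp add: a_minus_def a_inv_def add_B)

text \<open>
  On \<open>x \<in> A\<^sub>n\<close>, multiplication by \<open>a\<close> in \<open>B\<close> is multiplication by \<open>t\<^sub>n(a)\<close> in \<open>A\<close>; a graded left ideal
  contains with \<open>x\<close> all its parts.
\<close>

lemma graded_left_ideal_twist:
  assumes I: "graded_left_ideal A I"
  shows "graded_left_ideal B I"
proof (rule B.graded_left_idealI)
  note ID = A.graded_left_idealD[OF I]
  show "a \<otimes>\<^bsub>B\<^esub> x \<in> I" if a: "a \<in> carrier B" and x: "x \<in> I" for a x
    using ID(1)[OF x]
  proof (induction rule: A.parts_induct)
    case (part n)
    have ac: "a \<in> carrier A" using a by (simp add: carrier_B)
    show ?case
      unfolding mult_B[OF ac A.part_grade[OF ID(1)[OF x]]] by (rule ID(5)[OF A.t_closed[OF ac] ID(6)[OF x]])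
  next
    case zero
    then show ?case using a ID(2) B.A.r_null[OF a] by (simp add: zero_B)
  next
    case (add y z)
    then show ?case using a B.A.r_distr[of y z a] ID(3) by (simp add: carrier_B add_B)
  qed
qed (use A.graded_left_idealD[OF I] in \<open>auto simp: carrier_B zero_B minus_B part_B\<close>)

end

context twist_pair
begin

lemma graded_left_ideal_B: "graded_left_ideal B = graded_left_ideal A"
  using graded_left_ideal_twist twist_pair.graded_left_ideal_twist[OF twist_pair_sym] by blast

lemma J_B: "graded_jacobson_radical B = graded_jacobson_radical A"
  unfolding graded_jacobson_radical_def maximal_graded_left_ideal_def graded_left_ideal_B carrier_B ..

lemma to_top_B: "to_top B = to_top A"
  using same_group_add_monoid[OF carrier_B add_B zero_B]
  unfolding to_top_def[abs_def] J_B by (simp only: a_r_coset_def)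

text \<open>
  Classes are represented in degree 0, where both products agree. The products of the two records can
  differ on arguments that are not classes, so they are compared on the carrier.
\<close>

lemma top_ring_B:
  shows "carrier (top_ring B) = carrier (top_ring A)" "ring.add (top_ring B) = ring.add (top_ring A)"
    "\<zero>\<^bsub>top_ring B\<^esub> = \<zero>\<^bsub>top_ring A\<^esub>" "\<one>\<^bsub>top_ring B\<^esub> = \<one>\<^bsub>top_ring A\<^esub>"
    "s \<in> carrier (top_ring A) \<Longrightarrow> s' \<in> carrier (top_ring A) \<Longrightarrow>
      s \<otimes>\<^bsub>top_ring B\<^esub> s' = s \<otimes>\<^bsub>top_ring A\<^esub> s'"
proof -
  show "carrier (top_ring B) = carrier (top_ring A)"
    by (simp add: A.top_surj B.top_surj to_top_B carrier_B)
  show "\<zero>\<^bsub>top_ring B\<^esub> = \<zero>\<^bsub>top_ring A\<^esub>" by (simp add: top_ring_def FactRing_def J_B)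
  show "\<one>\<^bsub>top_ring B\<^esub> = \<one>\<^bsub>top_ring A\<^esub>"
    using A.top_one B.top_one by (simp add: to_top_B one_B)
  show "ring.add (top_ring B) = ring.add (top_ring A)"
    using same_group_add_monoid[OF carrier_B add_B zero_B]
    by (simp add: top_ring_def FactRing_def set_add_def)
  assume "s \<in> carrier (top_ring A)" "s' \<in> carrier (top_ring A)"
  then obtain a b where a: "a \<in> grade A 0" "s = to_top A a" and b: "b \<in> grade A 0" "s' = to_top A b"
    using A.top_rep by metis
  note c = A.grade_carrier[OF a(1)] A.grade_carrier[OF b(1)]
  have "s \<otimes>\<^bsub>top_ring B\<^esub> s' = to_top A (a \<otimes>\<^bsub>B\<^esub> b)"
    using B.top_mult[of a b] c by (simp add: a(2) b(2) to_top_B carrier_B)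
  also have "\<dots> = s \<otimes>\<^bsub>top_ring A\<^esub> s'"
    using c by (simp add: mult_B[OF c(1) b(1)] A.t_0 A.top_mult a(2) b(2))
  finally show "s \<otimes>\<^bsub>top_ring B\<^esub> s' = s \<otimes>\<^bsub>top_ring A\<^esub> s'" .
qed

lemma top_module_twisted: "twisted_modules A B t (top_module A) (top_module B)"
proof -
  have homog: "homog (top_module B) = homog (top_module A)"
    by (rule ext) (simp add: A.top_module_homog B.top_module_homog top_ring_B)
  have "a \<odot>\<^bsub>top_module B\<^esub> x = t n a \<odot>\<^bsub>top_module A\<^esub> x"
    if a: "a \<in> carrier A" and x: "x \<in> homog (top_module A) n" for a x n
  proof -
    have "x \<in> carrier (top_ring A)" using x by (auto simp: A.top_module_homog split: if_splits)
    then have "a \<odot>\<^bsub>top_module B\<^esub> x = to_top A a \<otimes>\<^bsub>top_ring A\<^esub> x"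
      using top_ring_B(5)[OF A.top_closed[OF a]] by (simp add: to_top_B)
    also have "\<dots> = to_top A (t n a) \<otimes>\<^bsub>top_ring A\<^esub> x"
      using a x A.top_closed A.t_closed by (cases "n = 0") (auto simp: A.t_0 A.top_module_homog)
    finally show ?thesis by simp
  qed
  then show ?thesis
    using A.top_module_graded B.top_module_graded
    by (simp add: twisted_modules_def homog top_ring_B)
qed

lemma projective_dimension_le:
  fixes M M' :: "('a, 'm) graded_module"
  assumes M: "twisted_modules A B t M M'"
  shows "graded_projective_dimension B M' \<le> graded_projective_dimension A M"
  unfolding graded_projective_dimension_def
proof (rule Inf_superset_mono, safe)
  fix n and P :: "nat \<Rightarrow> ('a, 'm) graded_module" and \<delta> \<epsilon>
  assume res: "graded_projective_resolution A M P \<delta> \<epsilon>" and zero: "\<forall>i>n. carrier (P i) = {\<zero>\<^bsub>P i\<^esub>}"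
  have "\<exists>P'. twisted_modules A B t (P i) P'" for i
    using res by (intro twisted_module_exists) (simp add: graded_projective_resolution_def graded_projective_def)
  then obtain P' where P': "\<And>i. twisted_modules A B t (P i) (P' i)" by metis
  have "graded_projective_resolution B M' P' \<delta> \<epsilon>" by (rule resolution_twisted[OF M P' res])
  moreover have "\<forall>i>n. carrier (P' i) = {\<zero>\<^bsub>P' i\<^esub>}"
    using zero unfolding twisted_modulesD(3,5)[OF P'] .
  ultimately show "\<exists>m. enat n = enat m \<and> (\<exists>(P :: nat \<Rightarrow> ('a, 'm) graded_module) \<delta> \<epsilon>.
      graded_projective_resolution B M' P \<delta> \<epsilon> \<and> (\<forall>i>m. carrier (P i) = {\<zero>\<^bsub>P i\<^esub>}))"
    by (intro exI[of _ n] conjI refl exI[of _ P'] exI[of _ \<delta>] exI[of _ \<epsilon>])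
qed

lemma global_dimension_le:
  fixes U :: "'m itself"
  shows "graded_global_dimension U A \<le> graded_global_dimension U B"
  unfolding graded_global_dimension_def
proof (rule SUP_least)
  fix M :: "('a, 'm) graded_module" assume "M \<in> {M. graded_left_module A M}"
  then obtain M' where M': "twisted_modules A B t M M'" using twisted_module_exists by blast
  have "graded_projective_dimension A M \<le> graded_projective_dimension B M'"
    using twist_pair.projective_dimension_le[OF twist_pair_sym twisted_modules_sym[OF M']] .
  also have "\<dots> \<le> (SUP M\<in>{M :: ('a, 'm) graded_module. graded_left_module B M}. graded_projective_dimension B M)"
    by (rule SUP_upper[of M' _ "graded_projective_dimension B"]) (simp add: twisted_modulesD(2)[OF M'])
  finally show "graded_projective_dimension A M \<le>
    (SUP M\<in>{M :: ('a, 'm) graded_module. graded_left_module B M}. graded_projective_dimension B M)" .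
qed

end

lemma (in twist_pair) global_dimension_B: "graded_global_dimension U B = graded_global_dimension U A"
  using global_dimension_le twist_pair.global_dimension_le[OF twist_pair_sym] by (rule antisym[rotated])

lemma graded_twist_pair:
  fixes K :: "'k ring" and A :: "('k, 'a) graded_algebra"
  assumes A: "graded_algebra K A" and \<tau>: "graded_automorphism K A \<tau>"
  shows "twist_pair K A (graded_twist \<tau> A) (int_power (carrier A) \<tau>)"
proof -
  define t where "t = int_power (carrier A) \<tau>"
  interpret graded_flow K A t unfolding t_def by (rule graded_automorphism_flow[OF A \<tau>])
  define B where "B = graded_twist \<tau> A"
  have B_simps: "carrier B = carrier A" "ring.add B = ring.add A" "\<zero>\<^bsub>B\<^esub> = \<zero>\<^bsub>A\<^esub>" "\<one>\<^bsub>B\<^esub> = \<one>\<^bsub>A\<^esub>"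
    "smult B = smult A" "grade B = grade A"
    by (simp_all add: B_def graded_twist_def)
  note same = B_simps(1-3)
  have mult_eq: "x \<otimes>\<^bsub>B\<^esub> y = glue A (grade A) A (\<lambda>n y. t (int n) x \<otimes>\<^bsub>A\<^esub> y) y" for x y
    by (simp add: B_def graded_twist_def glue_def t_def int_power_of_nat)
  have hom: "additive_on (grade A n) A A (\<lambda>y. t (int n) x \<otimes>\<^bsub>A\<^esub> y)" if "x \<in> carrier A" for n x
    using that by (intro additive_on_subset[OF additive_mult_left grade_subset] t_closed)
  have mult: "x \<otimes>\<^bsub>B\<^esub> y = t (int n) x \<otimes>\<^bsub>A\<^esub> y" if "x \<in> carrier A" "y \<in> grade A n" for x y n
    unfolding mult_eq using glue_grade[OF A.abelian_group_axioms hom[OF that(1)] that(2)] .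
  have add: "additive A A (\<lambda>y. x \<otimes>\<^bsub>B\<^esub> y)" if "x \<in> carrier A" for x
    unfolding mult_eq using glue_additive[OF A.abelian_group_axioms hom[OF that]] .
  note closed = additive_onD(1)[OF add] and r_distr = additive_onD(2)[OF add]
  have l_distr: "(x \<oplus>\<^bsub>A\<^esub> x') \<otimes>\<^bsub>B\<^esub> y = x \<otimes>\<^bsub>B\<^esub> y \<oplus>\<^bsub>A\<^esub> x' \<otimes>\<^bsub>B\<^esub> y"
    if "x \<in> carrier A" "x' \<in> carrier A" "y \<in> carrier A" for x x' y
    using that(3)
  proof (induction rule: homogeneous_induct)
    case (grade n y)
    then show ?case using that by (simp add: mult t_add A.l_distr t_closed grade_carrier)
  next
    case (add y z)
    then show ?case using that by (simp add: r_distr closed A.a_ac)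
  qed
  have add_l: "additive A A (\<lambda>x. x \<otimes>\<^bsub>B\<^esub> y)" if "y \<in> carrier A" for y
    using that by (auto simp: additive_on_def l_distr closed)
  have mult_grade_B: "x \<otimes>\<^bsub>B\<^esub> y \<in> grade A (m + n)" if "x \<in> grade A m" "y \<in> grade A n" for x y m n
    using that by (simp add: mult grade_carrier mult_grade t_grade)
  have assoc: "(x \<otimes>\<^bsub>B\<^esub> y) \<otimes>\<^bsub>B\<^esub> z = x \<otimes>\<^bsub>B\<^esub> (y \<otimes>\<^bsub>B\<^esub> z)"
    if x: "x \<in> carrier A" and y: "y \<in> carrier A" and z: "z \<in> carrier A" for x y z
  proof (rule additive_eqI[OF add additive_comp[OF add add] _ z])
    fix p z assume z: "z \<in> grade A p"
    then have zc: "z \<in> carrier A" by (rule grade_carrier)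
    show "(x \<otimes>\<^bsub>B\<^esub> y) \<otimes>\<^bsub>B\<^esub> z = x \<otimes>\<^bsub>B\<^esub> (y \<otimes>\<^bsub>B\<^esub> z)"
    proof (rule additive_eqI[OF additive_comp[OF add add_l] additive_comp[OF add_l add] _ y])
      fix n y assume y: "y \<in> grade A n"
      then have yc: "y \<in> carrier A" by (rule grade_carrier)
      have yz: "t (int p) y \<otimes>\<^bsub>A\<^esub> z \<in> grade A (n + p)" using y z by (simp add: mult_grade t_grade)
      show "(x \<otimes>\<^bsub>B\<^esub> y) \<otimes>\<^bsub>B\<^esub> z = x \<otimes>\<^bsub>B\<^esub> (y \<otimes>\<^bsub>B\<^esub> z)"
        unfolding mult[OF x y] mult[OF yc z] mult[OF x yz]
        using x y z yc zc by (simp add: mult t_closed t_mult t_t A.m_assoc add.commute)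
    qed (use x zc in auto)
  qed (use x y closed in auto)
  have one_mult: "\<one>\<^bsub>A\<^esub> \<otimes>\<^bsub>B\<^esub> x = x" if "x \<in> carrier A" for x
    by (rule additive_eqI[OF add _ _ that]) (auto simp: additive_on_def mult t_one grade_carrier)
  have ring_B: "ring B"
  proof (rule ringI)
    show "abelian_group B" by (rule same_group_abelian[OF same A.abelian_group_axioms])
    show "Group.monoid B"
      by (rule monoidI) (use mult[OF _ one_grade] in \<open>auto simp: B_simps closed assoc one_mult t_0\<close>)
  qed (simp_all add: B_simps l_distr r_distr)
  have mod_B: "module K B"
    using K_module.module_axioms same_group_abelian[OF same]
    by (simp add: module_def module_axioms_def B_simps)
  have B_alg: "graded_algebra K B"
  proof (intro graded_algebra.intro graded_algebra_axioms.intro K.field_axioms ring_B mod_B)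
    fix c x y assume "c \<in> carrier K" "x \<in> carrier B" "y \<in> carrier B"
    then have c: "c \<in> carrier K" and x: "x \<in> carrier A" and y: "y \<in> carrier A" by (simp_all add: B_simps)
    have cx: "c \<odot>\<^bsub>A\<^esub> x \<in> carrier A" using c x by simp
    have add_c: "additive A A (\<lambda>y. c \<odot>\<^bsub>A\<^esub> y)" using c by (auto simp: additive_on_def K_module.smult_r_distr)
    have cy: "c \<odot>\<^bsub>A\<^esub> y \<in> grade A n" if "y \<in> grade A n" for y n
      using grade_submodule[of n] c that by (simp add: submodule_def submodule_axioms_def)
    show "(c \<odot>\<^bsub>B\<^esub> x) \<otimes>\<^bsub>B\<^esub> y = c \<odot>\<^bsub>B\<^esub> (x \<otimes>\<^bsub>B\<^esub> y)"
      unfolding B_simps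
      by (rule additive_eqI[OF add[OF cx] additive_comp[OF add[OF x] add_c] _ y])
        (use c x cx in \<open>simp add: mult t_smult t_closed smult_mult_left grade_carrier\<close>)
    show "x \<otimes>\<^bsub>B\<^esub> (c \<odot>\<^bsub>B\<^esub> y) = c \<odot>\<^bsub>B\<^esub> (x \<otimes>\<^bsub>B\<^esub> y)"
      unfolding B_simps
      by (rule additive_eqI[OF additive_comp[OF add_c add[OF x]] additive_comp[OF add[OF x] add_c] _ y])
        (use c x in \<open>simp add: mult[OF x] mult[OF x cy] t_closed smult_mult_right grade_carrier\<close>)
  next
    show "submodule (grade B n) K B" for n
      using grade_submodule[of n] same_group_add_monoid[OF same]
      by (simp add: submodule_def submodule_axioms_def B_simps)
    show "direct_sum_decomposition B (grade B)"
      using grade_direct_sum same_group_decomposition[OF same, of "grade A"] by (simp add: B_simps)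
  qed (simp_all add: B_simps one_grade mult_grade_B)
  have "graded_flow K B t"
  proof (intro graded_flow.intro graded_flow_axioms.intro)
    show "graded_k_algebra K B" using B_alg by (simp add: graded_k_algebra_def)
    fix x y k assume "x \<in> carrier B" "y \<in> carrier B"
    then have x: "x \<in> carrier A" and y: "y \<in> carrier A" by (simp_all add: B_simps)
    show "t k (x \<otimes>\<^bsub>B\<^esub> y) = t k x \<otimes>\<^bsub>B\<^esub> t k y"
      by (rule additive_eqI[OF additive_comp[OF add[OF x] t_additive]
            additive_comp[OF t_additive add[OF t_closed[OF x]]] _ y])
        (use x in \<open>simp add: mult[OF _ t_grade] mult t_mult t_closed t_t grade_carrier add.commute\<close>)
  qed (simp_all add: B_simps t_closed t_add t_smult t_grade t_0 t_t)
  then have "twist_pair K A B t"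
    by (intro twist_pair.intro twist_pair_axioms.intro graded_flow_axioms) (simp_all add: B_simps mult)
  then show ?thesis by (simp add: B_def t_def)
qed

lemma (in twist_pair) locally_finite_B:
  assumes "locally_finite_graded_algebra K A" shows "locally_finite_graded_algebra K B"
  using locally_finite_graded_algebra.finite_dimensional[OF assms]
  by (intro locally_finite_graded_algebra.intro locally_finite_graded_algebra_axioms.intro B.graded_algebra_axioms)
    (simp add: grade_B smult_B same_group_finsum[OF carrier_B add_B zero_B])

section \<open>Invertible bimodules\<close>

definition balanced ::
    "('s, 'x) ring_scheme \<Rightarrow> ('r, 's, 'v) bimodule \<Rightarrow> ('s, 't, 'w) bimodule \<Rightarrow> ('g, 'y) ring_scheme
      \<Rightarrow> ('v \<Rightarrow> 'w \<Rightarrow> 'g) \<Rightarrow> bool"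
  where "balanced S V W G g \<longleftrightarrow>
    (\<forall>v\<in>carrier V. additive W G (g v)) \<and> (\<forall>w\<in>carrier W. additive V G (\<lambda>v. g v w)) \<and>
    (\<forall>v\<in>carrier V. \<forall>s\<in>carrier S. \<forall>w\<in>carrier W. g (v \<triangleleft>\<^bsub>V\<^esub> s) w = g v (s \<odot>\<^bsub>W\<^esub> w))"

lemma balancedD:
  assumes "balanced S V W G g"
  shows "v \<in> carrier V \<Longrightarrow> w \<in> carrier W \<Longrightarrow> g v w \<in> carrier G"
    "v \<in> carrier V \<Longrightarrow> v' \<in> carrier V \<Longrightarrow> w \<in> carrier W \<Longrightarrow> g (v \<oplus>\<^bsub>V\<^esub> v') w = g v w \<oplus>\<^bsub>G\<^esub> g v' w"
    "v \<in> carrier V \<Longrightarrow> w \<in> carrier W \<Longrightarrow> w' \<in> carrier W \<Longrightarrow> g v (w \<oplus>\<^bsub>W\<^esub> w') = g v w \<oplus>\<^bsub>G\<^esub> g v w'"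
    "v \<in> carrier V \<Longrightarrow> s \<in> carrier S \<Longrightarrow> w \<in> carrier W \<Longrightarrow> g (v \<triangleleft>\<^bsub>V\<^esub> s) w = g v (s \<odot>\<^bsub>W\<^esub> w)"
  using assms by (simp_all add: balanced_def additive_on_def)

lemma balancedI:
  assumes "\<And>v w. v \<in> carrier V \<Longrightarrow> w \<in> carrier W \<Longrightarrow> g v w \<in> carrier G"
    "\<And>v v' w. v \<in> carrier V \<Longrightarrow> v' \<in> carrier V \<Longrightarrow> w \<in> carrier W \<Longrightarrow> g (v \<oplus>\<^bsub>V\<^esub> v') w = g v w \<oplus>\<^bsub>G\<^esub> g v' w"
    "\<And>v w w'. v \<in> carrier V \<Longrightarrow> w \<in> carrier W \<Longrightarrow> w' \<in> carrier W \<Longrightarrow> g v (w \<oplus>\<^bsub>W\<^esub> w') = g v w \<oplus>\<^bsub>G\<^esub> g v w'"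
    "\<And>v s w. v \<in> carrier V \<Longrightarrow> s \<in> carrier S \<Longrightarrow> w \<in> carrier W \<Longrightarrow> g (v \<triangleleft>\<^bsub>V\<^esub> s) w = g v (s \<odot>\<^bsub>W\<^esub> w)"
  shows "balanced S V W G g"
  using assms by (simp add: balanced_def additive_on_def)

definition frags :: "('r, 's, 'v) bimodule \<Rightarrow> ('s, 't, 'w) bimodule \<Rightarrow> ('v \<times> 'w \<Rightarrow>\<^sub>0 int) monoid"
  where "frags V W = free_Abelian_group (carrier V \<times> carrier W)"

definition coset ::
    "'s ring \<Rightarrow> ('r, 's, 'v) bimodule \<Rightarrow> ('s, 't, 'w) bimodule \<Rightarrow> ('v \<times> 'w \<Rightarrow>\<^sub>0 int)
      \<Rightarrow> ('v \<times> 'w \<Rightarrow>\<^sub>0 int) set"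
  where "coset S V W c = generate (frags V W) (tensor_rels S V W) #>\<^bsub>frags V W\<^esub> c"

text \<open>
  The tensor product is handled through the quotient map \<open>q\<close> from formal sums.
\<close>

locale bimodule_pair = V: bimodule R S V + W: bimodule S T W
  for R :: "'r ring" and S :: "'s ring" and T :: "'t ring"
    and V :: "('r, 's, 'v) bimodule" and W :: "('s, 't, 'w) bimodule"
begin

abbreviation F where "F \<equiv> frags V W"
abbreviation N where "N \<equiv> generate F (tensor_rels S V W)"
abbreviation q where "q \<equiv> coset S V W"

lemma mem_F: "c \<in> carrier F \<longleftrightarrow> Poly_Mapping.keys c \<subseteq> carrier V \<times> carrier W"
  by (simp add: frags_def)

lemma F_ops: "x \<otimes>\<^bsub>F\<^esub> y = x + y" "\<one>\<^bsub>F\<^esub> = 0"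
  by (simp_all add: frags_def)

lemma F_comm: "comm_group F"
  by (simp add: frags_def abelian_free_Abelian_group)

sublocale F: comm_group F by (rule F_comm)

lemma F_of: "v \<in> carrier V \<Longrightarrow> w \<in> carrier W \<Longrightarrow> frag_of (v, w) \<in> carrier F"
  by (simp add: mem_F)

lemma F_diff: "x \<in> carrier F \<Longrightarrow> y \<in> carrier F \<Longrightarrow> x - y \<in> carrier F"
  unfolding mem_F by (rule order_trans[OF keys_diff]) simp

lemma F_inv: "x \<in> carrier F \<Longrightarrow> inv\<^bsub>F\<^esub> x = - x"
  by (simp add: frags_def)

lemma rels_F: "tensor_rels S V W \<subseteq> carrier F"
  unfolding tensor_rels_def
  by (auto intro!: F_diff F_of V.M.a_closed W.M.a_closed V.rsmult_closed W.smult_closed)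

lemma N_subgroup: "subgroup N F"
  by (rule F.generate_is_subgroup[OF rels_F])

sublocale N: normal N F
  using F.normal_iff_subgroup N_subgroup by blast

lemma rels_N: "r \<in> tensor_rels S V W \<Longrightarrow> r \<in> N"
  by (rule generate.incl)

lemma N_induct:
  assumes "\<And>r. r \<in> tensor_rels S V W \<Longrightarrow> Q r" "Q 0"
    "\<And>x y. x \<in> carrier F \<Longrightarrow> y \<in> carrier F \<Longrightarrow> Q x \<Longrightarrow> Q y \<Longrightarrow> Q (x - y)" "c \<in> N"
  shows "Q c"
proof -
  have neg: "Q (- x)" if "x \<in> carrier F" "Q x" for x
    using assms(3)[OF _ that(1) assms(2) that(2)] by (simp add: mem_F)
  have "subgroup {x \<in> carrier F. Q x} F"
  proof (rule F.subgroupI)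
    show "{x \<in> carrier F. Q x} \<noteq> {}" using assms(2) F.one_closed by (auto simp: F_ops)
    fix x assume x: "x \<in> {x \<in> carrier F. Q x}"
    have "- x \<in> carrier F" using x F.inv_closed F_inv by force
    then show "inv\<^bsub>F\<^esub> x \<in> {x \<in> carrier F. Q x}" using x neg by (simp add: F_inv)
    fix y assume y: "y \<in> {x \<in> carrier F. Q x}"
    have "- y \<in> carrier F" using y F.inv_closed F_inv by force
    then have "Q (x - (- y))" using x y neg by (intro assms(3)) auto
    then show "x \<otimes>\<^bsub>F\<^esub> y \<in> {x \<in> carrier F. Q x}" using x y F.m_closed[of x y] by (simp add: F_ops)
  qed auto
  then have "N \<subseteq> {x \<in> carrier F. Q x}"
    using assms(1) rels_F by (intro F.generate_subgroup_incl) auto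
  then show ?thesis using assms(4) by blast
qed

lemma q_mem: "c' \<in> q c \<longleftrightarrow> c' - c \<in> N"
proof -
  have "c' = n + c \<longleftrightarrow> n = c' - c" for n by (auto simp: algebra_simps)
  then show ?thesis by (auto simp: coset_def r_coset_def F_ops)
qed

lemma q_eq_iff:
  assumes "c \<in> carrier F" "d \<in> carrier F" shows "q c = q d \<longleftrightarrow> c - d \<in> N"
proof
  assume "q c = q d"
  moreover have "c \<in> q c" using subgroup.one_closed[OF N_subgroup] by (simp add: q_mem F_ops)
  ultimately show "c - d \<in> N" by (simp add: q_mem)
next
  assume "c - d \<in> N"
  then have "c \<in> N #>\<^bsub>F\<^esub> d" using q_mem[of c d] by (simp add: coset_def)
  then show "q c = q d" using F.repr_independence[OF _ assms(2) N_subgroup] by (simp add: coset_def)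
qed

lemma tensor_simps:
  "carrier (tensor S V W) = q ` carrier F"
  "c \<in> carrier F \<Longrightarrow> d \<in> carrier F \<Longrightarrow> q c \<oplus>\<^bsub>tensor S V W\<^esub> q d = q (c + d)"
proof -
  show "carrier (tensor S V W) = q ` carrier F"
    by (auto simp: tensor_def Let_def frags_def[symmetric] coset_def FactGroup_def RCOSETS_def)
  show "q c \<oplus>\<^bsub>tensor S V W\<^esub> q d = q (c + d)" if "c \<in> carrier F" "d \<in> carrier F"
    using hom_mult[OF N.r_coset_hom_Mod that]
    by (simp add: tensor_def Let_def frags_def[symmetric] coset_def F_ops)
qed

text \<open>
  The module structure of the tensor product is defined by a union over all representatives. It
  is computed by any one of them if the map on formal sums respects the relations.
\<close>

lemma frag_extend_N:
  assumes f: "\<And>v w. v \<in> carrier V \<Longrightarrow> w \<in> carrier W \<Longrightarrow> f (v, w) \<in> carrier F"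
    and r: "\<And>r. r \<in> tensor_rels S V W \<Longrightarrow> frag_extend f r \<in> N" and c: "c \<in> carrier F"
  shows "(\<Union>c'\<in>q c. N #>\<^bsub>F\<^esub> frag_extend f c') = q (frag_extend f c)"
proof -
  have fF: "frag_extend f c \<in> carrier F" if "c \<in> carrier F" for c
  proof -
    have "Poly_Mapping.keys c \<subseteq> carrier V \<times> carrier W" using that by (simp add: mem_F)
    then show ?thesis
    proof (rule free_Abelian_group_induct)
      show "frag_extend f 0 \<in> carrier F" using F.one_closed by (simp add: F_ops)
      show "frag_extend f (x - y) \<in> carrier F"
        if "frag_extend f x \<in> carrier F" "frag_extend f y \<in> carrier F" for x y
        using that by (simp add: frag_extend_diff F_diff)
      show "frag_extend f (frag_of a) \<in> carrier F" if "a \<in> carrier V \<times> carrier W" for a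
        using that f by auto
    qed
  qed
  have fN: "frag_extend f n \<in> N" if "n \<in> N" for n
  proof (rule N_induct[OF r _ _ that])
    show "frag_extend f 0 \<in> N" using subgroup.one_closed[OF N_subgroup] by (simp add: F_ops)
    fix x y assume xy: "x \<in> carrier F" "y \<in> carrier F" "frag_extend f x \<in> N" "frag_extend f y \<in> N"
    have "frag_extend f x \<otimes>\<^bsub>F\<^esub> inv\<^bsub>F\<^esub> frag_extend f y \<in> N"
      using subgroup.m_closed[OF N_subgroup xy(3) subgroup.m_inv_closed[OF N_subgroup xy(4)]] .
    then show "frag_extend f (x - y) \<in> N"
      using F_inv[OF fF[OF xy(2)]] by (simp add: F_ops frag_extend_diff)
  qed
  have NF: "n \<in> N \<Longrightarrow> n \<in> carrier F" for n using subgroup.mem_carrier[OF N_subgroup] .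
  have "q (frag_extend f c') = q (frag_extend f c)" if "c' \<in> q c" for c'
  proof -
    have n: "c' - c \<in> N" using that by (simp add: q_mem)
    have "c' \<in> carrier F" using F.m_closed[OF NF[OF n] c] by (simp add: F_ops)
    then show ?thesis using fN[OF n] c fF by (simp add: q_eq_iff frag_extend_diff)
  qed
  moreover have "c \<in> q c" using subgroup.one_closed[OF N_subgroup] by (simp add: q_mem F_ops)
  ultimately show ?thesis unfolding coset_def by blast
qed

lemma frag_extend_tensor:
  assumes f: "\<And>v. v \<in> carrier V \<Longrightarrow> f v \<in> carrier V" "\<And>w. w \<in> carrier W \<Longrightarrow> g w \<in> carrier W"
    and add: "\<And>v v'. v \<in> carrier V \<Longrightarrow> v' \<in> carrier V \<Longrightarrow> f (v \<oplus>\<^bsub>V\<^esub> v') = f v \<oplus>\<^bsub>V\<^esub> f v'"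
      "\<And>w w'. w \<in> carrier W \<Longrightarrow> w' \<in> carrier W \<Longrightarrow> g (w \<oplus>\<^bsub>W\<^esub> w') = g w \<oplus>\<^bsub>W\<^esub> g w'"
    and lin: "\<And>v s. v \<in> carrier V \<Longrightarrow> s \<in> carrier S \<Longrightarrow> f (v \<triangleleft>\<^bsub>V\<^esub> s) = f v \<triangleleft>\<^bsub>V\<^esub> s"
      "\<And>w s. w \<in> carrier W \<Longrightarrow> s \<in> carrier S \<Longrightarrow> g (s \<odot>\<^bsub>W\<^esub> w) = s \<odot>\<^bsub>W\<^esub> g w"
    and v: "v \<in> carrier V" and w: "w \<in> carrier W"
  shows "(\<Union>c\<in>q (frag_of (v, w)). N #>\<^bsub>F\<^esub> frag_extend (\<lambda>(v, w). frag_of (f v, g w)) c) = q (frag_of (f v, g w))"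
proof -
  define h where "h = (\<lambda>(v, w). frag_of (f v, g w))"
  have "(\<Union>c\<in>q (frag_of (v, w)). N #>\<^bsub>F\<^esub> frag_extend h c) = q (frag_extend h (frag_of (v, w)))"
  proof (rule frag_extend_N)
    show "h (v, w) \<in> carrier F" if "v \<in> carrier V" "w \<in> carrier W" for v w
      using that f by (simp add: h_def F_of)
    show "frag_extend h x \<in> N" if "x \<in> tensor_rels S V W" for x
    proof (rule rels_N)
      show "frag_extend h x \<in> tensor_rels S V W"
        using that[unfolded tensor_rels_def]
      proof (elim UnE)
        assume "x \<in> {frag_of (v \<oplus>\<^bsub>V\<^esub> v', w) - frag_of (v, w) - frag_of (v', w) | v v' w.
          v \<in> carrier V \<and> v' \<in> carrier V \<and> w \<in> carrier W}"
        then obtain v v' w where *: "v \<in> carrier V" "v' \<in> carrier V" "w \<in> carrier W"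
          and x: "x = frag_of (v \<oplus>\<^bsub>V\<^esub> v', w) - frag_of (v, w) - frag_of (v', w)" by blast
        show ?thesis
          unfolding tensor_rels_def
          by (rule UnI1[OF UnI1], rule CollectI, intro exI[of _ "f v"] exI[of _ "f v'"] exI[of _ "g w"])
            (use * in \<open>simp add: x h_def frag_extend_diff f add\<close>)
      next
        assume "x \<in> {frag_of (v, w \<oplus>\<^bsub>W\<^esub> w') - frag_of (v, w) - frag_of (v, w') | v w w'.
          v \<in> carrier V \<and> w \<in> carrier W \<and> w' \<in> carrier W}"
        then obtain v w w' where *: "v \<in> carrier V" "w \<in> carrier W" "w' \<in> carrier W"
          and x: "x = frag_of (v, w \<oplus>\<^bsub>W\<^esub> w') - frag_of (v, w) - frag_of (v, w')" by blast
        show ?thesis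
          unfolding tensor_rels_def
          by (rule UnI1[OF UnI2], rule CollectI, intro exI[of _ "f v"] exI[of _ "g w"] exI[of _ "g w'"])
            (use * in \<open>simp add: x h_def frag_extend_diff f add\<close>)
      next
        assume "x \<in> {frag_of (v \<triangleleft>\<^bsub>V\<^esub> s, w) - frag_of (v, s \<odot>\<^bsub>W\<^esub> w) | v s w.
          v \<in> carrier V \<and> s \<in> carrier S \<and> w \<in> carrier W}"
        then obtain v s w where *: "v \<in> carrier V" "s \<in> carrier S" "w \<in> carrier W"
          and x: "x = frag_of (v \<triangleleft>\<^bsub>V\<^esub> s, w) - frag_of (v, s \<odot>\<^bsub>W\<^esub> w)" by blast
        show ?thesis
          unfolding tensor_rels_def
          by (rule UnI2, rule CollectI, intro exI[of _ "f v"] exI[of _ s] exI[of _ "g w"])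
            (use * in \<open>simp add: x h_def frag_extend_diff f lin\<close>)
      qed
    qed
  qed (use v w in \<open>simp add: F_of\<close>)
  then show ?thesis by (simp add: h_def)
qed

lemma smult_tensor:
  assumes "r \<in> carrier R" "v \<in> carrier V" "w \<in> carrier W"
  shows "r \<odot>\<^bsub>tensor S V W\<^esub> q (frag_of (v, w)) = q (frag_of (r \<odot>\<^bsub>V\<^esub> v, w))"
  using frag_extend_tensor[of "\<lambda>v. r \<odot>\<^bsub>V\<^esub> v" "\<lambda>w. w"] assms
  by (simp add: tensor_def Let_def frags_def[symmetric] V.smult_closed V.smult_r_distr V.smult_rsmult)

lemma rsmult_tensor:
  assumes "t \<in> carrier T" "v \<in> carrier V" "w \<in> carrier W"
  shows "q (frag_of (v, w)) \<triangleleft>\<^bsub>tensor S V W\<^esub> t = q (frag_of (v, w \<triangleleft>\<^bsub>W\<^esub> t))"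
  using frag_extend_tensor[of "\<lambda>v. v" "\<lambda>w. w \<triangleleft>\<^bsub>W\<^esub> t"] assms
  by (simp add: tensor_def Let_def frags_def[symmetric] W.rsmult_closed W.rsmult_l_distr W.smult_rsmult)

lemma q_balanced:
  assumes "v \<in> carrier V" "w \<in> carrier W"
  shows "v' \<in> carrier V \<Longrightarrow> q (frag_of (v \<oplus>\<^bsub>V\<^esub> v', w)) = q (frag_of (v, w) + frag_of (v', w))"
    "w' \<in> carrier W \<Longrightarrow> q (frag_of (v, w \<oplus>\<^bsub>W\<^esub> w')) = q (frag_of (v, w) + frag_of (v, w'))"
    "s \<in> carrier S \<Longrightarrow> q (frag_of (v \<triangleleft>\<^bsub>V\<^esub> s, w)) = q (frag_of (v, s \<odot>\<^bsub>W\<^esub> w))"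
proof -
  have F_add: "x \<in> carrier F \<Longrightarrow> y \<in> carrier F \<Longrightarrow> x + y \<in> carrier F" for x y
    using F.m_closed[of x y] by (simp add: F_ops)
  show "q (frag_of (v \<oplus>\<^bsub>V\<^esub> v', w)) = q (frag_of (v, w) + frag_of (v', w))" if "v' \<in> carrier V"
  proof (subst q_eq_iff)
    have "frag_of (v \<oplus>\<^bsub>V\<^esub> v', w) - frag_of (v, w) - frag_of (v', w) \<in> N"
      by (rule rels_N) (use assms that in \<open>auto simp: tensor_rels_def\<close>)
    then show "frag_of (v \<oplus>\<^bsub>V\<^esub> v', w) - (frag_of (v, w) + frag_of (v', w)) \<in> N" by (simp add: diff_diff_eq)
  qed (use assms that in \<open>auto intro!: F_of F_add\<close>)
  show "q (frag_of (v, w \<oplus>\<^bsub>W\<^esub> w')) = q (frag_of (v, w) + frag_of (v, w'))" if "w' \<in> carrier W"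
  proof (subst q_eq_iff)
    have "frag_of (v, w \<oplus>\<^bsub>W\<^esub> w') - frag_of (v, w) - frag_of (v, w') \<in> N"
      by (rule rels_N) (use assms that in \<open>auto simp: tensor_rels_def\<close>)
    then show "frag_of (v, w \<oplus>\<^bsub>W\<^esub> w') - (frag_of (v, w) + frag_of (v, w')) \<in> N" by (simp add: diff_diff_eq)
  qed (use assms that in \<open>auto intro!: F_of F_add\<close>)
  show "q (frag_of (v \<triangleleft>\<^bsub>V\<^esub> s, w)) = q (frag_of (v, s \<odot>\<^bsub>W\<^esub> w))" if "s \<in> carrier S"
  proof (subst q_eq_iff)
    show "frag_of (v \<triangleleft>\<^bsub>V\<^esub> s, w) - frag_of (v, s \<odot>\<^bsub>W\<^esub> w) \<in> N"
      by (rule rels_N) (use assms that in \<open>auto simp: tensor_rels_def\<close>)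
  qed (use assms that in \<open>auto intro!: F_of V.rsmult_closed W.smult_closed\<close>)
qed

lemma tensor_universal:
  assumes G: "abelian_group G" and g: "balanced S V W G g"
  obtains h where "\<And>c. c \<in> carrier F \<Longrightarrow> h (q c) \<in> carrier G"
    "\<And>c d. c \<in> carrier F \<Longrightarrow> d \<in> carrier F \<Longrightarrow> h (q (c + d)) = h (q c) \<oplus>\<^bsub>G\<^esub> h (q d)"
    "\<And>v w. v \<in> carrier V \<Longrightarrow> w \<in> carrier W \<Longrightarrow> h (q (frag_of (v, w))) = g v w"
proof -
  interpret G: abelian_group G by fact
  note g = balancedD[OF g]
  obtain k where k: "k \<in> hom F (add_monoid G)"
    and k_of: "\<And>x. x \<in> carrier V \<times> carrier W \<Longrightarrow> k (frag_of x) = (case x of (v, w) \<Rightarrow> g v w)"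
    using comm_group.free_Abelian_group_universal[OF G.a_comm_group, of "\<lambda>(v, w). g v w" "carrier V \<times> carrier W"] g(1)
    unfolding frags_def by (auto simp: image_subset_iff)
  have kc: "k c \<in> carrier G" if "c \<in> carrier F" for c using hom_in_carrier[OF k that] by simp
  have k_add: "k (c + d) = k c \<oplus>\<^bsub>G\<^esub> k d" if "c \<in> carrier F" "d \<in> carrier F" for c d
    using hom_mult[OF k that] by (simp add: F_ops)
  have k_diff: "k (c - d) = k c \<ominus>\<^bsub>G\<^esub> k d" if "c \<in> carrier F" "d \<in> carrier F" for c d
    using k_add[OF F_diff[OF that] that(2)] kc that F_diff[OF that]
    by (simp add: a_minus_def G.a_assoc G.r_neg)
  have k_rel: "k (c - d - e) = \<zero>\<^bsub>G\<^esub>"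
    if "c \<in> carrier F" "d \<in> carrier F" "e \<in> carrier F" "k c = k d \<oplus>\<^bsub>G\<^esub> k e" for c d e
  proof -
    have "k (c - d - e) = ((k e \<oplus>\<^bsub>G\<^esub> k d) \<ominus>\<^bsub>G\<^esub> k d) \<ominus>\<^bsub>G\<^esub> k e"
      using that kc by (simp add: k_diff F_diff G.a_comm)
    also have "\<dots> = \<zero>\<^bsub>G\<^esub>" using that kc by (simp add: a_minus_def G.a_assoc G.r_neg)
    finally show ?thesis .
  qed
  have kN: "k n = \<zero>\<^bsub>G\<^esub>" if "n \<in> N" for n
  proof (rule N_induct[OF _ _ _ that])
    have "0 \<in> carrier F" using F.one_closed by (simp add: F_ops)
    then show "k 0 = \<zero>\<^bsub>G\<^esub>" using k_diff[of 0 0] kc[of 0] by (simp add: a_minus_def G.r_neg)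
    fix r assume "r \<in> tensor_rels S V W"
    from this[unfolded tensor_rels_def] show "k r = \<zero>\<^bsub>G\<^esub>"
    proof (elim UnE)
      assume "r \<in> {frag_of (v \<oplus>\<^bsub>V\<^esub> v', w) - frag_of (v, w) - frag_of (v', w) | v v' w.
        v \<in> carrier V \<and> v' \<in> carrier V \<and> w \<in> carrier W}"
      then obtain v v' w where *: "v \<in> carrier V" "v' \<in> carrier V" "w \<in> carrier W"
        and r: "r = frag_of (v \<oplus>\<^bsub>V\<^esub> v', w) - frag_of (v, w) - frag_of (v', w)" by blast
      show ?thesis unfolding r by (rule k_rel) (use * in \<open>simp_all add: F_of k_of g\<close>)
    next
      assume "r \<in> {frag_of (v, w \<oplus>\<^bsub>W\<^esub> w') - frag_of (v, w) - frag_of (v, w') | v w w'.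
        v \<in> carrier V \<and> w \<in> carrier W \<and> w' \<in> carrier W}"
      then obtain v w w' where *: "v \<in> carrier V" "w \<in> carrier W" "w' \<in> carrier W"
        and r: "r = frag_of (v, w \<oplus>\<^bsub>W\<^esub> w') - frag_of (v, w) - frag_of (v, w')" by blast
      show ?thesis unfolding r by (rule k_rel) (use * in \<open>simp_all add: F_of k_of g\<close>)
    next
      assume "r \<in> {frag_of (v \<triangleleft>\<^bsub>V\<^esub> s, w) - frag_of (v, s \<odot>\<^bsub>W\<^esub> w) | v s w.
        v \<in> carrier V \<and> s \<in> carrier S \<and> w \<in> carrier W}"
      then obtain v s w where *: "v \<in> carrier V" "s \<in> carrier S" "w \<in> carrier W"
        and r: "r = frag_of (v \<triangleleft>\<^bsub>V\<^esub> s, w) - frag_of (v, s \<odot>\<^bsub>W\<^esub> w)" by blast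
      have sw: "s \<odot>\<^bsub>W\<^esub> w \<in> carrier W" "v \<triangleleft>\<^bsub>V\<^esub> s \<in> carrier V"
        using * by (auto intro: V.rsmult_closed W.smult_closed)
      have "k r = g v (s \<odot>\<^bsub>W\<^esub> w) \<ominus>\<^bsub>G\<^esub> g v (s \<odot>\<^bsub>W\<^esub> w)"
        unfolding r using * sw by (simp add: k_diff F_of k_of g(4))
      then show ?thesis using g(1)[OF *(1) sw(1)] by (simp add: a_minus_def G.r_neg)
    qed
  next
    fix x y assume "x \<in> carrier F" "y \<in> carrier F" "k x = \<zero>\<^bsub>G\<^esub>" "k y = \<zero>\<^bsub>G\<^esub>"
    then show "k (x - y) = \<zero>\<^bsub>G\<^esub>" by (simp add: k_diff a_minus_def)
  qed
  have kq: "k ` q c = {k c}" if c: "c \<in> carrier F" for c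
  proof -
    have "k c' = k c" if "c' \<in> q c" for c'
    proof -
      have n: "c' - c \<in> N" using that by (simp add: q_mem)
      have "k ((c' - c) + c) = k (c' - c) \<oplus>\<^bsub>G\<^esub> k c"
        using subgroup.mem_carrier[OF N_subgroup n] c by (rule k_add)
      then show ?thesis using kN[OF n] kc[OF c] by simp
    qed
    moreover have "c \<in> q c" using subgroup.one_closed[OF N_subgroup] by (simp add: q_mem F_ops)
    ultimately show ?thesis by blast
  qed
  show ?thesis
  proof (rule that[of "\<lambda>C. the_elem (k ` C)"])
    fix c d assume "c \<in> carrier F" "d \<in> carrier F"
    moreover then have "c + d \<in> carrier F" using F.m_closed[of c d] by (simp add: F_ops)
    ultimately show "the_elem (k ` q (c + d)) = the_elem (k ` q c) \<oplus>\<^bsub>G\<^esub> the_elem (k ` q d)"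
      by (simp add: kq k_add)
  qed (simp_all add: kq kc k_of F_of)
qed

end

lemma (in abelian_group) minus_eq_zero_iff:
  assumes "x \<in> carrier G" "y \<in> carrier G" shows "x \<ominus> y = \<zero> \<longleftrightarrow> x = y"
proof
  assume "x \<ominus> y = \<zero>"
  moreover have "(x \<ominus> y) \<oplus> y = x" using assms by (simp add: a_minus_def a_assoc l_neg)
  ultimately show "x = y" using assms by simp
qed (use assms in \<open>simp add: a_minus_def r_neg\<close>)

locale tensor_iso = bimodule_pair S S S V W
  for S :: "'s ring" and V :: "('s, 's, 'v) bimodule" and W :: "('s, 's, 'w) bimodule" +
  fixes \<theta> :: "('v \<times> 'w \<Rightarrow>\<^sub>0 int) set \<Rightarrow> 's"
  assumes bij: "bij_betw \<theta> (carrier (tensor S V W)) (carrier S)"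
    and \<theta>_add: "x \<in> carrier (tensor S V W) \<Longrightarrow> y \<in> carrier (tensor S V W) \<Longrightarrow>
      \<theta> (x \<oplus>\<^bsub>tensor S V W\<^esub> y) = \<theta> x \<oplus>\<^bsub>S\<^esub> \<theta> y"
    and \<theta>_smult: "s \<in> carrier S \<Longrightarrow> x \<in> carrier (tensor S V W) \<Longrightarrow>
      \<theta> (s \<odot>\<^bsub>tensor S V W\<^esub> x) = s \<otimes>\<^bsub>S\<^esub> \<theta> x"
    and \<theta>_rsmult: "s \<in> carrier S \<Longrightarrow> x \<in> carrier (tensor S V W) \<Longrightarrow>
      \<theta> (x \<triangleleft>\<^bsub>tensor S V W\<^esub> s) = \<theta> x \<otimes>\<^bsub>S\<^esub> s"
begin

definition pairing :: "'v \<Rightarrow> 'w \<Rightarrow> 's" where "pairing v w = \<theta> (q (frag_of (v, w)))"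

lemma q_closed: "c \<in> carrier F \<Longrightarrow> q c \<in> carrier (tensor S V W)"
  by (simp add: tensor_simps)

lemma \<theta>_q: "c \<in> carrier F \<Longrightarrow> \<theta> (q c) \<in> carrier S"
  using bij q_closed by (auto simp: bij_betw_def)

lemma \<theta>_q_add: "c \<in> carrier F \<Longrightarrow> d \<in> carrier F \<Longrightarrow> \<theta> (q (c + d)) = \<theta> (q c) \<oplus>\<^bsub>S\<^esub> \<theta> (q d)"
  using \<theta>_add[OF q_closed q_closed, of c d] by (simp add: tensor_simps)

lemma pairing_closed: "v \<in> carrier V \<Longrightarrow> w \<in> carrier W \<Longrightarrow> pairing v w \<in> carrier S"
  by (simp add: pairing_def \<theta>_q F_of)

lemma pairing_balanced: "balanced S V W S pairing"
  by (rule balancedI) (simp_all add: pairing_def q_balanced \<theta>_q_add F_of \<theta>_q)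

lemma pairing_smult:
  "s \<in> carrier S \<Longrightarrow> v \<in> carrier V \<Longrightarrow> w \<in> carrier W \<Longrightarrow> pairing (s \<odot>\<^bsub>V\<^esub> v) w = s \<otimes>\<^bsub>S\<^esub> pairing v w"
  using \<theta>_smult[OF _ q_closed[OF F_of]] by (simp add: pairing_def smult_tensor)

lemma pairing_rsmult:
  "s \<in> carrier S \<Longrightarrow> v \<in> carrier V \<Longrightarrow> w \<in> carrier W \<Longrightarrow> pairing v (w \<triangleleft>\<^bsub>W\<^esub> s) = pairing v w \<otimes>\<^bsub>S\<^esub> s"
  using \<theta>_rsmult[OF _ q_closed[OF F_of]] by (simp add: pairing_def rsmult_tensor)

lemma \<theta>_q_diff: "c \<in> carrier F \<Longrightarrow> d \<in> carrier F \<Longrightarrow> \<theta> (q (c - d)) = \<theta> (q c) \<ominus>\<^bsub>S\<^esub> \<theta> (q d)"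
  using \<theta>_q_add[OF F_diff, of c d d] \<theta>_q[OF F_diff, of c d] \<theta>_q[of c] \<theta>_q[of d]
  by (simp add: a_minus_def V.R.a_assoc V.R.r_neg)

lemma pairing_generates:
  assumes I: "subgroup I (add_monoid S)"
    and p: "\<And>v w. v \<in> carrier V \<Longrightarrow> w \<in> carrier W \<Longrightarrow> pairing v w \<in> I"
    and s: "s \<in> carrier S"
  shows "s \<in> I"
proof -
  have minus: "x \<ominus>\<^bsub>S\<^esub> y \<in> I" if "x \<in> I" "y \<in> I" for x y
    using subgroup.m_closed[OF I that(1) subgroup.m_inv_closed[OF I that(2)]]
    by (simp add: a_minus_def a_inv_def)
  have "\<theta> (q c) \<in> I" if "Poly_Mapping.keys c \<subseteq> carrier V \<times> carrier W" for c
    using that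
  proof (rule free_Abelian_group_induct)
    have "0 \<in> carrier F" using F.one_closed by (simp add: F_ops)
    then have "\<theta> (q 0) = \<zero>\<^bsub>S\<^esub>"
      using \<theta>_q_diff[of 0 0] \<theta>_q[of 0] by (simp add: a_minus_def V.R.r_neg)
    then show "\<theta> (q 0) \<in> I" using subgroup.one_closed[OF I] by simp
    show "\<theta> (q (x - y)) \<in> I" if "Poly_Mapping.keys x \<subseteq> carrier V \<times> carrier W"
      "Poly_Mapping.keys y \<subseteq> carrier V \<times> carrier W" "\<theta> (q x) \<in> I" "\<theta> (q y) \<in> I" for x y
      using that minus \<theta>_q_diff by (simp add: mem_F)
    show "\<theta> (q (frag_of a)) \<in> I" if "a \<in> carrier V \<times> carrier W" for a
      using that p by (auto simp: pairing_def)
  qed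
  moreover obtain c where "c \<in> carrier F" "s = \<theta> (q c)"
    using bij s by (auto simp: bij_betw_def tensor_simps)
  ultimately show ?thesis by (simp add: mem_F)
qed

lemma pairing_universal:
  assumes G: "abelian_group G" and g: "balanced S V W G g"
  obtains h where "additive S G h"
    "\<And>v w. v \<in> carrier V \<Longrightarrow> w \<in> carrier W \<Longrightarrow> h (pairing v w) = g v w"
proof -
  obtain h where h: "\<And>c. c \<in> carrier F \<Longrightarrow> h (q c) \<in> carrier G"
    "\<And>c d. c \<in> carrier F \<Longrightarrow> d \<in> carrier F \<Longrightarrow> h (q (c + d)) = h (q c) \<oplus>\<^bsub>G\<^esub> h (q d)"
    "\<And>v w. v \<in> carrier V \<Longrightarrow> w \<in> carrier W \<Longrightarrow> h (q (frag_of (v, w))) = g v w"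
    by (rule tensor_universal[OF G g]) blast
  define k where "k s = h (inv_into (carrier (tensor S V W)) \<theta> s)" for s
  have inj: "inj_on \<theta> (carrier (tensor S V W))" using bij by (simp add: bij_betw_def)
  have k: "k (\<theta> (q c)) = h (q c)" if "c \<in> carrier F" for c
    unfolding k_def using inv_into_f_f[OF inj q_closed[OF that]] by simp
  have rep: "\<exists>c\<in>carrier F. s = \<theta> (q c)" if "s \<in> carrier S" for s
    using bij that by (auto simp: bij_betw_def tensor_simps)
  show ?thesis
  proof (rule that[of k])
    show "additive S G k"
    proof (rule additive_onI)
      fix s t assume "s \<in> carrier S" "t \<in> carrier S"
      then obtain c d where c: "c \<in> carrier F" "s = \<theta> (q c)" and d: "d \<in> carrier F" "t = \<theta> (q d)"
        using rep by blast
      have cd: "c + d \<in> carrier F" using F.m_closed[OF c(1) d(1)] by (simp add: F_ops)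
      show "k s \<in> carrier G" using k h(1) c by simp
      show "k (s \<oplus>\<^bsub>S\<^esub> t) = k s \<oplus>\<^bsub>G\<^esub> k t"
        using k[OF cd] k[OF c(1)] k[OF d(1)] h(2)[OF c(1) d(1)] \<theta>_q_add[OF c(1) d(1)] by (simp add: c d)
    qed
    show "k (pairing v w) = g v w" if "v \<in> carrier V" "w \<in> carrier W" for v w
      using k[OF F_of[OF that]] h(3)[OF that] by (simp add: pairing_def)
  qed
qed

end

lemma tensor_iso_of_isomorphic:
  assumes "bimodule S S V" "bimodule S S W"
    and "bimodule_isomorphic S S (tensor S V W) (regular_bimodule S)"
  shows "\<exists>\<theta>. tensor_iso S V W \<theta>"
proof -
  obtain \<theta> where \<theta>: "bij_betw \<theta> (carrier (tensor S V W)) (carrier (regular_bimodule S))"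
    "\<forall>v\<in>carrier (tensor S V W). \<forall>w\<in>carrier (tensor S V W).
      \<theta> (v \<oplus>\<^bsub>tensor S V W\<^esub> w) = \<theta> v \<oplus>\<^bsub>regular_bimodule S\<^esub> \<theta> w"
    "\<forall>r\<in>carrier S. \<forall>v\<in>carrier (tensor S V W).
      \<theta> (r \<odot>\<^bsub>tensor S V W\<^esub> v) = r \<odot>\<^bsub>regular_bimodule S\<^esub> \<theta> v"
    "\<forall>s\<in>carrier S. \<forall>v\<in>carrier (tensor S V W).
      \<theta> (v \<triangleleft>\<^bsub>tensor S V W\<^esub> s) = \<theta> v \<triangleleft>\<^bsub>regular_bimodule S\<^esub> s"
    using assms(3) unfolding bimodule_isomorphic_def by (elim exE conjE)
  have "tensor_iso S V W \<theta>"
    by (intro tensor_iso.intro bimodule_pair.intro tensor_iso_axioms.intro assms(1,2))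
      (use \<theta> in \<open>simp_all add: regular_bimodule_def\<close>)
  then show ?thesis by blast
qed

text \<open>
  The isomorphisms \<open>\<alpha> : V \<otimes> W \<cong> S\<close> and \<open>\<beta> : W \<otimes> V \<cong> S\<close> need not be compatible with each other.
  Each is used through the pairing of elements it defines: this pairing is balanced, its values
  generate \<open>S\<close>, and every balanced map factors through it.
\<close>

locale mutually_inverse = VW: tensor_iso S V W \<alpha> + WV: tensor_iso S W V \<beta>
  for S :: "'s ring" and V :: "('s, 's, 'v) bimodule" and W :: "('s, 's, 'w) bimodule" and \<alpha> \<beta>
begin

text \<open>
  For fixed \<open>v\<close> and \<open>w\<close>, the map \<open>(w', u) \<mapsto> \<langle>v, w'\<rangle> u\<close> is balanced, so it depends on the pairing of \<open>w'\<close>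
  and \<open>u\<close> only. Hence all \<open>\<langle>v, w\<rangle>\<close> annihilate \<open>u\<close>, and they generate \<open>S\<close>.
\<close>

lemma pairing_cancel:
  assumes u: "u \<in> carrier V" and 0: "\<And>w. w \<in> carrier W \<Longrightarrow> WV.pairing w u = \<zero>\<^bsub>S\<^esub>"
  shows "u = \<zero>\<^bsub>V\<^esub>"
proof -
  note Vm = VW.V.smult_closed VW.V.smult_l_distr VW.V.smult_r_distr VW.V.smult_assoc
  note p = VW.pairing_closed balancedD[OF VW.pairing_balanced]
  have kill: "VW.pairing v w \<odot>\<^bsub>V\<^esub> u = \<zero>\<^bsub>V\<^esub>" if v: "v \<in> carrier V" and w: "w \<in> carrier W" for v w
  proof -
    have "balanced S W V V (\<lambda>w u. VW.pairing v w \<odot>\<^bsub>V\<^esub> u)"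
      by (rule balancedI)
        (use v p(1,4) in \<open>simp_all add: Vm VW.pairing_rsmult\<close>)
    then obtain h where h: "additive S V h"
      "\<And>w u. w \<in> carrier W \<Longrightarrow> u \<in> carrier V \<Longrightarrow> h (WV.pairing w u) = VW.pairing v w \<odot>\<^bsub>V\<^esub> u"
      by (rule WV.pairing_universal[OF VW.V.M.abelian_group_axioms]) blast
    have "h \<zero>\<^bsub>S\<^esub> = \<zero>\<^bsub>V\<^esub>"
      by (rule additive_zero[OF VW.V.R.abelian_group_axioms VW.V.M.abelian_group_axioms h(1)])
    then show ?thesis using h(2)[OF w u] 0[OF w] by simp
  qed
  have "subgroup {s \<in> carrier S. s \<odot>\<^bsub>V\<^esub> u = \<zero>\<^bsub>V\<^esub>} (add_monoid S)"
  proof (rule VW.V.R.add.subgroupI)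
    show "{s \<in> carrier S. s \<odot>\<^bsub>V\<^esub> u = \<zero>\<^bsub>V\<^esub>} \<noteq> {}"
      using VW.V.zero_smult[OF u] VW.V.R.zero_closed by blast
    have add: "additive S V (\<lambda>s. s \<odot>\<^bsub>V\<^esub> u)" using u by (auto simp: additive_on_def Vm)
    fix s assume s: "s \<in> {s \<in> carrier S. s \<odot>\<^bsub>V\<^esub> u = \<zero>\<^bsub>V\<^esub>}"
    show "\<ominus>\<^bsub>S\<^esub> s \<in> {s \<in> carrier S. s \<odot>\<^bsub>V\<^esub> u = \<zero>\<^bsub>V\<^esub>}"
      using additive_neg[OF VW.V.R.abelian_group_axioms VW.V.M.abelian_group_axioms add, of s] s by simp
    show "s \<oplus>\<^bsub>S\<^esub> r \<in> {s \<in> carrier S. s \<odot>\<^bsub>V\<^esub> u = \<zero>\<^bsub>V\<^esub>}" if "r \<in> {s \<in> carrier S. s \<odot>\<^bsub>V\<^esub> u = \<zero>\<^bsub>V\<^esub>}" for r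
      using that s u by (simp add: Vm)
  qed auto
  then have "\<one>\<^bsub>S\<^esub> \<in> {s \<in> carrier S. s \<odot>\<^bsub>V\<^esub> u = \<zero>\<^bsub>V\<^esub>}"
    by (rule VW.pairing_generates) (use kill p(1) in auto)
  then show ?thesis using VW.V.smult_one[OF u] by simp
qed

lemma right_mult_faithful:
  assumes z: "z \<in> carrier S" and 0: "\<And>v. v \<in> carrier V \<Longrightarrow> v \<triangleleft>\<^bsub>V\<^esub> z = \<zero>\<^bsub>V\<^esub>"
  shows "z = \<zero>\<^bsub>S\<^esub>"
proof -
  note p = WV.pairing_closed
  have kill: "WV.pairing w v \<otimes>\<^bsub>S\<^esub> z = \<zero>\<^bsub>S\<^esub>" if w: "w \<in> carrier W" and v: "v \<in> carrier V" for w v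
  proof -
    have "additive V S (WV.pairing w)" using WV.pairing_balanced w by (simp add: balanced_def)
    then have "WV.pairing w \<zero>\<^bsub>V\<^esub> = \<zero>\<^bsub>S\<^esub>"
      by (rule additive_zero[OF VW.V.M.abelian_group_axioms VW.V.R.abelian_group_axioms])
    then show ?thesis using WV.pairing_rsmult[OF z w v] 0[OF v] by simp
  qed
  have "subgroup {s \<in> carrier S. s \<otimes>\<^bsub>S\<^esub> z = \<zero>\<^bsub>S\<^esub>} (add_monoid S)"
  proof (rule VW.V.R.add.subgroupI)
    show "{s \<in> carrier S. s \<otimes>\<^bsub>S\<^esub> z = \<zero>\<^bsub>S\<^esub>} \<noteq> {}"
      using VW.V.R.l_null[OF z] VW.V.R.zero_closed by blast
    fix s assume s: "s \<in> {s \<in> carrier S. s \<otimes>\<^bsub>S\<^esub> z = \<zero>\<^bsub>S\<^esub>}"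
    show "\<ominus>\<^bsub>S\<^esub> s \<in> {s \<in> carrier S. s \<otimes>\<^bsub>S\<^esub> z = \<zero>\<^bsub>S\<^esub>}"
      using s z by (simp add: VW.V.R.l_minus)
    show "s \<oplus>\<^bsub>S\<^esub> r \<in> {s \<in> carrier S. s \<otimes>\<^bsub>S\<^esub> z = \<zero>\<^bsub>S\<^esub>}" if "r \<in> {s \<in> carrier S. s \<otimes>\<^bsub>S\<^esub> z = \<zero>\<^bsub>S\<^esub>}" for r
      using that s z by (simp add: VW.V.R.l_distr)
  qed auto
  then have "\<one>\<^bsub>S\<^esub> \<in> {s \<in> carrier S. s \<otimes>\<^bsub>S\<^esub> z = \<zero>\<^bsub>S\<^esub>}"
    by (rule WV.pairing_generates) (use kill p in auto)
  then show ?thesis using z by simp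
qed

text \<open>
  The endomorphism \<open>W \<otimes> e\<close> of \<open>W \<otimes> V \<cong> S\<close> is left linear, hence right multiplication by its value
  \<open>z\<close> at \<open>1\<close>. So \<open>e\<close> and right multiplication by \<open>z\<close> become equal after tensoring with \<open>W\<close>, and
  by cancellation they are equal.
\<close>

lemma left_linear_endomorphism:
  assumes e: "additive V V e"
    and lin: "\<And>s v. s \<in> carrier S \<Longrightarrow> v \<in> carrier V \<Longrightarrow> e (s \<odot>\<^bsub>V\<^esub> v) = s \<odot>\<^bsub>V\<^esub> e v"
  obtains z where "z \<in> carrier S" "\<And>v. v \<in> carrier V \<Longrightarrow> e v = v \<triangleleft>\<^bsub>V\<^esub> z"
proof -
  note eD = additive_onD[OF e]
  note p = balancedD[OF WV.pairing_balanced]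
  note S_group = VW.V.R.abelian_group_axioms and V_group = VW.V.M.abelian_group_axioms
  have "balanced S W V S (\<lambda>w v. WV.pairing w (e v))"
    by (rule balancedI) (simp_all add: eD p lin)
  then obtain h where h: "additive S S h"
    "\<And>w v. w \<in> carrier W \<Longrightarrow> v \<in> carrier V \<Longrightarrow> h (WV.pairing w v) = WV.pairing w (e v)"
    by (rule WV.pairing_universal[OF S_group]) blast
  note hD = additive_onD[OF h(1)]
  have h_lin: "h (s \<otimes>\<^bsub>S\<^esub> t) = s \<otimes>\<^bsub>S\<^esub> h t" if s: "s \<in> carrier S" and t: "t \<in> carrier S" for s t
  proof -
    have l: "additive S S (\<lambda>t. h (s \<otimes>\<^bsub>S\<^esub> t))" "additive S S (\<lambda>t. s \<otimes>\<^bsub>S\<^esub> h t)"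
      using s hD by (auto simp: additive_on_def VW.V.R.r_distr)
    have "subgroup {t \<in> carrier S. h (s \<otimes>\<^bsub>S\<^esub> t) = s \<otimes>\<^bsub>S\<^esub> h t} (add_monoid S)"
    proof (rule VW.V.R.add.subgroupI)
      show "{t \<in> carrier S. h (s \<otimes>\<^bsub>S\<^esub> t) = s \<otimes>\<^bsub>S\<^esub> h t} \<noteq> {}"
        using additive_zero[OF S_group S_group l(1)] additive_zero[OF S_group S_group l(2)]
          VW.V.R.zero_closed by force
      fix t assume t: "t \<in> {t \<in> carrier S. h (s \<otimes>\<^bsub>S\<^esub> t) = s \<otimes>\<^bsub>S\<^esub> h t}"
      show "\<ominus>\<^bsub>S\<^esub> t \<in> {t \<in> carrier S. h (s \<otimes>\<^bsub>S\<^esub> t) = s \<otimes>\<^bsub>S\<^esub> h t}"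
        using additive_neg[OF S_group S_group l(1), of t] additive_neg[OF S_group S_group l(2), of t] t by simp
      show "t \<oplus>\<^bsub>S\<^esub> r \<in> {t \<in> carrier S. h (s \<otimes>\<^bsub>S\<^esub> t) = s \<otimes>\<^bsub>S\<^esub> h t}"
        if "r \<in> {t \<in> carrier S. h (s \<otimes>\<^bsub>S\<^esub> t) = s \<otimes>\<^bsub>S\<^esub> h t}" for r
        using additive_onD(2)[OF l(1), of t r] additive_onD(2)[OF l(2), of t r] t that by simp
    qed auto
    then have "t \<in> {t \<in> carrier S. h (s \<otimes>\<^bsub>S\<^esub> t) = s \<otimes>\<^bsub>S\<^esub> h t}"
    proof (rule WV.pairing_generates[OF _ _ t])
      fix w v assume w: "w \<in> carrier W" and v: "v \<in> carrier V"
      have "h (s \<otimes>\<^bsub>S\<^esub> WV.pairing w v) = h (WV.pairing (s \<odot>\<^bsub>W\<^esub> w) v)"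
        using WV.pairing_smult[OF s w v] by simp
      also have "\<dots> = WV.pairing (s \<odot>\<^bsub>W\<^esub> w) (e v)"
        by (rule h(2)[OF VW.W.smult_closed[OF s w] v])
      also have "\<dots> = s \<otimes>\<^bsub>S\<^esub> h (WV.pairing w v)"
        using WV.pairing_smult[OF s w eD(1)[OF v]] h(2)[OF w v] by simp
      finally show "WV.pairing w v \<in> {t \<in> carrier S. h (s \<otimes>\<^bsub>S\<^esub> t) = s \<otimes>\<^bsub>S\<^esub> h t}"
        using p(1)[OF w v] by simp
    qed
    then show ?thesis by simp
  qed
  define z where "z = h \<one>\<^bsub>S\<^esub>"
  have z: "z \<in> carrier S" using hD(1) by (simp add: z_def)
  show ?thesis
  proof (rule that[OF z])
    fix v assume v: "v \<in> carrier V"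
    have vz: "v \<triangleleft>\<^bsub>V\<^esub> z \<in> carrier V" using v z by (rule VW.V.rsmult_closed)
    have "e v \<ominus>\<^bsub>V\<^esub> v \<triangleleft>\<^bsub>V\<^esub> z = \<zero>\<^bsub>V\<^esub>"
    proof (rule pairing_cancel)
      show "e v \<ominus>\<^bsub>V\<^esub> v \<triangleleft>\<^bsub>V\<^esub> z \<in> carrier V" using eD(1)[OF v] vz by simp
      fix w assume w: "w \<in> carrier W"
      have add: "additive V S (WV.pairing w)" using WV.pairing_balanced w by (simp add: balanced_def)
      have "WV.pairing w (e v) = h (WV.pairing w v \<otimes>\<^bsub>S\<^esub> \<one>\<^bsub>S\<^esub>)" using h(2)[OF w v] p(1)[OF w v] by simp
      also have "\<dots> = WV.pairing w (v \<triangleleft>\<^bsub>V\<^esub> z)"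
        using h_lin[OF p(1)[OF w v] VW.V.R.one_closed] WV.pairing_rsmult[OF z w v] by (simp add: z_def)
      finally show "WV.pairing w (e v \<ominus>\<^bsub>V\<^esub> v \<triangleleft>\<^bsub>V\<^esub> z) = \<zero>\<^bsub>S\<^esub>"
        using additive_minus[OF V_group S_group add eD(1)[OF v] vz] p(1)[OF w vz]
        by (simp add: a_minus_def VW.V.R.r_neg)
    qed
    then show "e v = v \<triangleleft>\<^bsub>V\<^esub> z" using VW.V.M.minus_eq_zero_iff[OF eD(1)[OF v] vz] by simp
  qed
qed

end

lemma invertible_bimodule_mutually_inverse:
  fixes V :: "('s, 's, 'v) bimodule"
  assumes "invertible_bimodule S V"
  obtains W :: "('s, 's, 'v) bimodule" and \<alpha> \<beta> where "mutually_inverse S V W \<alpha> \<beta>"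
proof -
  from assms obtain W :: "('s, 's, 'v) bimodule" where W: "bimodule S S V" "bimodule S S W"
    "bimodule_isomorphic S S (tensor S V W) (regular_bimodule S)"
    "bimodule_isomorphic S S (tensor S W V) (regular_bimodule S)"
    unfolding invertible_bimodule_def by blast
  obtain \<alpha> where "tensor_iso S V W \<alpha>" using tensor_iso_of_isomorphic[OF W(1,2,3)] ..
  moreover obtain \<beta> where "tensor_iso S W V \<beta>" using tensor_iso_of_isomorphic[OF W(2,1,4)] ..
  ultimately show ?thesis using that by (simp add: mutually_inverse_def)
qed

text \<open>
  The twists below leave the underlying groups of \<open>V\<close>, \<open>W\<close> and of the tensor products untouched;
  \<open>S'\<close> is \<open>S\<close> up to the values of its product outside of the carrier.
\<close>

definition twist_right :: "('s \<Rightarrow> 's) \<Rightarrow> ('r, 's, 'v) bimodule \<Rightarrow> ('r, 's, 'v) bimodule"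
  where "twist_right \<rho> V = V\<lparr>rsmult := \<lambda>v s. v \<triangleleft>\<^bsub>V\<^esub> \<rho> s\<rparr>"

lemma bimodule_twist:
  assumes V: "bimodule S S V" and S': "ring S'"
    and same: "carrier S' = carrier S" "ring.add S' = ring.add S" "\<one>\<^bsub>S'\<^esub> = \<one>\<^bsub>S\<^esub>"
      "\<And>x y. x \<in> carrier S \<Longrightarrow> y \<in> carrier S \<Longrightarrow> x \<otimes>\<^bsub>S'\<^esub> y = x \<otimes>\<^bsub>S\<^esub> y"
    and f: "f \<in> ring_hom S S" and \<rho>: "\<rho> \<in> ring_hom S S"
  shows "bimodule S' S' (V\<lparr>smult := \<lambda>s. smult V (f s), rsmult := \<lambda>v s. v \<triangleleft>\<^bsub>V\<^esub> \<rho> s\<rparr>)"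
proof -
  interpret V: bimodule S S V by fact
  interpret S': ring S' by fact
  define V' where "V' = V\<lparr>smult := \<lambda>s. smult V (f s), rsmult := \<lambda>v s. v \<triangleleft>\<^bsub>V\<^esub> \<rho> s\<rparr>"
  have V': "carrier V' = carrier V" "ring.add V' = ring.add V" "\<zero>\<^bsub>V'\<^esub> = \<zero>\<^bsub>V\<^esub>"
    "s \<odot>\<^bsub>V'\<^esub> v = f s \<odot>\<^bsub>V\<^esub> v" "v \<triangleleft>\<^bsub>V'\<^esub> s = v \<triangleleft>\<^bsub>V\<^esub> \<rho> s" for s v
    by (simp_all add: V'_def)
  note l = ring_hom_closed[OF f] ring_hom_add[OF f] ring_hom_mult[OF f] ring_hom_one[OF f]
  note r = ring_hom_closed[OF \<rho>] ring_hom_add[OF \<rho>] ring_hom_mult[OF \<rho>] ring_hom_one[OF \<rho>]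
  have "abelian_group V'" by (rule same_group_abelian[OF V'(1-3) V.M.abelian_group_axioms])
  then have "bimodule S' S' V'"
    by (intro bimodule.intro left_module.intro left_module_axioms.intro bimodule_axioms.intro S')
      (simp_all add: V' same l r V.smult_closed V.smult_l_distr V.smult_r_distr V.smult_assoc V.smult_one
        V.rsmult_closed V.rsmult_l_distr V.rsmult_r_distr V.rsmult_assoc V.rsmult_one V.smult_rsmult)
  then show ?thesis by (simp add: V'_def)
qed

text \<open>
  The inverse is \<open>W\<close> with left action along \<open>\<rho>\<close>. As \<open>\<rho>\<close> is onto, \<open>V \<otimes> W\<close> has the same relations as
  before. On \<open>W \<otimes> V\<close> both outer actions are now along \<open>\<rho>\<close>, which \<open>\<rho>\<inverse>\<close> turns into the regular bimodule.
\<close>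

lemma invertible_bimodule_twist_right:
  fixes S S' :: "'s ring" and V :: "('s, 's, 'v) bimodule"
  assumes inv: "invertible_bimodule S V" and S': "ring S'"
    and same: "carrier S' = carrier S" "ring.add S' = ring.add S" "\<one>\<^bsub>S'\<^esub> = \<one>\<^bsub>S\<^esub>"
      "\<And>x y. x \<in> carrier S \<Longrightarrow> y \<in> carrier S \<Longrightarrow> x \<otimes>\<^bsub>S'\<^esub> y = x \<otimes>\<^bsub>S\<^esub> y"
    and \<rho>: "\<rho> \<in> ring_hom S S" and bij: "bij_betw \<rho> (carrier S) (carrier S)"
  shows "invertible_bimodule S' (twist_right \<rho> V)"
proof -
  obtain W :: "('s, 's, 'v) bimodule" where V: "bimodule S S V" and W: "bimodule S S W"
    and \<alpha>: "bimodule_isomorphic S S (tensor S V W) (regular_bimodule S)"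
    and \<beta>: "bimodule_isomorphic S S (tensor S W V) (regular_bimodule S)"
    using inv unfolding invertible_bimodule_def by blast
  interpret S: ring S using V by (simp add: bimodule_def left_module_def)
  define W' where "W' = W\<lparr>smult := \<lambda>s. smult W (\<rho> s)\<rparr>"
  define V' where "V' = twist_right \<rho> V"
  have id: "(\<lambda>s. s) \<in> ring_hom S S" by (auto simp: ring_hom_def)
  have V'_bi: "bimodule S' S' V'"
    using bimodule_twist[OF V S' same id \<rho>] by (simp add: V'_def twist_right_def)
  have W'_bi: "bimodule S' S' W'"
    using bimodule_twist[OF W S' same \<rho> id] by (simp add: W'_def)
  have \<rho>S: "carrier S = \<rho> ` carrier S" using bij by (simp add: bij_betw_def)
  have \<rho>c: "\<rho> s \<in> carrier S" if "s \<in> carrier S" for s using \<rho>S that by blast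
  have mid: "{frag_of (v \<triangleleft>\<^bsub>V\<^esub> \<rho> s, w) - frag_of (v, \<rho> s \<odot>\<^bsub>W\<^esub> w) | v s w.
        v \<in> carrier V \<and> s \<in> carrier S \<and> w \<in> carrier W} =
      {frag_of (v \<triangleleft>\<^bsub>V\<^esub> s, w) - frag_of (v, s \<odot>\<^bsub>W\<^esub> w) | v s w.
        v \<in> carrier V \<and> s \<in> carrier S \<and> w \<in> carrier W}" (is "?L = ?R")
  proof
    show "?L \<subseteq> ?R" using \<rho>c by blast
    show "?R \<subseteq> ?L"
    proof
      fix x assume "x \<in> ?R"
      then obtain v s w where x: "x = frag_of (v \<triangleleft>\<^bsub>V\<^esub> s, w) - frag_of (v, s \<odot>\<^bsub>W\<^esub> w)"
        and c: "v \<in> carrier V" "s \<in> carrier S" "w \<in> carrier W" by blast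
      obtain r where "r \<in> carrier S" "s = \<rho> r" using \<rho>S c(2) by blast
      then show "x \<in> ?L" using x c by blast
    qed
  qed
  have rels: "tensor_rels S' V' W' = tensor_rels S V W"
    using mid by (simp add: tensor_rels_def V'_def twist_right_def W'_def same)
  have ten: "tensor S' V' W' = tensor S V W"
    unfolding tensor_def rels by (simp add: V'_def twist_right_def W'_def)
  have rels': "tensor_rels S' W' V' = tensor_rels S W V"
    by (simp add: tensor_rels_def V'_def twist_right_def W'_def same)
  have ten': "carrier (tensor S' W' V') = carrier (tensor S W V)"
    "ring.add (tensor S' W' V') = ring.add (tensor S W V)"
    "s \<odot>\<^bsub>tensor S' W' V'\<^esub> x = \<rho> s \<odot>\<^bsub>tensor S W V\<^esub> x" "x \<triangleleft>\<^bsub>tensor S' W' V'\<^esub> s = x \<triangleleft>\<^bsub>tensor S W V\<^esub> \<rho> s" for s x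
    unfolding tensor_def rels' by (simp_all add: V'_def twist_right_def W'_def Let_def)
  have \<alpha>': "bimodule_isomorphic S' S' (tensor S' V' W') (regular_bimodule S')"
  proof -
    obtain \<theta> where \<theta>: "tensor_iso S V W \<theta>" using tensor_iso_of_isomorphic[OF V W \<alpha>] ..
    interpret \<theta>: tensor_iso S V W \<theta> by (rule \<theta>)
    have \<theta>c: "\<theta> x \<in> carrier S" if "x \<in> carrier (tensor S V W)" for x
      using \<theta>.bij that by (auto simp: bij_betw_def)
    show ?thesis
      unfolding bimodule_isomorphic_def ten
      by (intro exI[of _ \<theta>])
        (simp add: regular_bimodule_def same \<theta>.bij \<theta>.\<theta>_add \<theta>.\<theta>_smult \<theta>.\<theta>_rsmult \<theta>c)
  qed
  have \<beta>': "bimodule_isomorphic S' S' (tensor S' W' V') (regular_bimodule S')"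
  proof -
    obtain \<theta> where \<theta>: "tensor_iso S W V \<theta>" using tensor_iso_of_isomorphic[OF W V \<beta>] ..
    interpret \<theta>: tensor_iso S W V \<theta> by (rule \<theta>)
    have \<theta>c: "\<theta> x \<in> carrier S" if "x \<in> carrier (tensor S W V)" for x
      using \<theta>.bij that by (auto simp: bij_betw_def)
    define i where "i = inv_into (carrier S) \<rho>"
    have i: "i s \<in> carrier S" "\<rho> (i s) = s" if "s \<in> carrier S" for s
      using that \<rho>S by (auto simp: i_def inv_into_into f_inv_into_f)
    have i_eq: "i s = r" if "r \<in> carrier S" "\<rho> r = s" for r s
      using that bij by (auto simp: i_def bij_betw_def)
    have i_bij: "bij_betw i (carrier S) (carrier S)" unfolding i_def using bij by (rule bij_betw_inv_into)
    note r = ring_hom_add[OF \<rho>] ring_hom_mult[OF \<rho>]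
    have i_add: "i (x \<oplus>\<^bsub>S\<^esub> y) = i x \<oplus>\<^bsub>S\<^esub> i y" if "x \<in> carrier S" "y \<in> carrier S" for x y
      using that by (intro i_eq) (simp_all add: r i)
    have i_l: "i (\<rho> s \<otimes>\<^bsub>S\<^esub> x) = s \<otimes>\<^bsub>S\<^esub> i x" "i (x \<otimes>\<^bsub>S\<^esub> \<rho> s) = i x \<otimes>\<^bsub>S\<^esub> s"
      if "s \<in> carrier S" "x \<in> carrier S" for s x
      using that by (auto intro!: i_eq simp: r i)
    have "bij_betw (\<lambda>x. i (\<theta> x)) (carrier (tensor S W V)) (carrier S)"
      using bij_betw_trans[OF \<theta>.bij i_bij] by (simp add: comp_def)
    then show ?thesis
      unfolding bimodule_isomorphic_def ten'
      by (intro exI[of _ "\<lambda>x. i (\<theta> x)"])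
        (simp add: regular_bimodule_def same \<theta>.\<theta>_add \<theta>.\<theta>_smult \<theta>.\<theta>_rsmult \<theta>c \<rho>c i i_add i_l)
  qed
  show ?thesis
    using V'_bi W'_bi \<alpha>' \<beta>' unfolding invertible_bimodule_def V'_def[symmetric] by blast
qed

section \<open>Operators on the homogeneous components of a map\<close>

context graded_k_algebra
begin

text \<open>
  On a homogeneous element \<open>x\<close> of degree \<open>n\<close>, the part of \<open>f x\<close> in degree \<open>m\<close> is the value at \<open>x\<close> of the
  component of \<open>f\<close> of degree \<open>m - n\<close>. So \<open>compwise P w f\<close> is \<open>\<Sum>\<^sub>k w\<^sub>k \<circ> f\<^sub>k\<close>, where \<open>f = \<Sum>\<^sub>k f\<^sub>k\<close> is the
  pointwise finite decomposition of \<open>f\<close> into maps of degree \<open>k\<close>.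
\<close>

definition shifted :: "(int \<Rightarrow> 'a \<Rightarrow> 'a) \<Rightarrow> int \<Rightarrow> 'a \<Rightarrow> 'a"
  where "shifted w n = glue A (grade A) A (\<lambda>m. w (int m - n))"

definition compwise :: "('a, 'm) graded_module \<Rightarrow> (int \<Rightarrow> 'a \<Rightarrow> 'a) \<Rightarrow> ('m \<Rightarrow> 'a) \<Rightarrow> 'm \<Rightarrow> 'a"
  where "compwise P w f = restrict (glue P (homog P) A (\<lambda>n x. shifted w n (f x))) (carrier P)"

lemma additive_restrict_grade: "additive A A u \<Longrightarrow> additive_on (grade A m) A A u"
  by (rule additive_on_subset[OF _ grade_subset])

lemma shifted_grade:
  assumes "\<And>k. additive A A (w k)" "y \<in> grade A m" shows "shifted w n y = w (int m - n) y"
  unfolding shifted_def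
  by (rule glue_grade[OF A.abelian_group_axioms _ assms(2)]) (intro additive_restrict_grade assms(1))

lemma shifted_additive:
  assumes "\<And>k. additive A A (w k)" shows "additive A A (shifted w n)"
  unfolding shifted_def
  by (rule glue_additive[OF A.abelian_group_axioms]) (intro additive_restrict_grade assms(1))

end

locale compwise_module = graded_k_algebra K A + P: graded_group P "homog P"
  for K :: "'k ring" and A :: "('k, 'a) graded_algebra" (structure)
    and P :: "('a, 'm) graded_module"
begin

lemma compwise_extensional: "compwise P w f \<in> extensional (carrier P)"
  by (simp add: compwise_def)

lemma compwise_family:
  assumes "\<And>k. additive A A (w k)" "additive P A f"
  shows "additive_on (homog P n) P A (\<lambda>x. shifted w n (f x))"
  by (rule additive_on_subset[OF additive_comp[OF assms(2) shifted_additive[OF assms(1)]]])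
    (auto intro: P.grade_carrier)

lemma compwise_homog:
  assumes "\<And>k. additive A A (w k)" "additive P A f" "x \<in> homog P n"
  shows "compwise P w f x = shifted w n (f x)"
  using P.glue_grade[OF A.abelian_group_axioms compwise_family[OF assms(1,2)] assms(3)] P.grade_carrier[OF assms(3)]
  by (simp add: compwise_def)

lemma compwise_additive:
  assumes "\<And>k. additive A A (w k)" "additive P A f"
  shows "additive P A (compwise P w f)"
  using P.glue_additive[OF A.abelian_group_axioms compwise_family[OF assms(1,2)]]
  by (simp add: compwise_def additive_on_def)

lemma extensional_eqI:
  assumes "additive P A f" "additive P A g" "f \<in> extensional (carrier P)" "g \<in> extensional (carrier P)"
    "\<And>n x. x \<in> homog P n \<Longrightarrow> f x = g x"
  shows "f = g"
  by (rule extensionalityI[OF assms(3,4)], rule P.additive_eqI[OF assms(1,2)]) (use assms(5) in auto)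

lemma compwise_eqI:
  assumes w: "\<And>k. additive A A (w k)" and f: "additive P A f"
    and g: "additive P A g" "g \<in> extensional (carrier P)"
    and eq: "\<And>n x y. x \<in> homog P n \<Longrightarrow> f x = y \<Longrightarrow> y \<in> carrier A \<Longrightarrow> shifted w n y = g x"
  shows "compwise P w f = g"
  by (rule extensional_eqI[OF compwise_additive[OF w f] g(1) compwise_extensional g(2)])
    (use compwise_homog[OF w f] eq additive_onD(1)[OF f] P.grade_carrier in simp)

text \<open>
  If \<open>w'\<close> raises degrees by \<open>p\<close>, the component of degree \<open>k\<close> becomes one of degree \<open>k + p\<close> before \<open>w\<close> is applied.
\<close>

lemma compwise_compwise:
  assumes w: "\<And>k. additive A A (w k)" and w': "\<And>k. additive A A (w' k)" and f: "additive P A f"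
    and gr: "\<And>k m y. y \<in> grade A m \<Longrightarrow> w' k y \<in> grade A (m + p)"
  shows "compwise P w (compwise P w' f) = compwise P (\<lambda>k y. w (k + int p) (w' k y)) f"
proof (rule compwise_eqI[OF w compwise_additive[OF w' f] compwise_additive[OF _ f] compwise_extensional])
  show ww: "additive A A (\<lambda>y. w (k + int p) (w' k y))" for k
    by (rule additive_comp[OF w' w])
  fix n x y assume x: "x \<in> homog P n" and y: "compwise P w' f x = y"
  have xc: "x \<in> carrier P" using x by (rule P.grade_carrier)
  have "shifted w n (shifted w' n z) = shifted (\<lambda>k y. w (k + int p) (w' k y)) n z"
    if z: "z \<in> carrier A" for z
  proof (rule additive_eqI[OF additive_comp[OF shifted_additive[OF w'] shifted_additive[OF w]]
        shifted_additive[OF ww] _ z])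
    fix m z assume z: "z \<in> grade A m"
    have "shifted w n (shifted w' n z) = w (int (m + p) - n) (w' (int m - n) z)"
      unfolding shifted_grade[of w', OF w' z] by (rule shifted_grade[of w, OF w gr[OF z]])
    also have "int (m + p) - n = int m - n + int p" by simp
    finally show "shifted w n (shifted w' n z) = shifted (\<lambda>k y. w (k + int p) (w' k y)) n z"
      using shifted_grade[of "\<lambda>k y. w (k + int p) (w' k y)", OF ww z, of n] by simp
  qed
  then show "shifted w n y = compwise P (\<lambda>k y. w (k + int p) (w' k y)) f x"
    unfolding y[symmetric] compwise_homog[OF w' f x] compwise_homog[of "\<lambda>k y. w (k + int p) (w' k y)", OF ww f x]
    using additive_onD(1)[OF f xc] by blast
qed

lemma compwise_const:
  assumes u: "additive A A u" and f: "additive P A f"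
  shows "compwise P (\<lambda>_. u) f = restrict (\<lambda>x. u (f x)) (carrier P)"
proof (rule compwise_eqI[of "\<lambda>_. u", OF u f])
  show "additive P A (restrict (\<lambda>x. u (f x)) (carrier P))"
    using additive_comp[OF f u] by (simp add: additive_on_def)
  fix n x y assume x: "x \<in> homog P n" and y: "f x = y" "y \<in> carrier A"
  have "shifted (\<lambda>_. u) n y = u y"
    by (rule additive_eqI[OF shifted_additive u _ y(2)]) (simp_all add: u shifted_grade)
  then show "shifted (\<lambda>_. u) n y = restrict (\<lambda>x. u (f x)) (carrier P) x"
    using y P.grade_carrier[OF x] by simp
qed simp

lemma compwise_cong:
  assumes w: "\<And>k. additive A A (w k)" and w': "\<And>k. additive A A (w' k)" and f: "additive P A f"
    and eq: "\<And>k y. y \<in> carrier A \<Longrightarrow> w k y = w' k y"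
  shows "compwise P w f = compwise P w' f"
proof (rule compwise_eqI[OF w f compwise_additive[OF w' f] compwise_extensional])
  fix n x y assume x: "x \<in> homog P n" and y: "f x = y" "y \<in> carrier A"
  have "shifted w n y = shifted w' n y"
    by (rule additive_eqI[OF shifted_additive[OF w] shifted_additive[OF w'] _ y(2)])
      (simp add: shifted_grade[of w, OF w] shifted_grade[of w', OF w'] eq grade_carrier)
  then show "shifted w n y = compwise P w' f x" using compwise_homog[OF w' f x] y by simp
qed

lemma compwise_add_family:
  assumes w: "\<And>k. additive A A (w k)" and w': "\<And>k. additive A A (w' k)" and f: "additive P A f"
  shows "compwise P (\<lambda>k y. w k y \<oplus> w' k y) f = restrict (\<lambda>x. compwise P w f x \<oplus> compwise P w' f x) (carrier P)"
proof (rule compwise_eqI[OF _ f])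
  have plus: "additive Q A (\<lambda>y. u y \<oplus> v y)" if "additive Q A u" "additive Q A v"
    for u v and Q :: "('q, 'z) ring_scheme"
    using additive_onD[OF that(1)] additive_onD[OF that(2)] by (auto simp: additive_on_def A.a_ac)
  show ww: "additive A A (\<lambda>y. w k y \<oplus> w' k y)" for k by (rule plus[OF w w'])
  show "additive P A (restrict (\<lambda>x. compwise P w f x \<oplus> compwise P w' f x) (carrier P))"
    using plus[OF compwise_additive[OF w f] compwise_additive[OF w' f]] by (simp add: additive_on_def)
  fix n x y assume x: "x \<in> homog P n" and y: "f x = y" "y \<in> carrier A"
  have "shifted (\<lambda>k y. w k y \<oplus> w' k y) n y = shifted w n y \<oplus> shifted w' n y"
  proof (rule additive_eqI[OF shifted_additive[of "\<lambda>k y. w k y \<oplus> w' k y", OF ww]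
        plus[OF shifted_additive[OF w] shifted_additive[OF w']] _ y(2)])
    fix m z assume z: "z \<in> grade A m"
    show "shifted (\<lambda>k y. w k y \<oplus> w' k y) n z = shifted w n z \<oplus> shifted w' n z"
      using shifted_grade[of "\<lambda>k y. w k y \<oplus> w' k y", OF ww z, of n]
        shifted_grade[of w, OF w z, of n] shifted_grade[of w', OF w' z, of n] by simp
  qed
  then show "shifted (\<lambda>k y. w k y \<oplus> w' k y) n y =
      restrict (\<lambda>x. compwise P w f x \<oplus> compwise P w' f x) (carrier P) x"
    using y P.grade_carrier[OF x] compwise_homog[OF w f x] compwise_homog[OF w' f x] by simp
qed simp

lemma compwise_add:
  assumes w: "\<And>k. additive A A (w k)" and f: "additive P A f" and g: "additive P A g"
    and fg: "additive P A (restrict (\<lambda>x. f x \<oplus> g x) (carrier P))"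
  shows "compwise P w (restrict (\<lambda>x. f x \<oplus> g x) (carrier P)) =
    restrict (\<lambda>x. compwise P w f x \<oplus> compwise P w g x) (carrier P)"
proof (rule compwise_eqI[OF w fg])
  show "additive P A (restrict (\<lambda>x. compwise P w f x \<oplus> compwise P w g x) (carrier P))"
    using additive_onD[OF compwise_additive[OF w f]] additive_onD[OF compwise_additive[OF w g]]
    by (auto simp: additive_on_def A.a_ac)
  fix n x y assume x: "x \<in> homog P n" and y: "restrict (\<lambda>x. f x \<oplus> g x) (carrier P) x = y"
  have xc: "x \<in> carrier P" using x by (rule P.grade_carrier)
  show "shifted w n y = restrict (\<lambda>x. compwise P w f x \<oplus> compwise P w g x) (carrier P) x"
    using xc additive_onD(2)[OF shifted_additive[OF w] additive_onD(1)[OF f xc] additive_onD(1)[OF g xc]]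
    by (simp add: y[symmetric] compwise_homog[OF w f x] compwise_homog[OF w g x])
qed simp

lemma compwise_pullback:
  assumes Q: "graded_group Q (homog Q)" and \<phi>: "additive P Q \<phi>"
    and gr: "\<And>n x. x \<in> homog P n \<Longrightarrow> \<phi> x \<in> homog Q n"
    and w: "\<And>k. additive A A (w k)" and f: "additive Q A f"
  shows "compwise P w (compose (carrier P) f \<phi>) = compose (carrier P) (compwise Q w f) \<phi>"
proof -
  interpret Q: compwise_module K A Q using Q by (simp add: compwise_module_def graded_k_algebra_axioms)
  have c: "additive P A (compose (carrier P) u \<phi>)" if "additive Q A u" for u
    using additive_comp[OF \<phi> that] by (simp add: additive_on_def compose_def)
  show ?thesis
  proof (rule compwise_eqI[OF w c[OF f] c[OF Q.compwise_additive[OF w f]]])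
    fix n x y assume x: "x \<in> homog P n" and y: "compose (carrier P) f \<phi> x = y"
    show "shifted w n y = compose (carrier P) (compwise Q w f) \<phi> x"
      using P.grade_carrier[OF x] Q.compwise_homog[OF w f gr[OF x]] y by (simp add: compose_def)
  qed (simp add: compose_def)
qed

lemma compwise_linear:
  assumes P: "graded_left_module A P" and f: "f \<in> linear_maps A P (regular_module A)"
    and w: "\<And>k. additive A A (w k)"
    and lin: "\<And>k a y. a \<in> carrier A \<Longrightarrow> y \<in> carrier A \<Longrightarrow> w k (a \<otimes> y) = a \<otimes> w k y"
  shows "compwise P w f \<in> linear_maps A P (regular_module A)"
proof -
  interpret PM: left_module A P using P by (rule graded_left_moduleD)
  have f: "additive P A f" "\<And>a x. a \<in> carrier A \<Longrightarrow> x \<in> carrier P \<Longrightarrow> f (a \<odot>\<^bsub>P\<^esub> x) = a \<otimes> f x"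
    using linear_mapsD[OF f] by (auto simp: regular_module_def additive_on_def)
  note d = compwise_additive[OF w f(1)]
  have "compwise P w f (a \<odot>\<^bsub>P\<^esub> x) = a \<otimes> compwise P w f x" if a: "a \<in> carrier A" and x: "x \<in> carrier P" for a x
  proof -
    have a_add: "additive A P (\<lambda>a. a \<odot>\<^bsub>P\<^esub> x)" if "x \<in> carrier P" for x
      using that by (auto simp: additive_on_def PM.smult_closed PM.smult_l_distr)
    have x_add: "additive P P (\<lambda>x. a \<odot>\<^bsub>P\<^esub> x)" if "a \<in> carrier A" for a
      using that by (auto simp: additive_on_def PM.smult_closed PM.smult_r_distr)
    show ?thesis
    proof (rule P.additive_eqI[OF additive_comp[OF x_add[OF a] d] additive_comp[OF d additive_mult_left[OF a]] _ x])
      fix n x assume x: "x \<in> homog P n"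
      have xc: "x \<in> carrier P" using x by (rule P.grade_carrier)
      note dx = additive_onD(1)[OF d xc] and fx = additive_onD(1)[OF f(1) xc]
      show "compwise P w f (a \<odot>\<^bsub>P\<^esub> x) = a \<otimes> compwise P w f x"
      proof (rule additive_eqI[OF additive_comp[OF a_add[OF xc] d] additive_mult_right[OF dx] _ a])
        fix l a assume a: "a \<in> grade A l"
        have ac: "a \<in> carrier A" using a by (rule grade_carrier)
        have ax: "a \<odot>\<^bsub>P\<^esub> x \<in> homog P (int l + n)" by (rule graded_left_moduleD(4)[OF P a x])
        have "shifted w (int l + n) (a \<otimes> y) = a \<otimes> shifted w n y" if "y \<in> carrier A" for y
        proof (rule additive_eqI[OF additive_comp[OF additive_mult_left[OF ac] shifted_additive[OF w]]
              additive_comp[OF shifted_additive[OF w] additive_mult_left[OF ac]] _ that])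
          fix m y assume y: "y \<in> grade A m"
          show "shifted w (int l + n) (a \<otimes> y) = a \<otimes> shifted w n y"
            using shifted_grade[of w, OF w mult_grade[OF a y], of "int l + n"] shifted_grade[of w, OF w y, of n]
              lin[OF ac grade_carrier[OF y]] by simp
        qed
        then show "compwise P w f (a \<odot>\<^bsub>P\<^esub> x) = a \<otimes> compwise P w f x"
          using compwise_homog[OF w f(1) ax] compwise_homog[OF w f(1) x] f(2)[OF ac xc] fx by simp
      qed
    qed
  qed
  then show ?thesis
    using additive_onD[OF d] by (intro linear_mapsI) (simp_all add: regular_module_def)
qed

end

section \<open>The bimodule Ext\<close>

context graded_k_algebra
begin

lemma hom_group_carrier:
  "f \<in> carrier (hom_group A P) \<longleftrightarrow> f \<in> extensional (carrier P) \<and> additive P A f \<and>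
    (\<forall>a\<in>carrier A. \<forall>x\<in>carrier P. f (a \<odot>\<^bsub>P\<^esub> x) = a \<otimes> f x)"
  by (auto simp: hom_group_def linear_maps_def additive_on_def regular_module_def)

lemma hom_group_simps:
  "f \<oplus>\<^bsub>hom_group A P\<^esub> g = restrict (\<lambda>x. f x \<oplus> g x) (carrier P)"
  "\<zero>\<^bsub>hom_group A P\<^esub> = restrict (\<lambda>x. \<zero>) (carrier P)"
  by (simp_all add: hom_group_def)

lemma hom_group_linear: "f \<in> carrier (hom_group A P) \<Longrightarrow> f \<in> linear_maps A P (regular_module A)"
  by (simp add: hom_group_def)

lemma hom_group_abelian:
  assumes "left_module A P" shows "abelian_group (hom_group A P)"
proof -
  interpret P: left_module A P by fact
  have closed: "f x \<in> carrier A" if "f \<in> carrier (hom_group A P)" "x \<in> carrier P" for f x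
    using that by (simp add: hom_group_carrier additive_on_def)
  note simps = hom_group_simps hom_group_carrier additive_on_def P.smult_closed
  show ?thesis
  proof (rule abelian_groupI)
    fix f g h assume f: "f \<in> carrier (hom_group A P)" and g: "g \<in> carrier (hom_group A P)"
    show "f \<oplus>\<^bsub>hom_group A P\<^esub> g \<in> carrier (hom_group A P)"
      using f g by (simp add: simps A.a_ac A.r_distr)
    show "f \<oplus>\<^bsub>hom_group A P\<^esub> g = g \<oplus>\<^bsub>hom_group A P\<^esub> f"
      unfolding hom_group_simps by (rule restrict_ext) (simp add: A.a_comm closed f g)
    assume h: "h \<in> carrier (hom_group A P)"
    show "(f \<oplus>\<^bsub>hom_group A P\<^esub> g) \<oplus>\<^bsub>hom_group A P\<^esub> h = f \<oplus>\<^bsub>hom_group A P\<^esub> (g \<oplus>\<^bsub>hom_group A P\<^esub> h)"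
      unfolding hom_group_simps by (rule restrict_ext) (simp add: A.a_assoc closed f g h)
  next
    show "\<zero>\<^bsub>hom_group A P\<^esub> \<in> carrier (hom_group A P)" by (simp add: simps)
    fix f assume f: "f \<in> carrier (hom_group A P)"
    then have fe: "f \<in> extensional (carrier P)" by (simp add: hom_group_carrier)
    show "\<zero>\<^bsub>hom_group A P\<^esub> \<oplus>\<^bsub>hom_group A P\<^esub> f = f"
      unfolding hom_group_simps
      by (rule extensionalityI[OF _ fe]) (simp_all add: closed f)
    let ?g = "restrict (\<lambda>x. \<ominus> f x) (carrier P)"
    have "?g \<in> carrier (hom_group A P)"
      using f by (simp add: simps A.minus_add A.a_ac A.r_minus)
    moreover have "?g \<oplus>\<^bsub>hom_group A P\<^esub> f = \<zero>\<^bsub>hom_group A P\<^esub>"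
      unfolding hom_group_simps by (rule restrict_ext) (simp add: A.l_neg closed f)
    ultimately show "\<exists>g\<in>carrier (hom_group A P). g \<oplus>\<^bsub>hom_group A P\<^esub> f = \<zero>\<^bsub>hom_group A P\<^esub>" by blast
  qed
qed

lemma hom_group_compose:
  assumes P: "left_module A P" and f: "f \<in> carrier (hom_group A Q)" and \<phi>: "\<phi> \<in> graded_maps A P Q"
  shows "compose (carrier P) f \<phi> \<in> carrier (hom_group A P)"
proof -
  interpret P: left_module A P by fact
  show ?thesis
    using f graded_mapsD(1-3)[OF \<phi>]
    by (simp add: hom_group_carrier compose_def additive_on_def P.smult_closed)
qed

end

locale top_resolution = graded_k_algebra K A
  for K :: "'k ring" and A :: "('k, 'a) graded_algebra" (structure) +
  fixes P :: "nat \<Rightarrow> ('a, 'm) graded_module" and \<delta> :: "nat \<Rightarrow> 'm \<Rightarrow> 'm" and \<epsilon> :: "'m \<Rightarrow> 'a set"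
  assumes projective_resolution: "graded_projective_resolution A (top_module A) P \<delta> \<epsilon>"
begin

abbreviation H where "H i \<equiv> hom_group A (P i)"
abbreviation Z where "Z i \<equiv> cocycles A P \<delta> i"
abbreviation Bd where "Bd i \<equiv> coboundaries A P \<delta> i"

lemma resolution: "graded_resolution A (top_module A) P \<delta> \<epsilon>"
  and projective: "graded_projective A (P i)"
  using projective_resolution graded_projective_resolution_iff[OF top_module_graded] by blast+

lemmas resD = graded_resolutionD[OF resolution]
lemmas P_modD = graded_left_moduleD[OF resD(2)]

sublocale Pd: compwise_module K A "P i" for i
  using P_modD(2) by (simp add: compwise_module_def graded_k_algebra_axioms)

sublocale H: abelian_group "H i" for i
  by (rule hom_group_abelian[OF P_modD(1)])

lemma H_additive: "f \<in> carrier (H i) \<Longrightarrow> additive (P i) A f"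
  by (simp add: hom_group_carrier)

lemma H_closed: "f \<in> carrier (H i) \<Longrightarrow> x \<in> carrier (P i) \<Longrightarrow> f x \<in> carrier A"
  using additive_onD(1)[OF H_additive] .

lemma H_minus:
  assumes f: "f \<in> carrier (H i)" and g: "g \<in> carrier (H i)"
  shows "f \<ominus>\<^bsub>H i\<^esub> g = restrict (\<lambda>x. f x \<ominus> g x) (carrier (P i))"
proof -
  define h where "h = f \<ominus>\<^bsub>H i\<^esub> g"
  have h: "h \<in> carrier (H i)" using f g by (simp add: h_def)
  have hg: "h \<oplus>\<^bsub>H i\<^esub> g = f" using f g by (simp add: h_def a_minus_def H.a_assoc H.l_neg)
  have "h = restrict (\<lambda>x. f x \<ominus> g x) (carrier (P i))"
  proof (rule extensionalityI)
    show "h \<in> extensional (carrier (P i))" using h by (simp add: hom_group_carrier)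
    fix x assume x: "x \<in> carrier (P i)"
    have "f x = h x \<oplus> g x" using x by (simp add: hg[symmetric] hom_group_simps)
    then show "h x = restrict (\<lambda>x. f x \<ominus> g x) (carrier (P i)) x"
      using H_closed[OF h x] H_closed[OF g x] x by (simp add: a_minus_def A.a_assoc A.r_neg)
  qed simp
  then show ?thesis by (simp add: h_def)
qed

abbreviation pull :: "nat \<Rightarrow> ('m \<Rightarrow> 'a) \<Rightarrow> ('m \<Rightarrow> 'm) \<Rightarrow> 'm \<Rightarrow> 'a" where "pull i \<equiv> compose (carrier (P i))"

lemma pull_closed: "f \<in> carrier (H j) \<Longrightarrow> \<phi> \<in> graded_maps A (P i) (P j) \<Longrightarrow> pull i f \<phi> \<in> carrier (H i)"
  by (rule hom_group_compose[OF P_modD(1)])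

lemma pull_add:
  assumes "\<phi> \<in> graded_maps A (P i) (P j)"
  shows "pull i (f \<oplus>\<^bsub>H j\<^esub> g) \<phi> = pull i f \<phi> \<oplus>\<^bsub>H i\<^esub> pull i g \<phi>"
  unfolding hom_group_simps compose_def
  by (rule restrict_ext) (simp add: graded_mapsD(1)[OF assms])

lemma Z_iff: "f \<in> Z i \<longleftrightarrow> f \<in> carrier (H i) \<and> pull (Suc i) f (\<delta> i) = \<zero>\<^bsub>H (Suc i)\<^esub>"
  by (auto simp: cocycles_def hom_group_simps compose_def restrict_def fun_eq_iff)

lemma Z_H: "f \<in> Z i \<Longrightarrow> f \<in> carrier (H i)"
  by (simp add: Z_iff)

lemma pull_additive: "\<phi> \<in> graded_maps A (P i) (P j) \<Longrightarrow> additive (H j) (H i) (\<lambda>f. pull i f \<phi>)"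
  by (simp add: additive_on_def pull_closed pull_add)

lemma pull_zero: "\<phi> \<in> graded_maps A (P i) (P j) \<Longrightarrow> pull i \<zero>\<^bsub>H j\<^esub> \<phi> = \<zero>\<^bsub>H i\<^esub>"
  by (rule additive_zero[OF H.abelian_group_axioms H.abelian_group_axioms pull_additive])

lemma Z_subgroup: "subgroup (Z i) (add_monoid (H i))"
proof (rule H.add.subgroupI)
  note pa = pull_additive[OF resD(4)]
  show "Z i \<subseteq> carrier (H i)" using Z_H by blast
  have "\<zero>\<^bsub>H i\<^esub> \<in> Z i" by (simp add: Z_iff pull_zero[OF resD(4)])
  then show "Z i \<noteq> {}" by blast
  fix f assume f: "f \<in> Z i"
  show "\<ominus>\<^bsub>H i\<^esub> f \<in> Z i"
    using f additive_neg[OF H.abelian_group_axioms H.abelian_group_axioms pa, of f i] by (simp add: Z_iff)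
  show "f \<oplus>\<^bsub>H i\<^esub> g \<in> Z i" if "g \<in> Z i" for g
    using f that by (simp add: Z_iff pull_add[OF resD(4)])
qed

lemma Z_add: "f \<in> Z i \<Longrightarrow> g \<in> Z i \<Longrightarrow> f \<oplus>\<^bsub>H i\<^esub> g \<in> Z i"
  using subgroup.m_closed[OF Z_subgroup] by simp

lemma Z_minus: "f \<in> Z i \<Longrightarrow> g \<in> Z i \<Longrightarrow> f \<ominus>\<^bsub>H i\<^esub> g \<in> Z i"
  using subgroup.m_closed[OF Z_subgroup _ subgroup.m_inv_closed[OF Z_subgroup]] by (simp add: a_minus_def a_inv_def)

lemma Bd_SucI: "g \<in> carrier (H i) \<Longrightarrow> pull (Suc i) g (\<delta> i) \<in> Bd (Suc i)"
  by auto

lemma Bd_SucE: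
  assumes "f \<in> Bd (Suc i)" obtains g where "g \<in> carrier (H i)" "f = pull (Suc i) g (\<delta> i)"
  using assms by auto

lemma Bd_Z: "Bd i \<subseteq> Z i"
proof
  fix f assume f: "f \<in> Bd i"
  show "f \<in> Z i"
  proof (cases i)
    case 0
    then show ?thesis using f pull_zero[OF resD(4)] by (simp add: Z_iff)
  next
    case (Suc j)
    obtain g where g: "g \<in> carrier (H j)" "f = pull (Suc j) g (\<delta> j)" using f Suc by (auto elim: Bd_SucE)
    have "g \<zero>\<^bsub>P j\<^esub> = \<zero>"
      using additive_zero[OF P_modD(3) A.abelian_group_axioms H_additive[OF g(1)]] .
    then have "pull (Suc (Suc j)) f (\<delta> (Suc j)) = \<zero>\<^bsub>H (Suc (Suc j))\<^esub>"
      using resD(9) graded_mapsD(1)[OF resD(4)]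
      unfolding hom_group_simps compose_def by (intro restrict_ext) (simp add: g(2) compose_def)
    then show ?thesis using g pull_closed[OF g(1) resD(4)] Suc by (simp add: Z_iff)
  qed
qed

lemma Bd_subgroup: "subgroup (Bd i) (add_monoid (H i))"
proof (cases i)
  case 0
  then show ?thesis using H.add.triv_subgroup[of 0] by simp
next
  case (Suc j)
  note pa = pull_additive[OF resD(4), of j]
  show ?thesis unfolding Suc
  proof (rule H.add.subgroupI)
    show "Bd (Suc j) \<subseteq> carrier (H (Suc j))" using Bd_Z Z_H by blast
    show "Bd (Suc j) \<noteq> {}" using Bd_SucI[OF H.zero_closed] by blast
    fix f assume "f \<in> Bd (Suc j)"
    then obtain g where g: "g \<in> carrier (H j)" "f = pull (Suc j) g (\<delta> j)" by (rule Bd_SucE)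
    have "\<ominus>\<^bsub>H (Suc j)\<^esub> f = pull (Suc j) (\<ominus>\<^bsub>H j\<^esub> g) (\<delta> j)"
      using additive_neg[OF H.abelian_group_axioms H.abelian_group_axioms pa g(1)] g(2) by simp
    then show "\<ominus>\<^bsub>H (Suc j)\<^esub> f \<in> Bd (Suc j)" using Bd_SucI[of "\<ominus>\<^bsub>H j\<^esub> g" j] g(1) by simp
    fix f' assume "f' \<in> Bd (Suc j)"
    then obtain g' where g': "g' \<in> carrier (H j)" "f' = pull (Suc j) g' (\<delta> j)" by (rule Bd_SucE)
    show "f \<oplus>\<^bsub>H (Suc j)\<^esub> f' \<in> Bd (Suc j)"
      using Bd_SucI[of "g \<oplus>\<^bsub>H j\<^esub> g'" j] g g' by (simp add: pull_add[OF resD(4)])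
  qed
qed

lemma Bd_H: "f \<in> Bd i \<Longrightarrow> f \<in> carrier (H i)"
  using Bd_Z Z_H by blast

sublocale Bd: abelian_subgroup "Bd i" "H i" for i
  by (rule abelian_subgroupI3[OF additive_subgroup.intro[OF Bd_subgroup] H.abelian_group_axioms])

abbreviation cls where "cls i f \<equiv> Bd i +>\<^bsub>H i\<^esub> f"

lemma cls_mem: "f' \<in> cls i f \<longleftrightarrow> (\<exists>b\<in>Bd i. f' = b \<oplus>\<^bsub>H i\<^esub> f)"
  by (auto simp: a_r_coset_def r_coset_def)

lemma cls_eq: "f \<in> carrier (H i) \<Longrightarrow> b \<in> Bd i \<Longrightarrow> cls i (b \<oplus>\<^bsub>H i\<^esub> f) = cls i f"
  using H.a_repr_independence[OF _ _ Bd_subgroup, of "b \<oplus>\<^bsub>H i\<^esub> f" i f] cls_mem by blast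

lemma cls_eqI: "f \<in> carrier (H i) \<Longrightarrow> g \<in> carrier (H i) \<Longrightarrow> f \<ominus>\<^bsub>H i\<^esub> g \<in> Bd i \<Longrightarrow> cls i f = cls i g"
  using cls_eq[of g i "f \<ominus>\<^bsub>H i\<^esub> g"] by (simp add: a_minus_def H.a_assoc H.l_neg)

lemma cls_zero: "f \<in> carrier (H i) \<Longrightarrow> cls i f = Bd i \<longleftrightarrow> f \<in> Bd i"
  using Bd.a_rcos_self[of f i] Bd.a_rcos_const[of f i] by blast

lemma cls_self: "f \<in> carrier (H i) \<Longrightarrow> f \<in> cls i f"
  by (rule Bd.a_rcos_self)

lemma Ext_simps:
  "carrier (Ext_top A P \<delta> \<epsilon> i) = {cls i f | f. f \<in> Z i}"
  "\<zero>\<^bsub>Ext_top A P \<delta> \<epsilon> i\<^esub> = Bd i"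
  "f \<in> Z i \<Longrightarrow> g \<in> Z i \<Longrightarrow> cls i f \<oplus>\<^bsub>Ext_top A P \<delta> \<epsilon> i\<^esub> cls i g = cls i (f \<oplus>\<^bsub>H i\<^esub> g)"
  using Bd.a_rcos_sum[of f i g] Z_H by (simp_all add: Ext_top_def Let_def)

lemma Ext_vanishes_iff:
  "carrier (Ext_top A P \<delta> \<epsilon> i) = {\<zero>\<^bsub>Ext_top A P \<delta> \<epsilon> i\<^esub>} \<longleftrightarrow> Z i \<subseteq> Bd i"
proof -
  have z: "\<zero>\<^bsub>H i\<^esub> \<in> Z i" using subgroup.one_closed[OF Z_subgroup] by simp
  have "\<zero>\<^bsub>H i\<^esub> \<in> Bd i" using subgroup.one_closed[OF Bd_subgroup] by simp
  then have Bd: "Bd i = cls i \<zero>\<^bsub>H i\<^esub>" using cls_zero[OF H.zero_closed] by simp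
  have cls: "cls i f = Bd i \<longleftrightarrow> f \<in> Bd i" if "f \<in> Z i" for f by (rule cls_zero[OF Z_H[OF that]])
  show ?thesis
  proof
    assume eq: "carrier (Ext_top A P \<delta> \<epsilon> i) = {\<zero>\<^bsub>Ext_top A P \<delta> \<epsilon> i\<^esub>}"
    show "Z i \<subseteq> Bd i"
    proof
      fix f assume f: "f \<in> Z i"
      then have "cls i f \<in> carrier (Ext_top A P \<delta> \<epsilon> i)" unfolding Ext_simps by blast
      then have "cls i f = Bd i" unfolding eq by (simp add: Ext_simps(2))
      then show "f \<in> Bd i" using cls[OF f] by simp
    qed
  next
    assume sub: "Z i \<subseteq> Bd i"
    have "cls i f = Bd i" if "f \<in> Z i" for f using cls[OF that] sub that by blast
    then show "carrier (Ext_top A P \<delta> \<epsilon> i) = {\<zero>\<^bsub>Ext_top A P \<delta> \<epsilon> i\<^esub>}"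
      unfolding Ext_simps using z by auto
  qed
qed

end

context top_resolution
begin

definition right_mult :: "nat \<Rightarrow> 'a \<Rightarrow> ('m \<Rightarrow> 'a) \<Rightarrow> 'm \<Rightarrow> 'a"
  where "right_mult i a f = restrict (\<lambda>x. f x \<otimes> a) (carrier (P i))"

lemma cocycle_iff:
  "f \<in> Z i \<longleftrightarrow> f \<in> carrier (H i) \<and> (\<forall>x\<in>carrier (P (Suc i)). f (\<delta> i x) = \<zero>)"
  by (simp add: cocycles_def)

lemma right_mult_H: "a \<in> carrier A \<Longrightarrow> f \<in> carrier (H i) \<Longrightarrow> right_mult i a f \<in> carrier (H i)"
proof -
  interpret Pi: left_module A "P i" by (rule P_modD)
  show "a \<in> carrier A \<Longrightarrow> f \<in> carrier (H i) \<Longrightarrow> right_mult i a f \<in> carrier (H i)"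
    by (simp add: hom_group_carrier right_mult_def additive_on_def A.l_distr A.m_assoc Pi.smult_closed)
qed

lemma right_mult_pull:
  "\<phi> \<in> graded_maps A (P i) (P j) \<Longrightarrow> right_mult i a (pull i f \<phi>) = pull i (right_mult j a f) \<phi>"
  unfolding right_mult_def compose_def by (rule restrict_ext) (simp add: graded_mapsD(1))

lemma right_mult_add:
  "a \<in> carrier A \<Longrightarrow> f \<in> carrier (H i) \<Longrightarrow> g \<in> carrier (H i) \<Longrightarrow>
    right_mult i a (f \<oplus>\<^bsub>H i\<^esub> g) = right_mult i a f \<oplus>\<^bsub>H i\<^esub> right_mult i a g"
  unfolding right_mult_def hom_group_simps by (rule restrict_ext) (simp add: A.l_distr H_closed)

lemma right_mult_Z: "a \<in> carrier A \<Longrightarrow> f \<in> Z i \<Longrightarrow> right_mult i a f \<in> Z i"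
  using right_mult_H[of a f i] graded_mapsD(1)[OF resD(4)] by (simp add: cocycle_iff right_mult_def)

lemma zero_function_Bd:
  assumes "f \<in> carrier (H i)" "\<And>x. x \<in> carrier (P i) \<Longrightarrow> f x = \<zero>" shows "f \<in> Bd i"
proof -
  have "f = \<zero>\<^bsub>H i\<^esub>"
    unfolding hom_group_simps
    by (rule extensionalityI[of f "carrier (P i)"]) (use assms in \<open>simp_all add: hom_group_carrier\<close>)
  then show ?thesis using subgroup.one_closed[OF Bd_subgroup] by simp
qed

lemma right_mult_Bd:
  assumes a: "a \<in> carrier A" and f: "f \<in> Bd i" shows "right_mult i a f \<in> Bd i"
proof (cases i)
  case 0
  then have "f = \<zero>\<^bsub>H 0\<^esub>" using f by simp
  then show ?thesis
    using 0 a right_mult_H[OF a H.zero_closed, of 0]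
    by (intro zero_function_Bd) (simp_all add: right_mult_def hom_group_simps)
next
  case (Suc j)
  obtain g where g: "g \<in> carrier (H j)" "f = pull (Suc j) g (\<delta> j)" using f Suc by (auto elim: Bd_SucE)
  then show ?thesis
    using Bd_SucI[OF right_mult_H[OF a g(1)]] right_mult_pull[OF resD(4), of j a g] Suc by simp
qed

lemma is_liftD:
  assumes "is_lift A P \<delta> \<epsilon> \<rho> \<phi>"
  shows "\<phi> i \<in> graded_maps A (P i) (P i)"
    "x \<in> carrier (P 0) \<Longrightarrow> \<epsilon> (\<phi> 0 x) = \<rho> (\<epsilon> x)"
    "x \<in> carrier (P (Suc i)) \<Longrightarrow> \<delta> i (\<phi> (Suc i) x) = \<phi> i (\<delta> i x)"
  using assms by (simp_all add: is_lift_def)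

lemma pull_lift_Z:
  assumes \<phi>: "is_lift A P \<delta> \<epsilon> \<rho> \<phi>" and f: "f \<in> Z i" shows "pull i f (\<phi> i) \<in> Z i"
  using pull_closed[OF Z_H[OF f] is_liftD(1)[OF \<phi>]] f is_liftD(3)[OF \<phi>, of _ i]
    graded_mapsD(1)[OF resD(4), of _ i] graded_mapsD(1)[OF is_liftD(1)[OF \<phi>], of _ "Suc i"]
  by (simp add: cocycle_iff compose_def) metis

lemma pull_lift_Bd:
  assumes \<phi>: "is_lift A P \<delta> \<epsilon> \<rho> \<phi>" and f: "f \<in> Bd i" shows "pull i f (\<phi> i) \<in> Bd i"
proof (cases i)
  case 0
  then have "f = \<zero>\<^bsub>H 0\<^esub>" using f by simp
  then show ?thesis using 0 pull_zero[OF is_liftD(1)[OF \<phi>], of 0] by simp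
next
  case (Suc j)
  obtain g where g: "g \<in> carrier (H j)" "f = pull (Suc j) g (\<delta> j)" using f Suc by (auto elim: Bd_SucE)
  have "pull (Suc j) f (\<phi> (Suc j)) = pull (Suc j) (pull j g (\<phi> j)) (\<delta> j)"
    unfolding g(2) compose_def
    by (rule restrict_ext)
      (simp add: graded_mapsD(1)[OF resD(4)] graded_mapsD(1)[OF is_liftD(1)[OF \<phi>]] is_liftD(3)[OF \<phi>])
  then show ?thesis using Bd_SucI[OF pull_closed[OF g(1) is_liftD(1)[OF \<phi>]]] Suc by simp
qed

text \<open>
  The difference of the two lifts is a chain map over 0, hence null-homotopic.
\<close>

lemma lift_unique:
  assumes \<phi>: "is_lift A P \<delta> \<epsilon> \<rho> \<phi>" and \<phi>': "is_lift A P \<delta> \<epsilon> \<rho> \<phi>'" and f: "f \<in> Z i"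
  shows "pull i f (\<phi> i) \<ominus>\<^bsub>H i\<^esub> pull i f (\<phi>' i) \<in> Bd i"
proof -
  note l = is_liftD[OF \<phi>] and l' = is_liftD[OF \<phi>']
  note lc = graded_mapsD(1)[OF l(1)] and l'c = graded_mapsD(1)[OF l'(1)]
  define \<chi> where "\<chi> i x = \<phi> i x \<ominus>\<^bsub>P i\<^esub> \<phi>' i x" for i x
  have \<chi>: "\<chi> i \<in> graded_maps A (P i) (P i)" for i
    unfolding \<chi>_def[abs_def] by (rule graded_maps_minus[OF resD(2) l(1) l'(1)])
  interpret T: abelian_group "top_module A" by (rule top_module_group)
  have \<chi>0: "\<epsilon> (\<chi> 0 x) = \<zero>\<^bsub>top_module A\<^esub>" if x: "x \<in> carrier (P 0)" for x
    using graded_maps_minus_arg[OF resD(2) top_module_graded resD(3) lc[OF x] l'c[OF x]]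
      l(2)[OF x] l'(2)[OF x] graded_mapsD(1)[OF resD(3) lc[OF x]]
    unfolding \<chi>_def a_minus_def by (simp only: T.r_neg)
  have \<chi>Suc: "\<delta> i (\<chi> (Suc i) x) = \<chi> i (\<delta> i x)" if x: "x \<in> carrier (P (Suc i))" for i x
    using graded_maps_minus_arg[OF resD(2) resD(2) resD(4) lc[OF x] l'c[OF x]] l(3)[OF x] l'(3)[OF x]
    by (simp add: \<chi>_def)
  obtain s where s: "\<And>i. s i \<in> graded_maps A (P i) (P (Suc i))"
    "\<And>x. x \<in> carrier (P 0) \<Longrightarrow> \<chi> 0 x = \<delta> 0 (s 0 x)"
    "\<And>i x. x \<in> carrier (P (Suc i)) \<Longrightarrow>
      \<chi> (Suc i) x = \<delta> (Suc i) (s (Suc i) x) \<oplus>\<^bsub>P (Suc i)\<^esub> s i (\<delta> i x)"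
    by (rule chain_map_null_homotopic[where A = A and P = P and Q = P and M = "top_module A"
          and N = "top_module A" and \<delta> = \<delta> and \<epsilon> = \<epsilon> and \<gamma> = \<delta> and \<eta> = \<epsilon> and \<chi> = \<chi>,
          OF grade_subset resolution projective resolution \<chi> \<chi>0 \<chi>Suc]) blast+
  note sc = graded_mapsD(1)[OF s(1)]
  note fH = Z_H[OF f]
  have pH: "pull i f (\<phi> i) \<in> carrier (H i)" using pull_closed[of f i "\<phi> i" i] fH l(1)[of i] by simp
  have p'H: "pull i f (\<phi>' i) \<in> carrier (H i)" using pull_closed[of f i "\<phi>' i" i] fH l'(1)[of i] by simp
  have diff: "(pull i f (\<phi> i) \<ominus>\<^bsub>H i\<^esub> pull i f (\<phi>' i)) x = f (\<chi> i x)" if x: "x \<in> carrier (P i)" for x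
    using fun_cong[OF H_minus[OF pH p'H], of x]
      additive_minus[of "P i" A f "\<phi> i x" "\<phi>' i x"] P_modD(3)[of i] A.abelian_group_axioms
      H_additive[OF fH] lc[OF x] l'c[OF x] x
    by (simp add: compose_eq \<chi>_def)
  have dH: "pull i f (\<phi> i) \<ominus>\<^bsub>H i\<^esub> pull i f (\<phi>' i) \<in> carrier (H i)"
    using pH p'H by simp
  have f0: "f (\<delta> i x) = \<zero>" if "x \<in> carrier (P (Suc i))" for x using f that by (simp add: cocycle_iff)
  show ?thesis
  proof (cases i)
    case 0
    show ?thesis
      by (rule zero_function_Bd[OF dH]) (use diff s(2) f0 sc 0 in simp)
  next
    case (Suc j)
    have "pull i f (\<phi> i) \<ominus>\<^bsub>H i\<^esub> pull i f (\<phi>' i) = pull (Suc j) (pull j f (s j)) (\<delta> j)"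
    proof (rule extensionalityI)
      show "pull i f (\<phi> i) \<ominus>\<^bsub>H i\<^esub> pull i f (\<phi>' i) \<in> extensional (carrier (P i))"
        using dH by (simp add: hom_group_carrier)
      show "pull (Suc j) (pull j f (s j)) (\<delta> j) \<in> extensional (carrier (P i))"
        unfolding Suc by (rule compose_extensional)
      fix x assume x: "x \<in> carrier (P i)"
      then have x': "x \<in> carrier (P (Suc j))" using Suc by simp
      have dx: "\<delta> j x \<in> carrier (P j)" using graded_mapsD(1)[OF resD(4) x'] .
      have "f (\<chi> i x) = f (\<delta> i (s i x)) \<oplus> f (s j (\<delta> j x))"
        using s(3)[OF x'] additive_onD(2)[OF H_additive[OF fH]]
          graded_mapsD(1)[OF resD(4) sc[OF x]] sc[OF dx] Suc by simp
      then show "(pull i f (\<phi> i) \<ominus>\<^bsub>H i\<^esub> pull i f (\<phi>' i)) x = pull (Suc j) (pull j f (s j)) (\<delta> j) x"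
        using diff[OF x] f0[OF sc[OF x]] x' dx H_closed[OF fH, of "s j (\<delta> j x)"] sc[OF dx] Suc
        by (simp add: compose_def)
    qed
    moreover have "pull j f (s j) \<in> carrier (H j)" using pull_closed[of f "Suc j" "s j" j] fH s(1) Suc by simp
    ultimately show ?thesis using Bd_SucI[of "pull j f (s j)" j] Suc by simp
  qed
qed

lemma lift_exists:
  assumes "s \<in> carrier (top_ring A)"
  shows "\<exists>\<phi>. is_lift A P \<delta> \<epsilon> (\<lambda>x. x \<otimes>\<^bsub>top_ring A\<^esub> s) \<phi>"
proof -
  obtain \<phi> where "\<And>i. \<phi> i \<in> graded_maps A (P i) (P i)"
    "\<And>x. x \<in> carrier (P 0) \<Longrightarrow> \<epsilon> (\<phi> 0 x) = \<epsilon> x \<otimes>\<^bsub>top_ring A\<^esub> s"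
    "\<And>i x. x \<in> carrier (P (Suc i)) \<Longrightarrow> \<delta> i (\<phi> (Suc i) x) = \<phi> i (\<delta> i x)"
    by (rule comparison_exists[where A = A and P = P and Q = P and M = "top_module A"
          and N = "top_module A" and \<delta> = \<delta> and \<epsilon> = \<epsilon> and \<gamma> = \<delta> and \<eta> = \<epsilon>,
          OF grade_subset resolution projective resolution
          graded_maps_top_module_right_mult[OF assms]]) blast
  then have "is_lift A P \<delta> \<epsilon> (\<lambda>x. x \<otimes>\<^bsub>top_ring A\<^esub> s) \<phi>" by (simp add: is_lift_def)
  then show ?thesis by (rule exI[of _ \<phi>])
qed

lemma Ext_smult:
  assumes f: "f \<in> Z i" and \<phi>: "is_lift A P \<delta> \<epsilon> (\<lambda>x. x \<otimes>\<^bsub>top_ring A\<^esub> s) \<phi>"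
  shows "s \<odot>\<^bsub>Ext_top A P \<delta> \<epsilon> i\<^esub> cls i f = cls i (pull i f (\<phi> i))"
proof -
  have eq: "cls i (pull i f' (\<phi>' i)) = cls i (pull i f (\<phi> i))"
    if f': "f' \<in> cls i f" and \<phi>': "is_lift A P \<delta> \<epsilon> (\<lambda>x. x \<otimes>\<^bsub>top_ring A\<^esub> s) \<phi>'" for f' \<phi>'
  proof -
    obtain b where b: "b \<in> Bd i" "f' = b \<oplus>\<^bsub>H i\<^esub> f" using f' cls_mem by blast
    have "pull i f' (\<phi>' i) = pull i b (\<phi>' i) \<oplus>\<^bsub>H i\<^esub> pull i f (\<phi>' i)"
      unfolding b(2) by (rule pull_add[OF is_liftD(1)[OF \<phi>']])
    then have "cls i (pull i f' (\<phi>' i)) = cls i (pull i f (\<phi>' i))"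
      using cls_eq[OF Z_H[OF pull_lift_Z[OF \<phi>' f]] pull_lift_Bd[OF \<phi>' b(1)]] by simp
    also have "\<dots> = cls i (pull i f (\<phi> i))"
      by (rule cls_eqI[OF Z_H[OF pull_lift_Z[OF \<phi>' f]] Z_H[OF pull_lift_Z[OF \<phi> f]] lift_unique[OF \<phi>' \<phi> f]])
    finally show ?thesis .
  qed
  have "s \<odot>\<^bsub>Ext_top A P \<delta> \<epsilon> i\<^esub> cls i f = \<Union>{cls i (pull i f' (\<phi>' i)) | f' \<phi>'.
      f' \<in> cls i f \<and> is_lift A P \<delta> \<epsilon> (\<lambda>x. x \<otimes>\<^bsub>top_ring A\<^esub> s) \<phi>'}"
    by (simp add: Ext_top_def Let_def)
  also have "{cls i (pull i f' (\<phi>' i)) | f' \<phi>'.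
      f' \<in> cls i f \<and> is_lift A P \<delta> \<epsilon> (\<lambda>x. x \<otimes>\<^bsub>top_ring A\<^esub> s) \<phi>'} = {cls i (pull i f (\<phi> i))}"
    (is "?X = _")
  proof
    show "?X \<subseteq> {cls i (pull i f (\<phi> i))}"
    proof
      fix C assume "C \<in> ?X"
      then obtain f' \<phi>' where "C = cls i (pull i f' (\<phi>' i))" "f' \<in> cls i f"
        "is_lift A P \<delta> \<epsilon> (\<lambda>x. x \<otimes>\<^bsub>top_ring A\<^esub> s) \<phi>'" by (elim CollectE exE conjE)
      then show "C \<in> {cls i (pull i f (\<phi> i))}" using eq[of f' \<phi>'] by simp
    qed
    show "{cls i (pull i f (\<phi> i))} \<subseteq> ?X" using cls_self[OF Z_H[OF f]] \<phi> by blast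
  qed
  finally show ?thesis by simp
qed

lemma Ext_rsmult:
  assumes f: "f \<in> Z i" and a: "a \<in> carrier A"
  shows "cls i f \<triangleleft>\<^bsub>Ext_top A P \<delta> \<epsilon> i\<^esub> a = cls i (right_mult i a f)"
proof -
  have eq: "cls i (right_mult i a f') = cls i (right_mult i a f)" if f': "f' \<in> cls i f" for f'
  proof -
    obtain b where b: "b \<in> Bd i" "f' = b \<oplus>\<^bsub>H i\<^esub> f" using f' cls_mem by blast
    have "right_mult i a f' = right_mult i a b \<oplus>\<^bsub>H i\<^esub> right_mult i a f"
      unfolding b(2) by (rule right_mult_add[OF a Bd_H[OF b(1)] Z_H[OF f]])
    then show ?thesis
      using cls_eq[OF right_mult_H[OF a Z_H[OF f]] right_mult_Bd[OF a b(1)]] by simp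
  qed
  have "cls i f \<triangleleft>\<^bsub>Ext_top A P \<delta> \<epsilon> i\<^esub> a = \<Union>((\<lambda>f'. cls i (right_mult i a f')) ` cls i f)"
    by (simp add: Ext_top_def Let_def right_mult_def Setcompr_eq_image)
  also have "(\<lambda>f'. cls i (right_mult i a f')) ` cls i f = {cls i (right_mult i a f)}"
  proof
    show "(\<lambda>f'. cls i (right_mult i a f')) ` cls i f \<subseteq> {cls i (right_mult i a f)}"
      using eq by (auto simp only: image_subset_iff singleton_iff)
    show "{cls i (right_mult i a f)} \<subseteq> (\<lambda>f'. cls i (right_mult i a f')) ` cls i f"
      using cls_self[OF Z_H[OF f]] by blast
  qed
  finally show ?thesis by simp
qed

text \<open>
  A map on cocycles that induces an isomorphism of \<open>Ext\<^sup>i\<close> with \<open>V\<close>. Working with it instead of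
  with cosets keeps all constructions below at the level of cochains.
\<close>

definition presents :: "nat \<Rightarrow> ('a set, 'a set, 'v) bimodule \<Rightarrow> (('m \<Rightarrow> 'a) \<Rightarrow> 'v) \<Rightarrow> bool"
  where "presents i V q \<longleftrightarrow>
    q ` Z i = carrier V \<and>
    (\<forall>f\<in>Z i. \<forall>g\<in>Z i. q (f \<oplus>\<^bsub>H i\<^esub> g) = q f \<oplus>\<^bsub>V\<^esub> q g) \<and>
    (\<forall>f\<in>Z i. q f = \<zero>\<^bsub>V\<^esub> \<longleftrightarrow> f \<in> Bd i) \<and>
    (\<forall>f\<in>Z i. \<forall>a\<in>carrier A. q (right_mult i a f) = q f \<triangleleft>\<^bsub>V\<^esub> to_top A a) \<and>
    (\<forall>f\<in>Z i. \<forall>s\<in>carrier (top_ring A). \<forall>\<phi>. is_lift A P \<delta> \<epsilon> (\<lambda>x. x \<otimes>\<^bsub>top_ring A\<^esub> s) \<phi> \<longrightarrow>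
      q (pull i f (\<phi> i)) = s \<odot>\<^bsub>V\<^esub> q f)"

lemma presentsD:
  assumes "presents i V q"
  shows "f \<in> Z i \<Longrightarrow> q f \<in> carrier V" "v \<in> carrier V \<Longrightarrow> \<exists>f\<in>Z i. q f = v"
    "f \<in> Z i \<Longrightarrow> g \<in> Z i \<Longrightarrow> q (f \<oplus>\<^bsub>H i\<^esub> g) = q f \<oplus>\<^bsub>V\<^esub> q g"
    "f \<in> Z i \<Longrightarrow> q f = \<zero>\<^bsub>V\<^esub> \<longleftrightarrow> f \<in> Bd i"
    "f \<in> Z i \<Longrightarrow> a \<in> carrier A \<Longrightarrow> q (right_mult i a f) = q f \<triangleleft>\<^bsub>V\<^esub> to_top A a"
    "f \<in> Z i \<Longrightarrow> s \<in> carrier (top_ring A) \<Longrightarrow> is_lift A P \<delta> \<epsilon> (\<lambda>x. x \<otimes>\<^bsub>top_ring A\<^esub> s) \<phi> \<Longrightarrow>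
      q (pull i f (\<phi> i)) = s \<odot>\<^bsub>V\<^esub> q f"
proof -
  note c1 = assms[unfolded presents_def, THEN conjunct1]
  note r1 = assms[unfolded presents_def, THEN conjunct2]
  show "q f \<in> carrier V" if "f \<in> Z i" using imageI[OF that, of q] c1 by simp
  show "\<exists>f\<in>Z i. q f = v" if "v \<in> carrier V" using that unfolding c1[symmetric] by fast
  show "q (f \<oplus>\<^bsub>H i\<^esub> g) = q f \<oplus>\<^bsub>V\<^esub> q g" if "f \<in> Z i" "g \<in> Z i"
    using r1[THEN conjunct1, rule_format, OF that] .
  note r2 = r1[THEN conjunct2]
  show "q f = \<zero>\<^bsub>V\<^esub> \<longleftrightarrow> f \<in> Bd i" if "f \<in> Z i" using r2[THEN conjunct1, rule_format, OF that] .
  note r3 = r2[THEN conjunct2]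
  show "q (right_mult i a f) = q f \<triangleleft>\<^bsub>V\<^esub> to_top A a" if "f \<in> Z i" "a \<in> carrier A"
    using r3[THEN conjunct1, rule_format, OF that] .
  show "q (pull i f (\<phi> i)) = s \<odot>\<^bsub>V\<^esub> q f" if "f \<in> Z i" "s \<in> carrier (top_ring A)"
    "is_lift A P \<delta> \<epsilon> (\<lambda>x. x \<otimes>\<^bsub>top_ring A\<^esub> s) \<phi>"
    using r3[THEN conjunct2, rule_format, OF that] .
qed

lemma Ext_isomorphic_presents:
  assumes V: "abelian_group V"
    and iso: "bimodule_isomorphic (top_ring A) A (Ext_top A P \<delta> \<epsilon> i) (restrict_right (to_top A) V)"
  shows "\<exists>q. presents i V q"
proof -
  interpret V: abelian_group V by fact
  obtain \<theta> where \<theta>: "bij_betw \<theta> (carrier (Ext_top A P \<delta> \<epsilon> i)) (carrier V)"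
    "\<forall>x\<in>carrier (Ext_top A P \<delta> \<epsilon> i). \<forall>y\<in>carrier (Ext_top A P \<delta> \<epsilon> i).
      \<theta> (x \<oplus>\<^bsub>Ext_top A P \<delta> \<epsilon> i\<^esub> y) = \<theta> x \<oplus>\<^bsub>V\<^esub> \<theta> y"
    "\<forall>s\<in>carrier (top_ring A). \<forall>x\<in>carrier (Ext_top A P \<delta> \<epsilon> i).
      \<theta> (s \<odot>\<^bsub>Ext_top A P \<delta> \<epsilon> i\<^esub> x) = s \<odot>\<^bsub>V\<^esub> \<theta> x"
    "\<forall>a\<in>carrier A. \<forall>x\<in>carrier (Ext_top A P \<delta> \<epsilon> i).
      \<theta> (x \<triangleleft>\<^bsub>Ext_top A P \<delta> \<epsilon> i\<^esub> a) = \<theta> x \<triangleleft>\<^bsub>V\<^esub> to_top A a"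
    using iso unfolding bimodule_isomorphic_def restrict_right_def by auto
  have cls: "cls i f \<in> carrier (Ext_top A P \<delta> \<epsilon> i)" if "f \<in> Z i" for f
    using that unfolding Ext_simps by blast
  define q where "q f = \<theta> (cls i f)" for f
  have q_add: "q (f \<oplus>\<^bsub>H i\<^esub> g) = q f \<oplus>\<^bsub>V\<^esub> q g" if "f \<in> Z i" "g \<in> Z i" for f g
    using \<theta>(2) cls that by (simp add: q_def Ext_simps(3)[symmetric])
  have qV: "q f \<in> carrier V" if "f \<in> Z i" for f
    using bij_betwE[OF \<theta>(1)] cls[OF that] by (simp add: q_def)
  have z: "\<zero>\<^bsub>H i\<^esub> \<in> Z i" using subgroup.one_closed[OF Z_subgroup] by simp
  have zB: "\<zero>\<^bsub>H i\<^esub> \<in> Bd i" using subgroup.one_closed[OF Bd_subgroup] by simp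
  have q0: "q \<zero>\<^bsub>H i\<^esub> = \<zero>\<^bsub>V\<^esub>"
    using q_add[OF z z] qV[OF z] V.add.r_cancel_one'[of "q \<zero>\<^bsub>H i\<^esub>" "q \<zero>\<^bsub>H i\<^esub>"] by simp
  have "presents i V q"
    unfolding presents_def
  proof (intro conjI ballI allI impI)
    show "q ` Z i = carrier V"
    proof -
      have "carrier V = \<theta> ` carrier (Ext_top A P \<delta> \<epsilon> i)" using \<theta>(1) by (simp add: bij_betw_def)
      also have "carrier (Ext_top A P \<delta> \<epsilon> i) = cls i ` Z i" unfolding Ext_simps by blast
      finally show ?thesis by (simp add: q_def image_image)
    qed
    show "q f = \<zero>\<^bsub>V\<^esub> \<longleftrightarrow> f \<in> Bd i" if f: "f \<in> Z i" for f
    proof -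
      have "q f = \<zero>\<^bsub>V\<^esub> \<longleftrightarrow> \<theta> (cls i f) = \<theta> (cls i \<zero>\<^bsub>H i\<^esub>)" using q0 by (simp add: q_def)
      also have "\<dots> \<longleftrightarrow> cls i f = cls i \<zero>\<^bsub>H i\<^esub>"
        by (rule inj_on_eq_iff[OF bij_betw_imp_inj_on[OF \<theta>(1)] cls[OF f] cls[OF z]])
      also have "cls i \<zero>\<^bsub>H i\<^esub> = Bd i" using cls_zero[OF H.zero_closed] zB by simp
      also have "cls i f = Bd i \<longleftrightarrow> f \<in> Bd i" by (rule cls_zero[OF Z_H[OF f]])
      finally show ?thesis .
    qed
    show "q (f \<oplus>\<^bsub>H i\<^esub> g) = q f \<oplus>\<^bsub>V\<^esub> q g" if "f \<in> Z i" "g \<in> Z i" for f g using q_add[OF that] .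
    show "q (right_mult i a f) = q f \<triangleleft>\<^bsub>V\<^esub> to_top A a" if "f \<in> Z i" "a \<in> carrier A" for f a
      using \<theta>(4) cls that by (simp add: q_def Ext_rsmult[symmetric])
    show "q (pull i f (\<phi> i)) = s \<odot>\<^bsub>V\<^esub> q f" if "f \<in> Z i" "s \<in> carrier (top_ring A)"
      "is_lift A P \<delta> \<epsilon> (\<lambda>x. x \<otimes>\<^bsub>top_ring A\<^esub> s) \<phi>" for f s \<phi>
      using \<theta>(3)[THEN bspec, THEN bspec, OF that(2) cls[OF that(1)]] Ext_smult[OF that(1,3)]
      by (simp add: q_def)
  qed
  then show ?thesis by (rule exI[of _ q])
qed

lemma presents_Ext_isomorphic:
  assumes V: "abelian_group V" and q: "presents i V q"
  shows "bimodule_isomorphic (top_ring A) A (Ext_top A P \<delta> \<epsilon> i) (restrict_right (to_top A) V)"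
proof -
  interpret V: abelian_group V by fact
  note q = presentsD[OF q]
  have q_const: "q ` cls i f = {q f}" if f: "f \<in> Z i" for f
  proof -
    have "q f' = q f" if "f' \<in> cls i f" for f'
    proof -
      obtain b where b: "b \<in> Bd i" "f' = b \<oplus>\<^bsub>H i\<^esub> f" using \<open>f' \<in> cls i f\<close> cls_mem by blast
      have bZ: "b \<in> Z i" using b(1) Bd_Z by blast
      have "q b = \<zero>\<^bsub>V\<^esub>" using q(4)[OF bZ] b(1) by simp
      then show ?thesis using q(3)[OF bZ f] q(1)[OF f] by (simp add: b(2))
    qed
    then show ?thesis using cls_self[OF Z_H[OF f]] by blast
  qed
  define \<theta> where "\<theta> C = the_elem (q ` C)" for C
  have \<theta>: "\<theta> (cls i f) = q f" if "f \<in> Z i" for f by (simp add: \<theta>_def q_const[OF that])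
  have q_eq: "cls i f = cls i g" if f: "f \<in> Z i" and g: "g \<in> Z i" and eq: "q f = q g" for f g
  proof (rule cls_eqI[OF Z_H[OF f] Z_H[OF g]])
    have d: "f \<ominus>\<^bsub>H i\<^esub> g \<in> Z i" using f g by (rule Z_minus)
    have "q ((f \<ominus>\<^bsub>H i\<^esub> g) \<oplus>\<^bsub>H i\<^esub> g) = q f"
      using Z_H[OF f] Z_H[OF g] by (simp add: a_minus_def H.a_assoc H.l_neg)
    then have "q (f \<ominus>\<^bsub>H i\<^esub> g) \<oplus>\<^bsub>V\<^esub> q g = q g" using q(3)[OF d g] eq by simp
    then have "q (f \<ominus>\<^bsub>H i\<^esub> g) = \<zero>\<^bsub>V\<^esub>" using q(1)[OF d] q(1)[OF g] by simp
    then show "f \<ominus>\<^bsub>H i\<^esub> g \<in> Bd i" using q(4)[OF d] by simp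
  qed
  have car: "carrier (Ext_top A P \<delta> \<epsilon> i) = cls i ` Z i" unfolding Ext_simps by blast
  show ?thesis
    unfolding bimodule_isomorphic_def
  proof (intro exI[of _ \<theta>] conjI ballI)
    have "inj_on \<theta> (cls i ` Z i)"
    proof (rule inj_onI)
      fix C D assume "C \<in> cls i ` Z i" "D \<in> cls i ` Z i" "\<theta> C = \<theta> D"
      then obtain f g where "f \<in> Z i" "g \<in> Z i" "C = cls i f" "D = cls i g" by blast
      then show "C = D" using q_eq[of f g] \<theta> \<open>\<theta> C = \<theta> D\<close> by simp
    qed
    moreover have "\<theta> ` (cls i ` Z i) = carrier V"
      using q(1,2) by (auto simp: image_image \<theta>)
    ultimately show "bij_betw \<theta> (carrier (Ext_top A P \<delta> \<epsilon> i)) (carrier (restrict_right (to_top A) V))"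
      by (simp add: bij_betw_def car restrict_right_def)
    fix C assume "C \<in> carrier (Ext_top A P \<delta> \<epsilon> i)"
    then obtain f where f: "f \<in> Z i" "C = cls i f" unfolding car by blast
    show "\<theta> (C \<oplus>\<^bsub>Ext_top A P \<delta> \<epsilon> i\<^esub> D) = \<theta> C \<oplus>\<^bsub>restrict_right (to_top A) V\<^esub> \<theta> D"
      if D: "D \<in> carrier (Ext_top A P \<delta> \<epsilon> i)" for D
    proof -
      obtain g where g: "g \<in> Z i" "D = cls i g" using D unfolding car by blast
      show ?thesis
        using q(3)[OF f(1) g(1)] \<theta>[OF f(1)] \<theta>[OF g(1)] \<theta>[OF Z_add[OF f(1) g(1)]] Ext_simps(3)[OF f(1) g(1)]
        by (simp add: f(2) g(2) restrict_right_def)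
    qed
    show "\<theta> (s \<odot>\<^bsub>Ext_top A P \<delta> \<epsilon> i\<^esub> C) = s \<odot>\<^bsub>restrict_right (to_top A) V\<^esub> \<theta> C"
      if s: "s \<in> carrier (top_ring A)" for s
    proof -
      obtain \<phi> where \<phi>: "is_lift A P \<delta> \<epsilon> (\<lambda>x. x \<otimes>\<^bsub>top_ring A\<^esub> s) \<phi>" using lift_exists[OF s] by blast
      show ?thesis
        using Ext_smult[OF f(1) \<phi>] \<theta>[OF pull_lift_Z[OF \<phi> f(1)]] q(6)[OF f(1) s \<phi>] \<theta>[OF f(1)]
        by (simp add: f(2) restrict_right_def)
    qed
    show "\<theta> (C \<triangleleft>\<^bsub>Ext_top A P \<delta> \<epsilon> i\<^esub> a) = \<theta> C \<triangleleft>\<^bsub>restrict_right (to_top A) V\<^esub> a"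
      if a: "a \<in> carrier A" for a
      using Ext_rsmult[OF f(1) a] \<theta>[OF right_mult_Z[OF a f(1)]] q(5)[OF f(1) a] \<theta>[OF f(1)]
      by (simp add: f(2) restrict_right_def)
  qed
qed

end

section \<open>Twisting the complex that computes Ext\<close>

context twist_pair
begin

lemma shifted_B: "B.shifted = A.shifted"
  unfolding A.shifted_def[abs_def] B.shifted_def[abs_def] glue_def[abs_def]
  by (simp add: part_B zero_B same_group_finsum[OF carrier_B add_B zero_B])

lemma compwise_B:
  assumes M: "twisted_modules A B t M M'" shows "B.compwise M' w f = A.compwise M w f"
proof -
  note MD = twisted_modulesD(3-6)[OF M]
  have "component M' (homog M') = component M (homog M)"
    using same_group_component[OF MD(1-3), of "homog M"] by (simp add: MD)
  then show ?thesis
    unfolding A.compwise_def B.compwise_def glue_def[abs_def]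
    by (simp add: shifted_B MD same_group_finsum[OF carrier_B add_B zero_B])
qed

lemma twisted_compwise_module: "twisted_modules A B t M M' \<Longrightarrow> compwise_module K A M"
  using graded_left_moduleD(2)[OF twisted_modulesD(1)]
  by (simp add: compwise_module_def A.graded_k_algebra_axioms)

lemma additive_B:
  "twisted_modules A B t M M' \<Longrightarrow> additive M' B f \<longleftrightarrow> additive M A f"
  by (simp add: additive_on_def twisted_modulesD carrier_B add_B)

lemma compwise_t_inverse:
  assumes M: "twisted_modules A B t M M'" and f: "additive M A f" "f \<in> extensional (carrier M)"
  shows "A.compwise M (\<lambda>k. t (- k)) (A.compwise M t f) = f" "A.compwise M t (A.compwise M (\<lambda>k. t (- k)) f) = f"
proof -
  interpret compwise_module K A M using M by (rule twisted_compwise_module)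
  have id: "A.compwise M w f = f" if w: "\<And>k x. x \<in> carrier A \<Longrightarrow> w k x = x" for w
  proof -
    have wa: "additive A A (w k)" for k using w by (simp add: additive_on_def)
    have i: "additive A A (\<lambda>x. x)" by (simp add: additive_on_def)
    have "A.compwise M w f = A.compwise M (\<lambda>_ x. x) f"
      by (rule compwise_cong[of w "\<lambda>_ x. x", OF wa i f(1) w])
    also have "\<dots> = restrict (\<lambda>x. f x) (carrier M)" by (rule compwise_const[OF i f(1)])
    finally show ?thesis using extensional_restrict[OF f(2)] by simp
  qed
  have "A.compwise M (\<lambda>k. t (- k)) (A.compwise M t f) = A.compwise M (\<lambda>k y. t (- (k + int 0)) (t k y)) f"
    by (rule compwise_compwise[of "\<lambda>k. t (- k)" t f 0, OF A.t_additive A.t_additive f(1)]) (simp add: A.t_grade)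
  then show "A.compwise M (\<lambda>k. t (- k)) (A.compwise M t f) = f" using id by (simp add: A.t_inverse)
  have "A.compwise M t (A.compwise M (\<lambda>k. t (- k)) f) = A.compwise M (\<lambda>k y. t (k + int 0) (t (- k) y)) f"
    by (rule compwise_compwise[of t "\<lambda>k. t (- k)" f 0, OF A.t_additive A.t_additive f(1)]) (simp add: A.t_grade)
  then show "A.compwise M t (A.compwise M (\<lambda>k. t (- k)) f) = f" using id by (simp add: A.t_inverse)
qed

text \<open>
  A map of degree \<open>k\<close> that is linear over \<open>A\<close> becomes linear over the twist after composition with
  \<open>t\<^sub>k\<close>; applied to all homogeneous components of a map at once, this gives the transfer.
\<close>

lemma twist_hom:
  assumes M: "twisted_modules A B t M M'" and f: "f \<in> carrier (hom_group A M)"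
  shows "A.compwise M t f \<in> carrier (hom_group B M')"
proof -
  interpret compwise_module K A M using M by (rule twisted_compwise_module)
  note MD = twisted_modulesD[OF M]
  interpret M: left_module A M using MD(1) by (rule graded_left_moduleD)
  interpret M': left_module B M' using MD(2) by (rule graded_left_moduleD)
  have fa: "additive M A f" and fl: "\<And>a x. a \<in> carrier A \<Longrightarrow> x \<in> carrier M \<Longrightarrow> f (a \<odot>\<^bsub>M\<^esub> x) = a \<otimes>\<^bsub>A\<^esub> f x"
    using f by (simp_all add: A.hom_group_carrier)
  note d = compwise_additive[of t, OF A.t_additive fa]
  have B_left: "additive A A (\<lambda>y. a \<otimes>\<^bsub>B\<^esub> y)" if "a \<in> carrier A" for a
    using B.additive_mult_left[of a] that by (simp add: additive_on_def carrier_B add_B)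
  have B_right: "additive A A (\<lambda>a. a \<otimes>\<^bsub>B\<^esub> y)" if "y \<in> carrier A" for y
    using B.additive_mult_right[of y] that by (simp add: additive_on_def carrier_B add_B)
  have x_add: "additive M M (\<lambda>x. a \<odot>\<^bsub>M'\<^esub> x)" if "a \<in> carrier A" for a
    using that M'.smult_closed[of a] M'.smult_r_distr[of a] by (simp add: additive_on_def carrier_B MD(3,4))
  have a_add: "additive A M (\<lambda>a. a \<odot>\<^bsub>M'\<^esub> x)" if "x \<in> carrier M" for x
    using that M'.smult_closed[of _ x] M'.smult_l_distr[of _ _ x]
    by (simp add: additive_on_def carrier_B add_B MD(3,4))
  have "A.compwise M t f (a \<odot>\<^bsub>M'\<^esub> x) = a \<otimes>\<^bsub>B\<^esub> A.compwise M t f x" if a: "a \<in> carrier A" and x: "x \<in> carrier M" for a x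
  proof (rule P.additive_eqI[OF additive_comp[OF x_add[OF a] d] additive_comp[OF d B_left[OF a]] _ x])
    fix n x assume x: "x \<in> homog M n"
    have xc: "x \<in> carrier M" using x by (rule P.grade_carrier)
    note dx = additive_onD(1)[OF d xc] and fx = additive_onD(1)[OF fa xc]
    show "A.compwise M t f (a \<odot>\<^bsub>M'\<^esub> x) = a \<otimes>\<^bsub>B\<^esub> A.compwise M t f x"
    proof (rule A.additive_eqI[OF additive_comp[OF a_add[OF xc] d] B_right[OF dx] _ a])
      fix l a assume a: "a \<in> grade A l"
      have ac: "a \<in> carrier A" using a by (rule A.grade_carrier)
      have ax: "t n a \<odot>\<^bsub>M\<^esub> x \<in> homog M (int l + n)"
        by (rule graded_left_moduleD(4)[OF MD(1) A.t_grade[OF a] x])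
      have "A.shifted t (int l + n) (t n a \<otimes>\<^bsub>A\<^esub> y) = a \<otimes>\<^bsub>B\<^esub> A.shifted t n y" if y: "y \<in> carrier A" for y
      proof (rule A.additive_eqI[OF additive_comp[OF A.additive_mult_left[OF A.t_closed[OF ac]]
              A.shifted_additive[of t, OF A.t_additive]]
            additive_comp[OF A.shifted_additive[of t, OF A.t_additive] B_left[OF ac]] _ y])
        fix m y assume y: "y \<in> grade A m"
        have yc: "y \<in> carrier A" using y by (rule A.grade_carrier)
        have ay: "t n a \<otimes>\<^bsub>A\<^esub> y \<in> grade A (l + m)" by (rule A.mult_grade[OF A.t_grade[OF a] y])
        have "A.shifted t (int l + n) (t n a \<otimes>\<^bsub>A\<^esub> y) = t (int m - n) (t n a \<otimes>\<^bsub>A\<^esub> y)"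
          using A.shifted_grade[of t, OF A.t_additive ay, of "int l + n"] by simp
        also have "\<dots> = t (int m) a \<otimes>\<^bsub>A\<^esub> t (int m - n) y"
          using ac yc by (simp add: A.t_mult A.t_closed A.t_t)
        also have "\<dots> = a \<otimes>\<^bsub>B\<^esub> A.shifted t n y"
          using mult_B[OF ac A.t_grade[OF y]] A.shifted_grade[of t, OF A.t_additive y, of n] by simp
        finally show "A.shifted t (int l + n) (t n a \<otimes>\<^bsub>A\<^esub> y) = a \<otimes>\<^bsub>B\<^esub> A.shifted t n y" .
      qed
      then show "A.compwise M t f (a \<odot>\<^bsub>M'\<^esub> x) = a \<otimes>\<^bsub>B\<^esub> A.compwise M t f x"
        using compwise_homog[of t, OF A.t_additive fa ax] compwise_homog[of t, OF A.t_additive fa x]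
          fl[OF A.t_closed[OF ac] xc] fx MD(7)[OF ac x] by simp
    qed
  qed
  then show ?thesis
    using d compwise_extensional[of t f] additive_B[OF M]
    by (simp add: B.hom_group_carrier carrier_B MD(3))
qed

end

locale twisted_resolution = twist_pair K A B t + RA: top_resolution K A P \<delta> \<epsilon>
  for K :: "'k ring" and A B :: "('k, 'a) graded_algebra" and t
    and P :: "nat \<Rightarrow> ('a, 'm) graded_module" and \<delta> \<epsilon> +
  fixes P' :: "nat \<Rightarrow> ('a, 'm) graded_module"
  assumes twisted_P: "twisted_modules A B t (P i) (P' i)"

sublocale twisted_resolution \<subseteq> RB: top_resolution K B P' \<delta> \<epsilon>
  using resolution_twisted[OF top_module_twisted twisted_P RA.projective_resolution]
  by unfold_locales

context twisted_resolution
begin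

lemma twisted_resolution_sym: "twisted_resolution K B A (\<lambda>k. t (- k)) P' \<delta> \<epsilon> P"
  by (intro twisted_resolution.intro twist_pair_sym RB.top_resolution_axioms
      twisted_resolution_axioms.intro twisted_modules_sym twisted_P)

lemmas P'D = twisted_modulesD[OF twisted_P]

lemma H_B: "ring.add (RB.H i) = ring.add (RA.H i)" "\<zero>\<^bsub>RB.H i\<^esub> = \<zero>\<^bsub>RA.H i\<^esub>"
  by (simp_all add: hom_group_def P'D add_B zero_B)

definition to_twist :: "nat \<Rightarrow> ('m \<Rightarrow> 'a) \<Rightarrow> 'm \<Rightarrow> 'a" where "to_twist i = A.compwise (P i) t"
definition from_twist :: "nat \<Rightarrow> ('m \<Rightarrow> 'a) \<Rightarrow> 'm \<Rightarrow> 'a" where "from_twist i = A.compwise (P i) (\<lambda>k. t (- k))"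

lemma from_twist_sym: "from_twist i = twisted_resolution.to_twist B (\<lambda>k. t (- k)) P' i"
  unfolding from_twist_def twisted_resolution.to_twist_def[OF twisted_resolution_sym]
  by (intro ext) (simp add: compwise_B[OF twisted_P])

lemma to_twist_H: "f \<in> carrier (RA.H i) \<Longrightarrow> to_twist i f \<in> carrier (RB.H i)"
  unfolding to_twist_def by (rule twist_hom[OF twisted_P])

lemma to_twist_pull:
  assumes "f \<in> carrier (RA.H j)" "\<phi> \<in> graded_maps A (P i) (P j)"
  shows "to_twist i (RA.pull i f \<phi>) = RA.pull i (to_twist j f) \<phi>"
  unfolding to_twist_def
  by (rule compwise_module.compwise_pullback[OF twisted_compwise_module[OF twisted_P] RA.P_modD(2)
        graded_mapsD(5)[OF assms(2)] graded_mapsD(4)[OF assms(2)] A.t_additive RA.H_additive[OF assms(1)]])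

lemma to_twist_add:
  assumes f: "f \<in> carrier (RA.H i)" and g: "g \<in> carrier (RA.H i)"
  shows "to_twist i (f \<oplus>\<^bsub>RA.H i\<^esub> g) = to_twist i f \<oplus>\<^bsub>RB.H i\<^esub> to_twist i g"
proof -
  have "f \<oplus>\<^bsub>RA.H i\<^esub> g \<in> carrier (RA.H i)" using f g by simp
  then have fg: "additive (P i) A (restrict (\<lambda>x. f x \<oplus>\<^bsub>A\<^esub> g x) (carrier (P i)))"
    using RA.H_additive A.hom_group_simps(1) by metis
  show ?thesis
    unfolding to_twist_def H_B A.hom_group_simps
    by (rule compwise_module.compwise_add[OF twisted_compwise_module[OF twisted_P] A.t_additive
          RA.H_additive[OF f] RA.H_additive[OF g] fg])
qed

lemma to_twist_zero: "to_twist i \<zero>\<^bsub>RA.H i\<^esub> = \<zero>\<^bsub>RB.H i\<^esub>"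
proof -
  have "additive (RA.H i) (RB.H i) (to_twist i)"
    by (simp add: additive_on_def to_twist_H to_twist_add)
  then show ?thesis
    by (rule additive_zero[OF RA.H.abelian_group_axioms RB.H.abelian_group_axioms])
qed

lemma to_twist_Z: "f \<in> RA.Z i \<Longrightarrow> to_twist i f \<in> RB.Z i"
  using to_twist_H to_twist_pull[OF _ RA.resD(4), of f i] to_twist_zero[of "Suc i"]
  by (simp add: RA.Z_iff RB.Z_iff P'D)

lemma to_twist_Bd: "f \<in> RA.Bd i \<Longrightarrow> to_twist i f \<in> RB.Bd i"
proof (cases i)
  case 0
  then show "f \<in> RA.Bd i \<Longrightarrow> to_twist i f \<in> RB.Bd i" using to_twist_zero[of 0] by simp
next
  case (Suc j)
  assume "f \<in> RA.Bd i"
  then obtain g where g: "g \<in> carrier (RA.H j)" "f = RA.pull (Suc j) g (\<delta> j)"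
    using Suc by (auto elim: RA.Bd_SucE)
  then show "to_twist i f \<in> RB.Bd i"
    using RB.Bd_SucI[OF to_twist_H[OF g(1)]] to_twist_pull[OF g(1) RA.resD(4)] Suc by (simp add: P'D)
qed

lemma from_twist_Z: "g \<in> RB.Z i \<Longrightarrow> from_twist i g \<in> RA.Z i"
  unfolding from_twist_sym by (rule twisted_resolution.to_twist_Z[OF twisted_resolution_sym])

lemma from_twist_Bd: "g \<in> RB.Bd i \<Longrightarrow> from_twist i g \<in> RA.Bd i"
  unfolding from_twist_sym by (rule twisted_resolution.to_twist_Bd[OF twisted_resolution_sym])

lemma from_to: "f \<in> carrier (RA.H i) \<Longrightarrow> from_twist i (to_twist i f) = f"
  unfolding to_twist_def from_twist_def
  by (rule compwise_t_inverse(1)[OF twisted_P RA.H_additive]) (simp_all add: A.hom_group_carrier)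

lemma to_from:
  assumes g: "g \<in> carrier (RB.H i)" shows "to_twist i (from_twist i g) = g"
proof -
  have "additive (P i) A g" by (rule iffD1[OF additive_B[OF twisted_P] RB.H_additive[OF g]])
  moreover have "g \<in> extensional (carrier (P i))" using g by (simp add: B.hom_group_carrier P'D(3))
  ultimately show ?thesis unfolding to_twist_def from_twist_def by (rule compwise_t_inverse(2)[OF twisted_P])
qed

lemma vanishing_twist:
  assumes "RA.Z i \<subseteq> RA.Bd i" shows "RB.Z i \<subseteq> RB.Bd i"
proof
  fix g assume g: "g \<in> RB.Z i"
  then have "to_twist i (from_twist i g) \<in> RB.Bd i" using assms from_twist_Z to_twist_Bd by blast
  then show "g \<in> RB.Bd i" using to_from[OF RB.Z_H[OF g]] by simp
qed

lemma is_lift_twist: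
  assumes "s \<in> carrier (top_ring A)" and "is_lift B P' \<delta> \<epsilon> (\<lambda>x. x \<otimes>\<^bsub>top_ring B\<^esub> s) \<phi>"
  shows "is_lift A P \<delta> \<epsilon> (\<lambda>x. x \<otimes>\<^bsub>top_ring A\<^esub> s) \<phi>"
proof -
  have "\<epsilon> x \<in> carrier (top_ring A)" if "x \<in> carrier (P 0)" for x
    using graded_mapsD(1)[OF RA.resD(3) that] by simp
  then show ?thesis
    using assms unfolding is_lift_def graded_maps_twisted[OF twisted_P twisted_P, symmetric] P'D(3)
    by (simp add: top_ring_B)
qed

text \<open>
  The transfer to the twist commutes with precomposition, thus with the left action of \<open>S\<close>. Only the right action changes;
  the second hypothesis says that on classes it changes by \<open>\<rho>\<close>.
\<close>

lemma presents_twist: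
  assumes q: "RA.presents i V q"
    and right: "\<And>f a. f \<in> RA.Z i \<Longrightarrow> a \<in> carrier A \<Longrightarrow>
      q (from_twist i (RB.right_mult i a (to_twist i f))) = q f \<triangleleft>\<^bsub>V\<^esub> \<rho> (to_top A a)"
  shows "RB.presents i (twist_right \<rho> V) (\<lambda>g. q (from_twist i g))"
  unfolding RB.presents_def
proof (intro conjI ballI allI impI)
  note q = RA.presentsD[OF q]
  show "(\<lambda>g. q (from_twist i g)) ` RB.Z i = carrier (twist_right \<rho> V)"
  proof
    show "(\<lambda>g. q (from_twist i g)) ` RB.Z i \<subseteq> carrier (twist_right \<rho> V)"
      using q(1) from_twist_Z by (auto simp: twist_right_def)
    show "carrier (twist_right \<rho> V) \<subseteq> (\<lambda>g. q (from_twist i g)) ` RB.Z i"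
    proof
      fix v assume "v \<in> carrier (twist_right \<rho> V)"
      then obtain f where f: "f \<in> RA.Z i" "q f = v" using q(2)[of v] by (auto simp: twist_right_def)
      show "v \<in> (\<lambda>g. q (from_twist i g)) ` RB.Z i"
        by (rule image_eqI[OF _ to_twist_Z[OF f(1)]]) (simp add: from_to[OF RA.Z_H[OF f(1)]] f(2))
    qed
  qed
  fix g assume g: "g \<in> RB.Z i"
  note fg = from_twist_Z[OF g]
  show "q (from_twist i (g \<oplus>\<^bsub>RB.H i\<^esub> g')) = q (from_twist i g) \<oplus>\<^bsub>twist_right \<rho> V\<^esub> q (from_twist i g')"
    if g': "g' \<in> RB.Z i" for g'
    using q(3)[OF fg from_twist_Z[OF g']]
      twisted_resolution.to_twist_add[OF twisted_resolution_sym RB.Z_H[OF g] RB.Z_H[OF g']]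
    by (simp add: from_twist_sym[symmetric] twist_right_def)
  show "q (from_twist i g) = \<zero>\<^bsub>twist_right \<rho> V\<^esub> \<longleftrightarrow> g \<in> RB.Bd i"
    using q(4)[OF fg] from_twist_Bd to_twist_Bd[of "from_twist i g" i] to_from[OF RB.Z_H[OF g]]
    by (auto simp: twist_right_def)
  show "q (from_twist i (RB.right_mult i a g)) = q (from_twist i g) \<triangleleft>\<^bsub>twist_right \<rho> V\<^esub> to_top B a"
    if "a \<in> carrier B" for a
    using right[OF fg, of a] that to_from[OF RB.Z_H[OF g]] by (simp add: carrier_B to_top_B twist_right_def)
  show "q (from_twist i (RB.pull i g (\<phi> i))) = s \<odot>\<^bsub>twist_right \<rho> V\<^esub> q (from_twist i g)"
    if s: "s \<in> carrier (top_ring B)" and \<phi>: "is_lift B P' \<delta> \<epsilon> (\<lambda>x. x \<otimes>\<^bsub>top_ring B\<^esub> s) \<phi>" for s \<phi>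
  proof -
    have s': "s \<in> carrier (top_ring A)" using s by (simp add: top_ring_B)
    have "from_twist i (RB.pull i g (\<phi> i)) = RB.pull i (from_twist i g) (\<phi> i)"
      unfolding from_twist_sym
      by (rule twisted_resolution.to_twist_pull[OF twisted_resolution_sym RB.Z_H[OF g] RB.is_liftD(1)[OF \<phi>]])
    then show ?thesis
      using q(6)[OF fg s' is_lift_twist[OF s' \<phi>]] by (simp add: P'D twist_right_def)
  qed
qed

end

section \<open>Finitely spanned subspaces\<close>

context graded_k_algebra
begin

text \<open>
  The span of a list, by recursion, so that a sequence in the span can be split into a scalar sequence
  times the first vector and a sequence in the span of the others.
\<close>

primrec combinations :: "'a list \<Rightarrow> 'a set" where
  "combinations [] = {\<zero>}"
| "combinations (b # bs) = {c \<odot> b \<oplus> x | c x. c \<in> carrier K \<and> x \<in> combinations bs}"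

lemma combinations_ConsI:
  "c \<in> carrier K \<Longrightarrow> x \<in> combinations bs \<Longrightarrow> c \<odot> b \<oplus> x \<in> combinations (b # bs)"
  by auto

lemma combinations_ConsE:
  assumes "y \<in> combinations (b # bs)"
  obtains c x where "c \<in> carrier K" "x \<in> combinations bs" "y = c \<odot> b \<oplus> x"
  using assms by auto

lemma combinations_closed: "set bs \<subseteq> carrier A \<Longrightarrow> x \<in> combinations bs \<Longrightarrow> x \<in> carrier A"
proof (induction bs arbitrary: x)
  case (Cons b bs)
  from Cons.prems(2) obtain c y where "c \<in> carrier K" "y \<in> combinations bs" "x = c \<odot> b \<oplus> y"
    by (rule combinations_ConsE)
  then show ?case using Cons by simp
qed simp

lemma combinations_zero: "set bs \<subseteq> carrier A \<Longrightarrow> \<zero> \<in> combinations bs"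
proof (induction bs)
  case (Cons b bs)
  then have "\<zero>\<^bsub>K\<^esub> \<odot> b \<oplus> \<zero> \<in> combinations (b # bs)"
    by (intro combinations_ConsI) auto
  then show ?case using Cons.prems by simp
qed simp

lemma combinations_smult:
  "set bs \<subseteq> carrier A \<Longrightarrow> c \<in> carrier K \<Longrightarrow> x \<in> combinations bs \<Longrightarrow> c \<odot> x \<in> combinations bs"
proof (induction bs arbitrary: x)
  case (Cons b bs)
  from Cons.prems(3) obtain e y where e: "e \<in> carrier K" "y \<in> combinations bs" "x = e \<odot> b \<oplus> y"
    by (rule combinations_ConsE)
  have "c \<odot> x = (c \<otimes>\<^bsub>K\<^esub> e) \<odot> b \<oplus> c \<odot> y"
    using Cons.prems(1,2) e combinations_closed[of bs y]
    by (simp add: K_module.smult_r_distr K_module.smult_assoc1)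
  also have "\<dots> \<in> combinations (b # bs)"
    using Cons e by (intro combinations_ConsI) auto
  finally show ?case .
qed simp

lemma combinations_add:
  "set bs \<subseteq> carrier A \<Longrightarrow> x \<in> combinations bs \<Longrightarrow> y \<in> combinations bs \<Longrightarrow> x \<oplus> y \<in> combinations bs"
proof (induction bs arbitrary: x y)
  case (Cons b bs)
  from Cons.prems(2) obtain c x' where c: "c \<in> carrier K" "x' \<in> combinations bs" "x = c \<odot> b \<oplus> x'"
    by (rule combinations_ConsE)
  from Cons.prems(3) obtain e y' where e: "e \<in> carrier K" "y' \<in> combinations bs" "y = e \<odot> b \<oplus> y'"
    by (rule combinations_ConsE)
  have "x \<oplus> y = (c \<oplus>\<^bsub>K\<^esub> e) \<odot> b \<oplus> (x' \<oplus> y')"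
    using Cons.prems(1) c e combinations_closed[of bs x'] combinations_closed[of bs y']
    by (simp add: K_module.smult_l_distr A.a_ac)
  also have "\<dots> \<in> combinations (b # bs)"
    using Cons c e by (intro combinations_ConsI) auto
  finally show ?case .
qed simp

lemma combinations_finsum:
  assumes "set bs \<subseteq> carrier A" "distinct bs" "c \<in> set bs \<rightarrow> carrier K"
  shows "(\<Oplus>b\<in>set bs. c b \<odot> b) \<in> combinations bs"
  using assms
proof (induction bs)
  case (Cons b bs)
  then have "(\<Oplus>b\<in>set (b # bs). c b \<odot> b) = c b \<odot> b \<oplus> (\<Oplus>b\<in>set bs. c b \<odot> b)"
    by (auto simp: Pi_def subset_iff)
  also have "\<dots> \<in> combinations (b # bs)"
    using Cons by (intro combinations_ConsI) auto
  finally show ?case .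
qed simp

lemma combinations_subspace:
  assumes "set bs \<subseteq> carrier A" "U \<subseteq> combinations bs"
    and "\<zero> \<in> U" "\<And>x y. x \<in> U \<Longrightarrow> y \<in> U \<Longrightarrow> x \<oplus> y \<in> U"
    and "\<And>c x. c \<in> carrier K \<Longrightarrow> x \<in> U \<Longrightarrow> c \<odot> x \<in> U"
  shows "\<exists>cs. set cs \<subseteq> U \<and> U \<subseteq> combinations cs"
  using assms
proof (induction bs arbitrary: U)
  case Nil
  then show ?case by (intro exI[of _ "[]"]) auto
next
  case (Cons b bs)
  have bs: "set bs \<subseteq> carrier A" and b: "b \<in> carrier A" using Cons.prems(1) by auto
  have UA: "u \<in> carrier A" if "u \<in> U" for u
    using combinations_closed[OF Cons.prems(1)] Cons.prems(2) that by blast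
  define U1 where "U1 = U \<inter> combinations bs"
  have "\<exists>cs. set cs \<subseteq> U1 \<and> U1 \<subseteq> combinations cs"
    by (rule Cons.IH[OF bs])
      (use Cons.prems(3-5) bs in \<open>auto simp: U1_def combinations_zero combinations_add combinations_smult\<close>)
  then obtain cs where cs: "set cs \<subseteq> U1" "U1 \<subseteq> combinations cs" by blast
  show ?case
  proof (cases "U \<subseteq> combinations bs")
    case True
    then have "U1 = U" by (auto simp: U1_def)
    with cs show ?thesis by blast
  next
    case False
    then obtain u0 where u0: "u0 \<in> U" "u0 \<notin> combinations bs" by blast
    have "u0 \<in> combinations (b # bs)" using u0(1) Cons.prems(2) by blast
    then obtain c0 s0 where c0: "c0 \<in> carrier K" "s0 \<in> combinations bs" "u0 = c0 \<odot> b \<oplus> s0"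
      by (rule combinations_ConsE)
    note s0 = combinations_closed[OF bs c0(2)]
    have "c0 \<noteq> \<zero>\<^bsub>K\<^esub>" using u0(2) c0 b s0 by auto
    then have inv: "inv\<^bsub>K\<^esub> c0 \<in> carrier K" "inv\<^bsub>K\<^esub> c0 \<otimes>\<^bsub>K\<^esub> c0 = \<one>\<^bsub>K\<^esub>"
      using c0(1) K.field_Units by auto
    have "u \<in> combinations (u0 # cs)" if u: "u \<in> U" for u
    proof -
      have "u \<in> combinations (b # bs)" using u Cons.prems(2) by blast
      then obtain c s where c: "c \<in> carrier K" "s \<in> combinations bs" "u = c \<odot> b \<oplus> s"
        by (rule combinations_ConsE)
      note sc = combinations_closed[OF bs c(2)]
      define e where "e = c \<otimes>\<^bsub>K\<^esub> inv\<^bsub>K\<^esub> c0"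
      have e: "e \<in> carrier K" using c(1) inv(1) by (simp add: e_def)
      have ec0: "e \<otimes>\<^bsub>K\<^esub> c0 = c" using c(1) c0(1) inv by (simp add: e_def K.m_assoc)
      define d where "d = \<ominus>\<^bsub>K\<^esub> e"
      have d: "d \<in> carrier K" using e by (simp add: d_def)
      define r where "r = d \<odot> u0 \<oplus> u"
      have r: "r \<in> U" using Cons.prems(4,5) u0(1) u d by (simp add: r_def)
      have dc0: "d \<otimes>\<^bsub>K\<^esub> c0 \<oplus>\<^bsub>K\<^esub> c = \<zero>\<^bsub>K\<^esub>"
        using e c0(1) c(1) ec0 by (simp add: d_def K.l_minus K.l_neg)
      have "r = ((d \<otimes>\<^bsub>K\<^esub> c0) \<oplus>\<^bsub>K\<^esub> c) \<odot> b \<oplus> (d \<odot> s0 \<oplus> s)"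
        using d c(1) c0(1) b s0 sc
        by (simp add: r_def c(3) c0(3) K_module.smult_r_distr K_module.smult_l_distr K_module.smult_assoc1 A.a_ac)
      then have "r = d \<odot> s0 \<oplus> s" using dc0 b d s0 sc by simp
      then have "r \<in> U1"
        using r combinations_add[OF bs combinations_smult[OF bs d c0(2)] c(2)] by (simp add: U1_def)
      then have "e \<odot> u0 \<oplus> r \<in> combinations (u0 # cs)" using cs(2) e by (intro combinations_ConsI) auto
      moreover have "e \<odot> u0 \<oplus> r = u"
      proof -
        have "e \<odot> u0 \<oplus> r = (e \<oplus>\<^bsub>K\<^esub> d) \<odot> u0 \<oplus> u"
          using e d UA[OF u0(1)] UA[OF u] by (simp add: r_def K_module.smult_l_distr A.a_assoc)
        then show ?thesis using e UA[OF u0(1)] UA[OF u] by (simp add: d_def K.r_neg)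
      qed
      ultimately show ?thesis by simp
    qed
    moreover have "set (u0 # cs) \<subseteq> U" using cs(1) u0(1) by (auto simp: U1_def)
    ultimately show ?thesis by blast
  qed
qed

lemma grade_smult: "c \<in> carrier K \<Longrightarrow> y \<in> grade A n \<Longrightarrow> c \<odot> y \<in> grade A n"
  using grade_submodule[of n] by (simp add: submodule_def submodule_axioms_def)

lemma J_smult: "c \<in> carrier K \<Longrightarrow> y \<in> J \<Longrightarrow> c \<odot> y \<in> J"
  using JD(5)[of "c \<odot> \<one>" y] JD(1)[of y] by (simp add: smult_mult_left)

lemma grade_combinations:
  assumes "locally_finite_graded_algebra K A"
  shows "\<exists>bs. set bs \<subseteq> grade A n \<and> grade A n \<subseteq> combinations bs"
proof -
  obtain E where E: "finite E" "E \<subseteq> grade A n"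
    "\<forall>x\<in>grade A n. \<exists>c\<in>E \<rightarrow> carrier K. x = (\<Oplus>b\<in>E. c b \<odot> b)"
    using locally_finite_graded_algebra.finite_dimensional[OF assms, of n] by blast
  obtain bs where bs: "set bs = E" "distinct bs" using finite_distinct_list[OF E(1)] by blast
  have bc: "set bs \<subseteq> carrier A" unfolding bs(1) using E(2) grade_subset[of n] by (rule subset_trans)
  have "x \<in> combinations bs" if x: "x \<in> grade A n" for x
  proof -
    from bspec[OF E(3) x] obtain c where c: "c \<in> E \<rightarrow> carrier K" "x = (\<Oplus>b\<in>E. c b \<odot> b)"
      by (elim bexE)
    show ?thesis
      unfolding c(2) bs(1)[symmetric] by (rule combinations_finsum[OF bc bs(2)]) (use c(1) bs(1) in simp)
  qed
  then have "set bs \<subseteq> grade A n \<and> grade A n \<subseteq> combinations bs" using bs(1) E(2) by auto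
  then show ?thesis by (rule exI[of _ bs])
qed

lemma J_grade_combinations:
  assumes "locally_finite_graded_algebra K A"
  shows "\<exists>bs. set bs \<subseteq> J \<inter> grade A n \<and> J \<inter> grade A n \<subseteq> combinations bs"
proof -
  obtain bs where bs: "set bs \<subseteq> grade A n" "grade A n \<subseteq> combinations bs"
    using grade_combinations[OF assms] by blast
  have sub: "set bs \<subseteq> carrier A" using bs(1) grade_subset[of n] by (rule subset_trans)
  show ?thesis
  proof (rule combinations_subspace[OF sub])
    show "J \<inter> grade A n \<subseteq> combinations bs" using bs(2) by auto
    show "\<zero> \<in> J \<inter> grade A n" using JD(2) zero_grade by simp
    show "x \<oplus> y \<in> J \<inter> grade A n" if "x \<in> J \<inter> grade A n" "y \<in> J \<inter> grade A n" for x y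
      using that JD(3) add_grade by simp
    show "c \<odot> x \<in> J \<inter> grade A n" if "c \<in> carrier K" "x \<in> J \<inter> grade A n" for c x
      using that J_smult grade_smult by simp
  qed
qed

end

section \<open>Multiplying the homogeneous components of a cocycle\<close>

context top_resolution
begin

text \<open>
  The map \<open>\<Sum>\<^sub>k f\<^sub>k \<mapsto> \<Sum>\<^sub>k f\<^sub>k r\<^sub>k\<close>.
\<close>

definition seq_mult :: "nat \<Rightarrow> (int \<Rightarrow> 'a) \<Rightarrow> ('m \<Rightarrow> 'a) \<Rightarrow> 'm \<Rightarrow> 'a"
  where "seq_mult i r = compwise (P i) (\<lambda>k y. y \<otimes> r k)"

lemma seq_mult_H:
  assumes r: "\<And>k. r k \<in> carrier A" and f: "f \<in> carrier (H i)" shows "seq_mult i r f \<in> carrier (H i)"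
proof -
  have "seq_mult i r f \<in> linear_maps A (P i) (regular_module A)"
    unfolding seq_mult_def
    by (rule Pd.compwise_linear[OF resD(2) hom_group_linear[OF f]])
      (use r in \<open>simp_all add: additive_mult_right A.m_assoc\<close>)
  then show ?thesis using Pd.compwise_extensional by (simp add: hom_group_def seq_mult_def)
qed

lemma seq_mult_pull:
  assumes r: "\<And>k. r k \<in> carrier A" and f: "f \<in> carrier (H j)" and \<phi>: "\<phi> \<in> graded_maps A (P i) (P j)"
  shows "seq_mult i r (pull i f \<phi>) = pull i (seq_mult j r f) \<phi>"
  unfolding seq_mult_def
  by (rule Pd.compwise_pullback[OF P_modD(2) graded_mapsD(5)[OF \<phi>] graded_mapsD(4)[OF \<phi>]
        additive_mult_right[OF r] H_additive[OF f]])

lemma seq_mult_add: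
  assumes r: "\<And>k. r k \<in> carrier A" and f: "f \<in> carrier (H i)" and g: "g \<in> carrier (H i)"
  shows "seq_mult i r (f \<oplus>\<^bsub>H i\<^esub> g) = seq_mult i r f \<oplus>\<^bsub>H i\<^esub> seq_mult i r g"
proof -
  have "additive (P i) A (f \<oplus>\<^bsub>H i\<^esub> g)" using f g by (intro H_additive) simp
  then have fg: "additive (P i) A (restrict (\<lambda>x. f x \<oplus> g x) (carrier (P i)))"
    by (simp only: hom_group_simps)
  show ?thesis
    unfolding seq_mult_def hom_group_simps
    by (rule Pd.compwise_add[OF additive_mult_right[OF r] H_additive[OF f] H_additive[OF g] fg])
qed

lemma seq_mult_zero: "(\<And>k. r k \<in> carrier A) \<Longrightarrow> seq_mult i r \<zero>\<^bsub>H i\<^esub> = \<zero>\<^bsub>H i\<^esub>"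
  by (rule additive_zero[OF H.abelian_group_axioms H.abelian_group_axioms])
    (simp add: additive_on_def seq_mult_H seq_mult_add)

lemma seq_mult_Z:
  assumes r: "\<And>k. r k \<in> carrier A" and f: "f \<in> Z i" shows "seq_mult i r f \<in> Z i"
  using seq_mult_H[of r, OF r Z_H[OF f]] seq_mult_pull[of r, OF r Z_H[OF f] resD(4), symmetric]
    seq_mult_zero[of r "Suc i", OF r] f by (simp add: Z_iff)

lemma seq_mult_Bd:
  assumes r: "\<And>k. r k \<in> carrier A" and f: "f \<in> Bd i" shows "seq_mult i r f \<in> Bd i"
proof (cases i)
  case 0
  then have "f = \<zero>\<^bsub>H 0\<^esub>" using f by simp
  then show ?thesis using 0 seq_mult_zero[of r 0, OF r] by simp
next
  case (Suc j)
  obtain g where g: "g \<in> carrier (H j)" "f = pull (Suc j) g (\<delta> j)" using f Suc by (auto elim: Bd_SucE)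
  then show ?thesis
    using Bd_SucI[OF seq_mult_H[of r, OF r g(1)]] seq_mult_pull[of r, OF r g(1) resD(4)] Suc by simp
qed

lemma seq_mult_const: "a \<in> carrier A \<Longrightarrow> f \<in> carrier (H i) \<Longrightarrow> seq_mult i (\<lambda>_. a) f = right_mult i a f"
  unfolding seq_mult_def right_mult_def
  by (rule Pd.compwise_const[OF additive_mult_right H_additive])

lemma seq_mult_plus:
  assumes r: "\<And>k. r k \<in> carrier A" and r': "\<And>k. r' k \<in> carrier A" and f: "f \<in> carrier (H i)"
  shows "seq_mult i (\<lambda>k. r k \<oplus> r' k) f = seq_mult i r f \<oplus>\<^bsub>H i\<^esub> seq_mult i r' f"
proof -
  have w: "additive A A (\<lambda>y. y \<otimes> r k \<oplus> y \<otimes> r' k)" for k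
    using r r' by (simp add: additive_on_def A.l_distr A.a_ac)
  have "seq_mult i (\<lambda>k. r k \<oplus> r' k) f =
      compwise (P i) (\<lambda>k y. y \<otimes> r k \<oplus> y \<otimes> r' k) f"
    unfolding seq_mult_def
    by (rule Pd.compwise_cong[OF additive_mult_right w H_additive[OF f]])
      (use r r' in \<open>simp_all add: A.r_distr\<close>)
  also have "\<dots> = seq_mult i r f \<oplus>\<^bsub>H i\<^esub> seq_mult i r' f"
    unfolding seq_mult_def hom_group_simps
    by (rule Pd.compwise_add_family[of "\<lambda>k y. y \<otimes> r k" "\<lambda>k y. y \<otimes> r' k",
          OF additive_mult_right[OF r] additive_mult_right[OF r'] H_additive[OF f]])
  finally show ?thesis .
qed

lemma seq_mult_seq_mult:
  assumes r: "\<And>k. r k \<in> carrier A" and r': "\<And>k. r' k \<in> grade A 0" and f: "f \<in> carrier (H i)"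
  shows "seq_mult i r (seq_mult i r' f) = seq_mult i (\<lambda>k. r' k \<otimes> r k) f"
proof -
  have r'c: "r' k \<in> carrier A" for k using r' grade_carrier by blast
  have "seq_mult i r (seq_mult i r' f) = compwise (P i) (\<lambda>k y. (y \<otimes> r' k) \<otimes> r (k + int 0)) f"
    unfolding seq_mult_def
    by (rule Pd.compwise_compwise[where w = "\<lambda>k y. y \<otimes> r k" and w' = "\<lambda>k y. y \<otimes> r' k"
          and p = 0, OF additive_mult_right[OF r] additive_mult_right[OF r'c] H_additive[OF f]])
      (rule mult_grade[OF _ r'])
  also have "\<dots> = seq_mult i (\<lambda>k. r' k \<otimes> r k) f"
    unfolding seq_mult_def
    by (rule Pd.compwise_cong[OF additive_comp[OF additive_mult_right additive_mult_right]
          additive_mult_right H_additive[OF f]])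
      (use r r'c in \<open>simp_all add: A.m_assoc\<close>)
  finally show ?thesis .
qed

end

text \<open>
  The right action of the twist, transferred back: for \<open>y\<close> of degree \<open>m\<close> and \<open>x\<close> of degree \<open>n\<close>, the
  product \<open>t\<^sub>k(y) \<star> a = t\<^sub>k\<^sub>+\<^sub>p(y) a\<close> with \<open>k = m - n\<close> has degree \<open>k + p\<close> relative to \<open>x\<close>, so transferring back
  applies \<open>t\<^sub>-\<^sub>k\<^sub>-\<^sub>p\<close>.
\<close>

lemma (in twisted_resolution) right_mult_twist:
  assumes f: "f \<in> carrier (RA.H i)" and a: "a \<in> grade A p"
  shows "from_twist i (RB.right_mult i a (to_twist i f)) = RA.seq_mult i (\<lambda>k. t (- k - int p) a) f"
proof -
  have ac: "a \<in> carrier A" using a by (rule A.grade_carrier)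
  note fa = RA.H_additive[OF f]
  have u: "additive A A (\<lambda>y. y \<otimes>\<^bsub>B\<^esub> a)"
    using B.additive_mult_right[of a] ac by (simp add: additive_on_def carrier_B add_B)
  have tu: "additive A A (\<lambda>y. t k y \<otimes>\<^bsub>B\<^esub> a)" for k by (rule additive_comp[OF A.t_additive u])
  have "RB.right_mult i a (to_twist i f) = A.compwise (P i) (\<lambda>_ y. y \<otimes>\<^bsub>B\<^esub> a) (A.compwise (P i) t f)"
    unfolding RB.right_mult_def to_twist_def P'D(3)
    by (rule RA.Pd.compwise_const[OF u RA.Pd.compwise_additive[OF A.t_additive fa], symmetric])
  also have "\<dots> = A.compwise (P i) (\<lambda>k y. t k y \<otimes>\<^bsub>B\<^esub> a) f"
    by (rule RA.Pd.compwise_compwise[where w = "\<lambda>_ y. y \<otimes>\<^bsub>B\<^esub> a" and w' = t and p = 0, OF u A.t_additive fa])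
      (simp add: A.t_grade)
  finally have "from_twist i (RB.right_mult i a (to_twist i f)) =
      A.compwise (P i) (\<lambda>k. t (- k)) (A.compwise (P i) (\<lambda>k y. t k y \<otimes>\<^bsub>B\<^esub> a) f)"
    by (simp add: from_twist_def)
  also have "\<dots> = A.compwise (P i) (\<lambda>k y. t (- (k + int p)) (t k y \<otimes>\<^bsub>B\<^esub> a)) f"
    by (rule RA.Pd.compwise_compwise[where w = "\<lambda>k. t (- k)" and w' = "\<lambda>k y. t k y \<otimes>\<^bsub>B\<^esub> a" and p = p,
          OF A.t_additive tu fa])
      (use B.mult_grade[OF _ a[folded grade_B]] in \<open>simp add: grade_B A.t_grade\<close>)
  also have "\<dots> = RA.seq_mult i (\<lambda>k. t (- k - int p) a) f"
    unfolding RA.seq_mult_def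
  proof (rule RA.Pd.compwise_cong[OF additive_comp[OF tu A.t_additive] A.additive_mult_right fa])
    show "t (- k - int p) a \<in> carrier A" for k by (rule A.t_closed[OF ac])
    show "t (- (k + int p)) (t k y \<otimes>\<^bsub>B\<^esub> a) = y \<otimes>\<^bsub>A\<^esub> t (- k - int p) a" if "y \<in> carrier A" for k y
      using that ac mult_B[OF A.t_closed[OF that] a, of k]
      by (simp add: A.t_mult A.t_closed A.t_t A.t_0)
  qed
  finally show ?thesis .
qed

section \<open>The action of sequences on a presented Ext group\<close>

locale presented_top = top_resolution K A P \<delta> \<epsilon> + graded_flow K A t +
    mi: mutually_inverse "top_ring A" V W \<alpha> \<beta>
  for K :: "'k ring" and A :: "('k, 'a) graded_algebra" (structure)
    and P :: "nat \<Rightarrow> ('a, 'm) graded_module" and \<delta> \<epsilon> t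
    and V :: "('a set, 'a set, 'v) bimodule" and W :: "('a set, 'a set, 'w) bimodule" and \<alpha> \<beta> +
  fixes d :: nat and \<pi> :: "('m \<Rightarrow> 'a) \<Rightarrow> 'v"
  assumes presented: "presents d V \<pi>" and locally_finite: "locally_finite_graded_algebra K A"
begin

lemmas piD = presentsD[OF presented]

lemma V_group: "abelian_group V"
  by (rule mi.VW.V.M.abelian_group_axioms)

lemmas rsm = mi.VW.V.rsmult_closed mi.VW.V.rsmult_r_distr mi.VW.V.rsmult_l_distr
  mi.VW.V.rsmult_assoc mi.VW.V.rsmult_one

lemma rsmult_additive: "v \<in> carrier V \<Longrightarrow> additive (top_ring A) V (\<lambda>s. v \<triangleleft>\<^bsub>V\<^esub> s)"
  by (simp add: additive_on_def rsm)

lemma faithful_eqI: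
  assumes "z \<in> carrier (top_ring A)" "z' \<in> carrier (top_ring A)"
    and eq: "\<And>v. v \<in> carrier V \<Longrightarrow> v \<triangleleft>\<^bsub>V\<^esub> z = v \<triangleleft>\<^bsub>V\<^esub> z'"
  shows "z = z'"
proof -
  have "z \<ominus>\<^bsub>top_ring A\<^esub> z' = \<zero>\<^bsub>top_ring A\<^esub>"
  proof (rule mi.right_mult_faithful)
    show "v \<triangleleft>\<^bsub>V\<^esub> (z \<ominus>\<^bsub>top_ring A\<^esub> z') = \<zero>\<^bsub>V\<^esub>" if v: "v \<in> carrier V" for v
      using additive_minus[OF S.abelian_group_axioms V_group rsmult_additive[OF v] assms(1,2)]
        eq[OF v] rsm(1)[OF v assms(2)] by (simp add: a_minus_def mi.VW.V.M.r_neg)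
  qed (use assms in simp)
  then show ?thesis using S.minus_eq_zero_iff[OF assms(1,2)] by simp
qed

lemma pi_eqD:
  assumes f: "f \<in> Z d" and g: "g \<in> Z d" and eq: "\<pi> f = \<pi> g"
  shows "f \<ominus>\<^bsub>H d\<^esub> g \<in> Bd d"
proof -
  have dZ: "f \<ominus>\<^bsub>H d\<^esub> g \<in> Z d" by (rule Z_minus[OF f g])
  have "(f \<ominus>\<^bsub>H d\<^esub> g) \<oplus>\<^bsub>H d\<^esub> g = f"
    using Z_H[OF f] Z_H[OF g] by (simp add: a_minus_def H.a_assoc H.l_neg)
  then have "\<pi> (f \<ominus>\<^bsub>H d\<^esub> g) \<oplus>\<^bsub>V\<^esub> \<pi> g = \<pi> g" using piD(3)[OF dZ g] eq by simp
  then have "\<pi> (f \<ominus>\<^bsub>H d\<^esub> g) = \<zero>\<^bsub>V\<^esub>" using piD(1)[OF dZ] piD(1)[OF g] by simp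
  then show ?thesis using piD(4)[OF dZ] by simp
qed

lemma pi_operator_cong:
  assumes T_Z: "\<And>f. f \<in> Z d \<Longrightarrow> T f \<in> Z d" and T_Bd: "\<And>f. f \<in> Bd d \<Longrightarrow> T f \<in> Bd d"
    and T_add: "\<And>f g. f \<in> carrier (H d) \<Longrightarrow> g \<in> carrier (H d) \<Longrightarrow> T (f \<oplus>\<^bsub>H d\<^esub> g) = T f \<oplus>\<^bsub>H d\<^esub> T g"
    and f: "f \<in> Z d" and g: "g \<in> Z d" and eq: "\<pi> f = \<pi> g"
  shows "\<pi> (T f) = \<pi> (T g)"
proof -
  define b where "b = f \<ominus>\<^bsub>H d\<^esub> g"
  have b: "b \<in> Bd d" unfolding b_def by (rule pi_eqD[OF f g eq])
  have f_eq: "b \<oplus>\<^bsub>H d\<^esub> g = f"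
    using Z_H[OF f] Z_H[OF g] by (simp add: b_def a_minus_def H.a_assoc H.l_neg)
  have Tb: "T b \<in> Bd d" by (rule T_Bd[OF b])
  then have TbZ: "T b \<in> Z d" using Bd_Z by blast
  have "T f = T b \<oplus>\<^bsub>H d\<^esub> T g" using T_add[OF Bd_H[OF b] Z_H[OF g]] f_eq by simp
  then have "\<pi> (T f) = \<pi> (T b) \<oplus>\<^bsub>V\<^esub> \<pi> (T g)" using piD(3)[OF TbZ T_Z[OF g]] by simp
  moreover have "\<pi> (T b) = \<zero>\<^bsub>V\<^esub>" using piD(4)[OF TbZ] Tb by simp
  ultimately show ?thesis using piD(1)[OF T_Z[OF g]] by simp
qed

text \<open>
  Multiplying components commutes with precomposition by lifts of degree 0, through which \<open>S\<close> acts from the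
  left. So on \<open>V\<close> it is a left linear endomorphism.
\<close>

lemma seq_action_exists:
  assumes r: "\<And>k. r k \<in> carrier A"
  shows "\<exists>z. z \<in> carrier (top_ring A) \<and> (\<forall>f\<in>Z d. \<pi> (seq_mult d r f) = \<pi> f \<triangleleft>\<^bsub>V\<^esub> z)"
proof -
  define e where "e v = \<pi> (seq_mult d r (SOME f. f \<in> Z d \<and> \<pi> f = v))" for v
  have e: "e (\<pi> f) = \<pi> (seq_mult d r f)" if f: "f \<in> Z d" for f
  proof -
    have "\<exists>g. g \<in> Z d \<and> \<pi> g = \<pi> f" using f by (intro exI[of _ f]) simp
    then have g: "(SOME g. g \<in> Z d \<and> \<pi> g = \<pi> f) \<in> Z d \<and> \<pi> (SOME g. g \<in> Z d \<and> \<pi> g = \<pi> f) = \<pi> f"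
      by (rule someI_ex)
    show ?thesis
      unfolding e_def
      by (rule pi_operator_cong[of "seq_mult d r", OF seq_mult_Z[of r, OF r] seq_mult_Bd[of r, OF r]
            seq_mult_add[of r, OF r]]) (use g f in auto)
  qed
  have rep: "\<exists>f\<in>Z d. v = \<pi> f" if "v \<in> carrier V" for v using piD(2)[OF that] by auto
  have add: "additive V V e"
  proof (rule additive_onI)
    fix v assume v: "v \<in> carrier V"
    obtain f where f: "f \<in> Z d" "v = \<pi> f" using rep[OF v] by (elim bexE)
    show "e v \<in> carrier V" unfolding f(2) e[OF f(1)] by (rule piD(1)[OF seq_mult_Z[of r, OF r f(1)]])
    fix w assume w: "w \<in> carrier V"
    obtain g where g: "g \<in> Z d" "w = \<pi> g" using rep[OF w] by (elim bexE)
    show "e (v \<oplus>\<^bsub>V\<^esub> w) = e v \<oplus>\<^bsub>V\<^esub> e w"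
      unfolding f(2) g(2) e[OF f(1)] e[OF g(1)] piD(3)[OF f(1) g(1), symmetric] e[OF Z_add[OF f(1) g(1)]]
        seq_mult_add[of r, OF r Z_H[OF f(1)] Z_H[OF g(1)]]
      by (rule piD(3)[OF seq_mult_Z[of r, OF r f(1)] seq_mult_Z[of r, OF r g(1)]])
  qed
  have lin: "e (s \<odot>\<^bsub>V\<^esub> v) = s \<odot>\<^bsub>V\<^esub> e v" if s: "s \<in> carrier (top_ring A)" and v: "v \<in> carrier V" for s v
  proof -
    obtain f where f: "f \<in> Z d" "v = \<pi> f" using rep[OF v] by (elim bexE)
    obtain \<phi> where \<phi>: "is_lift A P \<delta> \<epsilon> (\<lambda>x. x \<otimes>\<^bsub>top_ring A\<^esub> s) \<phi>" using lift_exists[OF s] by (elim exE)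
    show ?thesis
      unfolding f(2) e[OF f(1)] piD(6)[OF f(1) s \<phi>, symmetric] e[OF pull_lift_Z[OF \<phi> f(1)]]
        seq_mult_pull[of r, OF r Z_H[OF f(1)] is_liftD(1)[OF \<phi>]]
      by (rule piD(6)[OF seq_mult_Z[of r, OF r f(1)] s \<phi>])
  qed
  obtain z where z: "z \<in> carrier (top_ring A)" "\<And>v. v \<in> carrier V \<Longrightarrow> e v = v \<triangleleft>\<^bsub>V\<^esub> z"
    using mi.left_linear_endomorphism[OF add lin] by blast
  have "\<forall>f\<in>Z d. \<pi> (seq_mult d r f) = \<pi> f \<triangleleft>\<^bsub>V\<^esub> z" using z(2) e piD(1) by simp
  with z(1) show ?thesis by (intro exI[of _ z] conjI)
qed

definition seq_action :: "(int \<Rightarrow> 'a) \<Rightarrow> 'a set"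
  where "seq_action r = (SOME z. z \<in> carrier (top_ring A) \<and> (\<forall>f\<in>Z d. \<pi> (seq_mult d r f) = \<pi> f \<triangleleft>\<^bsub>V\<^esub> z))"

lemma seq_action:
  assumes "\<And>k. r k \<in> carrier A"
  shows "seq_action r \<in> carrier (top_ring A)" "f \<in> Z d \<Longrightarrow> \<pi> (seq_mult d r f) = \<pi> f \<triangleleft>\<^bsub>V\<^esub> seq_action r"
proof -
  have "seq_action r \<in> carrier (top_ring A) \<and> (\<forall>f\<in>Z d. \<pi> (seq_mult d r f) = \<pi> f \<triangleleft>\<^bsub>V\<^esub> seq_action r)"
    unfolding seq_action_def using seq_action_exists[of r, OF assms] by (rule someI_ex)
  then show "seq_action r \<in> carrier (top_ring A)" "f \<in> Z d \<Longrightarrow> \<pi> (seq_mult d r f) = \<pi> f \<triangleleft>\<^bsub>V\<^esub> seq_action r"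
    by blast+
qed

lemma seq_action_eqI:
  assumes r: "\<And>k. r k \<in> carrier A" and z: "z \<in> carrier (top_ring A)"
    and eq: "\<And>f. f \<in> Z d \<Longrightarrow> \<pi> (seq_mult d r f) = \<pi> f \<triangleleft>\<^bsub>V\<^esub> z"
  shows "seq_action r = z"
proof (rule faithful_eqI[OF seq_action(1)[of r, OF r] z])
  fix v assume "v \<in> carrier V"
  then obtain f where f: "f \<in> Z d" "\<pi> f = v" using piD(2) by blast
  show "v \<triangleleft>\<^bsub>V\<^esub> seq_action r = v \<triangleleft>\<^bsub>V\<^esub> z" using seq_action(2)[of r, OF r f(1)] eq[OF f(1)] f(2) by simp
qed

lemma seq_action_const: "a \<in> carrier A \<Longrightarrow> seq_action (\<lambda>_. a) = to_top A a"
  by (rule seq_action_eqI) (simp_all add: top_closed seq_mult_const Z_H piD(5))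

lemma seq_action_add:
  assumes r: "\<And>k. r k \<in> carrier A" and r': "\<And>k. r' k \<in> carrier A"
  shows "seq_action (\<lambda>k. r k \<oplus> r' k) = seq_action r \<oplus>\<^bsub>top_ring A\<^esub> seq_action r'"
proof (rule seq_action_eqI)
  fix f assume f: "f \<in> Z d"
  show "\<pi> (seq_mult d (\<lambda>k. r k \<oplus> r' k) f) = \<pi> f \<triangleleft>\<^bsub>V\<^esub> (seq_action r \<oplus>\<^bsub>top_ring A\<^esub> seq_action r')"
    unfolding seq_mult_plus[of r r', OF r r' Z_H[OF f]]
    using piD(3)[OF seq_mult_Z[of r, OF r f] seq_mult_Z[of r', OF r' f]]
      rsm(2)[OF piD(1)[OF f] seq_action(1)[of r, OF r] seq_action(1)[of r', OF r']]
      seq_action(2)[of r, OF r f] seq_action(2)[of r', OF r' f] by simp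
qed (use r r' seq_action(1)[of r, OF r] seq_action(1)[of r', OF r'] in simp_all)

lemma seq_action_diff_zero:
  assumes r: "\<And>k. r k \<in> carrier A" and r': "\<And>k. r' k \<in> carrier A"
    and 0: "seq_action (\<lambda>k. r k \<ominus> r' k) = \<zero>\<^bsub>top_ring A\<^esub>"
  shows "seq_action r = seq_action r'"
proof -
  have "(\<lambda>k. (r k \<ominus> r' k) \<oplus> r' k) = r"
    using r r' by (simp add: a_minus_def A.a_assoc A.l_neg)
  then have "seq_action r = seq_action (\<lambda>k. r k \<ominus> r' k) \<oplus>\<^bsub>top_ring A\<^esub> seq_action r'"
    using seq_action_add[of "\<lambda>k. r k \<ominus> r' k" r'] r r' by simp
  then show ?thesis using 0 seq_action(1)[of r', OF r'] by simp
qed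

lemma seq_action_mult:
  assumes r: "\<And>k. r k \<in> grade A 0" and r': "\<And>k. r' k \<in> carrier A"
  shows "seq_action (\<lambda>k. r k \<otimes> r' k) = seq_action r \<otimes>\<^bsub>top_ring A\<^esub> seq_action r'"
proof -
  have rc: "r k \<in> carrier A" for k using r grade_carrier by blast
  note l = seq_action(1)[of r, OF rc] and l' = seq_action(1)[of r', OF r']
  show ?thesis
  proof (rule seq_action_eqI)
    fix f assume f: "f \<in> Z d"
    show "\<pi> (seq_mult d (\<lambda>k. r k \<otimes> r' k) f) = \<pi> f \<triangleleft>\<^bsub>V\<^esub> (seq_action r \<otimes>\<^bsub>top_ring A\<^esub> seq_action r')"
      unfolding seq_mult_seq_mult[of r' r, OF r' r Z_H[OF f], symmetric]
        seq_action(2)[of r', OF r' seq_mult_Z[of r, OF rc f]] seq_action(2)[of r, OF rc f]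
      by (rule rsm(4)[OF piD(1)[OF f] l l', symmetric])
  qed (use rc r' l l' in simp_all)
qed

definition scalar :: "'k \<Rightarrow> 'a" where "scalar c = c \<odot> \<one>"

lemma scalar:
  assumes "c \<in> carrier K"
  shows "scalar c \<in> grade A 0" "scalar c \<in> carrier A" "x \<in> carrier A \<Longrightarrow> scalar c \<otimes> x = c \<odot> x"
  using grade_smult[OF assms one_grade] grade_carrier[OF grade_smult[OF assms one_grade]] assms
  by (simp_all add: scalar_def smult_mult_left)

lemma seq_action_smult:
  assumes c: "c \<in> carrier K" and r: "\<And>k. r k \<in> carrier A"
  shows "seq_action (\<lambda>k. c \<odot> r k) = to_top A (scalar c) \<otimes>\<^bsub>top_ring A\<^esub> seq_action r"
  using seq_action_mult[of "\<lambda>_. scalar c" r, OF scalar(1)[OF c] r] seq_action_const[OF scalar(2)[OF c]]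
    scalar(3)[OF c r] by simp

lemma seq_action_scaled_const:
  assumes c: "\<And>k. c k \<in> carrier K" and b: "b \<in> carrier A"
  shows "seq_action (\<lambda>k. c k \<odot> b) = seq_action (\<lambda>k. scalar (c k)) \<otimes>\<^bsub>top_ring A\<^esub> to_top A b"
proof -
  have "(\<lambda>k. scalar (c k) \<otimes> b) = (\<lambda>k. c k \<odot> b)" using scalar(3)[OF c b] by simp
  then show ?thesis
    using seq_action_mult[of "\<lambda>k. scalar (c k)" "\<lambda>_. b", OF scalar(1)[OF c]] b seq_action_const[OF b] by simp
qed

lemma combinations_Cons_seq:
  assumes "\<And>k. r k \<in> combinations (b # bs)"
  obtains c s where "\<And>k. c k \<in> carrier K" "\<And>k. s k \<in> combinations bs" "r = (\<lambda>k. c k \<odot> b \<oplus> s k)"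
proof -
  have "\<forall>k. \<exists>cs. fst cs \<in> carrier K \<and> snd cs \<in> combinations bs \<and> r k = fst cs \<odot> b \<oplus> snd cs"
  proof
    fix k
    obtain c s where "c \<in> carrier K" "s \<in> combinations bs" "r k = c \<odot> b \<oplus> s"
      by (rule combinations_ConsE[OF assms[of k]])
    then show "\<exists>cs. fst cs \<in> carrier K \<and> snd cs \<in> combinations bs \<and> r k = fst cs \<odot> b \<oplus> snd cs"
      by (intro exI[of _ "(c, s)"]) simp
  qed
  from choice[OF this] obtain f where
    f: "\<forall>k. fst (f k) \<in> carrier K \<and> snd (f k) \<in> combinations bs \<and> r k = fst (f k) \<odot> b \<oplus> snd (f k)"
    by (elim exE)
  show ?thesis
    by (rule that[of "\<lambda>k. fst (f k)" "\<lambda>k. snd (f k)"]) (use f in auto)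
qed

text \<open>
  Infinitely many components are multiplied at once, so it is not enough that each \<open>r\<^sub>k\<close> is in the
  radical. The values lie in one finitely spanned space, and collecting coefficients leaves finitely
  many right multiplications by radical elements, each applied to a cocycle with rescaled components.
\<close>

lemma seq_action_combinations_J:
  assumes "set bs \<subseteq> J" "\<And>k. r k \<in> combinations bs"
  shows "seq_action r = \<zero>\<^bsub>top_ring A\<^esub>"
  using assms
proof (induction bs arbitrary: r)
  case Nil
  then have "r = (\<lambda>_. \<zero>)" by auto
  then show ?case using seq_action_const[OF A.zero_closed] top_zero by simp
next
  case (Cons b bs)
  obtain c s where c: "\<And>k. c k \<in> carrier K" and s: "\<And>k. s k \<in> combinations bs"
    and r: "r = (\<lambda>k. c k \<odot> b \<oplus> s k)"
    by (rule combinations_Cons_seq[of r b bs, OF Cons.prems(2)]) blast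
  have b: "b \<in> J" "b \<in> carrier A" and bs: "set bs \<subseteq> J" "set bs \<subseteq> carrier A"
    using Cons.prems(1) JD(1) by auto
  have sc: "s k \<in> carrier A" for k by (rule combinations_closed[OF bs(2) s])
  have "seq_action r = seq_action (\<lambda>k. c k \<odot> b) \<oplus>\<^bsub>top_ring A\<^esub> seq_action s"
    unfolding r by (rule seq_action_add) (use c b sc in simp_all)
  moreover have "seq_action s = \<zero>\<^bsub>top_ring A\<^esub>" by (rule Cons.IH[OF bs(1) s])
  moreover have "seq_action (\<lambda>k. c k \<odot> b) = \<zero>\<^bsub>top_ring A\<^esub>"
    using seq_action_scaled_const[of c b, OF c b(2)] top_eq_zero_iff[OF b(2)] b(1)
      seq_action(1)[of "\<lambda>k. scalar (c k)", OF scalar(2)[OF c]] by simp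
  ultimately show ?case by simp
qed

lemma seq_action_J:
  assumes r: "\<And>k. r k \<in> J" "\<And>k. r k \<in> grade A n"
  shows "seq_action r = \<zero>\<^bsub>top_ring A\<^esub>"
proof -
  obtain bs where bs: "set bs \<subseteq> J \<inter> grade A n" "J \<inter> grade A n \<subseteq> combinations bs"
    using J_grade_combinations[OF locally_finite, of n] by (elim exE conjE)
  show ?thesis by (rule seq_action_combinations_J[of bs]) (use bs r in auto)
qed

lemma seq_action_cong_J:
  assumes r: "\<And>k. r k \<in> grade A 0" and r': "\<And>k. r' k \<in> grade A 0"
    and eq: "\<And>k. to_top A (r k) = to_top A (r' k)"
  shows "seq_action r = seq_action r'"
proof (rule seq_action_diff_zero)
  have c: "r k \<in> carrier A" "r' k \<in> carrier A" for k using r r' grade_carrier by blast+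
  then show "r k \<in> carrier A" "r' k \<in> carrier A" for k by blast+
  show "seq_action (\<lambda>k. r k \<ominus> r' k) = \<zero>\<^bsub>top_ring A\<^esub>"
    by (rule seq_action_J[of _ 0]) (use top_eq_iff[OF c] eq minus_grade r r' in auto)
qed

end

section \<open>Equivariance under the automorphism\<close>

context graded_flow
begin

text \<open>
  Restriction of scalars along \<open>t\<^sub>m\<close>. A map to this module is a \<open>t\<^sub>m\<close>-semilinear map to \<open>M\<close>.
\<close>

definition conj_module :: "int \<Rightarrow> ('a, 'n) graded_module \<Rightarrow> ('a, 'n) graded_module"
  where "conj_module m M = M\<lparr>smult := \<lambda>a x. t m a \<odot>\<^bsub>M\<^esub> x\<rparr>"

lemma conj_module_simps:
  "carrier (conj_module m M) = carrier M" "ring.add (conj_module m M) = ring.add M"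
  "\<zero>\<^bsub>conj_module m M\<^esub> = \<zero>\<^bsub>M\<^esub>" "homog (conj_module m M) = homog M"
  "a \<odot>\<^bsub>conj_module m M\<^esub> x = t m a \<odot>\<^bsub>M\<^esub> x"
  by (simp_all add: conj_module_def)

lemma conj_module_graded:
  assumes "graded_left_module A M" shows "graded_left_module A (conj_module m M)"
proof -
  interpret M: left_module A M using assms by (rule graded_left_moduleD)
  note same = conj_module_simps(1-3)[of m M]
  have "left_module A (conj_module m M)"
    by (intro left_module.intro left_module_axioms.intro A.ring_axioms
        same_group_abelian[OF same M.M.abelian_group_axioms])
      (simp_all add: conj_module_simps t_closed t_add t_mult t_one M.smult_closed M.smult_l_distr
        M.smult_r_distr M.smult_assoc M.smult_one)
  moreover have "direct_sum_decomposition (conj_module m M) (homog (conj_module m M))"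
    using assms same_group_decomposition[OF same, of "homog M"]
    by (simp add: conj_module_simps graded_left_module_def)
  moreover have "\<forall>k n. \<forall>a\<in>grade A k. \<forall>x\<in>homog (conj_module m M) n.
      a \<odot>\<^bsub>conj_module m M\<^esub> x \<in> homog (conj_module m M) (int k + n)"
    using graded_left_moduleD(4)[OF assms] t_grade by (simp add: conj_module_simps)
  ultimately show ?thesis unfolding graded_left_module_def by (intro conjI)
qed

lemma conj_module_maps:
  assumes "f \<in> graded_maps A M N" shows "f \<in> graded_maps A (conj_module m M) (conj_module m N)"
  by (rule graded_mapsI)
    (use graded_mapsD(1-4)[OF assms] in \<open>simp_all add: conj_module_simps t_closed\<close>)

lemma conj_module_resolution:
  assumes "graded_resolution A M Q \<delta> \<epsilon>"
  shows "graded_resolution A (conj_module m M) (\<lambda>i. conj_module m (Q i)) \<delta> \<epsilon>"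
proof -
  note R = assms[unfolded graded_resolution_def]
  note D = graded_resolutionD[OF assms]
  show ?thesis
    unfolding graded_resolution_def conj_module_simps
    by (intro conjI allI conj_module_graded[OF D(1)] conj_module_graded[OF D(2)]
        conj_module_maps[OF D(3)] conj_module_maps[OF D(4)]; insert R; elim conjE; (assumption | erule spec))
qed

text \<open>
  The automorphism of \<open>S\<close> induced by \<open>t\<^sub>m\<close>.
\<close>

definition top_map :: "int \<Rightarrow> 'a set \<Rightarrow> 'a set"
  where "top_map m C = to_top A (t m (SOME a. a \<in> carrier A \<and> to_top A a = C))"

lemma top_map_top:
  assumes a: "a \<in> carrier A" shows "top_map m (to_top A a) = to_top A (t m a)"
proof -
  have "\<exists>b. b \<in> carrier A \<and> to_top A b = to_top A a" using a by (intro exI[of _ a]) simp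
  then have b: "(SOME b. b \<in> carrier A \<and> to_top A b = to_top A a) \<in> carrier A \<and>
      to_top A (SOME b. b \<in> carrier A \<and> to_top A b = to_top A a) = to_top A a"
    by (rule someI_ex)
  show ?thesis unfolding top_map_def by (rule top_t_cong) (use a b in auto)
qed

lemma top_map_graded: "top_map m \<in> graded_maps A (top_module A) (conj_module m (top_module A))"
proof (rule graded_mapsI)
  fix x assume "x \<in> carrier (top_module A)"
  then obtain a where a: "a \<in> carrier A" "x = to_top A a" by (auto simp: top_surj)
  show "top_map m x \<in> carrier (conj_module m (top_module A))"
    using a by (simp add: top_map_top conj_module_simps top_closed t_closed)
  show "top_map m (b \<odot>\<^bsub>top_module A\<^esub> x) = b \<odot>\<^bsub>conj_module m (top_module A)\<^esub> top_map m x"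
    if b: "b \<in> carrier A" for b
    using a b top_map_top[of "b \<otimes> a" m]
    by (simp add: top_map_top conj_module_simps t_closed t_mult top_mult)
  fix y assume "y \<in> carrier (top_module A)"
  then obtain b where b: "b \<in> carrier A" "y = to_top A b" by (auto simp: top_surj)
  show "top_map m (x \<oplus>\<^bsub>top_module A\<^esub> y) = top_map m x \<oplus>\<^bsub>conj_module m (top_module A)\<^esub> top_map m y"
    using a b top_map_top[of "a \<oplus> b" m]
    by (simp add: top_map_top conj_module_simps t_closed t_add top_add)
next
  fix n x assume x: "x \<in> homog (top_module A) n"
  have 0: "top_map m \<zero>\<^bsub>top_ring A\<^esub> = \<zero>\<^bsub>top_ring A\<^esub>"
    using top_map_top[OF A.zero_closed, of m] by (simp add: top_zero t_zero)
  have "top_map m x \<in> carrier (top_ring A)" if "x \<in> carrier (top_ring A)" for x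
    using that by (auto simp: top_surj top_map_top t_closed)
  then show "top_map m x \<in> homog (conj_module m (top_module A)) n"
    using x 0 by (auto simp: conj_module_simps top_module_homog split: if_splits)
qed

end

context presented_top
begin

definition semilinear_lift :: "int \<Rightarrow> (nat \<Rightarrow> 'm \<Rightarrow> 'm) \<Rightarrow> bool"
  where "semilinear_lift m \<psi> \<longleftrightarrow> (\<forall>i. \<psi> i \<in> graded_maps A (P i) (conj_module m (P i))) \<and>
    (\<forall>x\<in>carrier (P 0). \<epsilon> (\<psi> 0 x) = top_map m (\<epsilon> x)) \<and>
    (\<forall>i. \<forall>x\<in>carrier (P (Suc i)). \<delta> i (\<psi> (Suc i) x) = \<psi> i (\<delta> i x))"

lemma semilinear_lift_exists: "\<exists>\<psi>. semilinear_lift m \<psi>"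
proof -
  obtain \<psi> where "\<And>i. \<psi> i \<in> graded_maps A (P i) (conj_module m (P i))"
    "\<And>x. x \<in> carrier (P 0) \<Longrightarrow> \<epsilon> (\<psi> 0 x) = top_map m (\<epsilon> x)"
    "\<And>i x. x \<in> carrier (P (Suc i)) \<Longrightarrow> \<delta> i (\<psi> (Suc i) x) = \<psi> i (\<delta> i x)"
    by (rule comparison_exists[where A = A and P = P and Q = "\<lambda>i. conj_module m (P i)"
          and M = "top_module A" and N = "conj_module m (top_module A)" and \<delta> = \<delta> and \<epsilon> = \<epsilon>
          and \<gamma> = \<delta> and \<eta> = \<epsilon>, OF grade_subset resolution projective
          conj_module_resolution[OF resolution] top_map_graded]) blast
  then have "semilinear_lift m \<psi>" by (simp add: semilinear_lift_def)
  then show ?thesis by (rule exI[of _ \<psi>])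
qed

lemma semilinear_liftD:
  assumes "semilinear_lift m \<psi>"
  shows "x \<in> carrier (P i) \<Longrightarrow> \<psi> i x \<in> carrier (P i)"
    "x \<in> carrier (P i) \<Longrightarrow> y \<in> carrier (P i) \<Longrightarrow> \<psi> i (x \<oplus>\<^bsub>P i\<^esub> y) = \<psi> i x \<oplus>\<^bsub>P i\<^esub> \<psi> i y"
    "a \<in> carrier A \<Longrightarrow> x \<in> carrier (P i) \<Longrightarrow> \<psi> i (a \<odot>\<^bsub>P i\<^esub> x) = t m a \<odot>\<^bsub>P i\<^esub> \<psi> i x"
    "x \<in> homog (P i) n \<Longrightarrow> \<psi> i x \<in> homog (P i) n"
    "x \<in> carrier (P 0) \<Longrightarrow> \<epsilon> (\<psi> 0 x) = top_map m (\<epsilon> x)"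
    "x \<in> carrier (P (Suc i)) \<Longrightarrow> \<delta> i (\<psi> (Suc i) x) = \<psi> i (\<delta> i x)"
proof -
  have \<psi>: "\<psi> i \<in> graded_maps A (P i) (conj_module m (P i))" using assms by (simp add: semilinear_lift_def)
  note D = graded_mapsD(1-4)[OF \<psi>, unfolded conj_module_simps]
  show "x \<in> carrier (P i) \<Longrightarrow> \<psi> i x \<in> carrier (P i)" by (rule D(1))
  show "x \<in> carrier (P i) \<Longrightarrow> y \<in> carrier (P i) \<Longrightarrow> \<psi> i (x \<oplus>\<^bsub>P i\<^esub> y) = \<psi> i x \<oplus>\<^bsub>P i\<^esub> \<psi> i y" by (rule D(2))
  show "a \<in> carrier A \<Longrightarrow> x \<in> carrier (P i) \<Longrightarrow> \<psi> i (a \<odot>\<^bsub>P i\<^esub> x) = t m a \<odot>\<^bsub>P i\<^esub> \<psi> i x" by (rule D(3))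
  show "x \<in> homog (P i) n \<Longrightarrow> \<psi> i x \<in> homog (P i) n" by (rule D(4))
  show "x \<in> carrier (P 0) \<Longrightarrow> \<epsilon> (\<psi> 0 x) = top_map m (\<epsilon> x)" using assms by (simp add: semilinear_lift_def)
  show "x \<in> carrier (P (Suc i)) \<Longrightarrow> \<delta> i (\<psi> (Suc i) x) = \<psi> i (\<delta> i x)"
    using assms by (simp add: semilinear_lift_def)
qed

text \<open>
  The action of \<open>\<tau>\<^sup>-\<^sup>m\<close> on \<open>Hom(P, A)\<close>, with \<open>\<psi>\<close> in the role of \<open>\<tau>\<^sup>m\<close> on the resolution.
\<close>

definition transport :: "int \<Rightarrow> (nat \<Rightarrow> 'm \<Rightarrow> 'm) \<Rightarrow> nat \<Rightarrow> ('m \<Rightarrow> 'a) \<Rightarrow> 'm \<Rightarrow> 'a"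
  where "transport m \<psi> i f = restrict (\<lambda>x. t (- m) (f (\<psi> i x))) (carrier (P i))"

context
  fixes m \<psi> assumes \<psi>: "semilinear_lift m \<psi>"
begin

lemmas \<psi>D = semilinear_liftD[OF \<psi>]

lemma transport_H:
  assumes f: "f \<in> carrier (H i)" shows "transport m \<psi> i f \<in> carrier (H i)"
proof -
  interpret Pi: left_module A "P i" by (rule P_modD)
  show ?thesis
    using f by (simp add: hom_group_carrier transport_def additive_on_def \<psi>D Pi.smult_closed t_closed
        t_add t_mult t_inverse)
qed

lemma transport_add:
  assumes f: "f \<in> carrier (H i)" and g: "g \<in> carrier (H i)"
  shows "transport m \<psi> i (f \<oplus>\<^bsub>H i\<^esub> g) = transport m \<psi> i f \<oplus>\<^bsub>H i\<^esub> transport m \<psi> i g"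
  unfolding hom_group_simps transport_def
  by (rule restrict_ext) (simp add: \<psi>D(1) t_add H_closed[OF f] H_closed[OF g])

lemma transport_pull:
  "transport m \<psi> (Suc i) (pull (Suc i) g (\<delta> i)) = pull (Suc i) (transport m \<psi> i g) (\<delta> i)"
  unfolding compose_def transport_def
  by (rule restrict_ext) (simp add: \<psi>D(1,6) graded_mapsD(1)[OF resD(4)])

lemma transport_Z:
  assumes f: "f \<in> Z i" shows "transport m \<psi> i f \<in> Z i"
proof -
  have "transport m \<psi> i f (\<delta> i x) = \<zero>" if x: "x \<in> carrier (P (Suc i))" for x
    using f \<psi>D(1)[OF x] \<psi>D(6)[OF x, symmetric] graded_mapsD(1)[OF resD(4) x]
    by (simp add: transport_def cocycle_iff t_zero)
  then show ?thesis using transport_H[OF Z_H[OF f]] by (simp add: cocycle_iff)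
qed

lemma transport_Bd:
  assumes f: "f \<in> Bd i" shows "transport m \<psi> i f \<in> Bd i"
proof (cases i)
  case 0
  then have "f = \<zero>\<^bsub>H 0\<^esub>" using f by simp
  then show ?thesis
    using 0 transport_H[OF H.zero_closed, of 0]
    by (intro zero_function_Bd) (simp_all add: transport_def hom_group_simps \<psi>D(1) t_zero)
next
  case (Suc j)
  obtain g where g: "g \<in> carrier (H j)" "f = pull (Suc j) g (\<delta> j)" using f Suc by (auto elim: Bd_SucE)
  then show ?thesis using Bd_SucI[OF transport_H[OF g(1)]] transport_pull[of j g] Suc by simp
qed

lemma transport_right_mult:
  assumes f: "f \<in> carrier (H i)" and a: "a \<in> carrier A"
  shows "transport m \<psi> i (right_mult i a f) = right_mult i (t (- m) a) (transport m \<psi> i f)"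
  unfolding transport_def right_mult_def
  by (rule restrict_ext) (simp add: \<psi>D(1) t_mult a H_closed[OF f])

lemma transport_seq_mult:
  assumes f: "f \<in> carrier (H i)" and r: "\<And>k. r k \<in> carrier A"
  shows "transport m \<psi> i (seq_mult i (\<lambda>k. t m (r k)) f) = seq_mult i r (transport m \<psi> i f)"
proof -
  have tr: "t m (r k) \<in> carrier A" for k by (rule t_closed[OF r])
  note F = seq_mult_H[of "\<lambda>k. t m (r k)", OF tr f]
  have w: "additive A A (\<lambda>y. y \<otimes> r k)" for k by (rule additive_mult_right[OF r])
  have w': "additive A A (\<lambda>y. y \<otimes> t m (r k))" for k by (rule additive_mult_right[OF tr])
  have Tf: "additive (P i) A (transport m \<psi> i f)" by (rule H_additive[OF transport_H[OF f]])
  have TF: "additive (P i) A (transport m \<psi> i (seq_mult i (\<lambda>k. t m (r k)) f))"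
    by (rule H_additive[OF transport_H[OF F]])
  have "compwise (P i) (\<lambda>k y. y \<otimes> r k) (transport m \<psi> i f) = transport m \<psi> i (seq_mult i (\<lambda>k. t m (r k)) f)"
  proof (rule Pd.compwise_eqI[OF w Tf TF])
    show "transport m \<psi> i (seq_mult i (\<lambda>k. t m (r k)) f) \<in> extensional (carrier (P i))"
      by (simp add: transport_def)
    fix n x y assume x: "x \<in> homog (P i) n" and y: "transport m \<psi> i f x = y"
    have xc: "x \<in> carrier (P i)" using x by (rule Pd.P.grade_carrier)
    have px: "\<psi> i x \<in> homog (P i) n" by (rule \<psi>D(4)[OF x])
    have eq: "shifted (\<lambda>k y. y \<otimes> r k) n (t (- m) z) =
        t (- m) (shifted (\<lambda>k y. y \<otimes> t m (r k)) n z)" if "z \<in> carrier A" for z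
    proof (rule additive_eqI[OF additive_comp[OF t_additive shifted_additive[OF w]]
          additive_comp[OF shifted_additive[OF w'] t_additive] _ that])
      fix l z assume z: "z \<in> grade A l"
      show "shifted (\<lambda>k y. y \<otimes> r k) n (t (- m) z) =
          t (- m) (shifted (\<lambda>k y. y \<otimes> t m (r k)) n z)"
        using shifted_grade[of "\<lambda>k y. y \<otimes> r k", OF w t_grade[OF z, of "- m"], of n]
          shifted_grade[of "\<lambda>k y. y \<otimes> t m (r k)", OF w' z, of n] grade_carrier[OF z]
        by (simp add: t_mult t_closed r t_inverse)
    qed
    have "transport m \<psi> i (seq_mult i (\<lambda>k. t m (r k)) f) x =
        t (- m) (shifted (\<lambda>k y. y \<otimes> t m (r k)) n (f (\<psi> i x)))"
      using xc Pd.compwise_homog[where w = "\<lambda>k y. y \<otimes> t m (r k)", OF w' H_additive[OF f] px]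
      by (simp add: transport_def seq_mult_def)
    also have "\<dots> = shifted (\<lambda>k y. y \<otimes> r k) n y"
      using eq[OF H_closed[OF f \<psi>D(1)[OF xc]]] xc y by (simp add: transport_def)
    finally show "shifted (\<lambda>k y. y \<otimes> r k) n y = transport m \<psi> i (seq_mult i (\<lambda>k. t m (r k)) f) x" ..
  qed
  then show ?thesis by (simp add: seq_mult_def)
qed

end

text \<open>
  A semilinear lift for \<open>-m\<close> after one for \<open>m\<close> is a lift of the identity of \<open>S\<close>, which acts on
  \<open>Ext\<close> as \<open>1 \<in> S\<close> does.
\<close>

lemma transport_surjective:
  assumes \<psi>: "semilinear_lift m \<psi>" and f: "f \<in> Z d"
  shows "\<exists>f'\<in>Z d. \<pi> (transport m \<psi> d f') = \<pi> f"
proof -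
  obtain \<psi>' where \<psi>': "semilinear_lift (- m) \<psi>'" using semilinear_lift_exists[of "- m"] by (elim exE)
  note D = semilinear_liftD[OF \<psi>] and D' = semilinear_liftD[OF \<psi>']
  define \<phi> where "\<phi> i x = \<psi>' i (\<psi> i x)" for i x
  have eps: "\<epsilon> (\<phi> 0 x) = \<epsilon> x \<otimes>\<^bsub>top_ring A\<^esub> \<one>\<^bsub>top_ring A\<^esub>" if x: "x \<in> carrier (P 0)" for x
  proof -
    have ex: "\<epsilon> x \<in> carrier (top_ring A)" using graded_mapsD(1)[OF resD(3) x] by simp
    then obtain a where a: "a \<in> carrier A" "\<epsilon> x = to_top A a" by (auto simp: top_surj)
    have "\<epsilon> (\<phi> 0 x) = top_map (- m) (top_map m (\<epsilon> x))"
      unfolding \<phi>_def D'(5)[OF D(1)[OF x]] D(5)[OF x] ..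
    also have "\<dots> = \<epsilon> x" using a by (simp add: top_map_top t_closed t_inverse)
    finally show ?thesis using ex by simp
  qed
  have "\<phi> i \<in> graded_maps A (P i) (P i)" for i
    by (rule graded_mapsI) (simp_all add: \<phi>_def D(1-4) D'(1-4) t_closed t_inverse)
  moreover have "\<delta> i (\<phi> (Suc i) x) = \<phi> i (\<delta> i x)" if "x \<in> carrier (P (Suc i))" for i x
    using that by (simp add: \<phi>_def D(1,6) D'(6))
  ultimately have \<phi>: "is_lift A P \<delta> \<epsilon> (\<lambda>x. x \<otimes>\<^bsub>top_ring A\<^esub> \<one>\<^bsub>top_ring A\<^esub>) \<phi>"
    using eps by (simp add: is_lift_def)
  have "transport m \<psi> d (transport (- m) \<psi>' d f) = pull d f (\<phi> d)"
    unfolding transport_def compose_def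
    by (rule restrict_ext) (simp add: D(1) D'(1) \<phi>_def t_inverse H_closed[OF Z_H[OF f]])
  then have "\<pi> (transport m \<psi> d (transport (- m) \<psi>' d f)) = \<pi> f"
    using piD(6)[OF f S.one_closed \<phi>] mi.VW.V.smult_one[OF piD(1)[OF f]] by simp
  then show ?thesis by (rule bexI[OF _ transport_Z[OF \<psi>' f]])
qed

text \<open>
  The transport turns multiplication of components by \<open>t\<^sub>m(r\<^sub>k)\<close> into multiplication by \<open>r\<^sub>k\<close>, and right multiplication by \<open>b\<close>
  into right multiplication by \<open>t\<^sub>-\<^sub>m(b)\<close>. Take for \<open>b\<close> a representative of the element of \<open>S\<close> that
  belongs to the sequence \<open>t\<^sub>m(r\<^sub>k)\<close>.
\<close>

lemma seq_action_equivariant: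
  assumes r: "\<And>k. r k \<in> carrier A" and l: "l \<in> carrier A" and top_l: "to_top A l = seq_action r"
  shows "to_top A (t m l) = seq_action (\<lambda>k. t m (r k))"
proof -
  obtain \<psi> where \<psi>: "semilinear_lift m \<psi>" using semilinear_lift_exists[of m] by (elim exE)
  have tr: "t m (r k) \<in> carrier A" for k by (rule t_closed[OF r])
  obtain b where b: "b \<in> carrier A" "seq_action (\<lambda>k. t m (r k)) = to_top A b"
    using seq_action(1)[of "\<lambda>k. t m (r k)", OF tr] by (auto simp: top_surj)
  have tb: "t (- m) b \<in> carrier A" by (rule t_closed[OF b(1)])
  have "seq_action r = to_top A (t (- m) b)"
  proof (rule faithful_eqI[OF seq_action(1)[of r, OF r] top_closed[OF tb]])
    fix v assume "v \<in> carrier V"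
    then obtain f where f: "f \<in> Z d" "\<pi> f = v" using piD(2) by blast
    obtain g where g: "g \<in> Z d" "\<pi> (transport m \<psi> d g) = v"
      using transport_surjective[OF \<psi> f(1)] f(2) by blast
    note gH = Z_H[OF g(1)]
    let ?T = "transport m \<psi> d" and ?r = "\<lambda>k. t m (r k)"
    have "v \<triangleleft>\<^bsub>V\<^esub> seq_action r = \<pi> (seq_mult d r (?T g))"
      using seq_action(2)[of r, OF r transport_Z[OF \<psi> g(1)]] g(2) by simp
    also have "\<dots> = \<pi> (?T (seq_mult d ?r g))"
      using transport_seq_mult[OF \<psi> gH, of r, OF r] by simp
    also have "\<dots> = \<pi> (?T (right_mult d b g))"
    proof (rule pi_operator_cong[of ?T])
      show "\<pi> (seq_mult d ?r g) = \<pi> (right_mult d b g)"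
        using seq_action(2)[of ?r, OF tr g(1)] piD(5)[OF g(1) b(1)] b(2) by simp
    qed (use transport_Z[OF \<psi>] transport_Bd[OF \<psi>] transport_add[OF \<psi>]
        seq_mult_Z[of ?r, OF tr g(1)] right_mult_Z[OF b(1) g(1)] in auto)
    also have "\<dots> = \<pi> (right_mult d (t (- m) b) (?T g))"
      using transport_right_mult[OF \<psi> gH b(1)] by simp
    also have "\<dots> = v \<triangleleft>\<^bsub>V\<^esub> to_top A (t (- m) b)"
      using piD(5)[OF transport_Z[OF \<psi> g(1)] tb] g(2) by simp
    finally show "v \<triangleleft>\<^bsub>V\<^esub> seq_action r = v \<triangleleft>\<^bsub>V\<^esub> to_top A (t (- m) b)" .
  qed
  then have "to_top A (t m l) = to_top A (t m (t (- m) b))"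
    using top_t_cong[OF l tb, of m] top_l by simp
  then show ?thesis using b by (simp add: t_inverse)
qed

section \<open>The endomorphisms of the top induced by Ext\<close>

text \<open>
  The endomorphism \<open>\<rho>\<^sub>j\<close> of \<open>S\<close>. On the part of degree \<open>k\<close> of \<open>Ext\<close>, the element \<open>\<rho>\<^sub>j(s)\<close> acts from the right
  as \<open>\<tau>\<^sup>j\<^sup>k(s)\<close> does.
\<close>

definition top_twist :: "int \<Rightarrow> 'a set \<Rightarrow> 'a set"
  where "top_twist j s = seq_action (\<lambda>k. t (j * k) (SOME a. a \<in> grade A 0 \<and> to_top A a = s))"

lemma top_twist_top:
  assumes a: "a \<in> grade A 0" shows "top_twist j (to_top A a) = seq_action (\<lambda>k. t (j * k) a)"
proof -
  have "\<exists>b. b \<in> grade A 0 \<and> to_top A b = to_top A a" using a by (intro exI[of _ a]) simp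
  then have b: "(SOME b. b \<in> grade A 0 \<and> to_top A b = to_top A a) \<in> grade A 0 \<and>
      to_top A (SOME b. b \<in> grade A 0 \<and> to_top A b = to_top A a) = to_top A a"
    by (rule someI_ex)
  show ?thesis
    unfolding top_twist_def
  proof (rule seq_action_cong_J)
    show "t (j * k) (SOME b. b \<in> grade A 0 \<and> to_top A b = to_top A a) \<in> grade A 0" for k
      using b by (simp add: t_grade)
    show "t (j * k) a \<in> grade A 0" for k by (rule t_grade[OF a])
    show "to_top A (t (j * k) (SOME b. b \<in> grade A 0 \<and> to_top A b = to_top A a)) = to_top A (t (j * k) a)"
      for k by (rule top_t_cong[OF grade_carrier grade_carrier[OF a]]) (use b in auto)
  qed
qed

lemma top_twist_closed: "s \<in> carrier (top_ring A) \<Longrightarrow> top_twist j s \<in> carrier (top_ring A)"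
  using top_rep[of s] top_twist_top seq_action(1) t_closed grade_carrier by metis

text \<open>
  For a constant sequence \<open>x\<close> both sides are \<open>\<rho>\<^sub>j\<close> of its class. By linearity over scalar sequences the
  claim extends to all sequences in a finitely spanned space: \<open>u\<close> has the same coefficients as \<open>x\<close>, with each
  spanning vector replaced by a representative of its image under \<open>\<rho>\<^sub>j\<close>.
\<close>

lemma top_twist_combinations:
  assumes "set bs \<subseteq> grade A 0" "\<And>k. x k \<in> combinations bs"
  shows "\<exists>u. (\<forall>k. u k \<in> grade A 0) \<and> (\<forall>k. to_top A (u k) = top_twist j (to_top A (x k))) \<and>
    seq_action u = seq_action (\<lambda>k. t (j * k) (x k))"
  using assms
proof (induction bs arbitrary: x)
  case Nil
  then have x: "x = (\<lambda>_. \<zero>)" by auto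
  have "top_twist j \<zero>\<^bsub>top_ring A\<^esub> = \<zero>\<^bsub>top_ring A\<^esub>"
    using top_twist_top[OF zero_grade, of j] seq_action_const[OF A.zero_closed] by (simp add: top_zero t_zero)
  then show ?case by (intro exI[of _ "\<lambda>_. \<zero>"]) (simp add: x zero_grade top_zero t_zero)
next
  case (Cons b bs)
  obtain c s where c: "\<And>k. c k \<in> carrier K" and s: "\<And>k. s k \<in> combinations bs"
    and x: "x = (\<lambda>k. c k \<odot> b \<oplus> s k)"
    by (rule combinations_Cons_seq[of x b bs, OF Cons.prems(2)]) blast
  have b: "b \<in> grade A 0" and bs: "set bs \<subseteq> grade A 0" using Cons.prems(1) by auto
  have bc: "b \<in> carrier A" using b by (rule grade_carrier)
  have bsc: "set bs \<subseteq> carrier A" using bs grade_subset[of 0] by (rule subset_trans)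
  have sc: "s k \<in> carrier A" for k by (rule combinations_closed[OF bsc s])
  have comb_grade: "y \<in> grade A 0" if "y \<in> combinations bs" for y
    using bs that
  proof (induction bs arbitrary: y)
    case Nil then show ?case using zero_grade by simp
  next
    case (Cons b bs)
    obtain c z where "c \<in> carrier K" "z \<in> combinations bs" "y = c \<odot> b \<oplus> z"
      by (rule combinations_ConsE[OF Cons.prems(2)])
    then show ?case using Cons by (simp add: add_grade grade_smult)
  qed
  have s0: "s k \<in> grade A 0" for k by (rule comb_grade[OF s])
  obtain u where u: "\<forall>k. u k \<in> grade A 0" "\<forall>k. to_top A (u k) = top_twist j (to_top A (s k))"
    "seq_action u = seq_action (\<lambda>k. t (j * k) (s k))"
    using Cons.IH[of s, OF bs s] by (elim exE conjE)
  have uc: "u k \<in> carrier A" for k using u(1) grade_carrier by blast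
  obtain p where p: "p \<in> grade A 0" "to_top A p = top_twist j (to_top A b)"
    using top_rep[OF top_twist_closed[OF top_closed[OF bc]]] by blast
  have pc: "p \<in> carrier A" using p(1) by (rule grade_carrier)
  define y where "y k = c k \<odot> p \<oplus> u k" for k
  have y0: "y k \<in> grade A 0" for k using c p(1) u(1) by (simp add: y_def add_grade grade_smult)
  have tb: "t (j * k) b \<in> carrier A" for k by (rule t_closed[OF bc])
  have ts: "t (j * l) (s k) \<in> carrier A" for k l by (rule t_closed[OF sc])
  have "to_top A (y k) = top_twist j (to_top A (x k))" for k
  proof -
    have "top_twist j (to_top A (x k)) = seq_action (\<lambda>l. t (j * l) (x k))"
      using b s0 c by (intro top_twist_top) (simp add: x add_grade grade_smult)
    also have "(\<lambda>l. t (j * l) (x k)) = (\<lambda>l. c k \<odot> t (j * l) b \<oplus> t (j * l) (s k))"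
      using c bc sc by (simp add: x t_add t_smult)
    also have "seq_action \<dots> = seq_action (\<lambda>l. c k \<odot> t (j * l) b) \<oplus>\<^bsub>top_ring A\<^esub> seq_action (\<lambda>l. t (j * l) (s k))"
      by (rule seq_action_add) (use c tb ts in simp_all)
    also have "seq_action (\<lambda>l. c k \<odot> t (j * l) b) = to_top A (scalar (c k)) \<otimes>\<^bsub>top_ring A\<^esub> seq_action (\<lambda>l. t (j * l) b)"
      by (rule seq_action_smult[OF c tb])
    also have "\<dots> = to_top A (c k \<odot> p)"
      using top_twist_top[OF b, of j] p(2) top_mult[OF scalar(2)[OF c] pc] scalar(3)[OF c pc] by simp
    also have "seq_action (\<lambda>l. t (j * l) (s k)) = to_top A (u k)"
      using top_twist_top[OF s0, of j] u(2) by simp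
    finally show ?thesis using c pc uc by (simp add: y_def top_add)
  qed
  moreover have "seq_action y = seq_action (\<lambda>k. t (j * k) (x k))"
  proof -
    have "seq_action y = seq_action (\<lambda>k. c k \<odot> p) \<oplus>\<^bsub>top_ring A\<^esub> seq_action u"
      unfolding y_def[abs_def] by (rule seq_action_add) (use c pc uc in simp_all)
    also have "seq_action (\<lambda>k. c k \<odot> p) = seq_action (\<lambda>k. scalar (c k)) \<otimes>\<^bsub>top_ring A\<^esub> to_top A p"
      by (rule seq_action_scaled_const[OF c pc])
    also have "\<dots> = seq_action (\<lambda>k. scalar (c k) \<otimes> t (j * k) b)"
      using seq_action_mult[of "\<lambda>k. scalar (c k)" "\<lambda>k. t (j * k) b", OF scalar(1)[OF c] tb] top_twist_top[OF b, of j] p(2)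
      by simp
    also have "\<dots> = seq_action (\<lambda>k. c k \<odot> t (j * k) b)" using scalar(3)[OF c tb] by simp
    also have "seq_action u = seq_action (\<lambda>k. t (j * k) (s k))" by (rule u(3))
    also have "seq_action (\<lambda>k. c k \<odot> t (j * k) b) \<oplus>\<^bsub>top_ring A\<^esub> seq_action (\<lambda>k. t (j * k) (s k)) =
        seq_action (\<lambda>k. c k \<odot> t (j * k) b \<oplus> t (j * k) (s k))"
      by (rule seq_action_add[symmetric]) (use c tb ts in simp_all)
    also have "(\<lambda>k. c k \<odot> t (j * k) b \<oplus> t (j * k) (s k)) = (\<lambda>k. t (j * k) (x k))"
      using c bc sc by (simp add: x t_add t_smult)
    finally show ?thesis .
  qed
  ultimately show ?case using y0 by (intro exI[of _ y]) simp
qed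

text \<open>
  The sequence \<open>u\<close> obtained for \<open>x\<^sub>k = t\<^sub>i\<^sub>k(a)\<close> agrees modulo the radical with \<open>t\<^sub>i\<^sub>k(r)\<close>, where \<open>r\<close>
  represents \<open>\<rho>\<^sub>j(s)\<close>, because \<open>\<rho>\<^sub>j\<close> commutes with \<open>\<tau>\<close>.
\<close>

lemma top_twist_top_twist:
  assumes s: "s \<in> carrier (top_ring A)" shows "top_twist i (top_twist j s) = top_twist (i + j) s"
proof -
  obtain a where a: "a \<in> grade A 0" "to_top A a = s" using top_rep[OF s] by blast
  have ac: "a \<in> carrier A" using a(1) by (rule grade_carrier)
  obtain r where r: "r \<in> grade A 0" "to_top A r = top_twist j s" using top_rep[OF top_twist_closed[OF s]] by blast
  have rc: "r \<in> carrier A" using r(1) by (rule grade_carrier)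
  obtain bs where bs: "set bs \<subseteq> grade A 0" "grade A 0 \<subseteq> combinations bs"
    using grade_combinations[OF locally_finite, of 0] by (elim exE conjE)
  have x: "t (i * k) a \<in> combinations bs" for k using bs(2) t_grade[OF a(1)] by blast
  obtain u where u: "\<forall>k. u k \<in> grade A 0" "\<forall>k. to_top A (u k) = top_twist j (to_top A (t (i * k) a))"
    "seq_action u = seq_action (\<lambda>k. t (j * k) (t (i * k) a))"
    using top_twist_combinations[of bs "\<lambda>k. t (i * k) a" j, OF bs(1) x] by (elim exE conjE)
  have eq: "to_top A (u k) = to_top A (t (i * k) r)" for k
  proof -
    have top_r: "to_top A r = seq_action (\<lambda>l. t (j * l) a)" using r(2) top_twist_top[OF a(1), of j] a(2) by simp
    have "to_top A (u k) = seq_action (\<lambda>l. t (j * l) (t (i * k) a))"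
      using u(2) top_twist_top[OF t_grade[OF a(1)], of j "i * k"] by simp
    also have "\<dots> = seq_action (\<lambda>l. t (i * k) (t (j * l) a))" using ac by (simp add: t_t add.commute)
    also have "\<dots> = to_top A (t (i * k) r)"
      by (rule seq_action_equivariant[OF t_closed[OF ac] rc top_r, symmetric])
    finally show ?thesis .
  qed
  have "top_twist i (top_twist j s) = seq_action (\<lambda>k. t (i * k) r)" using top_twist_top[OF r(1), of i] r(2) by simp
  also have "\<dots> = seq_action u"
    by (rule seq_action_cong_J) (use t_grade[OF r(1)] u(1) eq in auto)
  also have "\<dots> = seq_action (\<lambda>k. t ((i + j) * k) a)" using u(3) ac by (simp add: t_t algebra_simps)
  also have "\<dots> = top_twist (i + j) s" using top_twist_top[OF a(1), of "i + j"] a(2) by simp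
  finally show ?thesis .
qed

lemma top_twist_0: "s \<in> carrier (top_ring A) \<Longrightarrow> top_twist 0 s = s"
  using top_rep[of s] top_twist_top[of _ 0] seq_action_const grade_carrier t_0 by fastforce

lemma top_twist_bij: "bij_betw (top_twist j) (carrier (top_ring A)) (carrier (top_ring A))"
  by (rule bij_betwI[where g = "top_twist (- j)"]) (auto simp: top_twist_closed top_twist_top_twist top_twist_0)

lemma top_twist_add:
  assumes "s \<in> carrier (top_ring A)" "s' \<in> carrier (top_ring A)"
  shows "top_twist j (s \<oplus>\<^bsub>top_ring A\<^esub> s') = top_twist j s \<oplus>\<^bsub>top_ring A\<^esub> top_twist j s'"
proof -
  obtain a b where a: "a \<in> grade A 0" "to_top A a = s" and b: "b \<in> grade A 0" "to_top A b = s'"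
    using top_rep[OF assms(1)] top_rep[OF assms(2)] by blast
  note c = grade_carrier[OF a(1)] grade_carrier[OF b(1)]
  have "top_twist j (s \<oplus>\<^bsub>top_ring A\<^esub> s') = seq_action (\<lambda>k. t (j * k) (a \<oplus> b))"
    using top_twist_top[OF add_grade[OF a(1) b(1)], of j] top_add[OF c] a(2) b(2) by simp
  also have "\<dots> = seq_action (\<lambda>k. t (j * k) a \<oplus> t (j * k) b)" using c by (simp add: t_add)
  also have "\<dots> = top_twist j s \<oplus>\<^bsub>top_ring A\<^esub> top_twist j s'"
    using seq_action_add[of "\<lambda>k. t (j * k) a" "\<lambda>k. t (j * k) b", OF t_closed[OF c(1)] t_closed[OF c(2)]]
      top_twist_top[OF a(1), of j] top_twist_top[OF b(1), of j] a(2) b(2) by simp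
  finally show ?thesis .
qed

lemma top_twist_scalar:
  assumes "c \<in> carrier K" shows "top_twist j (to_top A (scalar c)) = to_top A (scalar c)"
proof -
  have "t (j * k) (scalar c) = scalar c" for k using assms by (simp add: scalar_def t_smult t_one)
  then show ?thesis using top_twist_top[OF scalar(1)[OF assms], of j] seq_action_const[OF scalar(2)[OF assms]] by simp
qed

lemma top_twist_hom: "top_twist j \<in> ring_hom (top_ring A) (top_ring A)"
proof (rule ring_hom_memI)
  fix s s' assume s: "s \<in> carrier (top_ring A)" and s': "s' \<in> carrier (top_ring A)"
  show "top_twist j s \<in> carrier (top_ring A)" by (rule top_twist_closed[OF s])
  show "top_twist j (s \<oplus>\<^bsub>top_ring A\<^esub> s') = top_twist j s \<oplus>\<^bsub>top_ring A\<^esub> top_twist j s'" by (rule top_twist_add[OF s s'])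
  obtain a b where a: "a \<in> grade A 0" "to_top A a = s" and b: "b \<in> grade A 0" "to_top A b = s'"
    using top_rep[OF s] top_rep[OF s'] by blast
  note c = grade_carrier[OF a(1)] grade_carrier[OF b(1)]
  have ab: "a \<otimes> b \<in> grade A 0" using mult_grade[OF a(1) b(1)] by simp
  have "top_twist j (s \<otimes>\<^bsub>top_ring A\<^esub> s') = seq_action (\<lambda>k. t (j * k) (a \<otimes> b))"
    using top_twist_top[OF ab, of j] top_mult[OF c] a(2) b(2) by simp
  also have "\<dots> = seq_action (\<lambda>k. t (j * k) a \<otimes> t (j * k) b)" using c by (simp add: t_mult)
  also have "\<dots> = top_twist j s \<otimes>\<^bsub>top_ring A\<^esub> top_twist j s'"
    using seq_action_mult[of "\<lambda>k. t (j * k) a" "\<lambda>k. t (j * k) b", OF t_grade[OF a(1)] t_closed[OF c(2)]]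
      top_twist_top[OF a(1), of j] top_twist_top[OF b(1), of j] a(2) b(2) by simp
  finally show "top_twist j (s \<otimes>\<^bsub>top_ring A\<^esub> s') = top_twist j s \<otimes>\<^bsub>top_ring A\<^esub> top_twist j s'" .
next
  have "(\<lambda>k. t (j * k) \<one>) = (\<lambda>_. \<one>)" by (simp add: t_one)
  then show "top_twist j \<one>\<^bsub>top_ring A\<^esub> = \<one>\<^bsub>top_ring A\<^esub>"
    using top_twist_top[OF one_grade, of j] seq_action_const[OF A.one_closed] by (simp add: top_one)
qed

end

section \<open>Regularity of the twist\<close>

locale presented_twist = twisted_resolution K A B t P \<delta> \<epsilon> P' +
    C: presented_top K A P \<delta> \<epsilon> t V W \<alpha> \<beta> d \<pi>
  for K :: "'k ring" and A B :: "('k, 'a) graded_algebra" and t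
    and P :: "nat \<Rightarrow> ('a, 'm) graded_module" and \<delta> \<epsilon> P'
    and V :: "('a set, 'a set, 'v) bimodule" and W :: "('a set, 'a set, 'w) bimodule"
    and \<alpha> \<beta> d \<pi>
begin

text \<open>
  An element of positive degree \<open>p\<close> multiplies the components by elements of \<open>A\<^sub>p\<close>, hence of the radical,
  and acts by zero.
\<close>

lemma twisted_right_action:
  assumes f: "f \<in> RA.Z d" and a: "a \<in> carrier A"
  shows "\<pi> (from_twist d (RB.right_mult d a (to_twist d f))) = \<pi> f \<triangleleft>\<^bsub>V\<^esub> C.top_twist (- 1) (to_top A a)"
  using a
proof (induction rule: A.homogeneous_induct)
  case (grade p a)
  have ac: "a \<in> carrier A" using grade by (rule A.grade_carrier)
  let ?r = "\<lambda>k. t (- k - int p) a"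
  have rc: "?r k \<in> carrier A" for k by (rule A.t_closed[OF ac])
  have "\<pi> (from_twist d (RB.right_mult d a (to_twist d f))) = \<pi> f \<triangleleft>\<^bsub>V\<^esub> C.seq_action ?r"
    unfolding right_mult_twist[OF RA.Z_H[OF f] grade] by (rule C.seq_action(2)[of ?r, OF rc f])
  moreover have "C.seq_action ?r = C.top_twist (- 1) (to_top A a)"
  proof (cases "p = 0")
    case True
    then show ?thesis using C.top_twist_top[of a "- 1"] grade by simp
  next
    case False
    have "C.seq_action ?r = \<zero>\<^bsub>top_ring A\<^esub>"
      by (rule C.seq_action_J[of ?r p])
        (use A.positive_grade_J[OF A.t_grade[OF grade]] A.t_grade[OF grade] False in auto)
    moreover have "to_top A a = to_top A (C.scalar \<zero>\<^bsub>K\<^esub>)"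
      using A.top_positive[OF grade] False A.top_zero by (simp add: C.scalar_def)
    moreover have "to_top A (C.scalar \<zero>\<^bsub>K\<^esub>) = \<zero>\<^bsub>top_ring A\<^esub>"
      using A.top_zero by (simp add: C.scalar_def)
    ultimately show ?thesis using C.top_twist_scalar[of "\<zero>\<^bsub>K\<^esub>" "- 1"] by simp
  qed
  ultimately show ?case by simp
next
  case (add a b)
  let ?g = "to_twist d f"
  have g: "?g \<in> RB.Z d" by (rule to_twist_Z[OF f])
  have ac: "a \<in> carrier B" "b \<in> carrier B" using add by (simp_all add: carrier_B)
  note gH = RB.H_closed[OF RB.Z_H[OF g]]
  have "RB.right_mult d (a \<oplus>\<^bsub>A\<^esub> b) ?g = RB.right_mult d a ?g \<oplus>\<^bsub>RB.H d\<^esub> RB.right_mult d b ?g"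
    unfolding RB.right_mult_def B.hom_group_simps
    by (rule restrict_ext) (use ac B.A.r_distr[OF ac gH] in \<open>simp add: add_B\<close>)
  then have "from_twist d (RB.right_mult d (a \<oplus>\<^bsub>A\<^esub> b) ?g) =
      from_twist d (RB.right_mult d a ?g) \<oplus>\<^bsub>RA.H d\<^esub> from_twist d (RB.right_mult d b ?g)"
    using twisted_resolution.to_twist_add[OF twisted_resolution_sym,
        OF RB.Z_H[OF RB.right_mult_Z[OF ac(1) g]] RB.Z_H[OF RB.right_mult_Z[OF ac(2) g]]]
    by (simp add: from_twist_sym[symmetric])
  then have "\<pi> (from_twist d (RB.right_mult d (a \<oplus>\<^bsub>A\<^esub> b) ?g)) =
      \<pi> (from_twist d (RB.right_mult d a ?g)) \<oplus>\<^bsub>V\<^esub> \<pi> (from_twist d (RB.right_mult d b ?g))"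
    using C.piD(3)[OF from_twist_Z[OF RB.right_mult_Z[OF ac(1) g]] from_twist_Z[OF RB.right_mult_Z[OF ac(2) g]]]
    by simp
  also have "\<dots> = \<pi> f \<triangleleft>\<^bsub>V\<^esub> C.top_twist (- 1) (to_top A a) \<oplus>\<^bsub>V\<^esub> \<pi> f \<triangleleft>\<^bsub>V\<^esub> C.top_twist (- 1) (to_top A b)"
    using add by simp
  also have "\<dots> = \<pi> f \<triangleleft>\<^bsub>V\<^esub> C.top_twist (- 1) (to_top A (a \<oplus>\<^bsub>A\<^esub> b))"
    using add C.rsm(2)[OF C.piD(1)[OF f] C.top_twist_closed C.top_twist_closed] C.top_twist_add A.top_add A.top_closed
    by simp
  finally show ?case .
qed

lemma twisted_Ext_isomorphic:
  "bimodule_isomorphic (top_ring B) B (Ext_top B P' \<delta> \<epsilon> d)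
    (restrict_right (to_top B) (twist_right (C.top_twist (- 1)) V))"
proof (rule RB.presents_Ext_isomorphic)
  show "abelian_group (twist_right (C.top_twist (- 1)) V)"
    by (rule same_group_abelian[OF _ _ _ C.V_group]) (simp_all add: twist_right_def)
  show "RB.presents d (twist_right (C.top_twist (- 1)) V) (\<lambda>g. \<pi> (from_twist d g))"
    by (rule presents_twist[OF C.presented twisted_right_action])
qed

lemma twisted_Ext:
  assumes "invertible_bimodule (top_ring A) V" and "central_bimodule K A V"
  shows "\<exists>V' :: ('a set, 'a set, 'v) bimodule. invertible_bimodule (top_ring B) V' \<and>
    central_bimodule K B V' \<and>
    bimodule_isomorphic (top_ring B) B (Ext_top B P' \<delta> \<epsilon> d) (restrict_right (to_top B) V')"
proof (intro exI[of _ "twist_right (C.top_twist (- 1)) V"] conjI twisted_Ext_isomorphic)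
  show "invertible_bimodule (top_ring B) (twist_right (C.top_twist (- 1)) V)"
    by (rule invertible_bimodule_twist_right[OF assms(1) B.S.ring_axioms top_ring_B(1,2,4,5)
          C.top_twist_hom C.top_twist_bij])
  show "central_bimodule K B (twist_right (C.top_twist (- 1)) V)"
    using assms(2) C.top_twist_scalar
    by (simp add: central_bimodule_def twist_right_def to_top_B smult_B one_B C.scalar_def)
qed

end

lemma (in twisted_resolution) twisted_Ext_vanishes:
  assumes "carrier (Ext_top A P \<delta> \<epsilon> i) = {\<zero>\<^bsub>Ext_top A P \<delta> \<epsilon> i\<^esub>}"
  shows "carrier (Ext_top B P' \<delta> \<epsilon> i) = {\<zero>\<^bsub>Ext_top B P' \<delta> \<epsilon> i\<^esub>}"
  unfolding RB.Ext_vanishes_iff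
  by (rule vanishing_twist) (rule assms[unfolded RA.Ext_vanishes_iff])

theorem theorem2:
  fixes K :: "'k ring" and A :: "('k, 'a) graded_algebra" and \<tau> :: "'a \<Rightarrow> 'a" and d :: nat
  assumes "algebraically_closed K"
    and "char_zero K"
    and "generalized_AS_regular TYPE('m) K A d"
    and "graded_automorphism K A \<tau>"
  shows "generalized_AS_regular TYPE('m) K (graded_twist \<tau> A) d"
proof -
  define B where "B = graded_twist \<tau> A"
  define t where "t = int_power (carrier A) \<tau>"
  note reg = assms(3)[unfolded generalized_AS_regular_def]
  have fin: "locally_finite_graded_algebra K A" using reg by (rule conjunct1)
  have gldim: "graded_global_dimension TYPE('m) A = enat d" using reg by (elim conjE)
  from reg obtain V :: "('a set, 'a set, 'm) bimodule"
    and P :: "nat \<Rightarrow> ('a, 'm) graded_module" and \<delta> \<epsilon> where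
    inv: "invertible_bimodule (top_ring A) V" and central: "central_bimodule K A V"
    and res: "graded_projective_resolution A (top_module A) P \<delta> \<epsilon>"
    and iso: "bimodule_isomorphic (top_ring A) A (Ext_top A P \<delta> \<epsilon> d) (restrict_right (to_top A) V)"
    and vanish: "\<forall>i. i \<noteq> d \<longrightarrow> carrier (Ext_top A P \<delta> \<epsilon> i) = {\<zero>\<^bsub>Ext_top A P \<delta> \<epsilon> i\<^esub>}"
    by (elim conjE exE)
  have pair: "twist_pair K A B t"
    unfolding B_def t_def
    by (rule graded_twist_pair[OF locally_finite_graded_algebra.axioms(1)[OF fin] assms(4)])
  have flow: "graded_flow K A t" using pair by (rule twist_pair.axioms(1))
  have RA: "top_resolution K A P \<delta> \<epsilon>"
    by (intro top_resolution.intro top_resolution_axioms.intro graded_flow.axioms(1)[OF flow] res)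
  have "\<forall>i. \<exists>P'. twisted_modules A B t (P i) P'"
    using twist_pair.twisted_module_exists[OF pair top_resolution.resD(2)[OF RA]] by (rule allI)
  from choice[OF this] obtain P' where P': "\<forall>i. twisted_modules A B t (P i) (P' i)" by (elim exE)
  have TR: "twisted_resolution K A B t P \<delta> \<epsilon> P'"
    by (intro twisted_resolution.intro twisted_resolution_axioms.intro pair RA) (rule P'[rule_format])
  obtain W :: "('a set, 'a set, 'm) bimodule" and \<alpha> \<beta> where mi: "mutually_inverse (top_ring A) V W \<alpha> \<beta>"
    by (rule invertible_bimodule_mutually_inverse[OF inv])
  have "bimodule (top_ring A) (top_ring A) V" using inv by (simp add: invertible_bimodule_def)
  then have "abelian_group V" by (intro left_module.axioms(2)[OF bimodule.axioms(1)])
  from top_resolution.Ext_isomorphic_presents[OF RA this iso]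
  obtain \<pi> where \<pi>: "top_resolution.presents A P \<delta> \<epsilon> d V \<pi>" by (elim exE)
  have PT: "presented_twist K A B t P \<delta> \<epsilon> P' V W \<alpha> \<beta> d \<pi>"
    by (intro presented_twist.intro presented_top.intro presented_top_axioms.intro TR RA flow mi \<pi> fin)
  obtain V' :: "('a set, 'a set, 'm) bimodule" where V': "invertible_bimodule (top_ring B) V'"
    "central_bimodule K B V'"
    "bimodule_isomorphic (top_ring B) B (Ext_top B P' \<delta> \<epsilon> d) (restrict_right (to_top B) V')"
    using presented_twist.twisted_Ext[OF PT inv central] by (elim exE conjE)
  have res': "graded_projective_resolution B (top_module B) P' \<delta> \<epsilon>"
    by (rule twist_pair.resolution_twisted[OF pair twist_pair.top_module_twisted[OF pair] P'[rule_format] res])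
  have vanish': "\<forall>i. i \<noteq> d \<longrightarrow> carrier (Ext_top B P' \<delta> \<epsilon> i) = {\<zero>\<^bsub>Ext_top B P' \<delta> \<epsilon> i\<^esub>}"
    using twisted_resolution.twisted_Ext_vanishes[OF TR] vanish by simp
  have "graded_global_dimension TYPE('m) B = enat d"
    using twist_pair.global_dimension_B[OF pair, of "TYPE('m)"] gldim by simp
  then show ?thesis
    unfolding generalized_AS_regular_def B_def[symmetric]
    by (intro conjI exI[of _ V'] exI[of _ P'] exI[of _ \<delta>] exI[of _ \<epsilon>]
        twist_pair.locally_finite_B[OF pair fin] V' res' vanish')
qed

end
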